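(* Let $u_h$ denote the solution of the semidiscrete problem with initial value $u_{h,0}$. Let $0<t_1<T$ be fixed and let $\mathcal T_{(0,T)}:=\mathcal T^M_{(\mathbf 0,t_1)}\cup\mathcal T_{(t_1,T)}$ be a mesh on $(0,T)$ that is geometrically refined towards $0$ on $(0,t_1)$ with $M$ layers and is of constant size on $(t_1,T)$. Choose $\mathbf r_t$ to be linearly increasing on the geometrically refined part and constant afterwards. Let $N:=\dim(\mathcal S^{\mathbf r_t,0}(\mathcal T_{(0,T)}))$. Assume that $u_0$ is analytic in $\overline\Omega$ and that the right-hand side $f$ satisfies $$\|f^{(\ell)}(t)\|_{L^2(\Omega)}\le C_f\,d_f^{\,\ell}\,\Gamma(\ell+1)\qquad\forall t\in[0,T],\ \ell\in\mathbb N_0,$$ with constants $C_f$, $d_f$ independent of $\ell$ and $t$. Suppose that the initial-condition assumption of the context is satisfied. Let $u_{h,k}=\operatorname{tr}\mathcal U^h_{x,y,t}$ be the trace of the discontinuous Galerkin solution. Then there are $C,b>0$, independent of $M$ and of the spaces $\mathbb V_h^{\mathcal X},\mathbb V_h^{\mathcal Y}$, such that $$\Big(\int_0^T\|u_h(t)-u_{h,k}(t)\|^2_{\widetilde H^s(\Omega)}\,dt\Big)^{1/2}\le C\big(e^{-bN^{1/2}}+e^{-b\,\mathcal N_\Omega^\mu}\big).$$ The constant $C$ depends on $\Omega$, $u_0$, $f$, $\mu$, the mesh grading, $T$, and the constants of the initial-condition assumption.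
   Context: Setting. $\Omega\subset\mathbb R^d$ is a bounded Lipschitz domain, $s\in(0,1)$, $\alpha=1-2s$, $d_s=2^{\alpha}\Gamma(1-s)/\Gamma(s)$. $A\in L^\infty(\Omega,\mathbb R^{d\times d})$ is symmetric and uniformly positive definite, $c\in L^\infty(\Omega)$, $c\ge0$ (the underlying operator is $\mathcal Lu=-\operatorname{div}(A\nabla u)+cu$ with Dirichlet conditions). For Banach spaces $X_1\subseteq X_0$ and $\theta\in(0,1)$, $[X_0,X_1]_{\theta,2}$ is the space with norm $\|u\|^2=\int_0^\infty t^{-2\theta}\big(\inf_{v\in X_1}\|u-v\|_{X_0}+t\|v\|_{X_1}\big)^2\frac{dt}{t}$. $\widetilde H^s(\Omega)=[L^2(\Omega),H_0^1(\Omega)]_{s,2}$. Extension. $\mathcal C=\Omega\times\mathbb R_+$, points $(x,y)$; $H^1(y^\alpha,\mathcal C)$ consists of $w$ with $\int_{\mathcal C}y^\alpha(|w|^2+|\nabla w|^2)<\infty$; $\mathring H^1(y^\alpha,\mathcal C)$ is the subspace of functions vanishing on $\partial\Omega\times\mathbb R_+$, normed by $\|\mathcal U\|^2=\int_{\mathcal C}y^\alpha|\nabla\mathcal U|^2$. $\operatorname{tr}\mathcal U=\mathcal U(\cdot,0)$; $\mathcal A(\mathcal U,\mathcal V)=\int_{\mathcal C}y^\alpha(A\nabla\mathcal U)\cdot\nabla\mathcal V+y^\alpha c\,\mathcal U\mathcal V$, where $A$ acts on the $x$-part of the gradient and as identity on $\partial_y$. Space discretization. $\mathbb V_h^{\mathcal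 X}\subset H_0^1(\Omega)$ and $\mathbb V_h^{\mathcal Y}\subset H^1(y^\alpha,\mathbb R_+)$ are finite dimensional, $\mathbb V_h^{\mathcal Y}$ contains some $v$ with $v(0)=1$, $\mathbb V_h^{\mathcal X,\mathcal Y}=\mathbb V_h^{\mathcal X}\otimes\mathbb V_h^{\mathcal Y}$, $\mathcal N_\Omega=\dim\mathbb V_h^{\mathcal X}$. For $u\in\mathbb V_h^{\mathcal X}$ the lifting $\mathcal D_hu\in\mathbb V_h^{\mathcal X,\mathcal Y}$ is defined by $\operatorname{tr}\mathcal D_hu=u$ and $\mathcal A(\mathcal D_hu,\mathcal V_h)=0$ for all $\mathcal V_h\in\mathbb V_h^{\mathcal X,\mathcal Y}$ with $\operatorname{tr}\mathcal V_h=0$; $\mathcal L_h^s$ is defined on $\mathbb V_h^{\mathcal X}$ by $(\mathcal L_h^su,v)_{L^2(\Omega)}=d_s^{-1}\mathcal A(\mathcal D_hu,\mathcal D_hv)$. Semidiscrete problem: $\dot u_h+\mathcal L_h^su_h=\Pi_{L^2}f$, $u_h(0)=u_{h,0}\in\mathbb V_h^{\mathcal X}$, with $\Pi_{L^2}$ the $L^2(\Omega)$-projection onto $\mathbb V_h^{\mathcal X}$. $\|u\|_{\mathbb V_h^{\mathcal X}}:=\|\mathcal D_hu\|_{\mathring H^1(y^\alpha,\mathcal C)}$ and $\mathbb V^{\mathcal X}_{h,\beta}:=[(\mathbb V_h^{\mathcal X},\|\cdot\|_{L^2(\Omega)}),(\mathbb V_h^{\mathcal X},\|\cdot\|_{\mathbb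 V_h^{\mathcal X}})]_{\beta,2}$. Initial-condition assumption. There are $\beta\in(0,1)$, $b,\mu>0$ and $C_{stab},C_{approx}$ with $\|u_{h,0}\|_{\mathbb V^{\mathcal X}_{h,\beta}}\le C_{stab}$ and $\|u_0-u_{h,0}\|_{L^2(\Omega)}\le C_{approx}e^{-b\mathcal N_\Omega^\mu}$. Time mesh and degrees. With fixed grading factor $\sigma\in(0,1)$, $\mathcal T^M_{(\mathbf 0,t_1)}$ has nodes $0$, $\frac{t_1}{2}\sigma^{M+1-i}$ ($i=1,\dots,M$), $t_1$. $\mathcal T_{(t_1,T)}$ is a uniform partition of $(t_1,T)$ into a fixed number of elements. The degree on the $j$-th element from $t=0$ of the geometric part is $\lfloor\mathfrak m j\rfloor$ with fixed slope $\mathfrak m>0$; on $(t_1,T)$ the degree is constant and equal to the largest degree of the geometric part. Time discretization. Write $\mathcal T_{(0,T)}=\{(t_{j-1},t_j)\}_{j=1}^{J}$ for the time mesh (here $t_j$ denote generic nodes). $\mathcal S^{\mathbf r_t,0}(\mathcal T_{(0,T)})$ are the (discontinuous) piecewise polynomials of degree $(\mathbf r_t)_j$ on the $j$-th interval, $\mathbb V_h^{\mathcal X,\mathcal Y,\mathcal T}=\mathcal S^{\mathbf r_t,0}(\mathcal T_{(0,T)})\otimes\mathbb V_h^{\mathcal X,\mathcal Y}$. With one-sided limits $u_j^{\pm}$ at $t_j$ and $[u]_j=u_j^+-u_j^-$, set $B(\mathcal U,\mathcal V)=\sum_{j=1}^J\int_{t_{j-1}}^{t_j}(\operatorname{tr}\dot{\mathcal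 U},\operatorname{tr}\mathcal V)_{L^2(\Omega)}+d_s^{-1}\mathcal A(\mathcal U,\mathcal V)\,dt+\sum_{j=2}^J([\operatorname{tr}\mathcal U]_{j-1},\operatorname{tr}\mathcal V_{j-1}^+)_{L^2(\Omega)}+(\operatorname{tr}\mathcal U_0^+,\operatorname{tr}\mathcal V_0^+)_{L^2(\Omega)}$ and $F(\mathcal V)=\sum_{j=1}^J\int_{t_{j-1}}^{t_j}(f,\operatorname{tr}\mathcal V)_{L^2(\Omega)}dt+(u_0,\operatorname{tr}\mathcal V_0^+)_{L^2(\Omega)}$. The DG solution $\mathcal U^h_{x,y,t}\in\mathbb V_h^{\mathcal X,\mathcal Y,\mathcal T}$ satisfies $B(\mathcal U^h_{x,y,t},\mathcal V_h)=F(\mathcal V_h)$ for all $\mathcal V_h\in\mathbb V_h^{\mathcal X,\mathcal Y,\mathcal T}$. *)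

theory Defs
  imports
    "HOL-Analysis.Analysis"
    "HOL-Computational_Algebra.Polynomial"
    "HOL-Library.Function_Algebras"
begin

text \<open>
  Function spaces are sets of functions; functions form a real vector space under pointwise operations,
  so that \<^const>\<open>subspace\<close>, \<^const>\<open>span\<close> and \<^const>\<open>dim\<close> apply to them.
\<close>

instantiation "fun" :: (type, real_vector) real_vector
begin

definition scaleR_fun :: "real \<Rightarrow> ('a \<Rightarrow> 'b) \<Rightarrow> 'a \<Rightarrow> 'b"
  where "scaleR_fun r f = (\<lambda>x. r *\<^sub>R f x)"

instance
  by standard (simp_all add: scaleR_fun_def fun_eq_iff scaleR_add_right scaleR_add_left)

end


section \<open>Domains and analytic functions\<close>

text \<open>The witness \<open>e\<close> is the vertical direction and \<open>x - (x \<bullet> e) *\<^sub>R e\<close> the horizontal part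
  of \<open>x\<close>; inside \<open>U\<close> the domain is the epigraph of a Lipschitz function of the horizontal part.\<close>

definition lipschitz_domain :: "'a::euclidean_space set \<Rightarrow> bool"
  where "lipschitz_domain \<Omega> \<longleftrightarrow> open \<Omega> \<and> connected \<Omega> \<and> \<Omega> \<noteq> {} \<and>
    (\<forall>p\<in>frontier \<Omega>. \<exists>e U g L. norm e = 1 \<and> open U \<and> p \<in> U \<and> L-lipschitz_on UNIV g \<and>
      \<Omega> \<inter> U = {x\<in>U. x \<bullet> e > (g :: 'a \<Rightarrow> real) (x - (x \<bullet> e) *\<^sub>R e)})"

text \<open>Real analogue of \<^const>\<open>analytic_on\<close>: a power series, indexed by multi-indices, represents
  the function on a full ball around every point of \<open>S\<close>.\<close>

definition real_analytic_on :: "(real^'d \<Rightarrow> real) \<Rightarrow> (real^'d) set \<Rightarrow> bool"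
  where "real_analytic_on u S \<longleftrightarrow> (\<forall>x\<in>S. \<exists>r>0. \<exists>a :: ('d \<Rightarrow> nat) \<Rightarrow> real. \<forall>z\<in>ball x r.
    ((\<lambda>k. a k * (\<Prod>i\<in>UNIV. (z $ i - x $ i) ^ k i)) has_sum u z) UNIV)"


section \<open>Lebesgue and Sobolev spaces\<close>

text \<open>Elements of \<open>L\<^sup>2\<close> are represented by Borel functions; every class has such a representative.\<close>

definition vol :: "'a::euclidean_space set \<Rightarrow> 'a measure"
  where "vol S = restrict_space lborel S"

definition L2 :: "'a measure \<Rightarrow> ('a \<Rightarrow> 'b::euclidean_space) set"
  where "L2 M = {u. u \<in> borel_measurable M \<and> integrable M (\<lambda>x. (norm (u x))\<^sup>2)}"

definition L2_norm :: "'a measure \<Rightarrow> ('a \<Rightarrow> 'b::euclidean_space) \<Rightarrow> real"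
  where "L2_norm M u = sqrt (LINT x|M. (norm (u x))\<^sup>2)"

definition L2_inner :: "'a measure \<Rightarrow> ('a \<Rightarrow> real) \<Rightarrow> ('a \<Rightarrow> real) \<Rightarrow> real"
  where "L2_inner M u v = (LINT x|M. u x * v x)"

primrec Ck :: "nat \<Rightarrow> ('a::euclidean_space \<Rightarrow> real) \<Rightarrow> bool"
  where
    "Ck 0 f = continuous_on UNIV f"
  | "Ck (Suc k) f = ((\<forall>x. f differentiable (at x)) \<and>
      (\<forall>v. Ck k (\<lambda>x. frechet_derivative f (at x) v)))"

definition test_functions :: "'a::euclidean_space set \<Rightarrow> ('a \<Rightarrow> real) set"
  where "test_functions S =
    {\<phi>. (\<forall>k. Ck k \<phi>) \<and> (\<exists>K. compact K \<and> K \<subseteq> S \<and> (\<forall>x. x \<notin> K \<longrightarrow> \<phi> x = 0))}"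

definition grad :: "('a::euclidean_space \<Rightarrow> real) \<Rightarrow> 'a \<Rightarrow> 'a"
  where "grad \<phi> x = (\<Sum>b\<in>Basis. frechet_derivative \<phi> (at x) b *\<^sub>R b)"

definition is_weak_grad :: "'a::euclidean_space set \<Rightarrow> ('a \<Rightarrow> real) \<Rightarrow> ('a \<Rightarrow> 'a) \<Rightarrow> bool"
  where "is_weak_grad S u g \<longleftrightarrow>
    (\<forall>K. compact K \<and> K \<subseteq> S \<longrightarrow> set_integrable lborel K u \<and> set_integrable lborel K g) \<and>
    (\<forall>\<phi>\<in>test_functions S.
      (LINT x:S|lborel. u x *\<^sub>R grad \<phi> x) = - (LINT x:S|lborel. \<phi> x *\<^sub>R g x))"

text \<open>Weak gradients are unique almost everywhere on open sets; below they only occur under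
  integrals.\<close>

definition wgrad :: "'a::euclidean_space set \<Rightarrow> ('a \<Rightarrow> real) \<Rightarrow> 'a \<Rightarrow> 'a"
  where "wgrad S u = (SOME g. is_weak_grad S u g)"

definition H1 :: "'a::euclidean_space measure \<Rightarrow> 'a set \<Rightarrow> ('a \<Rightarrow> real) set"
  where "H1 M S = {u \<in> L2 M. (\<exists>g. is_weak_grad S u g) \<and> wgrad S u \<in> L2 M}"

definition H1_norm :: "'a::euclidean_space measure \<Rightarrow> 'a set \<Rightarrow> ('a \<Rightarrow> real) \<Rightarrow> real"
  where "H1_norm M S u = sqrt ((L2_norm M u)\<^sup>2 + (L2_norm M (wgrad S u))\<^sup>2)"

definition H10 :: "'a::euclidean_space set \<Rightarrow> ('a \<Rightarrow> real) set"
  where "H10 \<Omega> = {u \<in> H1 (vol \<Omega>) \<Omega>. \<exists>\<phi>. (\<forall>n::nat. \<phi> n \<in> test_functions \<Omega>) \<and>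
    (\<lambda>n. L2_norm (vol \<Omega>) (u - \<phi> n)) \<longlonglongrightarrow> 0 \<and>
    (\<lambda>n. L2_norm (vol \<Omega>) (wgrad \<Omega> u - grad (\<phi> n))) \<longlonglongrightarrow> 0}"


section \<open>Real interpolation\<close>

text \<open>\<open>n0\<close> and \<open>n1\<close> are the norms of \<open>X0\<close> and of \<open>X1 \<subseteq> X0\<close>.\<close>

definition K_functional ::
  "('u::ab_group_add \<Rightarrow> real) \<Rightarrow> 'u set \<Rightarrow> ('u \<Rightarrow> real) \<Rightarrow> real \<Rightarrow> 'u \<Rightarrow> real"
  where "K_functional n0 X1 n1 t u = (INF v\<in>X1. n0 (u - v) + t * n1 v)"

definition interp_sqnorm ::
  "real \<Rightarrow> ('u::ab_group_add \<Rightarrow> real) \<Rightarrow> 'u set \<Rightarrow> ('u \<Rightarrow> real) \<Rightarrow> 'u \<Rightarrow> ennreal"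
  where "interp_sqnorm \<theta> n0 X1 n1 u =
    (\<integral>\<^sup>+ t\<in>{0<..}. ennreal (t powr (- 2 * \<theta>) * (K_functional n0 X1 n1 t u)\<^sup>2 / t) \<partial>lborel)"

definition interp_space ::
  "real \<Rightarrow> 'u set \<Rightarrow> ('u::ab_group_add \<Rightarrow> real) \<Rightarrow> 'u set \<Rightarrow> ('u \<Rightarrow> real) \<Rightarrow> 'u set"
  where "interp_space \<theta> X0 n0 X1 n1 = {u \<in> X0. interp_sqnorm \<theta> n0 X1 n1 u < \<infinity>}"

definition interp_norm ::
  "real \<Rightarrow> ('u::ab_group_add \<Rightarrow> real) \<Rightarrow> 'u set \<Rightarrow> ('u \<Rightarrow> real) \<Rightarrow> 'u \<Rightarrow> real"
  where "interp_norm \<theta> n0 X1 n1 u = sqrt (enn2real (interp_sqnorm \<theta> n0 X1 n1 u))"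

definition Hs_tilde :: "'a::euclidean_space set \<Rightarrow> real \<Rightarrow> ('a \<Rightarrow> real) set"
  where "Hs_tilde \<Omega> s =
    interp_space s (L2 (vol \<Omega>)) (L2_norm (vol \<Omega>)) (H10 \<Omega>) (H1_norm (vol \<Omega>) \<Omega>)"

definition Hs_tilde_norm :: "'a::euclidean_space set \<Rightarrow> real \<Rightarrow> ('a \<Rightarrow> real) \<Rightarrow> real"
  where "Hs_tilde_norm \<Omega> s =
    interp_norm s (L2_norm (vol \<Omega>)) (H10 \<Omega>) (H1_norm (vol \<Omega>) \<Omega>)"


section \<open>The elliptic coefficients and the extension problem\<close>

definition admissible_coeffs ::
  "(real^'d) set \<Rightarrow> (real^'d \<Rightarrow> real^'d^'d) \<Rightarrow> (real^'d \<Rightarrow> real) \<Rightarrow> bool"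
  where "admissible_coeffs \<Omega> A c \<longleftrightarrow>
    A \<in> borel_measurable (vol \<Omega>) \<and> (\<exists>k. AE x in vol \<Omega>. norm (A x) \<le> k) \<and>
    (AE x in vol \<Omega>. transpose (A x) = A x) \<and>
    (\<exists>a>0. AE x in vol \<Omega>. \<forall>\<xi>. \<xi> \<bullet> (A x *v \<xi>) \<ge> a * (norm \<xi>)\<^sup>2) \<and>
    c \<in> borel_measurable (vol \<Omega>) \<and> (\<exists>k. AE x in vol \<Omega>. \<bar>c x\<bar> \<le> k) \<and>
    (AE x in vol \<Omega>. c x \<ge> 0)"

definition weight :: "real \<Rightarrow> real"
  where "weight s = 1 - 2 * s"

definition d_const :: "real \<Rightarrow> real"
  where "d_const s = 2 powr weight s * Gamma (1 - s) / Gamma s"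

definition cylinder :: "'x set \<Rightarrow> ('x \<times> real) set"
  where "cylinder \<Omega> = \<Omega> \<times> {0<..}"

definition cyl_measure :: "real \<Rightarrow> 'x::euclidean_space set \<Rightarrow> ('x \<times> real) measure"
  where "cyl_measure s \<Omega> =
    density (vol (cylinder \<Omega>)) (\<lambda>(x, y). ennreal (y powr weight s))"

definition halfline_measure :: "real \<Rightarrow> real measure"
  where "halfline_measure s = density (vol {0<..}) (\<lambda>y. ennreal (y powr weight s))"

text \<open>Members of \<open>H\<^sup>1(y\<^sup>\<alpha>, \<real>\<^sub>+)\<close> are given by their representative that is continuous up
  to \<open>y = 0\<close> (it exists since \<open>\<alpha> < 1\<close>), so that the trace is evaluation at \<open>0\<close>.\<close>

definition H1_halfline :: "real \<Rightarrow> (real \<Rightarrow> real) set"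
  where "H1_halfline s = {v \<in> H1 (halfline_measure s) {0<..}. continuous_on {0..} v}"

definition tr :: "('x \<times> real \<Rightarrow> real) \<Rightarrow> 'x \<Rightarrow> real"
  where "tr W = (\<lambda>x. W (x, 0))"

definition ext_norm :: "real \<Rightarrow> 'x::euclidean_space set \<Rightarrow> ('x \<times> real \<Rightarrow> real) \<Rightarrow> real"
  where "ext_norm s \<Omega> W = L2_norm (cyl_measure s \<Omega>) (wgrad (cylinder \<Omega>) W)"

definition ext_form ::
  "real \<Rightarrow> (real^'d) set \<Rightarrow> (real^'d \<Rightarrow> real^'d^'d) \<Rightarrow> (real^'d \<Rightarrow> real) \<Rightarrow>
    ((real^'d) \<times> real \<Rightarrow> real) \<Rightarrow> ((real^'d) \<times> real \<Rightarrow> real) \<Rightarrow> real"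
  where "ext_form s \<Omega> A c U V = (LINT z|cyl_measure s \<Omega>.
    (let x = fst z; p = wgrad (cylinder \<Omega>) U z; q = wgrad (cylinder \<Omega>) V z
     in (A x *v fst p, snd p) \<bullet> q + c x * U z * V z))"


section \<open>Space discretization\<close>

text \<open>
  A finite dimensional subspace of \<open>L\<^sup>2(M)\<close> is given by a linear choice of one representative
  for each of its classes: the last condition says that distinct functions in \<open>V\<close> belong to
  distinct classes, so \<^term>\<open>dim V\<close> is the dimension of the space of classes. Every finite
  dimensional subspace arises in this way.
\<close>

definition discrete_space :: "'a measure \<Rightarrow> ('a \<Rightarrow> real) set \<Rightarrow> bool"
  where "discrete_space M V \<longleftrightarrow> subspace V \<and> (\<exists>B. finite B \<and> span B = V) \<and>
    (\<forall>v\<in>V. (AE x in M. v x = 0) \<longrightarrow> v = 0)"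

definition tensor :: "('a \<Rightarrow> real) set \<Rightarrow> ('b \<Rightarrow> real) set \<Rightarrow> ('a \<times> 'b \<Rightarrow> real) set"
  where "tensor V W = span {\<lambda>(x, y). v x * w y | v w. v \<in> V \<and> w \<in> W}"

definition admissible_spaces ::
  "real \<Rightarrow> (real^'d) set \<Rightarrow> (real^'d \<Rightarrow> real) set \<Rightarrow> (real \<Rightarrow> real) set \<Rightarrow> bool"
  where "admissible_spaces s \<Omega> VX VY \<longleftrightarrow>
    discrete_space (vol \<Omega>) VX \<and> VX \<subseteq> H10 \<Omega> \<and>
    discrete_space (vol {0<..}) VY \<and> VY \<subseteq> H1_halfline s \<and> (\<exists>v\<in>VY. v 0 = 1)"

definition lifting ::
  "real \<Rightarrow> (real^'d) set \<Rightarrow> (real^'d \<Rightarrow> real^'d^'d) \<Rightarrow> (real^'d \<Rightarrow> real) \<Rightarrow>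
    (real^'d \<Rightarrow> real) set \<Rightarrow> (real \<Rightarrow> real) set \<Rightarrow> (real^'d \<Rightarrow> real) \<Rightarrow> (real^'d) \<times> real \<Rightarrow> real"
  where "lifting s \<Omega> A c VX VY u = (THE W. W \<in> tensor VX VY \<and> tr W = u \<and>
    (\<forall>V\<in>tensor VX VY. tr V = 0 \<longrightarrow> ext_form s \<Omega> A c W V = 0))"

definition discrete_op ::
  "real \<Rightarrow> (real^'d) set \<Rightarrow> (real^'d \<Rightarrow> real^'d^'d) \<Rightarrow> (real^'d \<Rightarrow> real) \<Rightarrow>
    (real^'d \<Rightarrow> real) set \<Rightarrow> (real \<Rightarrow> real) set \<Rightarrow> (real^'d \<Rightarrow> real) \<Rightarrow> real^'d \<Rightarrow> real"
  where "discrete_op s \<Omega> A c VX VY u = (THE w. w \<in> VX \<and>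
    (\<forall>v\<in>VX. L2_inner (vol \<Omega>) w v = inverse (d_const s) *
      ext_form s \<Omega> A c (lifting s \<Omega> A c VX VY u) (lifting s \<Omega> A c VX VY v)))"

definition L2_proj :: "'a measure \<Rightarrow> ('a \<Rightarrow> real) set \<Rightarrow> ('a \<Rightarrow> real) \<Rightarrow> 'a \<Rightarrow> real"
  where "L2_proj M V f = (THE w. w \<in> V \<and> (\<forall>v\<in>V. L2_inner M w v = L2_inner M f v))"

definition discrete_norm ::
  "real \<Rightarrow> (real^'d) set \<Rightarrow> (real^'d \<Rightarrow> real^'d^'d) \<Rightarrow> (real^'d \<Rightarrow> real) \<Rightarrow>
    (real^'d \<Rightarrow> real) set \<Rightarrow> (real \<Rightarrow> real) set \<Rightarrow> (real^'d \<Rightarrow> real) \<Rightarrow> real"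
  where "discrete_norm s \<Omega> A c VX VY u = ext_norm s \<Omega> (lifting s \<Omega> A c VX VY u)"

definition discrete_interp_norm ::
  "real \<Rightarrow> (real^'d) set \<Rightarrow> (real^'d \<Rightarrow> real^'d^'d) \<Rightarrow> (real^'d \<Rightarrow> real) \<Rightarrow>
    (real^'d \<Rightarrow> real) set \<Rightarrow> (real \<Rightarrow> real) set \<Rightarrow> real \<Rightarrow> (real^'d \<Rightarrow> real) \<Rightarrow> real"
  where "discrete_interp_norm s \<Omega> A c VX VY \<beta> =
    interp_norm \<beta> (L2_norm (vol \<Omega>)) VX (discrete_norm s \<Omega> A c VX VY)"


section \<open>The semidiscrete problem\<close>

definition has_L2_deriv ::
  "'a measure \<Rightarrow> (real \<Rightarrow> 'a \<Rightarrow> real) \<Rightarrow> ('a \<Rightarrow> real) \<Rightarrow> real \<Rightarrow> real set \<Rightarrow> bool"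
  where "has_L2_deriv M u d t S \<longleftrightarrow>
    ((\<lambda>\<tau>. L2_norm M (\<lambda>x. (u \<tau> x - u t x) / (\<tau> - t) - d x)) \<longlongrightarrow> 0) (at t within S)"

text \<open>\<open>fd l\<close> is the \<open>l\<close>-th derivative of the \<open>L\<^sup>2(M)\<close>-valued function \<open>f\<close> on \<open>S\<close>.\<close>

definition L2_time_derivs ::
  "'a measure \<Rightarrow> real set \<Rightarrow> (real \<Rightarrow> 'a \<Rightarrow> real) \<Rightarrow> (nat \<Rightarrow> real \<Rightarrow> 'a \<Rightarrow> real) \<Rightarrow> bool"
  where "L2_time_derivs M S f fd \<longleftrightarrow> fd 0 = f \<and>
    (\<forall>l. \<forall>t\<in>S. fd l t \<in> L2 M \<and> has_L2_deriv M (fd l) (fd (Suc l) t) t S)"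

definition semidiscrete_solution ::
  "real \<Rightarrow> (real^'d) set \<Rightarrow> (real^'d \<Rightarrow> real^'d^'d) \<Rightarrow> (real^'d \<Rightarrow> real) \<Rightarrow>
    (real^'d \<Rightarrow> real) set \<Rightarrow> (real \<Rightarrow> real) set \<Rightarrow> real \<Rightarrow> (real \<Rightarrow> real^'d \<Rightarrow> real) \<Rightarrow>
    (real^'d \<Rightarrow> real) \<Rightarrow> (real \<Rightarrow> real^'d \<Rightarrow> real) \<Rightarrow> bool"
  where "semidiscrete_solution s \<Omega> A c VX VY T f uh0 uh \<longleftrightarrow>
    uh 0 = uh0 \<and> (\<forall>t\<in>{0..T}. uh t \<in> VX \<and>
      (\<exists>d\<in>VX. has_L2_deriv (vol \<Omega>) uh d t {0..T} \<and>
        d + discrete_op s \<Omega> A c VX VY (uh t) = L2_proj (vol \<Omega>) VX (f t)))"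


section \<open>Time mesh and polynomial degrees\<close>

text \<open>Nodes \<open>0, \<dots>, M + 1\<close> are those of the geometric mesh on \<open>(0, t1)\<close>; nodes
  \<open>M + 1, \<dots>, M + 1 + K\<close> form the uniform partition of \<open>(t1, T)\<close> into \<open>K\<close> elements.\<close>

definition time_node :: "real \<Rightarrow> real \<Rightarrow> real \<Rightarrow> nat \<Rightarrow> nat \<Rightarrow> nat \<Rightarrow> real"
  where "time_node \<sigma> t1 T K M j =
    (if j = 0 then 0
     else if j \<le> M then t1 / 2 * \<sigma> ^ (M + 1 - j)
     else t1 + (T - t1) * real (j - (M + 1)) / real K)"

definition num_elements :: "nat \<Rightarrow> nat \<Rightarrow> nat"
  where "num_elements K M = M + 1 + K"

definition geo_degree :: "real \<Rightarrow> nat \<Rightarrow> nat"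
  where "geo_degree m j = nat \<lfloor>m * real j\<rfloor>"

definition time_degree :: "real \<Rightarrow> nat \<Rightarrow> nat \<Rightarrow> nat"
  where "time_degree m M j =
    (if j \<le> M + 1 then geo_degree m j else Max (geo_degree m ` {1..M + 1}))"

text \<open>\<open>tn\<close>: nodes, \<open>J\<close>: number of elements, \<open>r\<close>: degrees. Values at the nodes are fixed
  by left-continuity and values outside of the mesh are \<open>0\<close>, which selects one function from
  each class and does not affect any limit, integral or dimension.\<close>

definition dg_space :: "(nat \<Rightarrow> real) \<Rightarrow> nat \<Rightarrow> (nat \<Rightarrow> nat) \<Rightarrow> (real \<Rightarrow> real) set"
  where "dg_space tn J r = {v.
    (\<forall>j\<in>{1..J}. \<exists>p. degree p \<le> r j \<and> (\<forall>t\<in>{tn (j - 1)<..tn j}. v t = poly p t)) \<and>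
    (\<forall>t. t \<notin> {tn 0<..tn J} \<longrightarrow> v t = 0)}"


section \<open>The discontinuous Galerkin method\<close>

text \<open>Fully discrete functions live on \<open>(t, (x, y))\<close>.\<close>

definition at_time :: "(real \<times> 'z \<Rightarrow> real) \<Rightarrow> real \<Rightarrow> 'z \<Rightarrow> real"
  where "at_time U t = (\<lambda>z. U (t, z))"

definition tr_dot :: "(real \<times> ('x \<times> real) \<Rightarrow> real) \<Rightarrow> real \<Rightarrow> 'x \<Rightarrow> real"
  where "tr_dot U t = (\<lambda>x. deriv (\<lambda>\<tau>. tr (at_time U \<tau>) x) t)"

definition tr_right :: "(real \<times> ('x \<times> real) \<Rightarrow> real) \<Rightarrow> real \<Rightarrow> 'x \<Rightarrow> real"
  where "tr_right U t = (\<lambda>x. Lim (at_right t) (\<lambda>\<tau>. tr (at_time U \<tau>) x))"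

definition tr_left :: "(real \<times> ('x \<times> real) \<Rightarrow> real) \<Rightarrow> real \<Rightarrow> 'x \<Rightarrow> real"
  where "tr_left U t = (\<lambda>x. Lim (at_left t) (\<lambda>\<tau>. tr (at_time U \<tau>) x))"

definition tr_jump :: "(real \<times> ('x \<times> real) \<Rightarrow> real) \<Rightarrow> real \<Rightarrow> 'x \<Rightarrow> real"
  where "tr_jump U t = tr_right U t - tr_left U t"

definition dg_form ::
  "real \<Rightarrow> (real^'d) set \<Rightarrow> (real^'d \<Rightarrow> real^'d^'d) \<Rightarrow> (real^'d \<Rightarrow> real) \<Rightarrow>
    (nat \<Rightarrow> real) \<Rightarrow> nat \<Rightarrow> (real \<times> ((real^'d) \<times> real) \<Rightarrow> real) \<Rightarrow>
    (real \<times> ((real^'d) \<times> real) \<Rightarrow> real) \<Rightarrow> real"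
  where "dg_form s \<Omega> A c tn J U V =
    (\<Sum>j=1..J. LINT t:{tn (j - 1)<..<tn j}|lborel.
        L2_inner (vol \<Omega>) (tr_dot U t) (tr (at_time V t))
        + inverse (d_const s) * ext_form s \<Omega> A c (at_time U t) (at_time V t))
    + (\<Sum>j=2..J. L2_inner (vol \<Omega>) (tr_jump U (tn (j - 1))) (tr_right V (tn (j - 1))))
    + L2_inner (vol \<Omega>) (tr_right U (tn 0)) (tr_right V (tn 0))"

definition dg_rhs ::
  "(real^'d) set \<Rightarrow> (real \<Rightarrow> real^'d \<Rightarrow> real) \<Rightarrow> (real^'d \<Rightarrow> real) \<Rightarrow>
    (nat \<Rightarrow> real) \<Rightarrow> nat \<Rightarrow> (real \<times> ((real^'d) \<times> real) \<Rightarrow> real) \<Rightarrow> real"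
  where "dg_rhs \<Omega> f u0 tn J V =
    (\<Sum>j=1..J. LINT t:{tn (j - 1)<..<tn j}|lborel.
        L2_inner (vol \<Omega>) (f t) (tr (at_time V t)))
    + L2_inner (vol \<Omega>) u0 (tr_right V (tn 0))"

definition dg_solution ::
  "real \<Rightarrow> (real^'d) set \<Rightarrow> (real^'d \<Rightarrow> real^'d^'d) \<Rightarrow> (real^'d \<Rightarrow> real) \<Rightarrow>
    (real^'d \<Rightarrow> real) set \<Rightarrow> (real \<Rightarrow> real) set \<Rightarrow> (nat \<Rightarrow> real) \<Rightarrow> nat \<Rightarrow> (nat \<Rightarrow> nat) \<Rightarrow>
    (real \<Rightarrow> real^'d \<Rightarrow> real) \<Rightarrow> (real^'d \<Rightarrow> real) \<Rightarrow>
    (real \<times> ((real^'d) \<times> real) \<Rightarrow> real) \<Rightarrow> bool"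
  where "dg_solution s \<Omega> A c VX VY tn J r f u0 U \<longleftrightarrow>
    U \<in> tensor (dg_space tn J r) (tensor VX VY) \<and>
    (\<forall>V\<in>tensor (dg_space tn J r) (tensor VX VY).
      dg_form s \<Omega> A c tn J U V = dg_rhs \<Omega> f u0 tn J V)"

end

theory Submission
 imports Defs
begin

text \<open>
  The trace of an extension \<open>W\<close> is controlled slice by slice: for \<open>t > 0\<close> the function \<open>W (\<cdot>, t)\<close> is
  a competitor in the K-functional of \<open>tr W\<close> at \<open>t\<close>, and Hardy's inequality bounds the weighted
  integral of \<open>\<parallel>W (\<cdot>, t) - tr W\<parallel>\<^sup>2\<close> by the energy of \<open>W\<close>. Hence the trace maps the
  energy space boundedly into the fractional Sobolev space (\<open>hs_bound\<close>), and it is enough to estimate the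
  time discretization error in \<open>L\<^sup>2 (0, T)\<close> with values in the extension energy.

  In a basis of the discrete extension space that is orthonormal for the energy form, both the semidiscrete
  and the fully discrete problem become the system \<open>m u' + u = F\<close>, where the mass matrix \<open>m\<close>
  is the Gram matrix of the traces; it is only positive semidefinite, but it is bounded by a constant
  that does not depend on the discrete spaces. All estimates for this system use the two quadratic forms
  \<open>mm\<close> (the \<open>L\<^sup>2\<close> norm of the trace) and \<open>sq\<close> (the energy), hence are uniform in the spaces.

  Testing the \<open>l\<close>-th time derivative of the system with powers of \<open>t\<close> yields analytic regularity away
  from \<open>t = 0\<close>: \<open>\<integral> t\<^sup>2\<^sup>l sq (u\<^sup>(\<^sup>l\<^sup>))\<close> over \<open>(0, \<tau>)\<close> is at most \<open>D\<^sup>l (l!)\<^sup>2\<close> times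
  the energy on \<open>(0, \<tau>)\<close> plus a multiple of \<open>\<tau>\<close> (\<open>X_growth\<close>), and the interpolation norm of the
  initial value makes the energy on \<open>(0, \<tau>)\<close> decay like \<open>\<tau>\<^sup>\<beta>\<close> (\<open>X_0_bound\<close>,
  \<open>initial_splitting\<close>). On an element whose length is comparable to its distance from \<open>0\<close>, a Legendre
  projection of degree \<open>r\<close> then has an error \<open>exp (- \<gamma> r)\<close>; on a geometric mesh with linearly
  increasing degrees the sum of these errors is \<open>exp (- b (M + 1))\<close> (\<open>geometric_mesh_sum\<close>), and
  \<open>M + 1\<close> is at least a multiple of \<open>N\<^sup>1\<^sup>/\<^sup>2\<close>. The discontinuous Galerkin form is coercive, and
  the projection is chosen such that time derivatives and jumps disappear from the error equation
  (\<open>dg_element\<close>); what remains besides the projection error is \<open>u0 - uh0\<close>, which contributes the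
  second exponential.
\<close>

section \<open>Calculus of test functions\<close>

lemma Ck_SucI:
 assumes "!!x. (f has_derivative f' x) (at x)" "!!v. Ck k (%x. f' x v)"
 shows "Ck (Suc k) f"
proof -
 have "frechet_derivative f (at x) = f' x" for x
  using frechet_derivative_at[OF assms(1)] by simp
 then show ?thesis using assms by (auto simp: differentiable_def)
qed

lemma Ck_has_derivative: "Ck (Suc k) f ==> (f has_derivative frechet_derivative f (at x)) (at x)"
 by (simp add: frechet_derivative_works)

lemma Ck_Suc_imp: "Ck (Suc k) f ==> Ck k f"
proof (induction k arbitrary: f)
 case 0
 then show ?case
  by (auto intro!: continuous_at_imp_continuous_on differentiable_imp_continuous_within)
next
 case (Suc k)
 then show ?case by simp
qed

lemma Ck_const: "Ck k (%_. c)"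
proof (induction k arbitrary: c)
 case (Suc k)
 show ?case by (rule Ck_SucI[where f' = "%_ _. 0"]) (auto intro: Suc)
qed simp

lemma Ck_add: "Ck k f ==> Ck k g ==> Ck k (%x. f x + g x)"
proof (induction k arbitrary: f g)
 case 0
 then show ?case by (auto intro: continuous_on_add)
next
 case (Suc k)
 show ?case
  by (rule Ck_SucI, rule has_derivative_add[OF Ck_has_derivative[OF Suc.prems(1)] Ck_has_derivative[OF Suc.prems(2)]])
   (use Suc in auto)
qed

lemma Ck_mult: "Ck k f ==> Ck k g ==> Ck k (%x. f x * g x)"
proof (induction k arbitrary: f g)
 case 0
 then show ?case by (auto intro: continuous_on_mult)
next
 case (Suc k)
 have fg: "Ck k f" "Ck k g" using Suc.prems by (blast intro: Ck_Suc_imp)+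
 show ?case
 proof (rule Ck_SucI)
  show "((%x. f x * g x) has_derivative (%v. f x * frechet_derivative g (at x) v + frechet_derivative f (at x) v * g x)) (at x)" for x
   by (rule has_derivative_mult[OF Ck_has_derivative[OF Suc.prems(1)] Ck_has_derivative[OF Suc.prems(2)]])
  show "Ck k (%x. f x * frechet_derivative g (at x) v + frechet_derivative f (at x) v * g x)" for v
   using Suc.prems fg by (intro Ck_add Suc.IH) auto
 qed
qed

lemma Ck_cmult: "Ck k f ==> Ck k (%x. c * f x)"
 by (rule Ck_mult[OF Ck_const])

lemma Ck_prod: "(!!i. i \<in> I ==> Ck k (f i)) ==> Ck k (%x. \<Prod>i\<in>I. f i x)"
 by (induction I rule: infinite_finite_induct) (auto intro: Ck_const Ck_mult)

lemma Ck_affine: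
 assumes "bounded_linear A"
 shows "Ck k f ==> Ck k (%x. f (A x + c))"
proof (induction k arbitrary: f)
 case 0
 have "continuous_on UNIV (%x. A x + c)"
  by (intro continuous_intros linear_continuous_on assms)
 then show ?case using 0 by (auto intro: continuous_on_compose2[of UNIV f _ "%x. A x + c"])
next
 case (Suc k)
 have A: "((%x. A x + c) has_derivative A) (at x)" for x
  using bounded_linear_imp_has_derivative[OF assms] by (auto intro!: derivative_eq_intros)
 show ?case
 proof (rule Ck_SucI)
  show "((%x. f (A x + c)) has_derivative (%v. frechet_derivative f (at (A x + c)) (A v))) (at x)" for x
   using has_derivative_compose[OF A Ck_has_derivative[OF Suc.prems]] .
  show "Ck k (%x. frechet_derivative f (at (A x + c)) (A v))" for v
   using Suc.IH[of "%x. frechet_derivative f (at x) (A v)"] Suc.prems by simp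
 qed
qed

lemma Ck_real_sequence:
 fixes D :: "nat => real => real"
 assumes D: "!!l x. (D l has_real_derivative D (Suc l) x) (at x)"
 shows "Ck k (D l)"
proof (induction k arbitrary: l)
 case 0
 show ?case by (simp, rule continuous_at_imp_continuous_on) (use D DERIV_isCont in blast)
next
 case (Suc k)
 show ?case
  by (rule Ck_SucI[where f' = "%x v. D (Suc l) x * v"])
   (use D in "auto simp: has_field_derivative_def intro: Ck_mult[OF Suc Ck_const]")
qed

lemma Ck_inner_real:
 fixes h :: "real => real" and v :: "'a::euclidean_space"
 assumes "Ck k h"
 shows "Ck k (%x. h (x \<bullet> v + c))"
 by (rule Ck_affine[OF bounded_linear_inner_left assms])

text \<open>The functions \<open>p (1/x) exp (- 1/x)\<close>, extended by \<open>0\<close> to the nonpositive axis, are closed under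
  differentiation.\<close>

definition flat_exp :: "real poly => real => real" where
 "flat_exp p x = (if x > 0 then poly p (1 / x) * exp (- 1 / x) else 0)"

lemma poly_exp_tendsto_0: "((%y. poly p y / exp y) \<longlongrightarrow> (0 :: real)) at_top"
proof -
 have "((%y. \<Sum>i\<le>degree p. coeff p i * (y ^ i / exp y)) \<longlongrightarrow> (\<Sum>i\<le>degree p. coeff p i * 0)) at_top"
  by (intro tendsto_sum tendsto_mult tendsto_const tendsto_power_div_exp_0)
 then show ?thesis by (simp add: poly_altdef sum_divide_distrib)
qed

lemma flat_exp_DERIV:
 "(flat_exp p has_real_derivative flat_exp ([:0, 0, 1:] * (p - pderiv p)) x) (at x)"
proof -
 let ?A = "(%h. flat_exp p h / h) \<longlongrightarrow> 0"
 consider "x > 0" | "x < 0" | "x = 0" by linarith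
 then show ?thesis
 proof cases
  case 1
  have "((%x. poly p (1 / x) * exp (- 1 / x)) has_real_derivative
   flat_exp ([:0, 0, 1:] * (p - pderiv p)) x) (at x)"
  proof -
   have a: "((%x. poly p (1 / x)) has_real_derivative poly (pderiv p) (1 / x) * (- (1 / x^2))) (at x)"
   by (rule DERIV_chain2[OF poly_DERIV]) (use 1 in "auto intro!: derivative_eq_intros simp: power2_eq_square")
   have b: "((%x. exp (- 1 / x)) has_real_derivative exp (- 1 / x) * (1 / x^2)) (at x)"
   by (rule DERIV_chain2[OF DERIV_exp]) (use 1 in "auto intro!: derivative_eq_intros simp: power2_eq_square")
   show ?thesis
   by (rule DERIV_cong[OF DERIV_mult[OF a b]])
   (use 1 in "simp add: flat_exp_def algebra_simps power2_eq_square")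
  qed
  then show ?thesis
   by (rule has_field_derivative_transform_within_open[of _ _ _ "{0<..}"]) (use 1 in "auto simp: flat_exp_def")
 next
  case 2
  have "((%x. 0) has_real_derivative flat_exp ([:0, 0, 1:] * (p - pderiv p)) x) (at x)"
   using 2 by (simp add: flat_exp_def)
  then show ?thesis
   by (rule has_field_derivative_transform_within_open[of _ _ _ "{..<0}"]) (use 2 in "auto simp: flat_exp_def")
 next
  case 3
  have "?A (at_right 0)"
  proof -
   have "((%h. poly ([:0, 1:] * p) (inverse h) / exp (inverse h)) \<longlongrightarrow> 0) (at_right 0)"
   using poly_exp_tendsto_0 filterlim_inverse_at_top_right by (rule filterlim_compose)
   then show ?thesis
   by (rule tendsto_cong[THEN iffD1, rotated])
   (auto simp: eventually_at_right_field flat_exp_def field_simps exp_minus intro!: exI[of _ 1])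
  qed
  moreover have "?A (at_left 0)"
   by (rule tendsto_eventually) (auto simp: eventually_at_left_field flat_exp_def intro!: exI[of _ "-1"])
  ultimately have "?A (at 0)"
   by (simp add: filterlim_split_at)
  then show ?thesis
   unfolding DERIV_def using 3 by (simp add: flat_exp_def)
 qed
qed

definition smooth_ramp :: "real => real" where
 "smooth_ramp = flat_exp 1"

lemma Ck_smooth_ramp: "Ck k smooth_ramp"
proof -
 define q where "q l = ((%p. [:0, 0, 1:] * (p - pderiv p)) ^^ l) (1 :: real poly)" for l :: nat
 have "Ck k (flat_exp (q 0))"
  by (rule Ck_real_sequence[where D = "%l. flat_exp (q l)"]) (unfold q_def funpow.simps comp_def, rule flat_exp_DERIV)
 then show ?thesis by (simp add: smooth_ramp_def q_def)
qed

lemma smooth_ramp_bounds: "0 <= smooth_ramp x" "smooth_ramp x <= 1" "x <= 0 ==> smooth_ramp x = 0"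
  "x > 0 ==> smooth_ramp x > 0"
 by (auto simp: smooth_ramp_def flat_exp_def)

lemma smooth_ramp_limit: "x > 0 ==> (%n. smooth_ramp (real n * x)) \<longlonglongrightarrow> 1"
proof -
 assume x: "x > 0"
 have "(%n. - (1 / x) * inverse (real (Suc n))) \<longlonglongrightarrow> - (1 / x) * 0"
  by (intro tendsto_mult tendsto_const LIMSEQ_inverse_real_of_nat)
 moreover have "- (1 / x) * inverse (real (Suc n)) = - 1 / (real (Suc n) * x)" for n
  using x by (simp add: field_simps)
 ultimately have "(%n. - 1 / (real (Suc n) * x)) \<longlonglongrightarrow> 0" by simp
 then have "(%n. exp (- 1 / (real (Suc n) * x))) \<longlonglongrightarrow> exp 0"
  by (rule tendsto_exp)
 then have "(%n. smooth_ramp (real (Suc n) * x)) \<longlonglongrightarrow> 1"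
  using x by (simp add: smooth_ramp_def flat_exp_def)
 then show ?thesis by (rule LIMSEQ_imp_Suc)
qed

definition box_bump :: "'a::euclidean_space => 'a => nat => 'a => real" where
 "box_bump a b n x = (\<Prod>i\<in>Basis. smooth_ramp (real n * (x \<bullet> i - a \<bullet> i)) * smooth_ramp (real n * (b \<bullet> i - x \<bullet> i)))"

lemma Ck_box_bump: "Ck k (box_bump a b n)"
proof -
 have "Ck k (%x. smooth_ramp (real n * (x \<bullet> i - a \<bullet> i)) * smooth_ramp (real n * (b \<bullet> i - x \<bullet> i)))" for i
 proof (rule Ck_mult)
  show "Ck k (%x. smooth_ramp (real n * (x \<bullet> i - a \<bullet> i)))"
   using Ck_inner_real[OF Ck_smooth_ramp, of k "real n *\<^sub>R i" "- (real n * (a \<bullet> i))"]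
   by (simp add: algebra_simps)
  show "Ck k (%x. smooth_ramp (real n * (b \<bullet> i - x \<bullet> i)))"
   using Ck_inner_real[OF Ck_smooth_ramp, of k "- (real n *\<^sub>R i)" "real n * (b \<bullet> i)"]
   by (simp add: algebra_simps)
 qed
 then show ?thesis unfolding box_bump_def[abs_def] by (rule Ck_prod)
qed

lemma box_bump_bounds: "0 <= box_bump a b n x" "box_bump a b n x <= 1"
 unfolding box_bump_def
 by (auto intro!: prod_nonneg prod_le_1 mult_nonneg_nonneg mult_le_one smooth_ramp_bounds)

lemma box_bump_zero: "x \<notin> box a b ==> box_bump a b n x = 0"
proof -
 assume "x \<notin> box a b"
 then obtain i where i: "i \<in> Basis" "x \<bullet> i <= a \<bullet> i \<or> b \<bullet> i <= x \<bullet> i" by (auto simp: mem_box not_less)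
 then have "smooth_ramp (real n * (x \<bullet> i - a \<bullet> i)) = 0 \<or> smooth_ramp (real n * (b \<bullet> i - x \<bullet> i)) = 0"
  by (auto intro!: smooth_ramp_bounds(3) mult_nonneg_nonpos)
 then show ?thesis using i unfolding box_bump_def by (intro prod_zero) auto
qed

lemma box_bump_limit: "(%n. box_bump a b n x) \<longlonglongrightarrow> indicator (box a b) x"
proof (cases "x \<in> box a b")
 case True
 have "(%n. box_bump a b n x) \<longlonglongrightarrow> (\<Prod>i::'a\<in>Basis. 1 * 1)"
  unfolding box_bump_def
  by (intro tendsto_prod tendsto_mult smooth_ramp_limit) (use True in "auto simp: mem_box")
 then show ?thesis using True by simp
next
 case False
 then show ?thesis by (simp add: box_bump_zero)
qed

lemma box_bump_test_function: "cbox a b \<subseteq> S ==> box_bump a b n \<in> test_functions S"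
proof -
 assume S: "cbox a b \<subseteq> S"
 have "box_bump a b n x = 0" if "x \<notin> cbox a b" for x
  by (rule box_bump_zero) (use that box_subset_cbox[of a b] in auto)
 then have "\<exists>K. compact K & K \<subseteq> S & (\<forall>x. x \<notin> K --> box_bump a b n x = 0)"
  using S by (intro exI[of _ "cbox a b"]) (simp add: compact_cbox)
 then show ?thesis by (simp add: test_functions_def Ck_box_bump)
qed

lemma test_function_Ck: "\<phi> \<in> test_functions S ==> Ck k \<phi>"
 by (auto simp: test_functions_def)

lemma test_function_continuous: "\<phi> \<in> test_functions S ==> continuous_on A \<phi>"
 using test_function_Ck[of \<phi> S 0] continuous_on_subset by auto

lemma test_function_has_derivative:
 "\<phi> \<in> test_functions S ==> (\<phi> has_derivative frechet_derivative \<phi> (at x)) (at x)"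
 using Ck_has_derivative[OF test_function_Ck[of \<phi> S "Suc 0"]] .

lemma test_function_derivative_continuous:
 "\<phi> \<in> test_functions S ==> continuous_on A (%x. frechet_derivative \<phi> (at x) v)"
 using test_function_Ck[of \<phi> S "Suc 0"] by (auto intro: continuous_on_subset[OF _ subset_UNIV])

lemma frechet_derivative_zero_outside:
 assumes K: "closed K" and z: "!!x. x \<notin> K ==> f x = 0" and x: "x \<notin> K"
 shows "frechet_derivative f (at x) = (%_. 0 :: real)"
proof -
 have "((%_. 0) has_derivative (%_. 0)) (at x)" by simp
 then have "(f has_derivative (%_. 0)) (at x)"
  by (rule has_derivative_transform_within_open[where s = "- K"]) (use assms in auto)
 then show ?thesis by (rule frechet_derivative_at[symmetric])
qed

lemma grad_inner: "(\<phi> has_derivative D) (at x) ==> b \<in> Basis ==> grad \<phi> x \<bullet> b = D b"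
 unfolding grad_def
 by (simp add: inner_sum_left inner_Basis frechet_derivative_at[symmetric] if_distrib cong: if_cong)

text \<open>A test function together with the compact set that carries it and its gradient.\<close>

lemma test_function_support:
 assumes "\<phi> \<in> test_functions S"
 obtains K where "compact K" "K \<subseteq> S" "!!x. x \<notin> K ==> \<phi> x = 0"
  "!!x v. x \<notin> K ==> frechet_derivative \<phi> (at x) v = 0" "!!x. x \<notin> K ==> grad \<phi> x = 0"
proof -
 obtain K where K: "compact K" "K \<subseteq> S" "!!x. x \<notin> K ==> \<phi> x = 0"
  using assms by (auto simp: test_functions_def)
 have "frechet_derivative \<phi> (at x) = (%_. 0)" if "x \<notin> K" for x
  using frechet_derivative_zero_outside[OF compact_imp_closed[OF K(1)] K(3) that] by simp
 then show thesis using K by (intro that[of K]) (auto simp: grad_def)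
qed

lemma compact_supp_bounded:
 fixes f :: "'a::euclidean_space => 'b::real_normed_vector"
 assumes "compact K" "!!x. x \<notin> K ==> f x = 0" "continuous_on UNIV f"
 obtains B where "B > 0" "!!x. norm (f x) <= B"
proof -
 have "bounded (f ` K)"
  by (intro compact_imp_bounded compact_continuous_image continuous_on_subset[OF assms(3)] assms) auto
 then obtain B where "B > 0" "!!x. x \<in> K ==> norm (f x) <= B"
  by (auto simp: bounded_pos)
 then show thesis using assms(2) by (intro that[of B]) (metis norm_zero less_imp_le)+
qed

lemma compact_supp_integrable:
 fixes f :: "'a::euclidean_space => real"
 assumes "compact K" "!!x. x \<notin> K ==> f x = 0" "continuous_on UNIV f"
 shows "integrable lborel f"
proof -
 have "integrable lborel (%x. indicator K x *\<^sub>R f x)"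
  by (rule borel_integrable_compact) (use assms in "auto intro: continuous_on_subset")
 also have "(%x. indicator K x *\<^sub>R f x) = f"
 proof
  fix x show "indicator K x *\<^sub>R f x = f x" using assms(2)[of x] by (cases "x \<in> K") auto
 qed
 finally show ?thesis .
qed

text \<open>By translation invariance the integral of a difference quotient vanishes.\<close>

lemma integral_derivative_compact_support:
 fixes \<psi> :: "'a::euclidean_space => real"
 assumes d: "!!x. (\<psi> has_derivative D x) (at x)" and c: "continuous_on UNIV (%x. D x v)"
  and K: "compact K" "!!x. x \<notin> K ==> \<psi> x = 0"
 shows "(LINT x|lborel. D x v) = 0"
proof -
 have c\<psi>: "continuous_on UNIV \<psi>"
  using d has_derivative_continuous by (blast intro: continuous_at_imp_continuous_on)
 have Dz: "D x v = 0" if "x \<notin> K" for x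
 proof -
  have "D x = frechet_derivative \<psi> (at x)" by (rule frechet_derivative_at[OF d])
  then show ?thesis using frechet_derivative_zero_outside[OF compact_imp_closed[OF K(1)] K(2) that] by simp
 qed
 obtain B where B: "B > 0" "!!x. norm (D x v) <= B" using compact_supp_bounded[OF K(1) Dz c] by auto
 obtain R where R: "!!x. x \<in> K ==> norm x <= R" using compact_imp_bounded[OF K(1)] by (auto simp: bounded_iff)
 define q where "q n x = real (Suc n) * (\<psi> (x + (1 / real (Suc n)) *\<^sub>R v) - \<psi> x)" for n x
 have ray: "((%t. \<psi> (x + t *\<^sub>R v)) has_real_derivative D (x + t *\<^sub>R v) v) (at t)" for x t
 proof -
  have "((%t. x + t *\<^sub>R v) has_derivative (%t. t *\<^sub>R v)) (at t)" by (auto intro!: derivative_eq_intros)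
  from has_derivative_compose[OF this d]
  have "((%t. \<psi> (x + t *\<^sub>R v)) has_derivative (%s. D (x + t *\<^sub>R v) (s *\<^sub>R v))) (at t)" .
  moreover have "D (x + t *\<^sub>R v) (s *\<^sub>R v) = D (x + t *\<^sub>R v) v * s" for s
   using linear_scale[OF has_derivative_linear[OF d]] by simp
  ultimately show ?thesis by (simp add: has_field_derivative_def)
 qed
 have qb: "\<bar>q n x\<bar> <= B" for n x
 proof -
  obtain z where "\<psi> (x + (1 / real (Suc n)) *\<^sub>R v) - \<psi> (x + 0 *\<^sub>R v) = (1 / real (Suc n) - 0) * D (x + z *\<^sub>R v) v"
   using MVT2[of 0 "1 / real (Suc n)" "%t. \<psi> (x + t *\<^sub>R v)" "%t. D (x + t *\<^sub>R v) v"] ray by auto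
  then have "q n x = D (x + z *\<^sub>R v) v" by (simp add: q_def)
  then show ?thesis using B(2)[of "x + z *\<^sub>R v"] by simp
 qed
 have qz: "q n x = 0" if "norm x > R + norm v" for n x
 proof -
  have "norm x <= norm (x + (1 / real (Suc n)) *\<^sub>R v) + norm ((1 / real (Suc n)) *\<^sub>R v)"
   using norm_triangle_ineq4[of "x + (1 / real (Suc n)) *\<^sub>R v" "(1 / real (Suc n)) *\<^sub>R v"] by simp
  moreover have "norm ((1 / real (Suc n)) *\<^sub>R v) <= norm v"
   using mult_right_mono[of "1 / real (Suc n)" 1 "norm v"] by simp
  ultimately have "x + (1 / real (Suc n)) *\<^sub>R v \<notin> K" using R that by force
  moreover have "x \<notin> K" using R[of x] that norm_ge_zero[of v] by linarith
  ultimately show ?thesis by (simp add: q_def K(2))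
 qed
 have int\<psi>: "integrable lborel \<psi>" by (rule compact_supp_integrable[OF K c\<psi>])
 have mD: "(%x. D x v) \<in> borel_measurable lborel" using c by (simp add: borel_measurable_continuous_onI)
 have m\<psi>: "\<psi> \<in> borel_measurable borel" using c\<psi> by (simp add: borel_measurable_continuous_onI)
 have "(%n. LINT x|lborel. q n x) \<longlonglongrightarrow> (LINT x|lborel. D x v)"
 proof (rule integral_dominated_convergence[where w = "%x. B * indicator (cball 0 (R + norm v)) x"])
  show "q n \<in> borel_measurable lborel" for n
   unfolding q_def using m\<psi> by simp
  have "emeasure lborel (cball (0::'a) (R + norm v)) < \<infinity>" by (rule emeasure_lborel_cball_finite)
  then show "integrable lborel (%x::'a. B * indicator (cball 0 (R + norm v)) x :: real)"
   by (intro integrable_mult_right integrable_real_indicator) auto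
  show "AE x in lborel. (%n. q n x) \<longlonglongrightarrow> D x v"
  proof (rule AE_I2)
   fix x
   have "((%h. (\<psi> (x + h *\<^sub>R v) - \<psi> x) / h) \<longlongrightarrow> D x v) (at 0)"
   using ray[of x 0] by (simp add: DERIV_def)
   moreover have "filterlim (%n. 1 / real (Suc n)) (at 0) sequentially"
   unfolding filterlim_at using LIMSEQ_Suc[OF lim_1_over_n] by auto
   ultimately have "(%n. (\<psi> (x + (1 / real (Suc n)) *\<^sub>R v) - \<psi> x) / (1 / real (Suc n))) \<longlonglongrightarrow> D x v"
   by (rule filterlim_compose)
   then show "(%n. q n x) \<longlonglongrightarrow> D x v" by (simp add: q_def mult.commute)
  qed
  show "AE x in lborel. norm (q n x) <= B * indicator (cball 0 (R + norm v)) x" for n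
   using qb[of n] qz[of _ n] by (intro AE_I2) (auto simp: indicator_def not_le)
 qed (use mD in auto)
 moreover have "(LINT x|lborel. q n x) = 0" for n
 proof -
  define h where "h = (1 / real (Suc n)) *\<^sub>R v"
  have "(LINT x|lborel. \<psi> (h + x)) = integral\<^sup>L (distr lborel borel ((+) h)) \<psi>"
   by (rule integral_distr[symmetric]) (use m\<psi> in auto)
  also have "... = (LINT x|lborel. \<psi> x)" by (simp add: lborel_distr_plus)
  finally have e: "(LINT x|lborel. \<psi> (x + h)) = (LINT x|lborel. \<psi> x)" by (simp add: add.commute)
  have "integrable lborel (%x. \<psi> (h + x))"
   using int\<psi> m\<psi> by (subst integrable_distr_eq[of "(+) h" lborel borel \<psi>, symmetric]) (auto simp: lborel_distr_plus)
  then have "(LINT x|lborel. \<psi> (x + h) - \<psi> x) = 0"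
   using int\<psi> e by (subst Bochner_Integration.integral_diff) (auto simp: add.commute)
  moreover have "q n x = real (Suc n) * (\<psi> (x + h) - \<psi> x)" for x by (simp only: q_def h_def)
  ultimately show ?thesis by simp
 qed
 ultimately have "(%n::nat. 0) \<longlonglongrightarrow> (LINT x|lborel. D x v)" by simp
 then show ?thesis using LIMSEQ_unique[OF tendsto_const] by metis
qed

section \<open>The fundamental lemma of the calculus of variations\<close>

lemma AE_zero_if_box_integrals_zero:
 fixes g :: "'a::euclidean_space => real"
 assumes g: "integrable lborel g" and z: "!!a b. (LINT x:box a b|lborel. g x) = 0" and t: "integral\<^sup>L lborel g = 0"
 shows "AE x in lborel. g x = 0"
proof (rule density_unique_real[OF g])
 show "integrable lborel (%_::'a. 0::real)" by simp
 have si: "set_integrable lborel A g" if "A \<in> sets borel" for A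
  unfolding set_integrable_def using integrable_mult_indicator[OF _ g, of A] that by simp
 fix A :: "'a set" assume "A \<in> sets lborel"
 then have gen: "A \<in> sigma_sets UNIV (range (%(a, b). box a b :: 'a set))"
  using sets_measure_of[of "range (%(a, b). box a b :: 'a set)" UNIV] by (simp add: borel_eq_box)
 have "Int_stable (range (%(a, b). box a b :: 'a set))" "range (%(a, b). box a b :: 'a set) \<subseteq> Pow UNIV"
  by (auto simp: Int_stable_def box_Int_box)
 from this gen have "(LINT x:A|lborel. g x) = 0"
 proof (induction rule: sigma_sets_induct_disjoint)
  case (basic A)
  then show ?case using z by auto
 next
  case empty
  then show ?case by (simp add: set_lebesgue_integral_def)
 next
  case (compl A)
  have A: "A \<in> sets borel" using compl(1) by (simp add: borel_eq_box)
  have "(LINT x:UNIV - A|lborel. g x) = (LINT x|lborel. g x - indicator A x *\<^sub>R g x)"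
   unfolding set_lebesgue_integral_def by (intro Bochner_Integration.integral_cong) (auto simp: indicator_def)
  also have "... = 0"
   using si[OF A] g t compl(2) by (subst Bochner_Integration.integral_diff) (auto simp: set_integrable_def set_lebesgue_integral_def)
  finally show ?case .
 next
  case (union A)
  have A: "A i \<in> sets borel" for i using union(2) by (auto simp: borel_eq_box)
  have "(LINT x:(\<Union>i. A i)|lborel. g x) = (\<Sum>i. (LINT x:(A i)|lborel. g x))"
   using A union(1) by (intro lebesgue_integral_countable_add si) (auto simp: disjoint_family_on_def)
  then show ?case using union(3) by simp
 qed
 then show "(LINT x:A|lborel. g x) = (LINT x:A|lborel. 0)" by (simp add: set_lebesgue_integral_def)
qed

text \<open>Scaled box bumps tend to the indicator functions of boxes, and boxes generate the Borel sets.\<close>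

lemma fundamental_lemma:
 fixes h :: "'a::euclidean_space => real"
 assumes S: "open S" and h: "!!K. compact K ==> K \<subseteq> S ==> set_integrable lborel K h"
  and z: "!!\<phi>. \<phi> \<in> test_functions S ==> (LINT x:S|lborel. \<phi> x * h x) = 0"
 shows "AE x in lborel. x \<in> S --> h x = 0"
proof -
 let ?A = "%a b x. indicator (cbox a b) x * h x"
 let ?B = "%a b. (LINT x|lborel. indicator (box a b) x * h x)"
 have box0: "(LINT x:box a b|lborel. h x) = 0" if ab: "cbox a b \<subseteq> S" for a b
 proof -
  have hi: "integrable lborel (%x. indicator (cbox a b) x * h x)"
   using h[OF compact_cbox ab] by (simp add: set_integrable_def)
  have hb: "set_integrable lborel (box a b) h"
   by (rule set_integrable_subset[OF h[OF compact_cbox ab]]) (auto simp: box_subset_cbox)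
  have e: "box_bump a b n x * (?A a b x) = indicator S x *\<^sub>R (box_bump a b n x * h x)" for n x
   using ab box_bump_zero[of x a b n] box_subset_cbox[of a b] by (auto simp: indicator_def)
  have m: "box_bump a b n \<in> borel_measurable borel" for n :: nat and a b :: 'a
   using Ck_box_bump[of 0 a b n] by (simp add: borel_measurable_continuous_onI)
  have "(%n. LINT x|lborel. box_bump a b n x * (?A a b x)) \<longlonglongrightarrow>
   (?B a b)"
  proof (rule integral_dominated_convergence[where w = "%x. \<bar>indicator (cbox a b) x * h x\<bar>"])
   show "AE x in lborel. (%n. box_bump a b n x * (?A a b x)) \<longlonglongrightarrow> indicator (box a b) x * h x"
   proof (rule AE_I2)
   fix x
   have "(%n. box_bump a b n x * (?A a b x)) \<longlonglongrightarrow> indicator (box a b) x * (?A a b x)"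
   by (intro tendsto_mult box_bump_limit tendsto_const)
   moreover have "indicator (box a b) x * (?A a b x) = indicator (box a b) x * h x"
   using box_subset_cbox[of a b] by (auto simp: indicator_def)
   ultimately show "(%n. box_bump a b n x * (?A a b x)) \<longlonglongrightarrow> indicator (box a b) x * h x" by simp
   qed
   show "AE x in lborel. norm (box_bump a b n x * (?A a b x)) <= \<bar>indicator (cbox a b) x * h x\<bar>" for n
   proof (rule AE_I2)
   fix x
   have "\<bar>box_bump a b n x\<bar> * \<bar>indicator (cbox a b) x * h x\<bar> <= 1 * \<bar>indicator (cbox a b) x * h x\<bar>"
   using box_bump_bounds[of a b n x] by (intro mult_right_mono) auto
   then show "norm (box_bump a b n x * (?A a b x)) <= \<bar>indicator (cbox a b) x * h x\<bar>"
   by (simp add: abs_mult)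
   qed
   show "(%x. indicator (box a b) x * h x) \<in> borel_measurable lborel"
   using borel_measurable_integrable[OF hb[unfolded set_integrable_def]] by simp
   show "(%x. box_bump a b n x * (?A a b x)) \<in> borel_measurable lborel" for n
   by (rule borel_measurable_times) (use m[of a b n] borel_measurable_integrable[OF hi] in simp_all)
  qed (use hi in auto)
  moreover have "(LINT x|lborel. box_bump a b n x * (?A a b x)) = 0" for n
   unfolding e using z[OF box_bump_test_function[OF ab], of n] by (simp add: set_lebesgue_integral_def)
  ultimately have "(%n::nat. 0) \<longlonglongrightarrow> (?B a b)" by simp
  then have "(?B a b) = 0" using LIMSEQ_unique[OF tendsto_const] by metis
  then show ?thesis by (simp add: set_lebesgue_integral_def)
 qed
 have local: "AE x in lborel. x \<in> box a b --> h x = 0" if ab: "cbox a b \<subseteq> S" for a b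
 proof -
  have hb: "set_integrable lborel (box a b) h"
   by (rule set_integrable_subset[OF h[OF compact_cbox ab]]) (auto simp: box_subset_cbox)
  have "AE x in lborel. indicator (box a b) x * h x = 0"
  proof (rule AE_zero_if_box_integrals_zero)
   show "integrable lborel (%x. indicator (box a b) x * h x)"
   using hb by (simp add: set_integrable_def)
   show "(?B a b) = 0"
   using box0[OF ab] by (simp add: set_lebesgue_integral_def)
   fix c d :: 'a
   obtain a' b' where i: "box a b \<inter> box c d = box a' b'" by (simp add: box_Int_box)
   have "cbox a' b' \<subseteq> S \<or> box a' b' = {}"
   proof (cases "box a' b' = {}")
   case False
   then have "cbox a' b' = closure (box a' b')" by (simp add: closure_box)
   also have "... \<subseteq> closure (box a b)" using i by (intro closure_mono) auto
   also have "... \<subseteq> cbox a b" by (rule closure_minimal[OF box_subset_cbox closed_cbox])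
   finally show ?thesis using ab by blast
   qed simp
   moreover have "(LINT x:box c d|lborel. indicator (box a b) x * h x) = (LINT x:box a' b'|lborel. h x)"
   unfolding set_lebesgue_integral_def i[symmetric]
   by (intro Bochner_Integration.integral_cong) (auto simp: indicator_def)
   ultimately show "(LINT x:box c d|lborel. indicator (box a b) x * h x) = 0"
   using box0[of a' b'] by (auto simp: set_lebesgue_integral_def)
  qed
  then show ?thesis by eventually_elim (auto simp: indicator_def split: if_splits)
 qed
 define F where "F = {box a b | a b. cbox a b \<subseteq> S}"
 obtain F' where F': "F' \<subseteq> F" "countable F'" "\<Union>F' = \<Union>F"
  using Lindelof[of F] by (auto simp: F_def)
 have "\<Union>F = S"
 proof
  show "\<Union>F \<subseteq> S" unfolding F_def using box_subset_cbox by blast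
  show "S \<subseteq> \<Union>F"
  proof
   fix x assume "x \<in> S"
   then obtain a b where "x \<in> box a b" "cbox a b \<subseteq> S" using S open_contains_cbox by metis
   then show "x \<in> \<Union>F" by (auto simp: F_def)
  qed
 qed
 have "AE x in lborel. \<forall>X\<in>F'. x \<in> X --> h x = 0"
 proof (subst AE_ball_countable[OF F'(2)], safe)
  fix X assume "X \<in> F'"
  then obtain a b where "X = box a b" "cbox a b \<subseteq> S" using F'(1) by (auto simp: F_def)
  then show "AE x in lborel. x \<in> X --> h x = 0" using local by simp
 qed
 then show ?thesis
 proof eventually_elim
  case (elim x)
  then show ?case using F'(3) \<open>\<Union>F = S\<close> by auto
 qed
qed

section \<open>Square integrable functions\<close>

lemma integral_vol: "S \<in> sets borel ==> (LINT x|vol S. f x) = (LINT x:S|lborel. (f x :: 'b::euclidean_space))"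
 unfolding vol_def set_lebesgue_integral_def by (subst integral_restrict_space) auto

lemma integrable_vol: "S \<in> sets borel ==> integrable (vol S) f \<longleftrightarrow> set_integrable lborel S (f :: _ => 'b::euclidean_space)"
 unfolding vol_def set_integrable_def by (subst integrable_restrict_space) auto

lemma AE_vol: "S \<in> sets borel ==> (AE x in vol S. P x) \<longleftrightarrow> (AE x in lborel. x \<in> S --> P x)"
 unfolding vol_def by (subst AE_restrict_space_iff) auto

lemma L2I: "u \<in> borel_measurable M ==> integrable M (%x. (norm (u x))^2) ==> u \<in> L2 M"
 by (simp add: L2_def)

lemma L2_meas: "u \<in> L2 M ==> u \<in> borel_measurable M"
 by (simp add: L2_def)

lemma L2_int: "u \<in> L2 M ==> integrable M (%x. (norm (u x))^2)"
 by (simp add: L2_def)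

lemma L2_int_real: "u \<in> L2 M ==> integrable M (%x. (u x :: real)^2)"
 by (simp add: L2_def)

lemma L2_add: "u \<in> L2 M ==> v \<in> L2 M ==> (%x. u x + v x) \<in> L2 M"
proof -
 assume u: "u \<in> L2 M" and v: "v \<in> L2 M"
 show ?thesis
 proof (rule L2I)
  show m: "(%x. u x + v x) \<in> borel_measurable M" using u v by (intro borel_measurable_add L2_meas)
  show "integrable M (%x. (norm (u x + v x))^2)"
  proof (rule Bochner_Integration.integrable_bound[of _ "%x. 2 * (norm (u x))^2 + 2 * (norm (v x))^2"])
   show "integrable M (%x. 2 * (norm (u x))^2 + 2 * (norm (v x))^2)"
   using L2_int[OF u] L2_int[OF v] by auto
   show "AE x in M. norm ((norm (u x + v x))^2) <= norm (2 * (norm (u x))^2 + 2 * (norm (v x))^2)"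
   proof (rule AE_I2)
   fix x
   have "(norm (u x + v x))^2 <= (norm (u x) + norm (v x))^2" by (intro power_mono norm_triangle_ineq) auto
   also have "... <= 2 * (norm (u x))^2 + 2 * (norm (v x))^2"
   using sum_squares_bound[of "norm (u x)" "norm (v x)"] by (simp add: power2_sum)
   finally show "norm ((norm (u x + v x))^2) <= norm (2 * (norm (u x))^2 + 2 * (norm (v x))^2)" by simp
   qed
  qed (use m in simp)
 qed
qed

lemma L2_scaleR: "u \<in> L2 M ==> (%x. c *\<^sub>R u x) \<in> L2 M"
 by (auto simp: L2_def power_mult_distrib)

lemma L2_mult_const: "u \<in> L2 M ==> (%x. c * u x :: real) \<in> L2 M"
 using L2_scaleR[of u M c] by simp

lemma L2_diff: "u \<in> L2 M ==> v \<in> L2 M ==> (%x. u x - v x) \<in> L2 M"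
 using L2_add[of u M "%x. (-1) *\<^sub>R v x"] L2_scaleR[of v M "-1"] by simp

lemma L2_product_integrable: "u \<in> L2 M ==> v \<in> L2 M ==> integrable M (%x. u x * v x :: real)"
proof (rule Bochner_Integration.integrable_bound[of _ "%x. (u x)^2 + (v x)^2"])
 assume u: "u \<in> L2 M" and v: "v \<in> L2 M"
 show "integrable M (%x. (u x)^2 + (v x)^2)" using u v by (intro Bochner_Integration.integrable_add L2_int_real)
 show "(%x. u x * v x) \<in> borel_measurable M" using u v by (intro borel_measurable_times L2_meas)
 have "\<bar>u x * v x\<bar> <= (u x)^2 + (v x)^2" for x
 proof -
  have "2 * (\<bar>u x\<bar> * \<bar>v x\<bar>) <= (u x)^2 + (v x)^2"
   using sum_squares_bound[of "\<bar>u x\<bar>" "\<bar>v x\<bar>"] by simp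
  moreover have "0 <= \<bar>u x\<bar> * \<bar>v x\<bar>" by simp
  ultimately show ?thesis unfolding abs_mult by linarith
 qed
 then show "AE x in M. norm (u x * v x) <= norm ((u x)^2 + (v x)^2)" by simp
qed

lemma L2_norm_sq: "(L2_norm M u)^2 = (LINT x|M. (norm (u x))^2)"
 by (simp add: L2_norm_def)

lemma L2_norm_sq_real: "(L2_norm M u)^2 = (LINT x|M. (u x :: real)^2)"
 by (simp add: L2_norm_def)

lemma L2_norm_nonneg: "0 <= L2_norm M u"
 by (simp add: L2_norm_def)

lemma L2_inner_self: "L2_inner M u u = (L2_norm M u)^2"
 by (simp add: L2_inner_def L2_norm_sq_real flip: power2_eq_square)

lemma L2_inner_sym: "L2_inner M u v = L2_inner M v u"
 by (simp add: L2_inner_def mult.commute)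

lemma L2_inner_add: "u \<in> L2 M ==> u' \<in> L2 M ==> v \<in> L2 M ==> L2_inner M (u + u') v = L2_inner M u v + L2_inner M u' v"
 by (simp add: L2_inner_def ring_distribs L2_product_integrable)

lemma L2_inner_diff: "u \<in> L2 M ==> u' \<in> L2 M ==> v \<in> L2 M ==> L2_inner M (u - u') v = L2_inner M u v - L2_inner M u' v"
 by (simp add: L2_inner_def left_diff_distrib L2_product_integrable)

lemma L2_inner_scale: "L2_inner M (c *\<^sub>R u) v = c * L2_inner M u v"
 by (simp add: L2_inner_def scaleR_fun_def mult.assoc)

lemma L2_Cauchy_Schwarz:
 assumes u: "u \<in> L2 M" and v: "v \<in> L2 M"
 shows "\<bar>L2_inner M u v\<bar> <= L2_norm M u * L2_norm M v"
proof -
 define a b c where "a = (L2_norm M u)^2" and "b = L2_inner M u v" and "c = (L2_norm M v)^2"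
 have q: "0 <= a * s^2 + 2 * b * s * t + c * t^2" for s t :: real
 proof -
  have i: "integrable M (%x. (u x)^2)" "integrable M (%x. u x * v x)" "integrable M (%x. (v x)^2)"
   using u v by (auto intro: L2_int_real L2_product_integrable)
  have "0 <= (LINT x|M. (s * u x + t * v x)^2)" by simp
  also have "(%x. (s * u x + t * v x)^2) = (%x. s^2 * (u x)^2 + (2 * s * t) * (u x * v x) + t^2 * (v x)^2)"
   by (auto simp: power2_eq_square algebra_simps)
  also have "integral\<^sup>L M ... = s^2 * a + (2 * s * t) * b + t^2 * c"
   using i by (simp add: a_def b_def c_def L2_norm_sq_real L2_inner_def)
  finally show ?thesis by (simp add: algebra_simps)
 qed
 have "b^2 <= a * c"
 proof (cases "c = 0")
  case True
  have "b = 0"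
  proof (rule ccontr)
   assume b: "b ~= 0"
   have "0 <= a * 1^2 + 2 * b * 1 * (- (a + 1) / (2 * b)) + c * (- (a + 1) / (2 * b))^2" by (rule q)
   also have "... = -1" using b True by simp
   finally show False by simp
  qed
  then show ?thesis using True by simp
 next
  case False
  then have c: "c > 0" by (simp add: c_def)
  have "0 <= a * c^2 + 2 * b * c * (- b) + c * (- b)^2" by (rule q)
  also have "... = c * (a * c - b^2)" by (simp add: power2_eq_square algebra_simps)
  finally show ?thesis using c by (simp add: zero_le_mult_iff)
 qed
 then have "\<bar>b\<bar>^2 <= (L2_norm M u * L2_norm M v)^2" by (simp add: a_def c_def power_mult_distrib)
 then show ?thesis
  unfolding b_def by (rule power2_le_imp_le) (simp add: L2_norm_nonneg)
qed

section \<open>Weak gradients\<close>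

lemma bounded_mult_integrable:
 fixes f :: "'a::euclidean_space => 'b::euclidean_space" and \<psi> :: "'a => real"
 assumes K: "compact K" and f: "set_integrable lborel K f"
  and \<psi>: "continuous_on UNIV \<psi>" "!!x. x \<notin> K ==> \<psi> x = 0"
 shows "integrable lborel (%x. \<psi> x *\<^sub>R f x)"
proof -
 let ?A = "%x. indicator K x *\<^sub>R f x"
 obtain B where B: "B > 0" "!!x. norm (\<psi> x) <= B" using compact_supp_bounded[OF K \<psi>(2,1)] by blast
 have e: "(%x. \<psi> x *\<^sub>R f x) = (%x. \<psi> x *\<^sub>R (?A x))"
 proof
  fix x show "\<psi> x *\<^sub>R f x = \<psi> x *\<^sub>R (?A x)"
   using \<psi>(2)[of x] by (cases "x \<in> K") auto
 qed
 have fi: "integrable lborel (%x. indicator K x *\<^sub>R f x)" using f by (simp add: set_integrable_def)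
 have m: "\<psi> \<in> borel_measurable lborel" using \<psi>(1) by (simp add: borel_measurable_continuous_onI)
 show ?thesis
  unfolding e
 proof (rule Bochner_Integration.integrable_bound[of _ "%x. B *\<^sub>R (?A x)"])
  show "integrable lborel (%x. B *\<^sub>R (?A x))" using fi by (rule integrable_scaleR_right)
  show "(%x. \<psi> x *\<^sub>R (?A x)) \<in> borel_measurable lborel"
   using borel_measurable_integrable[OF fi] m by (rule borel_measurable_scaleR[rotated])
  show "AE x in lborel. norm (\<psi> x *\<^sub>R (?A x)) <= norm (B *\<^sub>R (?A x))"
   unfolding norm_scaleR using B by (intro AE_I2 mult_right_mono) auto
 qed
qed

lemma grad_continuous: "\<phi> \<in> test_functions S ==> continuous_on A (grad \<phi>)"
 unfolding grad_def[abs_def]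
 by (intro continuous_intros test_function_derivative_continuous)

lemma grad_inner_test: "\<phi> \<in> test_functions S ==> b \<in> Basis ==> grad \<phi> x \<bullet> b = frechet_derivative \<phi> (at x) b"
 by (rule grad_inner[OF test_function_has_derivative])

lemma test_integrable:
 fixes f :: "'a::euclidean_space => 'b::euclidean_space"
 assumes \<phi>: "\<phi> \<in> test_functions S" and f: "!!K. compact K ==> K \<subseteq> S ==> set_integrable lborel K f"
 shows "set_integrable lborel S (%x. \<phi> x *\<^sub>R f x)"
  "set_integrable lborel S (%x. frechet_derivative \<phi> (at x) v *\<^sub>R f x)"
proof -
 obtain K where K: "compact K" "K \<subseteq> S" "!!x. x \<notin> K ==> \<phi> x = 0"
  "!!x v. x \<notin> K ==> frechet_derivative \<phi> (at x) v = 0" "!!x. x \<notin> K ==> grad \<phi> x = 0"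
  using test_function_support[OF \<phi>] by blast
 have "integrable lborel (%x. \<phi> x *\<^sub>R f x)"
  by (rule bounded_mult_integrable[OF K(1) f[OF K(1,2)] test_function_continuous[OF \<phi>] K(3)])
 also have "(%x. \<phi> x *\<^sub>R f x) = (%x. indicator S x *\<^sub>R (\<phi> x *\<^sub>R f x))"
 proof
  fix x show "\<phi> x *\<^sub>R f x = indicator S x *\<^sub>R (\<phi> x *\<^sub>R f x)"
   using K(2) K(3)[of x] by (cases "x \<in> S") auto
 qed
 finally show "set_integrable lborel S (%x. \<phi> x *\<^sub>R f x)" by (simp add: set_integrable_def)
 have "integrable lborel (%x. frechet_derivative \<phi> (at x) v *\<^sub>R f x)"
  by (rule bounded_mult_integrable[OF K(1) f[OF K(1,2)] test_function_derivative_continuous[OF \<phi>] K(4)])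
 also have "(%x. frechet_derivative \<phi> (at x) v *\<^sub>R f x) = (%x. indicator S x *\<^sub>R (frechet_derivative \<phi> (at x) v *\<^sub>R f x))"
 proof
  fix x show "frechet_derivative \<phi> (at x) v *\<^sub>R f x = indicator S x *\<^sub>R (frechet_derivative \<phi> (at x) v *\<^sub>R f x)"
   using K(2) K(4)[of x v] by (cases "x \<in> S") auto
 qed
 finally show "set_integrable lborel S (%x. frechet_derivative \<phi> (at x) v *\<^sub>R f x)" by (simp add: set_integrable_def)
qed

lemma grad_expand: "grad \<phi> x = (\<Sum>b\<in>Basis. frechet_derivative \<phi> (at x) b *\<^sub>R b)"
 by (simp add: grad_def)

lemma is_weak_grad_iff:
 fixes u :: "'a::euclidean_space => real"
 shows "is_weak_grad S u g \<longleftrightarrow>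
  (\<forall>K. compact K & K \<subseteq> S --> set_integrable lborel K u & set_integrable lborel K g) &
  (\<forall>\<phi>\<in>test_functions S. \<forall>b\<in>Basis.
   (LINT x:S|lborel. frechet_derivative \<phi> (at x) b * u x) = - (LINT x:S|lborel. \<phi> x * (g x \<bullet> b)))"
  (is "_ \<longleftrightarrow> ?I & ?E")
proof -
 have key: "(LINT x:S|lborel. u x *\<^sub>R grad \<phi> x) = - (LINT x:S|lborel. \<phi> x *\<^sub>R g x) \<longleftrightarrow>
   (\<forall>b\<in>Basis. (LINT x:S|lborel. frechet_derivative \<phi> (at x) b * u x) = - (LINT x:S|lborel. \<phi> x * (g x \<bullet> b)))"
  if I: ?I and \<phi>: "\<phi> \<in> test_functions S" for \<phi>
 proof -
  have i1: "set_integrable lborel S (%x. frechet_derivative \<phi> (at x) b * u x)" for b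
   using test_integrable(2)[OF \<phi>, of u b] I by simp
  have i2: "set_integrable lborel S (%x. \<phi> x *\<^sub>R g x)"
   using test_integrable(1)[OF \<phi>, of g] I by simp
  have "set_integrable lborel S (%x. \<Sum>b\<in>Basis. (frechet_derivative \<phi> (at x) b * u x) *\<^sub>R b)"
   unfolding set_integrable_def scaleR_sum_right
   by (intro Bochner_Integration.integrable_sum) (use i1 in \<open>auto simp: set_integrable_def intro!: integrable_scaleR_left[of "_", simplified]\<close>)
  moreover have "u x *\<^sub>R grad \<phi> x = (\<Sum>b\<in>Basis. (frechet_derivative \<phi> (at x) b * u x) *\<^sub>R b)" for x
   by (simp add: grad_expand scaleR_sum_right mult.commute)
  ultimately have i3: "set_integrable lborel S (%x. u x *\<^sub>R grad \<phi> x)" by simp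
  have "(LINT x:S|lborel. u x *\<^sub>R grad \<phi> x) \<bullet> b = (LINT x:S|lborel. frechet_derivative \<phi> (at x) b * u x)"
   if "b \<in> Basis" for b
   unfolding set_lebesgue_integral_def
   by (subst integral_inner_left[symmetric])
   (use i3 grad_inner_test[OF \<phi> that] in "auto simp: set_integrable_def mult.commute mult.assoc intro!: Bochner_Integration.integral_cong")
  moreover have "(LINT x:S|lborel. \<phi> x *\<^sub>R g x) \<bullet> b = (LINT x:S|lborel. \<phi> x * (g x \<bullet> b))" for b
   unfolding set_lebesgue_integral_def
   by (subst integral_inner_left[symmetric]) (use i2 in "auto simp: set_integrable_def mult.assoc")
  ultimately show ?thesis by (subst euclidean_eq_iff) simp
 qed
 show ?thesis
  unfolding is_weak_grad_def
  by (rule conj_cong[OF refl], rule ball_cong[OF refl], rule key) assumption+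
qed

lemma is_weak_gradD:
 assumes "is_weak_grad S u g"
 shows "!!K. compact K ==> K \<subseteq> S ==> set_integrable lborel K u"
  "!!K. compact K ==> K \<subseteq> S ==> set_integrable lborel K g"
  "!!\<phi> b. \<phi> \<in> test_functions S ==> b \<in> Basis ==>
   (LINT x:S|lborel. frechet_derivative \<phi> (at x) b * u x) = - (LINT x:S|lborel. \<phi> x * (g x \<bullet> b))"
 using assms[unfolded is_weak_grad_iff, THEN conjunct1] assms[unfolded is_weak_grad_iff, THEN conjunct2]
 by simp_all

lemma set_integrable_inner: "set_integrable lborel K g ==> set_integrable lborel K (%x. (g x :: 'b::euclidean_space) \<bullet> b)"
 unfolding set_integrable_def
 using integrable_inner_left[of b lborel "%x. indicator K x *\<^sub>R g x"] by simp

text \<open>This determines the choice made by \<open>wgrad\<close> up to null sets, so that properties of one weak gradient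
  carry over to it.\<close>

lemma weak_grad_unique:
 fixes u :: "'a::euclidean_space => real"
 assumes S: "open S" and g: "is_weak_grad S u g" and g': "is_weak_grad S u g'"
 shows "AE x in lborel. x \<in> S --> g x = g' x"
proof -
 note G = is_weak_gradD[OF g] and G' = is_weak_gradD[OF g']
 have "AE x in lborel. x \<in> S --> (g x - g' x) \<bullet> b = 0" if b: "b \<in> Basis" for b
 proof (rule fundamental_lemma[OF S])
  fix K assume K: "compact K" "K \<subseteq> S"
  show "set_integrable lborel K (%x. (g x - g' x) \<bullet> b)"
   using set_integral_diff(1)[OF G(2)[OF K] G'(2)[OF K]] by (rule set_integrable_inner)
 next
  fix \<phi> assume \<phi>: "\<phi> \<in> test_functions S"
  have i: "set_integrable lborel S (%x. \<phi> x * (g x \<bullet> b))" "set_integrable lborel S (%x. \<phi> x * (g' x \<bullet> b))"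
   using set_integrable_inner[OF test_integrable(1)[OF \<phi> G(2)], of b]
   set_integrable_inner[OF test_integrable(1)[OF \<phi> G'(2)], of b] by auto
  have "(LINT x:S|lborel. \<phi> x * ((g x - g' x) \<bullet> b)) = (LINT x:S|lborel. \<phi> x * (g x \<bullet> b) - \<phi> x * (g' x \<bullet> b))"
   by (simp add: inner_diff_left right_diff_distrib)
  also have "... = (LINT x:S|lborel. \<phi> x * (g x \<bullet> b)) - (LINT x:S|lborel. \<phi> x * (g' x \<bullet> b))"
   using i by (rule set_integral_diff)
  also have "... = 0" using G(3)[OF \<phi> b] G'(3)[OF \<phi> b] by simp
  finally show "(LINT x:S|lborel. \<phi> x * ((g x - g' x) \<bullet> b)) = 0" .
 qed
 then have "AE x in lborel. \<forall>b\<in>Basis. x \<in> S --> (g x - g' x) \<bullet> b = 0"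
  by (subst AE_ball_countable) (auto intro: countable_finite)
 then show ?thesis
 proof eventually_elim
  case (elim x)
  show ?case
  proof
   assume "x \<in> S"
   then have "g x - g' x = 0" using elim by (subst euclidean_eq_iff) simp
   then show "g x = g' x" by simp
  qed
 qed
qed

lemma wgrad_weak_grad: "is_weak_grad S u g ==> is_weak_grad S u (wgrad S u)"
 unfolding wgrad_def by (rule someI[of "is_weak_grad S u"])

lemma wgrad_AE: "open S ==> is_weak_grad S u g ==> AE x in lborel. x \<in> S --> wgrad S u x = g x"
 by (rule weak_grad_unique[OF _ wgrad_weak_grad])

lemma weak_grad_add:
 assumes g: "is_weak_grad S u g" and h: "is_weak_grad S v h"
 shows "is_weak_grad S (%x. u x + v x) (%x. g x + h x)"
 unfolding is_weak_grad_iff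
proof (intro conjI allI impI ballI)
 note G = is_weak_gradD[OF g] and H = is_weak_gradD[OF h]
 fix K assume "compact K & K \<subseteq> S"
 then show "set_integrable lborel K (%x. u x + v x)" "set_integrable lborel K (%x. g x + h x)"
  using G H by (auto intro!: set_integral_add)
next
 note G = is_weak_gradD[OF g] and H = is_weak_gradD[OF h]
 fix \<phi> b assume \<phi>: "\<phi> \<in> test_functions S" and b: "(b::'a) \<in> Basis"
 have i: "set_integrable lborel S (%x. \<phi> x * (g x \<bullet> b))" "set_integrable lborel S (%x. \<phi> x * (h x \<bullet> b))"
  using set_integrable_inner[OF test_integrable(1)[OF \<phi> G(2)], of b]
   set_integrable_inner[OF test_integrable(1)[OF \<phi> H(2)], of b] by auto
 have j: "set_integrable lborel S (%x. frechet_derivative \<phi> (at x) b * u x)"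
  "set_integrable lborel S (%x. frechet_derivative \<phi> (at x) b * v x)"
  using test_integrable(2)[OF \<phi> G(1), of b] test_integrable(2)[OF \<phi> H(1), of b] by auto
 show "(LINT x:S|lborel. frechet_derivative \<phi> (at x) b * (u x + v x)) = - (LINT x:S|lborel. \<phi> x * ((g x + h x) \<bullet> b))"
  using G(3)[OF \<phi> b] H(3)[OF \<phi> b] i j
  by (simp add: inner_add_left distrib_left set_integral_add)
qed

lemma weak_grad_scale:
 assumes g: "is_weak_grad S u g"
 shows "is_weak_grad S (%x. c * u x) (%x. c *\<^sub>R g x)"
 unfolding is_weak_grad_iff
proof (intro conjI allI impI ballI)
 note G = is_weak_gradD[OF g]
 fix K assume "compact K & K \<subseteq> S"
 then have "set_integrable lborel K u" "set_integrable lborel K g" using G by auto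
 then show "set_integrable lborel K (%x. c * u x)" "set_integrable lborel K (%x. c *\<^sub>R g x)"
  by (auto simp: set_integrable_scaleR_right)
next
 note G = is_weak_gradD[OF g]
 fix \<phi> b assume \<phi>: "\<phi> \<in> test_functions S" and b: "(b::'a) \<in> Basis"
 have "(LINT x:S|lborel. frechet_derivative \<phi> (at x) b * (c * u x)) = (LINT x:S|lborel. c * (frechet_derivative \<phi> (at x) b * u x))"
  by (simp add: mult.left_commute)
 also have "... = c * - (LINT x:S|lborel. \<phi> x * (g x \<bullet> b))" using G(3)[OF \<phi> b] by simp
 also have "... = - (LINT x:S|lborel. c * (\<phi> x * (g x \<bullet> b)))" by simp
 finally show "(LINT x:S|lborel. frechet_derivative \<phi> (at x) b * (c * u x)) = - (LINT x:S|lborel. \<phi> x * ((c *\<^sub>R g x) \<bullet> b))"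
  by (simp add: mult.left_commute)
qed

section \<open>The Poincare inequality\<close>

text \<open>Integrating the derivative of \<open>(x \<bullet> b) \<phi>\<^sup>2\<close> over the space gives \<open>\<integral> \<phi>\<^sup>2 = - 2 \<integral> (x \<bullet> b) \<phi> \<partial>\<^sub>b\<phi>\<close>
  for every basis vector \<open>b\<close>.\<close>

lemma Poincare_test:
 fixes \<phi> :: "'a::euclidean_space => real"
 assumes \<phi>: "\<phi> \<in> test_functions S" and R: "!!x. x \<in> S ==> norm x <= R"
 shows "(LINT x|lborel. (\<phi> x)^2) <= 4 * R^2 * (LINT x|lborel. (norm (grad \<phi> x))^2)"
proof -
 obtain K where K: "compact K" "K \<subseteq> S" "!!x. x \<notin> K ==> \<phi> x = 0"
  "!!x v. x \<notin> K ==> frechet_derivative \<phi> (at x) v = 0" "!!x. x \<notin> K ==> grad \<phi> x = 0"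
  using test_function_support[OF \<phi>] by blast
 obtain b :: 'a where b: "b \<in> Basis" using nonempty_Basis by blast
 note c = test_function_continuous[OF \<phi>] test_function_derivative_continuous[OF \<phi>] grad_continuous[OF \<phi>]
 let ?D = "%x. frechet_derivative \<phi> (at x)"
 have "(LINT x|lborel. (x \<bullet> b) * (2 * \<phi> x * ?D x b) + (b \<bullet> b) * (\<phi> x)^2) = 0"
 proof (rule integral_derivative_compact_support[where D = "%x v. (x \<bullet> b) * (2 * \<phi> x * ?D x v) + (v \<bullet> b) * (\<phi> x)^2" and v = b])
  fix x
  show "((%x. (x \<bullet> b) * (\<phi> x)^2) has_derivative (%v. (x \<bullet> b) * (2 * \<phi> x * ?D x v) + (v \<bullet> b) * (\<phi> x)^2)) (at x)"
   by (auto intro!: derivative_eq_intros test_function_has_derivative[OF \<phi>] simp: algebra_simps)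
 qed (use K c in "auto intro!: continuous_intros")
 moreover have i1: "integrable lborel (%x. (\<phi> x)^2)"
  by (rule compact_supp_integrable[OF K(1)]) (use K(3) c in "auto intro!: continuous_intros")
 moreover have "integrable lborel (%x. (x \<bullet> b) * (2 * \<phi> x * ?D x b))"
  by (rule compact_supp_integrable[OF K(1)]) (use K(3) c in "auto intro!: continuous_intros")
 ultimately have "(LINT x|lborel. (\<phi> x)^2) = (LINT x|lborel. - ((x \<bullet> b) * (2 * \<phi> x * ?D x b)))"
  using b by (simp add: inner_Basis)
 also have "... <= (LINT x|lborel. (\<phi> x)^2 / 2 + 2 * R^2 * (norm (grad \<phi> x))^2)"
 proof (rule integral_mono)
  show "integrable lborel (%x. - ((x \<bullet> b) * (2 * \<phi> x * ?D x b)))"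
   by (rule compact_supp_integrable[OF K(1)]) (use K(3) c in "auto intro!: continuous_intros")
  show "integrable lborel (%x. (\<phi> x)^2 / 2 + 2 * R^2 * (norm (grad \<phi> x))^2)"
   by (rule compact_supp_integrable[OF K(1)]) (use K(3,5) c in "auto intro!: continuous_intros")
  fix x
  show "- ((x \<bullet> b) * (2 * \<phi> x * ?D x b)) <= (\<phi> x)^2 / 2 + 2 * R^2 * (norm (grad \<phi> x))^2"
  proof (cases "x \<in> K")
   case True
   define d where "d = ?D x b"
   have d: "\<bar>d\<bar> <= norm (grad \<phi> x)"
   unfolding d_def grad_inner_test[OF \<phi> b, symmetric] by (rule Basis_le_norm[OF b])
   have xb: "\<bar>x \<bullet> b\<bar> <= R" using Basis_le_norm[OF b, of x] R[of x] K(2) True by force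
   have "0 <= (\<phi> x + 2 * ((x \<bullet> b) * d))^2 / 2" by simp
   also have "... = (\<phi> x)^2 / 2 + (x \<bullet> b) * (2 * \<phi> x * d) + 2 * ((x \<bullet> b) * d)^2"
   by (simp add: power2_eq_square field_simps)
   also have "((x \<bullet> b) * d)^2 = \<bar>x \<bullet> b\<bar>^2 * \<bar>d\<bar>^2" by (simp add: power_mult_distrib)
   also have "\<bar>x \<bullet> b\<bar>^2 * \<bar>d\<bar>^2 <= R^2 * (norm (grad \<phi> x))^2"
   using xb d by (intro mult_mono power_mono) auto
   finally show ?thesis by (simp add: d_def)
  qed (simp add: K)
 qed
 also have "... = (LINT x|lborel. (\<phi> x)^2) / 2 + 2 * R^2 * (LINT x|lborel. (norm (grad \<phi> x))^2)"
 proof -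
  have "integrable lborel (%x. (norm (grad \<phi> x))^2)"
   by (rule compact_supp_integrable[OF K(1)]) (use K(5) c in "auto intro!: continuous_intros")
  then show ?thesis using i1 by simp
 qed
 finally show ?thesis by simp
qed

lemma test_L2:
 assumes S: "S \<in> sets borel" and \<phi>: "\<phi> \<in> test_functions S"
 shows "\<phi> \<in> L2 (vol S)" "grad \<phi> \<in> L2 (vol S)"
  "(L2_norm (vol S) \<phi>)^2 = (LINT x|lborel. (\<phi> x)^2)"
  "(L2_norm (vol S) (grad \<phi>))^2 = (LINT x|lborel. (norm (grad \<phi> x))^2)"
proof -
 obtain K where K: "compact K" "K \<subseteq> S" "!!x. x \<notin> K ==> \<phi> x = 0"
  "!!x v. x \<notin> K ==> frechet_derivative \<phi> (at x) v = 0" "!!x. x \<notin> K ==> grad \<phi> x = 0"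
  using test_function_support[OF \<phi>] by blast
 note c = test_function_continuous[OF \<phi>] grad_continuous[OF \<phi>]
 have e: "indicator S x * (\<phi> x)^2 = (\<phi> x)^2" "indicator S x * (norm (grad \<phi> x))^2 = (norm (grad \<phi> x))^2" for x
  using K(2) K(3,5)[of x] by (cases "x \<in> S"; auto)+
 have m: "\<phi> \<in> borel_measurable (vol S)" "grad \<phi> \<in> borel_measurable (vol S)"
  unfolding vol_def using c by (auto intro!: measurable_restrict_space1 borel_measurable_continuous_onI)
 have "integrable lborel (%x. (\<phi> x)^2)" "integrable lborel (%x. (norm (grad \<phi> x))^2)"
  by (rule compact_supp_integrable[OF K(1)], use K(3,5) c in \<open>auto intro!: continuous_intros\<close>)+
 then show "\<phi> \<in> L2 (vol S)" "grad \<phi> \<in> L2 (vol S)"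
  using m by (auto intro!: L2I simp: integrable_vol[OF S] set_integrable_def e)
 show "(L2_norm (vol S) \<phi>)^2 = (LINT x|lborel. (\<phi> x)^2)"
  "(L2_norm (vol S) (grad \<phi>))^2 = (LINT x|lborel. (norm (grad \<phi> x))^2)"
  by (auto simp: L2_norm_sq integral_vol[OF S] set_lebesgue_integral_def e)
qed

lemma L2_norm_sq_le:
 assumes "u \<in> L2 M" "v \<in> L2 M"
 shows "(L2_norm M u)^2 <= 2 * (L2_norm M (%x. u x - v x))^2 + 2 * (L2_norm M v)^2"
proof -
 have d: "(%x. u x - v x) \<in> L2 M" using assms by (rule L2_diff)
 have "(LINT x|M. (norm (u x))^2) <= (LINT x|M. 2 * (norm (u x - v x))^2 + 2 * (norm (v x))^2)"
 proof (rule integral_mono)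
  show "integrable M (%x. 2 * (norm (u x - v x))^2 + 2 * (norm (v x))^2)"
   using L2_int[OF d] L2_int[OF assms(2)] by auto
  fix x
  have "norm (u x) <= norm (u x - v x) + norm (v x)" by (metis norm_triangle_sub add.commute)
  then have "(norm (u x))^2 <= (norm (u x - v x) + norm (v x))^2" by (intro power_mono) auto
  also have "... <= 2 * (norm (u x - v x))^2 + 2 * (norm (v x))^2"
   using sum_squares_bound[of "norm (u x - v x)" "norm (v x)"] by (simp add: power2_sum)
  finally show "(norm (u x))^2 <= 2 * (norm (u x - v x))^2 + 2 * (norm (v x))^2" .
 qed (rule L2_int[OF assms(1)])
 also have "... = 2 * (LINT x|M. (norm (u x - v x))^2) + 2 * (LINT x|M. (norm (v x))^2)"
  using L2_int[OF d] L2_int[OF assms(2)] by simp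
 finally show ?thesis by (simp add: L2_norm_sq)
qed

text \<open>By density of the test functions; passing to the limit with \<open>(a + b)\<^sup>2 \<le> 2 a\<^sup>2 + 2 b\<^sup>2\<close> costs
  a factor \<open>4\<close>.\<close>

lemma Poincare_H10:
 assumes S: "open S" and R: "!!x. x \<in> S ==> norm x <= R" and u: "u \<in> H10 S"
 shows "(L2_norm (vol S) u)^2 <= 16 * R^2 * (L2_norm (vol S) (wgrad S u))^2"
proof -
 let ?A = "L2_norm (vol S) (wgrad S u)"
 have Sb: "S \<in> sets borel" using S by simp
 obtain \<phi> where \<phi>: "!!n::nat. \<phi> n \<in> test_functions S"
  and l1: "(%n. L2_norm (vol S) (u - \<phi> n)) \<longlonglongrightarrow> 0"
  and l2: "(%n. L2_norm (vol S) (wgrad S u - grad (\<phi> n))) \<longlonglongrightarrow> 0"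
  using u by (auto simp: H10_def)
 have uL: "u \<in> L2 (vol S)" "wgrad S u \<in> L2 (vol S)" using u by (auto simp: H10_def H1_def)
 have 1: "(L2_norm (vol S) u)^2 <= 2 * (L2_norm (vol S) (u - \<phi> n))^2
   + 16 * R^2 * (L2_norm (vol S) (wgrad S u - grad (\<phi> n)))^2 + 16 * R^2 * ?A^2" for n
 proof -
  note t = test_L2[OF Sb \<phi>[of n]]
  have d: "u - \<phi> n = (%x. u x - \<phi> n x)" by (simp add: fun_diff_def)
  have a: "(L2_norm (vol S) u)^2 <= 2 * (L2_norm (vol S) (u - \<phi> n))^2 + 2 * (L2_norm (vol S) (\<phi> n))^2"
   unfolding d by (rule L2_norm_sq_le[OF uL(1) t(1)])
  have b: "(L2_norm (vol S) (\<phi> n))^2 <= 4 * R^2 * (L2_norm (vol S) (grad (\<phi> n)))^2"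
   using Poincare_test[OF \<phi>[of n] R] t(3,4) by simp
  have "(L2_norm (vol S) (grad (\<phi> n)))^2 <= 2 * (L2_norm (vol S) (%x. grad (\<phi> n) x - wgrad S u x))^2 + 2 * ?A^2"
   by (rule L2_norm_sq_le[OF t(2) uL(2)])
  also have "L2_norm (vol S) (%x. grad (\<phi> n) x - wgrad S u x) = L2_norm (vol S) (wgrad S u - grad (\<phi> n))"
   by (simp add: L2_norm_def norm_minus_commute)
  finally have "4 * R^2 * (L2_norm (vol S) (grad (\<phi> n)))^2
   <= 4 * R^2 * (2 * (L2_norm (vol S) (wgrad S u - grad (\<phi> n)))^2 + 2 * ?A^2)"
   by (rule mult_left_mono) simp
  also have "... = 8 * R^2 * (L2_norm (vol S) (wgrad S u - grad (\<phi> n)))^2 + 8 * R^2 * ?A^2"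
   by (simp add: algebra_simps)
  finally show ?thesis using a b by linarith
 qed
 have "(%n. 2 * (L2_norm (vol S) (u - \<phi> n))^2
   + 16 * R^2 * (L2_norm (vol S) (wgrad S u - grad (\<phi> n)))^2 + 16 * R^2 * ?A^2)
  \<longlonglongrightarrow> 2 * 0^2 + 16 * R^2 * 0^2 + 16 * R^2 * ?A^2"
  by (intro tendsto_intros l1 l2)
 then show ?thesis using 1 by (intro LIMSEQ_le_const[of _ "16 * R^2 * ?A^2"]) auto
qed

section \<open>Weak derivatives on the half line\<close>

definition bump :: "real => real" where
 "bump t = smooth_ramp t * smooth_ramp (1 - t)"

definition smooth_step :: "real => real" where
 "smooth_step t = integral {-1..t} bump"

lemma Ck_bump: "Ck k bump"
 unfolding bump_def[abs_def]
 using Ck_mult[OF Ck_smooth_ramp[of k] Ck_affine[OF bounded_linear_minus[OF bounded_linear_ident] Ck_smooth_ramp[of k], of 1]]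
 by (simp add: add.commute)

lemma bump_cont: "continuous_on A bump"
 using Ck_bump[of 0] continuous_on_subset by auto

lemma bump_nonneg: "0 <= bump t"
 by (simp add: bump_def smooth_ramp_bounds)

lemma bump_zero: "t <= 0 \<or> 1 <= t ==> bump t = 0"
 using smooth_ramp_bounds(3)[of t] smooth_ramp_bounds(3)[of "1 - t"] by (auto simp: bump_def)

lemma smooth_step_zero: "t <= 0 ==> smooth_step t = 0"
proof -
 assume t: "t <= 0"
 have "integral {-1..t} bump = integral {-1..t} (%_. 0)"
  by (rule integral_cong) (use t in "auto intro: bump_zero")
 then show ?thesis by (simp add: smooth_step_def)
qed

lemma smooth_step_DERIV: "(smooth_step has_real_derivative bump t) (at t)"
proof (cases "t > -1")
 case True
 have "((%u. integral {-1..u} bump) has_real_derivative bump t) (at t within {-1..t + 1})"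
  by (rule integral_has_real_derivative) (use True bump_cont in auto)
 then have "((%u. integral {-1..u} bump) has_real_derivative bump t) (at t)"
  using True by (simp add: at_within_interior[of t "{-1..t+1}"])
 then show ?thesis unfolding smooth_step_def[abs_def] .
next
 case False
 have "((%_. 0) has_real_derivative bump t) (at t)" using False by (simp add: bump_zero)
 then show ?thesis
  by (rule has_field_derivative_transform_within_open[of _ _ _ "{..<0}"]) (use False in "auto simp: smooth_step_zero")
qed

lemma Ck_smooth_step: "Ck k smooth_step"
proof -
 have "Ck (Suc k) smooth_step"
  by (rule Ck_SucI[where f' = "%x v. bump x * v"])
   (use smooth_step_DERIV in "auto simp: has_field_derivative_def intro: Ck_mult[OF Ck_bump Ck_const]")
 then show ?thesis by (rule Ck_Suc_imp)
qed

lemma smooth_step_mono: "s <= t ==> smooth_step s <= smooth_step t"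
 by (rule DERIV_nonneg_imp_nondecreasing[where f = smooth_step])
  (use smooth_step_DERIV bump_nonneg in blast)+

lemma smooth_step_one: "t >= 1 ==> smooth_step t = smooth_step 1"
proof -
 assume t: "t >= 1"
 have "integral {1..t} bump = integral {1..t} (%_. 0)"
  by (rule integral_cong) (auto intro: bump_zero)
 moreover have "integral {-1..1} bump + integral {1..t} bump = integral {-1..t} bump"
  by (rule Henstock_Kurzweil_Integration.integral_combine) (use t in "auto intro!: integrable_continuous_interval bump_cont")
 ultimately show ?thesis by (simp add: smooth_step_def)
qed

lemma smooth_step_bounds: "0 <= smooth_step t" "smooth_step t <= smooth_step 1"
 using smooth_step_mono[of "min t 0" t] smooth_step_zero[of "min t 0"]
  smooth_step_mono[of t "max t 1"] smooth_step_one[of "max t 1"] by auto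

lemma smooth_step_pos: "smooth_step 1 > 0"
proof -
 have "smooth_step 1 ~= 0"
 proof
  assume "smooth_step 1 = 0"
  then have z: "integral {-1..1} bump = 0" by (simp add: smooth_step_def)
  have "bump (1 / 2) = 0"
  proof -
   have "\<forall>x\<in>{-1..1}. bump x = 0"
   using z by (subst (asm) integral_eq_0_iff) (use bump_cont bump_nonneg in auto)
   then show ?thesis by auto
  qed
  moreover have "bump (1 / 2) > 0"
   unfolding bump_def by (intro mult_pos_pos smooth_ramp_bounds(4)) auto
  ultimately show False by simp
 qed
 then show ?thesis using smooth_step_bounds(1)[of 1] by simp
qed

lemma bump_integral: "integrable lborel bump" "(LINT s|lborel. bump s) = smooth_step 1"
proof -
 show i: "integrable lborel bump"
  by (rule compact_supp_integrable[of "{0..1}"]) (use bump_cont in "auto intro: bump_zero")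
 have "(LINT s|lborel. bump s) = (LINT s:{-1..1}|lborel. bump s)"
  unfolding set_lebesgue_integral_def
 proof (rule Bochner_Integration.integral_cong[OF refl])
  fix s show "bump s = indicator {-1..1} s *\<^sub>R bump s"
   using bump_zero[of s] by (cases "s \<in> {-1..1}") auto
 qed
 also have "... = integral {-1..1} bump"
  by (rule set_borel_integral_eq_integral)
   (simp add: set_integrable_def, rule integrable_mult_indicator[of _ _ bump, simplified], use i in auto)
 finally show "(LINT s|lborel. bump s) = smooth_step 1" by (simp add: smooth_step_def)
qed

text \<open>The factor \<open>smooth_step 1\<close> is the total mass of the unnormalized bump.\<close>

lemma mollified_value:
 fixes w :: "real => real"
 assumes w: "continuous_on UNIV w"
 shows "(%n. LINT t|lborel. w t * (real (Suc n) * bump (real (Suc n) * (t - x)))) \<longlonglongrightarrow> w x * smooth_step 1"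
proof -
 have e: "(LINT t|lborel. w t * (real (Suc n) * bump (real (Suc n) * (t - x)))) = (LINT s|lborel. w (x + s / real (Suc n)) * bump s)" for n
 proof -
  have "(LINT t|lborel. w t * (real (Suc n) * bump (real (Suc n) * (t - x))))
   = \<bar>1 / real (Suc n)\<bar> *\<^sub>R (LINT s|lborel. w (x + 1 / real (Suc n) * s) * (real (Suc n) * bump (real (Suc n) * ((x + 1 / real (Suc n) * s) - x))))"
   by (rule lborel_integral_real_affine) simp
  also have "... = 1 / real (Suc n) * (LINT s|lborel. real (Suc n) * (w (x + s / real (Suc n)) * bump s))"
   by (simp add: mult_ac del: of_nat_Suc)
  also have "... = (LINT s|lborel. w (x + s / real (Suc n)) * bump s)"
   by (subst Bochner_Integration.integral_mult_right_zero) (simp del: of_nat_Suc)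
  finally show ?thesis .
 qed
 obtain B where B: "!!t. t \<in> {x..x + 1} ==> \<bar>w t\<bar> <= B"
 proof -
  have "bounded (w ` {x..x + 1})"
   by (intro compact_imp_bounded compact_continuous_image continuous_on_subset[OF w]) auto
  then obtain B where "\<forall>t\<in>{x..x + 1}. \<bar>w t\<bar> <= B" by (auto simp: bounded_iff)
  then show thesis by (intro that[of B]) blast
 qed
 have "(%n. LINT s|lborel. w (x + s / real (Suc n)) * bump s) \<longlonglongrightarrow> (LINT s|lborel. w x * bump s)"
 proof (rule integral_dominated_convergence[where w = "%s. B * bump s"])
  show "integrable lborel (%s. B * bump s)" using bump_integral(1) by simp
  have mb: "bump \<in> borel_measurable borel" using bump_cont by (simp add: borel_measurable_continuous_onI)
  have mw: "w \<in> borel_measurable borel" using w by (simp add: borel_measurable_continuous_onI)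
  show "(%s. w x * bump s) \<in> borel_measurable lborel" using mb by simp
  show "(%s. w (x + s / real (Suc n)) * bump s) \<in> borel_measurable lborel" for n
   using mb mw by measurable
  show "AE s in lborel. (%n. w (x + s / real (Suc n)) * bump s) \<longlonglongrightarrow> w x * bump s"
  proof (rule AE_I2, intro tendsto_mult tendsto_const)
   fix s
   have "(%n. x + s * inverse (real (Suc n))) \<longlonglongrightarrow> x + s * 0"
   by (intro tendsto_intros LIMSEQ_inverse_real_of_nat)
   then have "(%n. x + s / real (Suc n)) \<longlonglongrightarrow> x" by (simp add: divide_inverse)
   moreover have "isCont w x" using w by (simp add: continuous_on_eq_continuous_at)
   ultimately show "(%n. w (x + s / real (Suc n))) \<longlonglongrightarrow> w x" by (rule isCont_tendsto_compose[rotated])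
  qed
  show "AE s in lborel. norm (w (x + s / real (Suc n)) * bump s) <= B * bump s" for n
  proof (rule AE_I2)
   fix s
   show "norm (w (x + s / real (Suc n)) * bump s) <= B * bump s"
   proof (cases "0 < s & s < 1")
   case True
   have "s / real (Suc n) <= s / 1" using True by (intro divide_left_mono) auto
   then have "x + s / real (Suc n) \<in> {x..x + 1}" using True by auto
   then show ?thesis unfolding real_norm_def abs_mult using B bump_nonneg[of s] by (simp add: mult_right_mono)
   next
   case False
   then show ?thesis by (auto simp: bump_zero)
   qed
  qed
 qed
 moreover have "(LINT s|lborel. w x * bump s) = w x * smooth_step 1" by (simp add: bump_integral)
 ultimately show ?thesis unfolding e by (simp only:)
qed

text \<open>Test the weak derivative with a smooth approximation of the indicator function of \<open>(x, y)\<close>: its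
  derivative is a difference of mollifiers at \<open>x\<close> and \<open>y\<close>.\<close>

lemma halfline_FTC:
 fixes w h :: "real => real"
 assumes w: "continuous_on {0..} w" and h: "is_weak_grad {0<..} w h" and xy: "0 < x" "x < y"
 shows "w y - w x = (LINT t:{x..y}|lborel. h t)"
proof -
 let ?A = "%x y t. indicator {x..y + 1} t * h t"
 let ?B = "%n t a. real (Suc n) * (t - a)"
 let ?C = "%n t x. real (Suc n) * bump (real (Suc n) * (t - x))"
 let ?D = "%n t y. real (Suc n) * bump (real (Suc n) * (t - y))"
 define c where "c = smooth_step 1"
 have c: "c > 0" using smooth_step_pos by (simp add: c_def)
 define w' where "w' t = w (max t 0)" for t
 have w': "continuous_on UNIV w'"
  unfolding w'_def by (rule continuous_on_compose2[OF w]) (auto intro!: continuous_intros)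
 define \<phi> where "\<phi> n t = smooth_step (real (Suc n) * (t - x)) - smooth_step (real (Suc n) * (t - y))" for n t
 have \<phi>0: "\<phi> n t = 0" if "t \<notin> {x..y + 1}" for n t
 proof (cases "t < x")
  case True
  then have "real (Suc n) * (t - x) <= 0" "real (Suc n) * (t - y) <= 0" using xy by (auto intro!: mult_nonneg_nonpos)
  then show ?thesis by (simp add: \<phi>_def smooth_step_zero)
 next
  case False
  then have t: "t > y + 1" using that by auto
  have "1 * 1 <= real (Suc n) * (t - x)" "1 * 1 <= real (Suc n) * (t - y)" using t xy by (intro mult_mono; simp)+
  then show ?thesis using smooth_step_one[of "real (Suc n) * (t - x)"] smooth_step_one[of "real (Suc n) * (t - y)"] by (simp add: \<phi>_def)
 qed
 have d\<phi>: "(\<phi> n has_real_derivative real (Suc n) * bump (real (Suc n) * (t - x)) - real (Suc n) * bump (real (Suc n) * (t - y))) (at t)" for n t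
 proof -
  have "((%t. smooth_step (?B n t a)) has_real_derivative bump (?B n t a) * real (Suc n)) (at t)" for a
   by (rule DERIV_chain2[OF smooth_step_DERIV]) (auto intro!: derivative_eq_intros)
  then show ?thesis unfolding \<phi>_def by (auto intro!: derivative_eq_intros simp: mult.commute)
 qed
 have test: "\<phi> n \<in> test_functions {0<..}" for n
 proof -
  have ck: "Ck k (%t. smooth_step (?B n t a))" for k a
   using Ck_affine[OF bounded_linear_mult_right[of "real (Suc n)"] Ck_smooth_step, of k "- real (Suc n) * a"]
   by (simp add: algebra_simps)
  have "Ck k (\<phi> n)" for k
   unfolding \<phi>_def[abs_def] using Ck_add[OF ck[of k x] Ck_cmult[OF ck[of k y], of "-1"]] by simp
  moreover have "\<exists>K. compact K & K \<subseteq> {0<..} & (\<forall>t. t \<notin> K --> \<phi> n t = 0)"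
   using \<phi>0 xy by (intro exI[of _ "{x..y + 1}"]) auto
  ultimately show ?thesis by (simp add: test_functions_def)
 qed
 have fd: "frechet_derivative (\<phi> n) (at t) 1 = real (Suc n) * bump (real (Suc n) * (t - x)) - real (Suc n) * bump (real (Suc n) * (t - y))" for n t
  using frechet_derivative_at[OF d\<phi>[of n t, unfolded has_field_derivative_def]] by (metis mult.right_neutral)
 note H = is_weak_gradD[OF h]
 have eq: "(LINT t:{0<..}|lborel. frechet_derivative (\<phi> n) (at t) 1 * w t) = - (LINT t:{0<..}|lborel. \<phi> n t * h t)" for n
  using H(3)[OF test, of 1 n] by simp
 have bz: "bump (?B n t a) = 0" if "t <= 0" "a > 0" for n t a
  using that by (intro bump_zero disjI1 mult_nonneg_nonpos) auto
 have lhs: "(LINT t:{0<..}|lborel. frechet_derivative (\<phi> n) (at t) 1 * w t)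
  = (LINT t|lborel. w' t * (?C n t x)) - (LINT t|lborel. w' t * (?D n t y))" for n
 proof -
  have i: "integrable lborel (%t. w' t * (real (Suc n) * bump (?B n t a)))" for a
  proof (rule compact_supp_integrable[of "{a..a + 1}"])
   show "continuous_on UNIV (%t. w' t * (real (Suc n) * bump (?B n t a)))"
   by (intro continuous_intros w' continuous_on_compose2[OF bump_cont[of UNIV]]) auto
   fix t assume "t \<notin> {a..a + 1}"
   then consider "t < a" | "a + 1 < t" by force
   then have "real (Suc n) * (t - a) <= 0 \<or> 1 * 1 <= real (Suc n) * (t - a)"
   proof cases
   case 1
   then show ?thesis by (intro disjI1 mult_nonneg_nonpos) auto
   next
   case 2
   then show ?thesis by (intro disjI2 mult_mono) auto
   qed
   then show "w' t * (real (Suc n) * bump (?B n t a)) = 0" by (simp add: bump_zero del: of_nat_Suc)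
  qed simp
  have "(LINT t:{0<..}|lborel. frechet_derivative (\<phi> n) (at t) 1 * w t)
   = (LINT t|lborel. w' t * (?C n t x) - w' t * (?D n t y))"
   unfolding set_lebesgue_integral_def fd
  proof (rule Bochner_Integration.integral_cong[OF refl])
   fix t
   show "indicator {0<..} t *\<^sub>R ((real (Suc n) * bump (real (Suc n) * (t - x)) - real (Suc n) * bump (real (Suc n) * (t - y))) * w t)
   = w' t * (?C n t x) - w' t * (?D n t y)"
   using bz[of t x n] bz[of t y n] xy by (cases "t > 0") (auto simp: w'_def algebra_simps)
  qed
  also have "... = (LINT t|lborel. w' t * (?C n t x)) - (LINT t|lborel. w' t * (?D n t y))"
   by (rule Bochner_Integration.integral_diff[OF i i])
  finally show ?thesis .
 qed
 have "(%n. LINT t:{0<..}|lborel. frechet_derivative (\<phi> n) (at t) 1 * w t) \<longlonglongrightarrow> w' x * c - w' y * c"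
  unfolding lhs c_def by (intro tendsto_diff mollified_value w')
 then have 1: "(%n. - (LINT t:{0<..}|lborel. \<phi> n t * h t)) \<longlonglongrightarrow> w' x * c - w' y * c" unfolding eq .
 have hi: "set_integrable lborel {x..y + 1} h" by (rule H(2)) (use xy in auto)
 have hi': "integrable lborel (%t. indicator {x..y + 1} t * h t)" using hi by (simp add: set_integrable_def)
 note mh = borel_measurable_integrable[OF hi']
 have "(%n. LINT t|lborel. \<phi> n t * (?A x y t)) \<longlonglongrightarrow> (LINT t|lborel. (c * indicator {x<..y} t) * (?A x y t))"
 proof (rule integral_dominated_convergence[where w = "%t. c * \<bar>indicator {x..y + 1} t * h t\<bar>"])
  show "integrable lborel (%t. c * \<bar>indicator {x..y + 1} t * h t\<bar>)" using hi' by (intro integrable_mult_right integrable_abs)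
  have "\<phi> n \<in> borel_measurable borel" for n
   using test_function_continuous[OF test] by (simp add: borel_measurable_continuous_onI)
  then show "(%t. \<phi> n t * (?A x y t)) \<in> borel_measurable lborel" for n
   by (intro borel_measurable_times[OF _ mh]) simp
  show "(%t. c * indicator {x<..y} t * (?A x y t)) \<in> borel_measurable lborel"
   by (intro borel_measurable_times[OF _ mh]) simp
  show "AE t in lborel. norm (\<phi> n t * (?A x y t)) <= c * \<bar>indicator {x..y + 1} t * h t\<bar>" for n
  proof (rule AE_I2)
   fix t
   have "\<bar>\<phi> n t\<bar> <= c"
   using smooth_step_bounds[of "real (Suc n) * (t - x)"] smooth_step_bounds[of "real (Suc n) * (t - y)"]
   by (simp add: \<phi>_def c_def abs_le_iff del: of_nat_Suc)
   then show "norm (\<phi> n t * (?A x y t)) <= c * \<bar>indicator {x..y + 1} t * h t\<bar>"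
   unfolding real_norm_def abs_mult[of "\<phi> n t"] by (rule mult_right_mono) simp
  qed
  have lim: "(%n. smooth_step (?B n t a)) \<longlonglongrightarrow> c * indicator {a<..} t" for t a
  proof (cases "t > a")
   case True
   obtain N where N: "real N * (t - a) > 1" using reals_Archimedean3[of "t - a"] True by auto
   have "smooth_step (?B n t a) = c" if "n >= N" for n
   proof -
   have "real N * (t - a) <= real (Suc n) * (t - a)" using that True by (intro mult_right_mono) auto
   then show ?thesis unfolding c_def using N by (intro smooth_step_one) linarith
   qed
   then have "(%n. smooth_step (?B n t a)) \<longlonglongrightarrow> c"
   by (intro tendsto_eventually eventually_sequentiallyI)
   then show ?thesis using True by simp
  next
   case False
   then have "smooth_step (?B n t a) = 0" for n
   by (intro smooth_step_zero mult_nonneg_nonpos) auto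
   then show ?thesis using False by simp
  qed
  show "AE t in lborel. (%n. \<phi> n t * (?A x y t)) \<longlonglongrightarrow> c * indicator {x<..y} t * (?A x y t)"
  proof (rule AE_I2, rule tendsto_mult[OF _ tendsto_const])
   fix t
   have "(%n. \<phi> n t) \<longlonglongrightarrow> c * indicator {x<..} t - c * indicator {y<..} t"
   unfolding \<phi>_def by (intro tendsto_diff lim)
   moreover have "c * indicator {x<..} t - c * indicator {y<..} t = c * indicator {x<..y} t"
   using xy by (auto simp: indicator_def)
   ultimately show "(%n. \<phi> n t) \<longlonglongrightarrow> c * indicator {x<..y} t" by simp
  qed
 qed
 moreover have "(LINT t|lborel. \<phi> n t * (?A x y t)) = (LINT t:{0<..}|lborel. \<phi> n t * h t)" for n
  unfolding set_lebesgue_integral_def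
 proof (rule Bochner_Integration.integral_cong[OF refl])
  fix t
  show "\<phi> n t * (?A x y t) = indicator {0<..} t *\<^sub>R (\<phi> n t * h t)"
   using \<phi>0[of t n] xy by (cases "t \<in> {x..y + 1}") auto
 qed
 moreover have "(LINT t|lborel. (c * indicator {x<..y} t) * (?A x y t)) = c * (LINT t:{x..y}|lborel. h t)"
 proof -
  have "(LINT t|lborel. (c * indicator {x<..y} t) * (?A x y t)) = (LINT t|lborel. c * (indicator {x..y} t * h t))"
  proof (rule integral_cong_AE)
   show "(%t. c * indicator {x<..y} t * (?A x y t)) \<in> borel_measurable lborel"
   by (intro borel_measurable_times[OF _ mh]) simp
   have "set_integrable lborel {x..y} h" by (rule set_integrable_subset[OF hi]) auto
   then show "(%t. c * (indicator {x..y} t * h t)) \<in> borel_measurable lborel"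
   using borel_measurable_integrable[of lborel "%t. indicator {x..y} t * h t"] by (simp add: set_integrable_def)
   show "AE t in lborel. c * indicator {x<..y} t * (?A x y t) = c * (indicator {x..y} t * h t)"
   using AE_lborel_singleton[of x] by eventually_elim (auto simp: indicator_def)
  qed
  then show ?thesis by (simp add: set_lebesgue_integral_def)
 qed
 ultimately have "(%n. LINT t:{0<..}|lborel. \<phi> n t * h t) \<longlonglongrightarrow> c * (LINT t:{x..y}|lborel. h t)" by simp
 then have "(%n. - (LINT t:{0<..}|lborel. \<phi> n t * h t)) \<longlonglongrightarrow> - (c * (LINT t:{x..y}|lborel. h t))" by (rule tendsto_minus)
 then have "- (c * (LINT t:{x..y}|lborel. h t)) = w' x * c - w' y * c" using 1 LIMSEQ_unique by blast
 then have "c * (w y - w x) = c * (LINT t:{x..y}|lborel. h t)" using xy by (simp add: w'_def algebra_simps)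
 then show ?thesis using c by simp
qed

section \<open>Hardy's inequality\<close>

text \<open>The weight \<open>t powr (1 - s)\<close> lies between the one for which the Cauchy-Schwarz inequality is
  applicable at \<open>0\<close> and the one for which the outer integration in Hardy's inequality converges.\<close>

lemma nn_Cauchy_Schwarz_interval:
 fixes h :: "real => real"
 assumes xy: "0 < x" "x < y" and h: "set_integrable lborel {x..y} h" and s: "0 < s" "s < 1"
 shows "ennreal ((LINT t:{x..y}|lborel. h t)^2)
  <= ennreal (y powr s / s) * (\<integral>\<^sup>+ t\<in>{0<..y}. ennreal (t powr (1 - s) * (h t)^2) \<partial>lborel)"
proof -
 let ?A = "%t. t powr ((1 - s) / 2) * \<bar>h t\<bar>"
 have hi: "integrable lborel (%t. indicator {x..y} t * h t)" using h by (simp add: set_integrable_def)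
 have mh: "(%t. indicator {x..y} t * h t) \<in> borel_measurable lborel" by (rule borel_measurable_integrable[OF hi])
 define f g where "f t = ennreal (indicator {x..y} t * t powr (- (1 - s) / 2))"
  and "g t = ennreal (t powr ((1 - s) / 2) * \<bar>indicator {x..y} t * h t\<bar>)" for t :: real
 have mf: "f \<in> borel_measurable lborel" "g \<in> borel_measurable lborel"
  unfolding f_def g_def using mh by measurable
 have ex: "- (1 - s) / 2 + (1 - s) / 2 = 0" "- (1 - s) / 2 + - (1 - s) / 2 = s - 1" "(1 - s) / 2 + (1 - s) / 2 = 1 - s"
  by argo+
 have p1: "t powr (- (1 - s) / 2) * t powr ((1 - s) / 2) = 1"
  and p2: "t powr (- (1 - s) / 2) * t powr (- (1 - s) / 2) = t powr (s - 1)"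
  and p3: "t powr ((1 - s) / 2) * t powr ((1 - s) / 2) = t powr (1 - s)" if "t > 0" for t
  unfolding powr_add[symmetric] ex using that by simp_all
 have fg: "f t * g t = ennreal \<bar>indicator {x..y} t * h t\<bar>" for t
 proof (cases "t \<in> {x..y}")
  case True
  then have "f t * g t = ennreal (t powr (- (1 - s) / 2) * (?A t))"
   by (simp add: f_def g_def ennreal_mult)
  also have "t powr (- (1 - s) / 2) * (?A t) = \<bar>h t\<bar>"
   unfolding mult.assoc[symmetric] using p1[of t] True xy by simp
  finally show ?thesis using True by simp
 qed (simp add: f_def)
 have "ennreal \<bar>LINT t:{x..y}|lborel. h t\<bar> <= (\<integral>\<^sup>+ t. ennreal \<bar>indicator {x..y} t * h t\<bar> \<partial>lborel)"
  using integral_norm_bound_ennreal[OF hi] by (simp add: set_lebesgue_integral_def)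
 then have "(ennreal \<bar>LINT t:{x..y}|lborel. h t\<bar>)^2 <= (\<integral>\<^sup>+ t. f t * g t \<partial>lborel)^2"
  unfolding fg by (rule power_mono) simp
 also have "... <= (\<integral>\<^sup>+ t. (f t)^2 \<partial>lborel) * (\<integral>\<^sup>+ t. (g t)^2 \<partial>lborel)"
  by (rule Cauchy_Schwarz_nn_integral[OF mf])
 also have "(\<integral>\<^sup>+ t. (f t)^2 \<partial>lborel) <= ennreal (y powr s / s)"
 proof -
  have "(\<integral>\<^sup>+ t. (f t)^2 \<partial>lborel) = (\<integral>\<^sup>+ t. ennreal (t powr (s - 1)) * indicator {x..y} t \<partial>lborel)"
  proof (rule nn_integral_cong)
   fix t
   show "(f t)^2 = ennreal (t powr (s - 1)) * indicator {x..y} t"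
   using p2[of t] xy by (cases "t \<in> {x..y}") (auto simp: f_def power2_eq_square ennreal_mult[symmetric])
  qed
  also have "... = ennreal (y powr s / s - x powr s / s)"
  proof (rule nn_integral_FTC_Icc)
   fix t assume t: "t \<in> {x..y}"
   show "((%t. t powr s / s) has_real_derivative t powr (s - 1)) (at t)"
   using xy s t by (auto intro!: derivative_eq_intros)
  qed (use xy in auto)
  also have "... <= ennreal (y powr s / s)" using s by (intro ennreal_leI) simp
  finally show ?thesis .
 qed
 also have "(\<integral>\<^sup>+ t. (g t)^2 \<partial>lborel) <= (\<integral>\<^sup>+ t\<in>{0<..y}. ennreal (t powr (1 - s) * (h t)^2) \<partial>lborel)"
 proof (rule nn_integral_mono)
  fix t
  show "(g t)^2 <= ennreal (t powr (1 - s) * (h t)^2) * indicator {0<..y} t"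
  proof (cases "t \<in> {x..y}")
   case True
   then have "g t = ennreal (?A t)" by (simp add: g_def)
   then have "(g t)^2 = ennreal ((?A t)^2)" by (simp only:) (rule ennreal_power, simp)
   also have "(?A t)^2 = (t powr ((1 - s) / 2))^2 * (h t)^2"
   by (simp add: power_mult_distrib)
   also have "(t powr ((1 - s) / 2))^2 = t powr (1 - s)"
   unfolding power2_eq_square using p3[of t] True xy by simp
   finally show ?thesis using True xy by simp
  qed (simp add: g_def)
 qed
 finally have *: "(ennreal \<bar>LINT t:{x..y}|lborel. h t\<bar>)^2 <= ennreal (y powr s / s) * (\<integral>\<^sup>+ t\<in>{0<..y}. ennreal (t powr (1 - s) * (h t)^2) \<partial>lborel)"
  by (simp add: mult_mono)
 have "(ennreal \<bar>LINT t:{x..y}|lborel. h t\<bar>)^2 = ennreal ((LINT t:{x..y}|lborel. h t)^2)"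
  by (simp add: power2_eq_square ennreal_mult[symmetric] abs_mult[symmetric])
 then show ?thesis using * by simp
qed

lemma pointwise_trace_bound:
 fixes w h :: "real => real"
 assumes w: "continuous_on {0..} w" and h: "is_weak_grad {0<..} w h" and y: "0 < y" and s: "0 < s" "s < 1"
 shows "ennreal ((w y - w 0)^2)
  <= ennreal (y powr s / s) * (\<integral>\<^sup>+ t\<in>{0<..y}. ennreal (t powr (1 - s) * (h t)^2) \<partial>lborel)"
proof -
 define x where "x n = y * inverse (real (Suc (Suc n)))" for n :: nat
 have x: "0 < x n" "x n < y" for n
 proof -
  show "0 < x n" using y by (simp add: x_def)
  have "y * inverse (real (Suc (Suc n))) < y * 1"
   by (rule mult_strict_left_mono[OF _ y]) (simp add: inverse_less_1_iff)
  then show "x n < y" by (simp add: x_def)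
 qed
 have "ennreal ((w y - w (x n))^2) <= ennreal (y powr s / s) * (\<integral>\<^sup>+ t\<in>{0<..y}. ennreal (t powr (1 - s) * (h t)^2) \<partial>lborel)" for n
  unfolding halfline_FTC[OF w h x(1) x(2)]
  by (rule nn_Cauchy_Schwarz_interval[OF x is_weak_gradD(2)[OF h] s]) (use x(1)[of n] in auto)
 moreover have "(%n. ennreal ((w y - w (x n))^2)) \<longlonglongrightarrow> ennreal ((w y - w 0)^2)"
 proof -
  have "(%n. y * inverse (real (Suc (Suc n)))) \<longlonglongrightarrow> y * 0"
   by (intro tendsto_mult tendsto_const LIMSEQ_Suc[OF LIMSEQ_inverse_real_of_nat])
  then have "x \<longlonglongrightarrow> 0" by (simp add: x_def[abs_def])
  then have "(%n. w (x n)) \<longlonglongrightarrow> w 0"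
   using w x(1) by (intro continuous_on_tendsto_compose[OF w]) (auto intro!: always_eventually less_imp_le)
  then show ?thesis by (intro tendsto_ennrealI tendsto_intros)
 qed
 ultimately show ?thesis using LIMSEQ_le_const2 by blast
qed

section \<open>Integration over the cylinder\<close>

lemma Suc_tail_integral:
 fixes t s :: real
 assumes t: "0 < t" and s: "0 < s"
 shows "(\<integral>\<^sup>+ y\<in>{t..}. ennreal (y powr (- s - 1)) \<partial>lborel) = ennreal (t powr (- s) / s)"
proof -
 have "(\<integral>\<^sup>+ y. ennreal (y powr (- s - 1)) * indicator {t..} y \<partial>lborel) = ennreal (0 - (- (t powr (- s)) / s))"
 proof (rule nn_integral_FTC_atLeast)
  show "((%y. - (y powr (- s)) / s) has_real_derivative y powr (- s - 1)) (at y)" if "t <= y" for y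
   using t s that by (auto intro!: derivative_eq_intros)
  have "((%y. y powr (- s)) \<longlongrightarrow> 0) at_top"
   using s by (intro tendsto_neg_powr) (auto simp: filterlim_ident)
  from tendsto_divide[OF tendsto_minus[OF this] tendsto_const[of s]]
  show "((%y. - (y powr (- s)) / s) \<longlongrightarrow> 0) at_top" using s by simp
 qed auto
 then show ?thesis by simp
qed

text \<open>Insert the pointwise bound and exchange the integrals:
  \<open>\<integral>\<^sub>t\<^sup>\<infinity> y\<^sup>-\<^sup>s\<^sup>-\<^sup>1 dy = t\<^sup>-\<^sup>s / s\<close> turns the weight \<open>t\<^sup>1\<^sup>-\<^sup>s\<close> into \<open>t\<^sup>1\<^sup>-\<^sup>2\<^sup>s\<close>.\<close>

lemma Hardy:
 fixes w h :: "real => real"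
 assumes w: "continuous_on {0..} w" and h: "is_weak_grad {0<..} w h" and s: "0 < s" "s < 1"
  and m: "h \<in> borel_measurable (vol {0<..})"
 shows "(\<integral>\<^sup>+ y\<in>{0<..}. ennreal (y powr (- 2 * s - 1) * (w y - w 0)^2) \<partial>lborel)
  <= ennreal (1 / s^2) * (\<integral>\<^sup>+ t\<in>{0<..}. ennreal (t powr (1 - 2 * s) * (h t)^2) \<partial>lborel)"
proof -
 let ?A = "%t. t powr (1 - 2 * s) * (h t)^2"
 let ?B = "%y. (\<integral>\<^sup>+ t\<in>{0<..y}. ennreal (t powr (1 - s) * (h t)^2) \<partial>lborel)"
 let ?C = "%f t. (\<integral>\<^sup>+ y. f y t \<partial>lborel)"
 have m': "(%t. indicator {0<..} t *\<^sub>R h t) \<in> borel_measurable lborel"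
  using m unfolding vol_def by (subst (asm) borel_measurable_restrict_space_iff) auto
 define H where "H t = indicator {0<..} t *\<^sub>R h t" for t :: real
 have mH[measurable]: "H \<in> borel_measurable borel" using m' by (simp add: H_def[abs_def])
 define f where "f y t = ennreal (y powr (- s - 1) / s) * ennreal (t powr (1 - s) * (H t)^2) * indicator {0<..y} t" for y t :: real
 have mf: "case_prod f \<in> borel_measurable (lborel \<Otimes>\<^sub>M lborel)"
 proof -
  have "(%(y, t). f y t) = (%(y, t). ennreal (y powr (- s - 1) / s) * ennreal (t powr (1 - s) * (H t)^2) * (if 0 < t & t <= y then 1 else 0))"
   by (auto simp: f_def indicator_def)
  also have "... \<in> borel_measurable (lborel \<Otimes>\<^sub>M lborel)" by measurable
  finally show ?thesis .
 qed
 have "(\<integral>\<^sup>+ y\<in>{0<..}. ennreal (y powr (- 2 * s - 1) * (w y - w 0)^2) \<partial>lborel) <= (\<integral>\<^sup>+ y. (\<integral>\<^sup>+ t. f y t \<partial>lborel) \<partial>lborel)"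
 proof (rule nn_integral_mono)
  fix y :: real
  show "ennreal (y powr (- 2 * s - 1) * (w y - w 0)^2) * indicator {0<..} y <= (\<integral>\<^sup>+ t. f y t \<partial>lborel)"
  proof (cases "0 < y")
   case True
   have "ennreal (y powr (- 2 * s - 1) * (w y - w 0)^2) = ennreal (y powr (- 2 * s - 1)) * ennreal ((w y - w 0)^2)"
   by (simp add: ennreal_mult)
   also have "... <= ennreal (y powr (- 2 * s - 1)) * (ennreal (y powr s / s) * (?B y))"
   by (intro mult_left_mono pointwise_trace_bound[OF w h True s]) simp
   also have "... = ennreal (y powr (- s - 1) / s) * (?B y)"
   proof -
   have "y powr (- 2 * s - 1) * (y powr s / s) = y powr (- 2 * s - 1 + s) / s" by (simp only: powr_add times_divide_eq_right)
   also have "- 2 * s - 1 + s = - s - 1" by simp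
   finally have "ennreal (y powr (- 2 * s - 1)) * ennreal (y powr s / s) = ennreal (y powr (- s - 1) / s)"
   using s by (simp flip: ennreal_mult)
   then show ?thesis by (simp add: mult.assoc[symmetric])
   qed
   also have "(?B y) = (\<integral>\<^sup>+ t\<in>{0<..y}. ennreal (t powr (1 - s) * (H t)^2) \<partial>lborel)"
   by (intro nn_integral_cong) (auto simp: H_def indicator_def)
   also have "ennreal (y powr (- s - 1) / s) * ... = (\<integral>\<^sup>+ t. f y t \<partial>lborel)"
   unfolding f_def mult.assoc by (rule nn_integral_cmult[symmetric]) measurable
   finally show ?thesis using True by simp
  qed simp
 qed
 also have "... = (\<integral>\<^sup>+ t. (?C f t) \<partial>lborel)"
  by (rule lborel_pair.Fubini'[symmetric, OF mf])
 also have "... = (\<integral>\<^sup>+ t. ennreal (1 / s^2) * (ennreal (?A t) * indicator {0<..} t) \<partial>lborel)"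
 proof (rule nn_integral_cong)
  fix t :: real
  show "(?C f t) = ennreal (1 / s^2) * (ennreal (?A t) * indicator {0<..} t)"
  proof (cases "0 < t")
   case True
   have "(?C f t) = (\<integral>\<^sup>+ y. ennreal (t powr (1 - s) * (H t)^2 / s) * (ennreal (y powr (- s - 1)) * indicator {t..} y) \<partial>lborel)"
   using True s by (intro nn_integral_cong) (auto simp: f_def indicator_def ennreal_mult[symmetric] mult_ac)
   also have "... = ennreal (t powr (1 - s) * (H t)^2 / s) * ennreal (t powr (- s) / s)"
   by (subst nn_integral_cmult) (use Suc_tail_integral[OF True s(1)] in auto)
   also have "... = ennreal (1 / s^2 * (?A t))"
   proof -
   have "t powr (1 - s) * t powr (- s) = t powr (1 - 2 * s)" by (simp flip: powr_add)
   then have "t powr (1 - s) * (H t)^2 / s * (t powr (- s) / s) = 1 / s^2 * (?A t)"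
   using True s by (simp add: H_def power2_eq_square[of s] field_simps)
   then show ?thesis using s by (simp flip: ennreal_mult)
   qed
   also have "... = ennreal (1 / s^2) * ennreal (?A t)" by (rule ennreal_mult) auto
   finally have e: "(?C f t) = ennreal (1 / s^2) * ennreal (?A t)" .
   show ?thesis unfolding e using True by simp
  next
   case False
   then show ?thesis by (simp add: f_def)
  qed
 qed
 also have "... = ennreal (1 / s^2) * (\<integral>\<^sup>+ t\<in>{0<..}. ennreal (?A t) \<partial>lborel)"
 proof (rule nn_integral_cmult)
  have "(%t. ennreal (?A t) * indicator {0<..} t) = (%t. ennreal (t powr (1 - 2 * s) * (H t)^2))"
   by (auto simp: H_def indicator_def)
  also have "... \<in> borel_measurable lborel" by measurable
  finally show "(%t. ennreal (?A t) * indicator {0<..} t) \<in> borel_measurable lborel" .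
 qed
 finally show ?thesis .
qed

lemma cylinder_open: "open \<Omega> ==> open (cylinder \<Omega>)"
 unfolding cylinder_def by (intro open_Times) auto

lemma fst_measurable_cyl: "open \<Omega> ==> fst \<in> vol (cylinder \<Omega>) \<rightarrow>\<^sub>M vol (\<Omega> :: 'x::euclidean_space set)"
 unfolding vol_def
 by (rule measurable_restrict_space3) (auto simp: cylinder_def intro!: borel_measurable_continuous_onI continuous_intros)

lemma snd_measurable_cyl: "snd \<in> vol (cylinder (\<Omega> :: 'x::euclidean_space set)) \<rightarrow>\<^sub>M vol {0<..}"
 unfolding vol_def
 by (rule measurable_restrict_space3) (auto simp: cylinder_def intro!: borel_measurable_continuous_onI continuous_intros)

lemma slice_measurable_y:
 "x \<in> \<Omega> ==> (%y. (x, y)) \<in> vol {0<..} \<rightarrow>\<^sub>M vol (cylinder (\<Omega> :: 'x::euclidean_space set))"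
 unfolding vol_def by (rule measurable_restrict_space3) (auto simp: cylinder_def)

lemma nn_integral_vol: "S \<in> sets borel ==> (\<integral>\<^sup>+ x. f x \<partial>vol S) = (\<integral>\<^sup>+ x\<in>S. f x \<partial>lborel)"
 unfolding vol_def by (subst nn_integral_restrict_space) auto

lemma cylinder_Tonelli:
 fixes f :: "'x::euclidean_space \<times> real => ennreal" and \<omega> :: "real => ennreal"
 assumes \<Omega>: "open \<Omega>" and f: "f \<in> borel_measurable (vol (cylinder \<Omega>))" and \<omega>: "\<omega> \<in> borel_measurable borel"
 shows "(\<integral>\<^sup>+ z. \<omega> (snd z) * f z \<partial>vol (cylinder \<Omega>)) = (\<integral>\<^sup>+ y\<in>{0<..}. \<omega> y * (\<integral>\<^sup>+ x. f (x, y) \<partial>vol \<Omega>) \<partial>lborel)"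
  "(\<integral>\<^sup>+ z. \<omega> (snd z) * f z \<partial>vol (cylinder \<Omega>)) = (\<integral>\<^sup>+ x. (\<integral>\<^sup>+ y\<in>{0<..}. \<omega> y * f (x, y) \<partial>lborel) \<partial>vol \<Omega>)"
proof -
 let ?A = "(\<integral>\<^sup>+ z. \<omega> (snd z) * f z \<partial>vol (cylinder \<Omega>))"
 let ?B = "%x. (\<integral>\<^sup>+ y\<in>{0<..}. \<omega> y * f (x, y) \<partial>lborel)"
 let ?C = "(\<integral>\<^sup>+ y\<in>{0<..}. \<omega> y * (\<integral>\<^sup>+ x. f (x, y) \<partial>vol \<Omega>) \<partial>lborel)"
 let ?D = "%y F. (\<integral>\<^sup>+ x. \<omega> y * F (x, y) \<partial>lborel)"
 have cy: "cylinder \<Omega> \<in> sets borel" using cylinder_open[OF \<Omega>] by simp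
 define F where "F z = f z * indicator (cylinder \<Omega>) z" for z
 have F: "F \<in> borel_measurable (lborel \<Otimes>\<^sub>M lborel)"
  using f unfolding F_def[abs_def] vol_def lborel_prod
  by (subst (asm) borel_measurable_restrict_space_iff_ennreal) (use cy in auto)
 have G: "(%(x, y). \<omega> y * F (x, y)) \<in> borel_measurable (lborel \<Otimes>\<^sub>M lborel)"
  using F \<omega> by measurable
 have 0: "?A = (\<integral>\<^sup>+ z. (%(x, y). \<omega> y * F (x, y)) z \<partial>(lborel \<Otimes>\<^sub>M lborel))"
  unfolding nn_integral_vol[OF cy] lborel_prod
  by (intro nn_integral_cong) (auto simp: F_def mult.assoc)
 have F2: "F (x, y) = f (x, y) * indicator \<Omega> x * indicator {0<..} y" for x y
  by (auto simp: F_def cylinder_def indicator_def)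
 show "?A = ?C"
 proof -
  have "?A = (\<integral>\<^sup>+ y. (?D y F) \<partial>lborel)"
   unfolding 0 using lborel_pair.nn_integral_snd[OF G] by simp
  also have "... = ?C"
  proof (rule nn_integral_cong)
   fix y :: real
   show "(?D y F) = \<omega> y * (\<integral>\<^sup>+ x. f (x, y) \<partial>vol \<Omega>) * indicator {0<..} y"
   proof (cases "y > 0")
   case True
   have "(%x. F (x, y)) \<in> borel_measurable lborel" using F by measurable
   then have "(?D y F) = \<omega> y * (\<integral>\<^sup>+ x. F (x, y) \<partial>lborel)"
   by (rule nn_integral_cmult)
   then show ?thesis using True \<Omega> by (simp add: F2 nn_integral_vol)
   qed (simp add: F2)
  qed
  finally show ?thesis .
 qed
 show "?A = (\<integral>\<^sup>+ x. (?B x) \<partial>vol \<Omega>)"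
 proof -
  have "?A = (\<integral>\<^sup>+ x. (\<integral>\<^sup>+ y. \<omega> y * F (x, y) \<partial>lborel) \<partial>lborel)"
   unfolding 0 using lborel.nn_integral_fst[OF G] by simp
  also have "... = (\<integral>\<^sup>+ x\<in>\<Omega>. (?B x) \<partial>lborel)"
  proof (rule nn_integral_cong)
   fix x :: 'x
   show "(\<integral>\<^sup>+ y. \<omega> y * F (x, y) \<partial>lborel) = (?B x) * indicator \<Omega> x"
   by (cases "x \<in> \<Omega>") (auto simp: F2 mult.assoc)
  qed
  finally show ?thesis using \<Omega> by (simp add: nn_integral_vol)
 qed
qed

lemma weight_measurable: "(%(x, y). ennreal (y powr weight s)) \<in> borel_measurable (vol (cylinder (\<Omega> :: 'x::euclidean_space set)))"
proof -
 have [measurable]: "(snd :: 'x \<times> real => real) \<in> borel_measurable borel"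
  by (intro borel_measurable_continuous_onI continuous_intros)
 have "(%z :: 'x \<times> real. ennreal (snd z powr weight s)) \<in> borel_measurable borel" by measurable
 then show ?thesis unfolding vol_def by (intro measurable_restrict_space1) (simp add: case_prod_beta')
qed

lemma cyl_nn_integral:
 assumes \<Omega>: "open \<Omega>" and f: "f \<in> borel_measurable (vol (cylinder (\<Omega> :: 'x::euclidean_space set)))"
 shows "(\<integral>\<^sup>+ z. f z \<partial>cyl_measure s \<Omega>) = (\<integral>\<^sup>+ y\<in>{0<..}. ennreal (y powr weight s) * (\<integral>\<^sup>+ x. f (x, y) \<partial>vol \<Omega>) \<partial>lborel)"
  "(\<integral>\<^sup>+ z. f z \<partial>cyl_measure s \<Omega>) = (\<integral>\<^sup>+ x. (\<integral>\<^sup>+ y\<in>{0<..}. ennreal (y powr weight s) * f (x, y) \<partial>lborel) \<partial>vol \<Omega>)"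
proof -
 let ?A = "(\<integral>\<^sup>+ z. f z \<partial>cyl_measure s \<Omega>)"
 have "?A = (\<integral>\<^sup>+ z. ennreal (snd z powr weight s) * f z \<partial>vol (cylinder \<Omega>))"
  unfolding cyl_measure_def by (subst nn_integral_density[OF weight_measurable f]) (simp add: case_prod_beta')
 then show "?A = (\<integral>\<^sup>+ y\<in>{0<..}. ennreal (y powr weight s) * (\<integral>\<^sup>+ x. f (x, y) \<partial>vol \<Omega>) \<partial>lborel)"
  "?A = (\<integral>\<^sup>+ x. (\<integral>\<^sup>+ y\<in>{0<..}. ennreal (y powr weight s) * f (x, y) \<partial>lborel) \<partial>vol \<Omega>)"
  using cylinder_Tonelli[OF \<Omega> f, of "%y. ennreal (y powr weight s)"] by auto
qed

lemma measurable_cyl_iff: "f \<in> borel_measurable (cyl_measure s \<Omega>) \<longleftrightarrow> f \<in> borel_measurable (vol (cylinder \<Omega>))"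
 unfolding cyl_measure_def by simp

lemma AE_cyl: "(AE z in cyl_measure s \<Omega>. P z) \<longleftrightarrow> (AE z in vol (cylinder (\<Omega> :: 'x::euclidean_space set)). P z)"
proof -
 have "(AE z in cyl_measure s \<Omega>. P z) \<longleftrightarrow> (AE z in vol (cylinder \<Omega>). 0 < (case z of (x, y) => ennreal (y powr weight s)) --> P z)"
  unfolding cyl_measure_def by (rule AE_density[OF weight_measurable])
 also have "... \<longleftrightarrow> (AE z in vol (cylinder \<Omega>). P z)"
 proof (rule AE_cong)
  fix z assume "z \<in> space (vol (cylinder \<Omega>))"
  then have "snd z > 0" by (auto simp: vol_def space_restrict_space cylinder_def)
  then show "((0 < (case z of (x, y) => ennreal (y powr weight s))) --> P z) = P z" by (auto simp: case_prod_beta')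
 qed
 finally show ?thesis .
qed

lemma AE_cyl_fst:
 assumes \<Omega>: "open \<Omega>" and P: "AE x in vol (\<Omega> :: 'x::euclidean_space set). P x"
 shows "AE z in cyl_measure s \<Omega>. P (fst z)"
proof -
 have "AE x in lborel. x \<in> \<Omega> --> P x" using P \<Omega> by (simp add: AE_vol)
 then obtain N where N: "!!x. x \<notin> N ==> x \<in> \<Omega> --> P x" "N \<in> null_sets lborel"
  by (rule AE_E3) auto
 have "N \<times> (UNIV :: real set) \<in> null_sets (lborel \<Otimes>\<^sub>M lborel)"
  by (rule lborel.times_in_null_sets1[OF N(2)]) simp
 then have "N \<times> (UNIV :: real set) \<in> null_sets lborel" by (simp add: lborel_prod)
 then have "AE z in lborel. z \<notin> N \<times> (UNIV :: real set)" by (rule AE_not_in)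
 then have "AE z in lborel. z \<in> cylinder \<Omega> --> P (fst z)"
 proof eventually_elim
  case (elim z)
  have "fst z \<notin> N" using elim by (cases z) auto
  then have "fst z \<in> \<Omega> --> P (fst z)" by (rule N(1))
  then show ?case by (auto simp: cylinder_def)
 qed
 then show ?thesis unfolding AE_cyl using cylinder_open[OF \<Omega>] by (subst AE_vol) auto
qed

lemma L2_nn_integral: "u \<in> L2 M ==> (\<integral>\<^sup>+ x. ennreal ((norm (u x))^2) \<partial>M) = ennreal ((L2_norm M u)^2)"
 unfolding L2_norm_sq by (rule nn_integral_eq_integral) (auto dest: L2_int)

lemma L2I_nn: "u \<in> borel_measurable M ==> (\<integral>\<^sup>+ x. ennreal ((norm (u x))^2) \<partial>M) < \<infinity> ==> u \<in> L2 M"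
 by (rule L2I, assumption, rule integrableI_nonneg) auto

lemma halfline_nn_integral:
 "f \<in> borel_measurable (vol {0<..}) ==> (\<integral>\<^sup>+ y. f y \<partial>halfline_measure s) = (\<integral>\<^sup>+ y\<in>{0<..}. ennreal (y powr weight s) * f y \<partial>lborel)"
proof -
 assume f: "f \<in> borel_measurable (vol {0<..})"
 have w: "(%y. ennreal (y powr weight s)) \<in> borel_measurable (vol {0<..})"
  unfolding vol_def by (intro measurable_restrict_space1) measurable
 show ?thesis
  unfolding halfline_measure_def nn_integral_density[OF w f] by (simp add: nn_integral_vol)
qed

lemma L2_tensor:
 fixes p :: "'x::euclidean_space => 'b::euclidean_space" and q :: "real => real"
 assumes \<Omega>: "open \<Omega>" and p: "p \<in> L2 (vol \<Omega>)" and q: "q \<in> L2 (halfline_measure s)"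
 shows "(%z. q (snd z) *\<^sub>R p (fst z)) \<in> L2 (cyl_measure s \<Omega>)"
proof (rule L2I_nn)
 have mq: "q \<in> borel_measurable (vol {0<..})" using L2_meas[OF q] by (simp add: halfline_measure_def)
 have mp: "p \<in> borel_measurable (vol \<Omega>)" using L2_meas[OF p] .
 have m: "(%z. q (snd z) *\<^sub>R p (fst z)) \<in> borel_measurable (vol (cylinder \<Omega>))"
  by (intro borel_measurable_scaleR measurable_compose[OF snd_measurable_cyl mq] measurable_compose[OF fst_measurable_cyl[OF \<Omega>] mp])
 then show "(%z. q (snd z) *\<^sub>R p (fst z)) \<in> borel_measurable (cyl_measure s \<Omega>)" by (simp add: measurable_cyl_iff)
 have m2: "(%z. ennreal ((norm (q (snd z) *\<^sub>R p (fst z)))^2)) \<in> borel_measurable (vol (cylinder \<Omega>))"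
  using borel_measurable_power[OF measurable_compose[OF m borel_measurable_norm], of 2] by (rule measurable_compose[OF _ measurable_ennreal])
 have "(\<integral>\<^sup>+ z. ennreal ((norm (q (snd z) *\<^sub>R p (fst z)))^2) \<partial>cyl_measure s \<Omega>)
  = (\<integral>\<^sup>+ y\<in>{0<..}. ennreal (y powr weight s) * (\<integral>\<^sup>+ x. ennreal ((norm (q y *\<^sub>R p x))^2) \<partial>vol \<Omega>) \<partial>lborel)"
  by (subst cyl_nn_integral(1)[OF \<Omega> m2]) simp
 also have "... = (\<integral>\<^sup>+ y\<in>{0<..}. ennreal (y powr weight s) * ennreal ((norm (q y))^2) * ennreal ((L2_norm (vol \<Omega>) p)^2) \<partial>lborel)"
 proof (rule nn_integral_cong)
  fix y
  have "(\<integral>\<^sup>+ x. ennreal ((norm (q y *\<^sub>R p x))^2) \<partial>vol \<Omega>) = (\<integral>\<^sup>+ x. ennreal ((q y)^2) * ennreal ((norm (p x))^2) \<partial>vol \<Omega>)"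
   by (simp add: power_mult_distrib ennreal_mult)
  also have "... = ennreal ((q y)^2) * ennreal ((L2_norm (vol \<Omega>) p)^2)"
   unfolding L2_nn_integral[OF p, symmetric] by (rule nn_integral_cmult) (use mp in auto)
  finally show "ennreal (y powr weight s) * (\<integral>\<^sup>+ x. ennreal ((norm (q y *\<^sub>R p x))^2) \<partial>vol \<Omega>) * indicator {0<..} y
   = ennreal (y powr weight s) * ennreal ((norm (q y))^2) * ennreal ((L2_norm (vol \<Omega>) p)^2) * indicator {0<..} y"
   by (simp add: mult.assoc)
 qed
 also have "... = (\<integral>\<^sup>+ y\<in>{0<..}. ennreal (y powr weight s) * (ennreal ((norm (q y))^2) * ennreal ((L2_norm (vol \<Omega>) p)^2)) \<partial>lborel)"
  by (simp add: mult.assoc)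
 also have "... = (\<integral>\<^sup>+ y. ennreal ((norm (q y))^2) * ennreal ((L2_norm (vol \<Omega>) p)^2) \<partial>halfline_measure s)"
  by (rule halfline_nn_integral[symmetric]) (use mq in auto)
 also have "... = ennreal ((L2_norm (halfline_measure s) q)^2) * ennreal ((L2_norm (vol \<Omega>) p)^2)"
  unfolding L2_nn_integral[OF q, symmetric]
  by (rule nn_integral_multc) (use mq in "auto simp: halfline_measure_def")
 finally show "(\<integral>\<^sup>+ z. ennreal ((norm (q (snd z) *\<^sub>R p (fst z)))^2) \<partial>cyl_measure s \<Omega>) < \<infinity>"
  by (simp add: ennreal_mult_less_top)
qed

text \<open>Away from \<open>y = 0\<close> the weight is bounded from below, and \<open>norm (f z) \<le> 1 + (norm (f z))\<^sup>2\<close>.\<close>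

lemma L2_cyl_locally_integrable:
 fixes f :: "'x::euclidean_space \<times> real => 'b::euclidean_space"
 assumes \<Omega>: "open \<Omega>" and f: "f \<in> L2 (cyl_measure s \<Omega>)" and K: "compact K" "K \<subseteq> cylinder \<Omega>"
 shows "set_integrable lborel K f"
proof -
 let ?w = "%z :: 'x \<times> real. snd z powr weight s"
 have cy: "cylinder \<Omega> \<in> sets borel" using cylinder_open[OF \<Omega>] by simp
 have mf: "f \<in> borel_measurable (vol (cylinder \<Omega>))" using L2_meas[OF f] by (simp add: measurable_cyl_iff)
 have Kb: "K \<in> sets borel" using K(1) by (simp add: borel_compact)
 obtain c where c: "c > 0" "!!z. z \<in> K ==> c <= ?w z"
 proof (cases "K = {}")
  case True
  then show ?thesis using that[of 1] by auto
 next
  case False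
  have "continuous_on K ?w" using K(2) by (intro continuous_intros) (auto simp: cylinder_def)
  then obtain z0 where "z0 \<in> K" "!!z. z \<in> K ==> ?w z0 <= ?w z"
   using continuous_attains_inf[OF K(1) False] by blast
  then show ?thesis using K(2) by (intro that[of "?w z0"]) (auto simp: cylinder_def)
 qed
 have m: "set_borel_measurable lborel K f"
 proof -
  have "set_borel_measurable lborel (cylinder \<Omega>) f"
   using mf unfolding vol_def set_borel_measurable_def by (subst (asm) borel_measurable_restrict_space_iff) (use cy in auto)
  then show ?thesis by (rule set_borel_measurable_subset) (use K(2) Kb in auto)
 qed
 have wm: "?w \<in> borel_measurable (vol (cylinder \<Omega>))"
 proof -
  have "(snd :: 'x \<times> real => real) \<in> borel_measurable borel" by (intro borel_measurable_continuous_onI continuous_intros)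
  then have "?w \<in> borel_measurable lborel" by simp
  then show ?thesis unfolding vol_def by (rule measurable_restrict_space1)
 qed
 have "integrable (vol (cylinder \<Omega>)) (%z. ?w z *\<^sub>R (norm (f z))^2)"
  using L2_int[OF f] unfolding cyl_measure_def case_prod_beta'
  by (subst (asm) integrable_density) (use wm measurable_compose[OF mf borel_measurable_norm] in auto)
 then have "set_integrable lborel (cylinder \<Omega>) (%z. ?w z *\<^sub>R (norm (f z))^2)" by (simp only: integrable_vol[OF cy])
 then have "set_integrable lborel K (%z. ?w z *\<^sub>R (norm (f z))^2)"
  by (rule set_integrable_subset) (use K(2) Kb in auto)
 moreover have "set_integrable lborel K (%z. 1 :: real)"
  using emeasure_compact_finite[OF K(1)] Kb by (simp add: set_integrable_def)
 ultimately have "set_integrable lborel K (%z. 1 + 1 / c * (?w z *\<^sub>R (norm (f z))^2))"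
  by (intro set_integral_add(1) set_integrable_mult_right) auto
 then show ?thesis
 proof (rule set_integrable_bound[OF _ m])
  show "AE z in lborel. z \<in> K --> norm (f z) <= norm (1 + 1 / c * (?w z *\<^sub>R (norm (f z))^2))"
  proof (intro AE_I2 impI)
   fix z assume z: "z \<in> K"
   have "norm (f z) <= 1 + (norm (f z))^2"
   using sum_squares_bound[of 1 "norm (f z)"] norm_ge_zero[of "f z"] unfolding one_power2 mult_1_right by linarith
   also have "(norm (f z))^2 = 1 / c * (c * (norm (f z))^2)" using c by simp
   also have "... <= 1 / c * (?w z *\<^sub>R (norm (f z))^2)"
   unfolding real_scaleR_def using c z by (intro mult_left_mono mult_right_mono) auto
   finally show "norm (f z) <= norm (1 + 1 / c * (?w z *\<^sub>R (norm (f z))^2))" unfolding real_norm_def by linarith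
  qed
 qed
qed

section \<open>Weak gradients on the cylinder\<close>

lemma test_slice_x:
 fixes \<phi> :: "'x::euclidean_space \<times> real => real"
 assumes \<phi>: "\<phi> \<in> test_functions (cylinder \<Omega>)"
 shows "(%x. \<phi> (x, y)) \<in> test_functions \<Omega>"
  "frechet_derivative (%x. \<phi> (x, y)) (at x) v = frechet_derivative \<phi> (at (x, y)) (v, 0)"
proof -
 obtain K where K: "compact K" "K \<subseteq> cylinder \<Omega>" "!!z. z \<notin> K ==> \<phi> z = 0"
  using \<phi> by (auto simp: test_functions_def)
 have bl: "bounded_linear (%x :: 'x. (x, 0 :: real))" by (intro bounded_linear_Pair bounded_linear_ident bounded_linear_zero)
 have "Ck k (%x. \<phi> (x, y))" for k
  using Ck_affine[OF bl test_function_Ck[OF \<phi>], of k "(0, y)"] by simp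
 moreover have "\<exists>K. compact K & K \<subseteq> \<Omega> & (\<forall>x. x \<notin> K --> \<phi> (x, y) = 0)"
 proof (intro exI[of _ "fst ` K"] conjI allI impI)
  show "compact (fst ` K)" by (intro compact_continuous_image continuous_intros K)
  show "fst ` K \<subseteq> \<Omega>" using K(2) by (auto simp: cylinder_def)
  show "\<phi> (x, y) = 0" if "x \<notin> fst ` K" for x using that by (intro K(3)) force
 qed
 ultimately show "(%x. \<phi> (x, y)) \<in> test_functions \<Omega>" by (simp add: test_functions_def)
 have "((%x. (x, y)) has_derivative (%v. (v, 0))) (at x)" by (auto intro!: derivative_eq_intros)
 from has_derivative_compose[OF this test_function_has_derivative[OF \<phi>]]
 show "frechet_derivative (%x. \<phi> (x, y)) (at x) v = frechet_derivative \<phi> (at (x, y)) (v, 0)"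
  by (simp add: frechet_derivative_at[symmetric])
qed

lemma test_slice_y:
 fixes \<phi> :: "'x::euclidean_space \<times> real => real"
 assumes \<phi>: "\<phi> \<in> test_functions (cylinder \<Omega>)"
 shows "(%y. \<phi> (x, y)) \<in> test_functions {0<..}"
  "frechet_derivative (%y. \<phi> (x, y)) (at y) v = frechet_derivative \<phi> (at (x, y)) (0, v)"
proof -
 obtain K where K: "compact K" "K \<subseteq> cylinder \<Omega>" "!!z. z \<notin> K ==> \<phi> z = 0"
  using \<phi> by (auto simp: test_functions_def)
 have bl: "bounded_linear (%y :: real. (0 :: 'x, y))" by (intro bounded_linear_Pair bounded_linear_ident bounded_linear_zero)
 have "Ck k (%y. \<phi> (x, y))" for k
  using Ck_affine[OF bl test_function_Ck[OF \<phi>], of k "(x, 0)"] by simp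
 moreover have "\<exists>K. compact K & K \<subseteq> {0<..} & (\<forall>y. y \<notin> K --> \<phi> (x, y) = 0)"
 proof (intro exI[of _ "snd ` K"] conjI allI impI)
  show "compact (snd ` K)" by (intro compact_continuous_image continuous_intros K)
  show "snd ` K \<subseteq> {0<..}" using K(2) by (auto simp: cylinder_def)
  show "\<phi> (x, y) = 0" if "y \<notin> snd ` K" for y using that by (intro K(3)) force
 qed
 ultimately show "(%y. \<phi> (x, y)) \<in> test_functions {0<..}" by (simp add: test_functions_def)
 have "((%y. (x, y)) has_derivative (%v. (0, v))) (at y)" by (auto intro!: derivative_eq_intros)
 from has_derivative_compose[OF this test_function_has_derivative[OF \<phi>]]
 show "frechet_derivative (%y. \<phi> (x, y)) (at y) v = frechet_derivative \<phi> (at (x, y)) (0, v)"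
  by (simp add: frechet_derivative_at[symmetric])
qed

definition slice_grad :: "real => 'x::euclidean_space set => ('x \<times> real => real) => ('x \<times> real => 'x) => ('x \<times> real => real) => bool"
 where "slice_grad s \<Omega> W Gx Gy \<longleftrightarrow>
  W \<in> L2 (cyl_measure s \<Omega>) & Gx \<in> L2 (cyl_measure s \<Omega>) & Gy \<in> L2 (cyl_measure s \<Omega>) &
  (\<forall>y>0. is_weak_grad \<Omega> (%x. W (x, y)) (%x. Gx (x, y))) &
  (\<forall>x\<in>\<Omega>. is_weak_grad {0<..} (%y. W (x, y)) (%y. Gy (x, y)))"

text \<open>Every slice of a test function on the cylinder is a test function on \<open>\<Omega>\<close> or on the half line, so
  the claim reduces to the slices by Fubini's theorem.\<close>

lemma weak_grad_from_slices:
 assumes \<Omega>: "open \<Omega>" and sl: "slice_grad s \<Omega> W Gx Gy"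
 shows "is_weak_grad (cylinder \<Omega>) W (%z. (Gx z, Gy z))"
proof -
 have L: "W \<in> L2 (cyl_measure s \<Omega>)" "Gx \<in> L2 (cyl_measure s \<Omega>)" "Gy \<in> L2 (cyl_measure s \<Omega>)"
  and wx: "!!y. y > 0 ==> is_weak_grad \<Omega> (%x. W (x, y)) (%x. Gx (x, y))"
  and wy: "!!x. x \<in> \<Omega> ==> is_weak_grad {0<..} (%y. W (x, y)) (%y. Gy (x, y))"
  using sl by (auto simp: slice_grad_def)
 note li = L2_cyl_locally_integrable[OF \<Omega> L(1)] L2_cyl_locally_integrable[OF \<Omega> L(2)] L2_cyl_locally_integrable[OF \<Omega> L(3)]
 have ind: "indicator (cylinder \<Omega>) (x, y) = (indicator \<Omega> x * indicator {0<..} y :: real)" for x y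
  by (auto simp: cylinder_def indicator_def)
 show ?thesis
  unfolding is_weak_grad_iff
 proof (intro conjI allI impI ballI)
  fix K assume K: "compact K & K \<subseteq> cylinder \<Omega>"
  then show "set_integrable lborel K W" using li(1) by blast
  have "integrable lborel (%z. (indicator K z *\<^sub>R Gx z, 0) + (0, indicator K z *\<^sub>R Gy z))"
  proof (rule Bochner_Integration.integrable_add)
   show "integrable lborel (%z. (indicator K z *\<^sub>R Gx z, 0 :: real))"
   by (rule integrable_bounded_linear[of "%x. (x, 0)"])
   (use li(2)[of K] K in "auto simp: set_integrable_def intro!: bounded_linear_Pair bounded_linear_ident bounded_linear_zero")
   show "integrable lborel (%z. (0 :: 'a, indicator K z *\<^sub>R Gy z))"
   by (rule integrable_bounded_linear[of "%x. (0, x)"])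
   (use li(3)[of K] K in "auto simp: set_integrable_def intro!: bounded_linear_Pair bounded_linear_ident bounded_linear_zero")
  qed
  then show "set_integrable lborel K (%z. (Gx z, Gy z))" by (simp add: set_integrable_def)
 next
  fix \<phi> and b :: "'a \<times> real" assume \<phi>: "\<phi> \<in> test_functions (cylinder \<Omega>)" and b: "b \<in> Basis"
  let ?D = "%z. frechet_derivative \<phi> (at z)"
  have iW: "integrable (lborel \<Otimes>\<^sub>M lborel) (%(x, y). indicator (cylinder \<Omega>) (x, y) * (?D (x, y) v * W (x, y)))" for v
   using test_integrable(2)[OF \<phi> li(1), of v] by (simp add: set_integrable_def lborel_prod case_prod_beta')
  have igx: "integrable (lborel \<Otimes>\<^sub>M lborel) (%(x, y). indicator (cylinder \<Omega>) (x, y) * (\<phi> (x, y) * (Gx (x, y) \<bullet> c)))" for c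
   using set_integrable_inner[OF test_integrable(1)[OF \<phi> li(2)], of c]
   by (simp add: set_integrable_def lborel_prod case_prod_beta')
  have igy: "integrable (lborel \<Otimes>\<^sub>M lborel) (%(x, y). indicator (cylinder \<Omega>) (x, y) * (\<phi> (x, y) * Gy (x, y)))"
   using test_integrable(1)[OF \<phi> li(3)] by (simp add: set_integrable_def lborel_prod case_prod_beta')
  have toprod: "(LINT z:cylinder \<Omega>|lborel. f z) = integral\<^sup>L (lborel \<Otimes>\<^sub>M lborel) (%(x, y). indicator (cylinder \<Omega>) (x, y) * f (x, y))" for f :: "'a \<times> real => real"
   by (simp add: set_lebesgue_integral_def lborel_prod case_prod_beta')
  consider c where "c \<in> Basis" "b = (c, 0)" | "b = (0, 1)"
   using b by (auto simp: Basis_prod_def)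
  then show "(LINT z:cylinder \<Omega>|lborel. ?D z b * W z) = - (LINT z:cylinder \<Omega>|lborel. \<phi> z * ((Gx z, Gy z) \<bullet> b))"
  proof cases
   case (1 c)
   have "(LINT z:cylinder \<Omega>|lborel. ?D z b * W z) = (LINT y|lborel. LINT x|lborel. indicator (cylinder \<Omega>) (x, y) * (?D (x, y) b * W (x, y)))"
   unfolding toprod by (rule lborel_pair.integral_snd[OF iW, symmetric])
   also have "... = (LINT y|lborel. - (LINT x|lborel. indicator (cylinder \<Omega>) (x, y) * (\<phi> (x, y) * (Gx (x, y) \<bullet> c))))"
   proof (rule Bochner_Integration.integral_cong[OF refl])
   fix y :: real
   show "(LINT x|lborel. indicator (cylinder \<Omega>) (x, y) * (?D (x, y) b * W (x, y)))
   = - (LINT x|lborel. indicator (cylinder \<Omega>) (x, y) * (\<phi> (x, y) * (Gx (x, y) \<bullet> c)))"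
   proof (cases "y > 0")
   case True
   then show ?thesis
   using is_weak_gradD(3)[OF wx[OF True] test_slice_x(1)[OF \<phi>] 1(1)]
   by (simp add: ind set_lebesgue_integral_def test_slice_x(2)[OF \<phi>] 1(2))
   qed (simp add: ind)
   qed
   also have "... = - (LINT y|lborel. LINT x|lborel. indicator (cylinder \<Omega>) (x, y) * (\<phi> (x, y) * (Gx (x, y) \<bullet> c)))" by simp
   also have "(LINT y|lborel. LINT x|lborel. indicator (cylinder \<Omega>) (x, y) * (\<phi> (x, y) * (Gx (x, y) \<bullet> c)))
   = (LINT z:cylinder \<Omega>|lborel. \<phi> z * (Gx z \<bullet> c))"
   unfolding toprod by (rule lborel_pair.integral_snd[OF igx])
   finally show ?thesis by (simp add: 1(2))
  next
   case 2
   have "(LINT z:cylinder \<Omega>|lborel. ?D z b * W z) = (LINT x|lborel. LINT y|lborel. indicator (cylinder \<Omega>) (x, y) * (?D (x, y) b * W (x, y)))"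
   unfolding toprod by (rule lborel_pair.integral_fst[OF iW, symmetric])
   also have "... = (LINT x|lborel. - (LINT y|lborel. indicator (cylinder \<Omega>) (x, y) * (\<phi> (x, y) * Gy (x, y))))"
   proof (rule Bochner_Integration.integral_cong[OF refl])
   fix x :: 'a
   show "(LINT y|lborel. indicator (cylinder \<Omega>) (x, y) * (?D (x, y) b * W (x, y)))
   = - (LINT y|lborel. indicator (cylinder \<Omega>) (x, y) * (\<phi> (x, y) * Gy (x, y)))"
   proof (cases "x \<in> \<Omega>")
   case True
   then show ?thesis
   using is_weak_gradD(3)[OF wy[OF True] test_slice_y(1)[OF \<phi>, of x], of 1]
   by (simp add: ind set_lebesgue_integral_def test_slice_y(2)[OF \<phi>] 2)
   qed (simp add: ind)
   qed
   also have "... = - (LINT x|lborel. LINT y|lborel. indicator (cylinder \<Omega>) (x, y) * (\<phi> (x, y) * Gy (x, y)))" by simp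
   also have "(LINT x|lborel. LINT y|lborel. indicator (cylinder \<Omega>) (x, y) * (\<phi> (x, y) * Gy (x, y)))
   = (LINT z:cylinder \<Omega>|lborel. \<phi> z * Gy z)"
   unfolding toprod by (rule lborel_pair.integral_fst[OF igy])
   finally show ?thesis by (simp add: 2)
  qed
 qed
qed

section \<open>The discrete extension space\<close>

lemma locally_integrable_measurable:
 fixes g :: "'a::euclidean_space => 'b::euclidean_space"
 assumes S: "open S" and g: "!!K. compact K ==> K \<subseteq> S ==> set_integrable lborel K g"
 shows "g \<in> borel_measurable (vol S)"
proof -
 obtain C :: "nat => 'a set" where C: "!!n. compact (C n)" "!!n. C n \<subseteq> S" "!!K. compact K ==> K \<subseteq> S ==> \<exists>N. \<forall>n\<ge>N. K \<subseteq> C n"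
  using open_Union_compact_subsets[OF S] by metis
 have "(%x. indicator S x *\<^sub>R g x) \<in> borel_measurable lborel"
 proof (rule borel_measurable_LIMSEQ_metric)
  show "(%x. indicator (C n) x *\<^sub>R g x) \<in> borel_measurable lborel" for n
   by (rule borel_measurable_integrable[OF g[OF C(1,2), unfolded set_integrable_def]])
  fix x
  show "(%n. indicator (C n) x *\<^sub>R g x) \<longlonglongrightarrow> indicator S x *\<^sub>R g x"
  proof (cases "x \<in> S")
   case True
   then obtain N where "\<forall>n\<ge>N. {x} \<subseteq> C n" using C(3)[of "{x}"] by auto
   then show ?thesis using True by (intro tendsto_eventually eventually_sequentiallyI[of N]) auto
  next
   case False
   then have "x \<notin> C n" for n using C(2) by blast
   then show ?thesis using False by simp
  qed
 qed
 then show ?thesis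
  unfolding vol_def by (subst borel_measurable_restrict_space_iff) (use S in auto)
qed

lemma wgrad_measurable: "open S ==> is_weak_grad S u g ==> wgrad S u \<in> borel_measurable (vol S)"
 by (rule locally_integrable_measurable) (auto dest: wgrad_weak_grad intro: is_weak_gradD(2))

lemma L2_AE_cong:
 assumes "u \<in> L2 M" "v \<in> borel_measurable M" "AE x in M. u x = v x"
 shows "v \<in> L2 M" "L2_norm M v = L2_norm M u"
proof -
 have m: "(%x. (norm (u x))^2) \<in> borel_measurable M" "(%x. (norm (v x))^2) \<in> borel_measurable M"
  using borel_measurable_power[OF measurable_compose[OF L2_meas[OF assms(1)] borel_measurable_norm], of 2]
   borel_measurable_power[OF measurable_compose[OF assms(2) borel_measurable_norm], of 2] by auto
 have ae: "AE x in M. (norm (u x))^2 = (norm (v x))^2" using assms(3) by eventually_elim simp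
 have "integrable M (%x. (norm (v x))^2)"
  using L2_int[OF assms(1)] integrable_cong_AE[OF m ae] by simp
 then show "v \<in> L2 M" using assms(2) by (intro L2I)
 show "L2_norm M v = L2_norm M u"
  unfolding L2_norm_def using integral_cong_AE[OF m ae] by simp
qed

lemma norm_matrix_vector_le: "norm (M *v x) <= norm M * norm (x :: real^'n)" for M :: "real^'n^'m"
proof -
 have "(norm (M *v x))^2 = (\<Sum>i\<in>UNIV. ((M $ i) \<bullet> x)^2)"
  by (simp add: norm_vec_def[of "M *v x"] L2_set_def sum_nonneg matrix_vector_mul_component)
 also have "... <= (\<Sum>i\<in>UNIV. (norm (M $ i))^2 * (norm x)^2)"
 proof (rule sum_mono)
  fix i
  have "\<bar>(M $ i) \<bullet> x\<bar>^2 <= (norm (M $ i) * norm x)^2" by (intro power_mono Cauchy_Schwarz_ineq2) auto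
  then show "((M $ i) \<bullet> x)^2 <= (norm (M $ i))^2 * (norm x)^2" by (simp add: power_mult_distrib)
 qed
 also have "... = (norm M)^2 * (norm x)^2"
  by (simp add: norm_vec_def[of M] L2_set_def sum_nonneg sum_distrib_right)
 finally have "(norm (M *v x))^2 <= (norm M * norm x)^2" by (simp add: power_mult_distrib)
 then show ?thesis by (rule power2_le_imp_le) simp
qed

lemma matrix_vector_measurable:
 fixes M :: "'z => real^'n^'m" and x :: "'z => real^'n"
 assumes "M \<in> borel_measurable N" "x \<in> borel_measurable N"
 shows "(%z. M z *v x z) \<in> borel_measurable N"
proof (rule borel_measurable_continuous_Pair[OF assms])
 show "continuous_on UNIV (%x. (fst x :: real^'n^'m) *v snd x)"
  unfolding matrix_vector_mult_def by (intro continuous_intros)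
qed

locale discretization =
 fixes \<Omega> :: "(real^'d) set" and s :: real and A :: "real^'d => real^'d^'d" and c :: "real^'d => real"
  and VX :: "(real^'d => real) set" and VY :: "(real => real) set" and R a0 kA kc :: real
 assumes open_\<Omega>: "open \<Omega>" and R: "!!x. x \<in> \<Omega> ==> norm x <= R" "R > 0"
  and s: "0 < s" "s < 1"
  and A_meas: "A \<in> borel_measurable (vol \<Omega>)" and A_bound: "AE x in vol \<Omega>. norm (A x) <= kA"
  and A_sym: "AE x in vol \<Omega>. transpose (A x) = A x"
  and A_ell: "AE x in vol \<Omega>. \<forall>\<xi>. \<xi> \<bullet> (A x *v \<xi>) >= a0 * (norm \<xi>)^2" and a0: "a0 > 0"
  and c_meas: "c \<in> borel_measurable (vol \<Omega>)" and c_bound: "AE x in vol \<Omega>. \<bar>c x\<bar> <= kc"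
  and c_nonneg: "AE x in vol \<Omega>. c x >= 0" and kA: "kA >= 0" and kc: "kc >= 0"
  and spaces: "admissible_spaces s \<Omega> VX VY"
begin

abbreviation "Z \<equiv> tensor VX VY"
abbreviation "nrm \<equiv> L2_norm (vol \<Omega>)"
abbreviation "L2\<Omega> \<equiv> L2 (vol \<Omega>)"
abbreviation "cyl \<equiv> cyl_measure s \<Omega>"

lemma \<Omega>_borel: "\<Omega> \<in> sets borel" using open_\<Omega> by simp

lemma VX_subspace: "subspace VX" and VY_subspace: "subspace VY"
 using spaces by (auto simp: admissible_spaces_def discrete_space_def)

lemma VX_H10: "v \<in> VX ==> v \<in> H10 \<Omega>"
 using spaces by (auto simp: admissible_spaces_def)

lemma VX_L2: "v \<in> VX ==> v \<in> L2\<Omega>"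
 using VX_H10 by (auto simp: H10_def H1_def)

lemma VX_weak_grad: "v \<in> VX ==> is_weak_grad \<Omega> v (wgrad \<Omega> v) & wgrad \<Omega> v \<in> L2\<Omega>"
 using VX_H10[of v] wgrad_weak_grad by (auto simp: H10_def H1_def)

lemma VX_zero: "v \<in> VX ==> AE x in vol \<Omega>. v x = 0 ==> v = 0"
 using spaces by (auto simp: admissible_spaces_def discrete_space_def)

lemma VY_zero: "w \<in> VY ==> AE x in vol {0<..}. w x = 0 ==> w = 0"
 using spaces by (auto simp: admissible_spaces_def discrete_space_def)

lemma VY_cont: "w \<in> VY ==> continuous_on {0..} w"
 using spaces by (auto simp: admissible_spaces_def H1_halfline_def)

lemma VY_weak_grad: "w \<in> VY ==> w \<in> L2 (halfline_measure s) & is_weak_grad {0<..} w (wgrad {0<..} w) & wgrad {0<..} w \<in> L2 (halfline_measure s)"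
proof -
 assume "w \<in> VY"
 then have "w \<in> L2 (halfline_measure s)" "\<exists>g. is_weak_grad {0<..} w g" "wgrad {0<..} w \<in> L2 (halfline_measure s)"
  using spaces by (auto simp: admissible_spaces_def H1_halfline_def H1_def)
 then show ?thesis using wgrad_weak_grad by blast
qed

lemma Z_subspace: "subspace Z"
 by (simp add: tensor_def)

lemma product_in_Z: "v \<in> VX ==> w \<in> VY ==> (%(x, y). v x * w y) \<in> Z"
 unfolding tensor_def by (rule span_base) blast

lemma slice_grad_product:
 assumes v: "v \<in> VX" and w: "w \<in> VY"
 shows "slice_grad s \<Omega> (%(x, y). v x * w y) (%z. w (snd z) *\<^sub>R wgrad \<Omega> v (fst z)) (%z. wgrad {0<..} w (snd z) *\<^sub>R v (fst z))"
proof -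
 note V = VX_weak_grad[OF v] and W = VY_weak_grad[OF w]
 have "(%z. w (snd z) *\<^sub>R v (fst z)) \<in> L2 cyl" using W by (intro L2_tensor open_\<Omega> VX_L2 v) auto
 moreover have "(%z. w (snd z) *\<^sub>R wgrad \<Omega> v (fst z)) \<in> L2 cyl" using V W by (intro L2_tensor open_\<Omega>) auto
 moreover have "(%z. wgrad {0<..} w (snd z) *\<^sub>R v (fst z)) \<in> L2 cyl" using W by (intro L2_tensor open_\<Omega> VX_L2 v) auto
 moreover have "is_weak_grad \<Omega> (%x. v x * w y) (%x. w y *\<^sub>R wgrad \<Omega> v x)" for y
  using weak_grad_scale[OF V[THEN conjunct1], of "w y"] by (simp add: mult.commute)
 moreover have "is_weak_grad {0<..} (%y. v x * w y) (%y. wgrad {0<..} w y * v x)" for x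
  using weak_grad_scale[OF W[THEN conjunct2, THEN conjunct1], of "v x"] by (simp add: mult.commute)
 ultimately show ?thesis
  by (simp add: slice_grad_def case_prod_beta' mult.commute)
qed

lemma slice_grad_add:
 "slice_grad s \<Omega> W Gx Gy ==> slice_grad s \<Omega> W' Gx' Gy' ==>
  slice_grad s \<Omega> (%z. W z + W' z) (%z. Gx z + Gx' z) (%z. Gy z + Gy' z)"
 unfolding slice_grad_def by (auto intro!: L2_add weak_grad_add)

lemma slice_grad_scale:
 "slice_grad s \<Omega> W Gx Gy ==> slice_grad s \<Omega> (%z. r * W z) (%z. r *\<^sub>R Gx z) (%z. r *\<^sub>R Gy z)"
 unfolding slice_grad_def
 by (auto intro!: L2_mult_const L2_scaleR weak_grad_scale weak_grad_scale[where 'a = real, simplified])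

text \<open>Elements of the tensor product are finite sums of products, for which the slicewise gradient is explicit.\<close>

lemma Z_slices:
 assumes "W \<in> Z"
 shows "\<exists>Gx Gy. slice_grad s \<Omega> W Gx Gy" "(%x. W (x, y)) \<in> VX" "(%y. W (x, y)) \<in> VY"
proof -
 have "(\<exists>Gx Gy. slice_grad s \<Omega> W Gx Gy) & (\<forall>y. (%x. W (x, y)) \<in> VX) & (\<forall>x. (%y. W (x, y)) \<in> VY)"
  using assms unfolding tensor_def
 proof (induction rule: span_induct_alt)
  case base
  have vw: "0 \<in> VX" "0 \<in> VY"
   using VX_subspace VY_subspace by (auto intro: subspace_0)
  have e: "(%(x, y). (0 :: real^'d => real) x * (0 :: real => real) y) = 0"
   "(%x. (0 :: (real^'d) \<times> real => real) (x, y)) = 0" "(%y. (0 :: (real^'d) \<times> real => real) (x, y)) = 0" for x y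
   by (simp_all add: fun_eq_iff)
  have "\<exists>Gx Gy. slice_grad s \<Omega> 0 Gx Gy"
   using slice_grad_product[OF vw] unfolding e by blast
  then show ?case unfolding e using vw by blast
 next
  case (step r p W)
  then obtain v w where vw: "v \<in> VX" "w \<in> VY" and p: "p = (%(x, y). v x * w y)" by auto
  obtain Gx Gy where G: "slice_grad s \<Omega> W Gx Gy" using step by blast
  have e: "r *\<^sub>R p + W = (%z. r * (case z of (x, y) => v x * w y) + W z)"
   by (simp add: p scaleR_fun_def fun_eq_iff)
  have "\<exists>Gx Gy. slice_grad s \<Omega> (r *\<^sub>R p + W) Gx Gy"
   unfolding e using slice_grad_add[OF slice_grad_scale[OF slice_grad_product[OF vw]] G] by blast
  moreover have "(%x. (r *\<^sub>R p + W) (x, y)) \<in> VX" for y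
  proof -
   have "(%x. (r *\<^sub>R p + W) (x, y)) = (r * w y) *\<^sub>R v + (%x. W (x, y))"
   by (simp add: p scaleR_fun_def fun_eq_iff)
   then show ?thesis using step vw VX_subspace by (simp add: subspace_add subspace_scale)
  qed
  moreover have "(%y. (r *\<^sub>R p + W) (x, y)) \<in> VY" for x
  proof -
   have "(%y. (r *\<^sub>R p + W) (x, y)) = (r * v x) *\<^sub>R w + (%y. W (x, y))"
   by (simp add: p scaleR_fun_def fun_eq_iff)
   then show ?thesis using step vw VY_subspace by (simp add: subspace_add subspace_scale)
  qed
  ultimately show ?case by blast
 qed
 then show "\<exists>Gx Gy. slice_grad s \<Omega> W Gx Gy" "(%x. W (x, y)) \<in> VX" "(%y. W (x, y)) \<in> VY" by auto
qed

lemma tr_VX: "W \<in> Z ==> tr W \<in> VX"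
 unfolding tr_def by (rule Z_slices(2))

lemma cyl_open: "open (cylinder \<Omega>)" by (rule cylinder_open[OF open_\<Omega>])

lemma Z_wgrad:
 assumes W: "W \<in> Z" and G: "slice_grad s \<Omega> W Gx Gy"
 shows "AE z in cyl. wgrad (cylinder \<Omega>) W z = (Gx z, Gy z)" "wgrad (cylinder \<Omega>) W \<in> L2 cyl"
  "(ext_norm s \<Omega> W)^2 = (L2_norm cyl Gx)^2 + (L2_norm cyl Gy)^2"
proof -
 note wg = weak_grad_from_slices[OF open_\<Omega> G]
 show ae: "AE z in cyl. wgrad (cylinder \<Omega>) W z = (Gx z, Gy z)"
  unfolding AE_cyl using wgrad_AE[OF cyl_open wg] cyl_open by (subst AE_vol) auto
 have m: "wgrad (cylinder \<Omega>) W \<in> borel_measurable cyl"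
  unfolding measurable_cyl_iff by (rule wgrad_measurable[OF cyl_open wg])
 have g: "Gx \<in> L2 cyl" "Gy \<in> L2 cyl" using G by (auto simp: slice_grad_def)
 have n: "(norm (Gx z, Gy z))^2 = (norm (Gx z))^2 + (norm (Gy z))^2" for z
  by (simp add: norm_Pair)
 have GL: "(%z. (Gx z, Gy z)) \<in> L2 cyl"
  by (rule L2I, intro borel_measurable_Pair L2_meas g, unfold n, intro Bochner_Integration.integrable_add L2_int g)
 have ae': "AE z in cyl. (Gx z, Gy z) = wgrad (cylinder \<Omega>) W z" using ae by eventually_elim simp
 show "wgrad (cylinder \<Omega>) W \<in> L2 cyl" by (rule L2_AE_cong(1)[OF GL m ae'])
 have "(ext_norm s \<Omega> W)^2 = (L2_norm cyl (%z. (Gx z, Gy z)))^2"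
  unfolding ext_norm_def by (simp add: L2_AE_cong(2)[OF GL m ae'])
 also have "... = (L2_norm cyl Gx)^2 + (L2_norm cyl Gy)^2"
  unfolding L2_norm_sq n by (intro Bochner_Integration.integral_add L2_int g)
 finally show "(ext_norm s \<Omega> W)^2 = (L2_norm cyl Gx)^2 + (L2_norm cyl Gy)^2" .
qed

lemma Z_wgrad_L2: "W \<in> Z ==> wgrad (cylinder \<Omega>) W \<in> L2 cyl"
 using Z_slices(1) Z_wgrad(2) by blast

lemma Z_L2: "W \<in> Z ==> W \<in> L2 cyl"
 using Z_slices(1)[of W] by (auto simp: slice_grad_def)

lemma Z_wgrad_add:
 assumes W: "W \<in> Z" and V: "V \<in> Z"
 shows "AE z in cyl. wgrad (cylinder \<Omega>) (W + r *\<^sub>R V) z = wgrad (cylinder \<Omega>) W z + r *\<^sub>R wgrad (cylinder \<Omega>) V z"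
proof -
 obtain Gx Gy where G: "slice_grad s \<Omega> W Gx Gy" using Z_slices(1)[OF W] by blast
 obtain Hx Hy where H: "slice_grad s \<Omega> V Hx Hy" using Z_slices(1)[OF V] by blast
 have e: "W + r *\<^sub>R V = (%z. W z + r * V z)" by (simp add: fun_eq_iff scaleR_fun_def)
 have sum: "W + r *\<^sub>R V \<in> Z" by (intro subspace_add[OF Z_subspace] subspace_scale[OF Z_subspace] W V)
 have "slice_grad s \<Omega> (W + r *\<^sub>R V) (%z. Gx z + r *\<^sub>R Hx z) (%z. Gy z + r *\<^sub>R Hy z)"
  unfolding e by (rule slice_grad_add[OF G slice_grad_scale[OF H]])
 from Z_wgrad(1)[OF sum this] Z_wgrad(1)[OF W G] Z_wgrad(1)[OF V H]
 show ?thesis by eventually_elim simp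
qed

section \<open>Trace inequalities\<close>

definition CP :: real where "CP = 16 * R^2"

lemma CP: "CP > 0" using R(2) by (simp add: CP_def)

lemma Poincare_VX: "v \<in> VX ==> (nrm v)^2 <= CP * (nrm (wgrad \<Omega> v))^2"
 unfolding CP_def by (rule Poincare_H10[OF open_\<Omega> R(1) VX_H10])

lemma meas_sq: "f \<in> borel_measurable M ==> (%z. ennreal ((norm (f z))^2)) \<in> borel_measurable M"
 using borel_measurable_power[OF measurable_compose[OF _ borel_measurable_norm], of f M 2]
 by (rule measurable_compose[OF _ measurable_ennreal])

lemma slice_gradient:
 assumes W: "W \<in> Z" and G: "slice_grad s \<Omega> W Gx Gy" and y: "y > 0"
 shows "ennreal ((nrm (wgrad \<Omega> (%x. W (x, y))))^2) = (\<integral>\<^sup>+ x. ennreal ((norm (Gx (x, y)))^2) \<partial>vol \<Omega>)"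
proof -
 have wg: "is_weak_grad \<Omega> (%x. W (x, y)) (%x. Gx (x, y))" using G y by (auto simp: slice_grad_def)
 have "(\<integral>\<^sup>+ x. ennreal ((norm (Gx (x, y)))^2) \<partial>vol \<Omega>) = (\<integral>\<^sup>+ x. ennreal ((norm (wgrad \<Omega> (%x. W (x, y)) x))^2) \<partial>vol \<Omega>)"
 proof (rule nn_integral_cong_AE)
  have "AE x in vol \<Omega>. wgrad \<Omega> (%x. W (x, y)) x = Gx (x, y)"
   using wgrad_AE[OF open_\<Omega> wg] \<Omega>_borel by (subst AE_vol) auto
  then show "AE x in vol \<Omega>. ennreal ((norm (Gx (x, y)))^2) = ennreal ((norm (wgrad \<Omega> (%x. W (x, y)) x))^2)"
   by eventually_elim simp
 qed
 also have "... = ennreal ((nrm (wgrad \<Omega> (%x. W (x, y))))^2)"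
  using VX_weak_grad[OF Z_slices(2)[OF W]] by (intro L2_nn_integral) auto
 finally show ?thesis by simp
qed

lemma gradient_energy:
 assumes W: "W \<in> Z" and G: "slice_grad s \<Omega> W Gx Gy"
 shows "(\<integral>\<^sup>+ t\<in>{0<..}. ennreal (t powr (1 - 2 * s)) * ennreal ((nrm (wgrad \<Omega> (%x. W (x, t))))^2) \<partial>lborel)
  <= ennreal ((ext_norm s \<Omega> W)^2)"
  "(%t. ennreal (t powr (1 - 2 * s)) * ennreal ((nrm (wgrad \<Omega> (%x. W (x, t))))^2) * indicator {0<..} t) \<in> borel_measurable lborel"
proof -
 let ?A = "%W. (\<integral>\<^sup>+ t\<in>{0<..}. ennreal (t powr (1 - 2 * s)) * ennreal ((nrm (wgrad \<Omega> (%x. W (x, t))))^2) \<partial>lborel)"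
 have gL: "Gx \<in> L2 cyl" using G by (auto simp: slice_grad_def)
 have gm: "(%z. ennreal ((norm (Gx z))^2)) \<in> borel_measurable (vol (cylinder \<Omega>))"
  using L2_meas[OF gL] by (intro meas_sq) (simp add: measurable_cyl_iff)
 have e: "ennreal (t powr (1 - 2 * s)) * ennreal ((nrm (wgrad \<Omega> (%x. W (x, t))))^2) * indicator {0<..} t
   = ennreal (t powr weight s) * (\<integral>\<^sup>+ x. ennreal ((norm (Gx (x, t)))^2) \<partial>vol \<Omega>) * indicator {0<..} t" for t
  using slice_gradient[OF W G, of t] by (cases "t > 0") (auto simp: weight_def)
 have "(?A W)
  = (\<integral>\<^sup>+ z. ennreal ((norm (Gx z))^2) \<partial>cyl)"
  unfolding e by (rule cyl_nn_integral(1)[OF open_\<Omega> gm, symmetric])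
 also have "... = ennreal ((L2_norm cyl Gx)^2)" by (rule L2_nn_integral[OF gL])
 also have "... <= ennreal ((ext_norm s \<Omega> W)^2)"
  unfolding Z_wgrad(3)[OF W G] by (intro ennreal_leI) simp
 finally show "(?A W)
  <= ennreal ((ext_norm s \<Omega> W)^2)" .
 have cy: "cylinder \<Omega> \<in> sets borel" using cyl_open by simp
 have F: "(%z. ennreal ((norm (Gx z))^2) * indicator (cylinder \<Omega>) z) \<in> borel_measurable (lborel \<Otimes>\<^sub>M lborel)"
  using gm unfolding vol_def lborel_prod by (subst (asm) borel_measurable_restrict_space_iff_ennreal) (use cy in auto)
 have e2: "ennreal (t powr weight s) * (\<integral>\<^sup>+ x. ennreal ((norm (Gx (x, t)))^2) \<partial>vol \<Omega>) * indicator {0<..} t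
   = ennreal (t powr weight s) * (\<integral>\<^sup>+ x. ennreal ((norm (Gx (x, t)))^2) * indicator (cylinder \<Omega>) (x, t) \<partial>lborel) * indicator {0<..} t" for t
  by (cases "t > 0") (auto simp: nn_integral_vol \<Omega>_borel cylinder_def indicator_def)
 show "(%t. ennreal (t powr (1 - 2 * s)) * ennreal ((nrm (wgrad \<Omega> (%x. W (x, t))))^2) * indicator {0<..} t) \<in> borel_measurable lborel"
  unfolding e e2 using F by measurable
qed

text \<open>Hardy's inequality along each line \<open>{x} \<times> (0, \<infinity>)\<close>, integrated over \<open>\<Omega>\<close>.\<close>

lemma trace_defect_energy:
 assumes W: "W \<in> Z"
 shows "(\<integral>\<^sup>+ t\<in>{0<..}. ennreal (t powr (- 2 * s - 1)) * ennreal ((nrm (%x. W (x, t) - W (x, 0)))^2) \<partial>lborel)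
  <= ennreal (1 / s^2 * (ext_norm s \<Omega> W)^2)"
  "(%t. ennreal (t powr (- 2 * s - 1)) * ennreal ((nrm (%x. W (x, t) - W (x, 0)))^2) * indicator {0<..} t) \<in> borel_measurable lborel"
proof -
 let ?A = "%Gy. %x. \<integral>\<^sup>+ t\<in>{0<..}. ennreal (t powr weight s) * (ennreal ((norm (Gy (x, t)))^2) * indicator (cylinder \<Omega>) (x, t)) \<partial>lborel"
 let ?B = "%W. (\<integral>\<^sup>+ t\<in>{0<..}. ennreal (t powr (- 2 * s - 1)) * ennreal ((nrm (%x. W (x, t) - W (x, 0)))^2) \<partial>lborel)"
 let ?C = "%Gy. %x. \<integral>\<^sup>+ t\<in>{0<..}. ennreal (t powr weight s) * ennreal ((norm (Gy (x, t)))^2) \<partial>lborel"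
 let ?D = "vol (cylinder \<Omega>)"
 obtain Gx Gy where G: "slice_grad s \<Omega> W Gx Gy" using Z_slices(1)[OF W] by blast
 have gL: "Gy \<in> L2 cyl" using G by (auto simp: slice_grad_def)
 have gm0: "Gy \<in> borel_measurable ?D" using L2_meas[OF gL] by (simp add: measurable_cyl_iff)
 have gm: "(%z. ennreal ((norm (Gy z))^2)) \<in> borel_measurable ?D"
  using gm0 by (rule meas_sq)
 have Wm: "W \<in> borel_measurable ?D" using L2_meas[OF Z_L2[OF W]] by (simp add: measurable_cyl_iff)
 have Tm: "(%z. W (fst z, 0)) \<in> borel_measurable ?D"
  by (rule measurable_compose[OF fst_measurable_cyl[OF open_\<Omega>] L2_meas[OF VX_L2[OF Z_slices(2)[OF W]]]])
 define D where "D z = W z - W (fst z, 0)" for z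
 have Dm: "(%z. ennreal ((norm (D z))^2)) \<in> borel_measurable ?D"
  unfolding D_def by (intro meas_sq borel_measurable_diff Wm Tm)
 have sl: "ennreal ((nrm (%x. W (x, t) - W (x, 0)))^2) = (\<integral>\<^sup>+ x. ennreal ((norm (D (x, t)))^2) \<partial>vol \<Omega>)" for t
  using L2_nn_integral[OF L2_diff[OF VX_L2[OF Z_slices(2)[OF W, of t]] VX_L2[OF Z_slices(2)[OF W, of 0]]]]
  by (simp add: D_def)
 define \<omega> :: "real => ennreal" where "\<omega> t = ennreal (t powr (- 2 * s - 1))" for t
 have \<omega>: "\<omega> \<in> borel_measurable borel" unfolding \<omega>_def by measurable
 have "(?B W)
  = (\<integral>\<^sup>+ t\<in>{0<..}. \<omega> t * (\<integral>\<^sup>+ x. ennreal ((norm (D (x, t)))^2) \<partial>vol \<Omega>) \<partial>lborel)"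
  by (simp add: sl \<omega>_def)
 also have "... = (\<integral>\<^sup>+ x. (\<integral>\<^sup>+ t\<in>{0<..}. \<omega> t * ennreal ((norm (D (x, t)))^2) \<partial>lborel) \<partial>vol \<Omega>)"
  using cylinder_Tonelli[OF open_\<Omega> Dm \<omega>] by simp
 also have "... <= (\<integral>\<^sup>+ x. ennreal (1 / s^2) * (\<integral>\<^sup>+ t\<in>{0<..}. ennreal (t powr weight s) * ennreal ((norm (Gy (x, t)))^2) \<partial>lborel) \<partial>vol \<Omega>)"
 proof (rule nn_integral_mono)
  fix x assume "x \<in> space (vol \<Omega>)"
  then have x: "x \<in> \<Omega>" by (simp add: vol_def space_restrict_space)
  have "(\<integral>\<^sup>+ t\<in>{0<..}. ennreal (t powr (- 2 * s - 1) * (W (x, t) - W (x, 0))^2) \<partial>lborel)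
   <= ennreal (1 / s^2) * (\<integral>\<^sup>+ t\<in>{0<..}. ennreal (t powr (1 - 2 * s) * (Gy (x, t))^2) \<partial>lborel)"
  proof (rule Hardy[OF VY_cont[OF Z_slices(3)[OF W]] _ s])
   show "is_weak_grad {0<..} (%y. W (x, y)) (%y. Gy (x, y))" using G x by (auto simp: slice_grad_def)
   show "(%y. Gy (x, y)) \<in> borel_measurable (vol {0<..})"
   by (rule measurable_compose[OF slice_measurable_y[OF x] gm0])
  qed
  then show "(\<integral>\<^sup>+ t\<in>{0<..}. \<omega> t * ennreal ((norm (D (x, t)))^2) \<partial>lborel)
   <= ennreal (1 / s^2) * (\<integral>\<^sup>+ t\<in>{0<..}. ennreal (t powr weight s) * ennreal ((norm (Gy (x, t)))^2) \<partial>lborel)"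
   by (simp add: \<omega>_def D_def weight_def ennreal_mult)
 qed
 also have "... = ennreal (1 / s^2) * (\<integral>\<^sup>+ z. ennreal ((norm (Gy z))^2) \<partial>cyl)"
  unfolding cyl_nn_integral(2)[OF open_\<Omega> gm]
 proof (rule nn_integral_cmult)
  have cy: "cylinder \<Omega> \<in> sets borel" using cyl_open by simp
  have F: "(%z. ennreal ((norm (Gy z))^2) * indicator (cylinder \<Omega>) z) \<in> borel_measurable (lborel \<Otimes>\<^sub>M lborel)"
   using gm unfolding vol_def lborel_prod by (subst (asm) borel_measurable_restrict_space_iff_ennreal) (use cy in auto)
  have m: "(?A Gy) \<in> borel_measurable lborel"
   using F by measurable
  have "(?A Gy) \<in> borel_measurable (vol \<Omega>)"
   unfolding vol_def by (rule measurable_restrict_space1[OF m])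
  also have "?this \<longleftrightarrow> (?C Gy) \<in> borel_measurable (vol \<Omega>)"
   by (intro measurable_cong nn_integral_cong) (auto simp: vol_def space_restrict_space cylinder_def indicator_def)
  finally show "(?C Gy) \<in> borel_measurable (vol \<Omega>)" .
 qed
 also have "... = ennreal (1 / s^2) * ennreal ((L2_norm cyl Gy)^2)" by (simp only: L2_nn_integral[OF gL])
 also have "... = ennreal (1 / s^2 * (L2_norm cyl Gy)^2)" by (rule ennreal_mult[symmetric]) auto
 also have "... <= ennreal (1 / s^2 * (ext_norm s \<Omega> W)^2)"
  unfolding Z_wgrad(3)[OF W G] by (intro ennreal_leI mult_left_mono) auto
 finally show "(?B W)
  <= ennreal (1 / s^2 * (ext_norm s \<Omega> W)^2)" .
 have cy: "cylinder \<Omega> \<in> sets borel" using cyl_open by simp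
 have F: "(%z. ennreal ((norm (D z))^2) * indicator (cylinder \<Omega>) z) \<in> borel_measurable (lborel \<Otimes>\<^sub>M lborel)"
  using Dm unfolding vol_def lborel_prod by (subst (asm) borel_measurable_restrict_space_iff_ennreal) (use cy in auto)
 have e2: "ennreal (t powr (- 2 * s - 1)) * ennreal ((nrm (%x. W (x, t) - W (x, 0)))^2) * indicator {0<..} t
   = ennreal (t powr (- 2 * s - 1)) * (\<integral>\<^sup>+ x. ennreal ((norm (D (x, t)))^2) * indicator (cylinder \<Omega>) (x, t) \<partial>lborel) * indicator {0<..} t" for t
  unfolding sl by (cases "t > 0") (auto simp: nn_integral_vol \<Omega>_borel cylinder_def indicator_def)
 show "(%t. ennreal (t powr (- 2 * s - 1)) * ennreal ((nrm (%x. W (x, t) - W (x, 0)))^2) * indicator {0<..} t) \<in> borel_measurable lborel"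
  unfolding e2 using F by measurable
qed

end

section \<open>Finite dimensional Euclidean geometry of function spaces\<close>

lemma sum_fun_apply: "(\<Sum>i\<in>I. f i) x = (\<Sum>i\<in>I. (f i x :: real))"
 by (induction I rule: infinite_finite_induct) auto

lemma span_set_eqI: "A \<subseteq> span B ==> B \<subseteq> span A ==> span A = span (B :: 'v::real_vector set)"
 by (simp add: span_minimal subset_antisym)

text \<open>A symmetric bilinear form that is positive definite on a finite dimensional subspace.\<close>

locale euclidean_subspace =
 fixes V :: "'v::real_vector set" and form :: "'v => 'v => real"
 assumes V_sub: "subspace V" and V_fin: "\<exists>B. finite B & V \<subseteq> span B"
  and form_lin: "!!u v w r. u \<in> V ==> v \<in> V ==> w \<in> V ==> form (u + r *\<^sub>R v) w = form u w + r * form v w"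
  and form_sym: "!!u v. u \<in> V ==> v \<in> V ==> form u v = form v u"
  and form_pos: "!!u. u \<in> V ==> u ~= 0 ==> form u u > 0"
begin

lemma zero_V: "0 \<in> V" using V_sub by (rule subspace_0)

lemma form_add: "u \<in> V ==> v \<in> V ==> w \<in> V ==> form (u + v) w = form u w + form v w"
 using form_lin[of u v w 1] by simp

lemma form_zero: "w \<in> V ==> form 0 w = 0"
 using form_add[OF zero_V zero_V, of w] by simp

lemma form_scale: "u \<in> V ==> w \<in> V ==> form (r *\<^sub>R u) w = r * form u w"
 using form_lin[OF zero_V, of u w r] form_zero[of w] by simp

lemma form_diff: "u \<in> V ==> v \<in> V ==> w \<in> V ==> form (u - v) w = form u w - form v w"
 using form_lin[of u v w "-1"] by simp

lemma sum_V: "(!!i. i \<in> I ==> f i \<in> V) ==> (\<Sum>i\<in>I. c i *\<^sub>R f i) \<in> V"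
 by (intro subspace_sum[OF V_sub] subspace_scale[OF V_sub])

lemma form_sum: "(!!i. i \<in> I ==> f i \<in> V) ==> w \<in> V ==> form (\<Sum>i\<in>I. c i *\<^sub>R f i) w = (\<Sum>i\<in>I. c i * form (f i) w)"
proof (induction I rule: infinite_finite_induct)
 case (insert i I)
 have "form ((\<Sum>i\<in>I. c i *\<^sub>R f i) + c i *\<^sub>R f i) w = form (\<Sum>i\<in>I. c i *\<^sub>R f i) w + c i * form (f i) w"
  using insert by (intro form_lin sum_V) auto
 then show ?case using insert by (simp add: add.commute)
qed (auto simp: form_zero)

lemma eq_if_form_eq:
 assumes "u \<in> V" "v \<in> V" "!!w. w \<in> V ==> form u w = form v w"
 shows "u = v"
proof (rule ccontr)
 assume "u ~= v"
 then have "form (u - v) (u - v) > 0" using assms V_sub by (intro form_pos) (auto simp: subspace_diff)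
 moreover have "form (u - v) (u - v) = 0"
  using assms V_sub by (subst form_diff) (auto simp: subspace_diff)
 ultimately show False by simp
qed

definition orthonormal :: "'v set => bool" where
 "orthonormal I \<longleftrightarrow> (\<forall>i\<in>I. \<forall>k\<in>I. form i k = (if i = k then 1 else 0))"

lemma Gram_Schmidt:
 "finite B ==> B \<subseteq> V ==> \<exists>I. finite I & I \<subseteq> V & orthonormal I & span I = span B"
proof (induction B rule: finite_induct)
 case empty
 show ?case by (intro exI[of _ "{}"]) (auto simp: orthonormal_def)
next
 case (insert b B)
 then obtain I where I: "finite I" "I \<subseteq> V" "orthonormal I" "span I = span B" by auto
 have bV: "b \<in> V" using insert by auto
 define p where "p = (\<Sum>i\<in>I. form b i *\<^sub>R i)"
 have pV: "p \<in> V" unfolding p_def using I(2) by (intro sum_V) auto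
 have pS: "p \<in> span I" unfolding p_def by (intro span_sum span_scale span_base)
 have pf: "form p k = form b k" if k: "k \<in> I" for k
 proof -
  have "form p k = (\<Sum>i\<in>I. form b i * form i k)" unfolding p_def using I(2) k by (intro form_sum) auto
  also have "... = (\<Sum>i\<in>I. if i = k then form b i else 0)"
   using I(3) k by (intro sum.cong) (auto simp: orthonormal_def)
  also have "... = form b k" using I(1) k by simp
  finally show ?thesis .
 qed
 have sp: "span (insert b B) = span (insert (b - p) I)"
 proof -
  have "span (insert b B) = span (insert b I)" using I(4) by (metis span_insert)
  also have "... = span (insert (b - p) I)"
  proof (rule span_set_eqI)
   have "b = (b - p) + p" by simp
   also have "... \<in> span (insert (b - p) I)"
   by (intro span_add span_base[of "b - p"] span_mono[THEN subsetD, OF _ pS]) auto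
   finally show "insert b I \<subseteq> span (insert (b - p) I)" by (auto intro: span_base)
   have "b - p \<in> span (insert b I)"
   by (intro span_diff span_base[of b] span_mono[THEN subsetD, OF _ pS]) auto
   then show "insert (b - p) I \<subseteq> span (insert b I)" by (auto intro: span_base)
  qed
  finally show ?thesis .
 qed
 show ?case
 proof (cases "b - p = 0")
  case True
  have "span (insert 0 I) = span I" by (rule span_insert_0)
  then show ?thesis using I sp True by (intro exI[of _ I]) auto
 next
  case False
  have rV: "b - p \<in> V" using bV pV V_sub by (simp add: subspace_diff)
  define n where "n = sqrt (form (b - p) (b - p))"
  have n: "n > 0" "n * n = form (b - p) (b - p)" using form_pos[OF rV False] by (auto simp: n_def)
  define q where "q = (1 / n) *\<^sub>R (b - p)"
  have qV: "q \<in> V" unfolding q_def using rV V_sub by (intro subspace_scale)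
  have rq: "b - p = n *\<^sub>R q" using n by (simp add: q_def)
  have qk: "form q k = 0" if "k \<in> I" for k
   using that I(2) pf[OF that] bV pV rV by (auto simp: q_def form_scale form_diff)
  have qq: "form q q = 1"
  proof -
   have "form q q = 1 / n * form (b - p) q" unfolding q_def[of] by (rule form_scale[OF rV qV[unfolded q_def]])
   also have "form (b - p) q = form q (b - p)" by (rule form_sym[OF rV qV])
   also have "form q (b - p) = 1 / n * form (b - p) (b - p)" unfolding q_def by (rule form_scale[OF rV rV])
   finally have "form q q = 1 / n * (1 / n * (n * n))" using n(2) by simp
   then show ?thesis using n(1) by simp
  qed
  have "orthonormal (insert q I)"
   unfolding orthonormal_def
  proof (intro ballI)
   fix i k assume ik: "i \<in> insert q I" "k \<in> insert q I"
   have qI: "q \<notin> I" using qk qq by force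
   show "form i k = (if i = k then 1 else 0)"
   proof (cases "i = q")
   case True
   then show ?thesis using ik(2) qk qq qI by auto
   next
   case False
   then have i: "i \<in> I" using ik(1) by simp
   show ?thesis
   proof (cases "k = q")
   case True
   have "form i q = form q i" using i I(2) qV by (intro form_sym) auto
   then show ?thesis using True qk[OF i] False by simp
   next
   case False
   then have "k \<in> I" using ik(2) by simp
   then show ?thesis using I(3) i unfolding orthonormal_def by simp
   qed
   qed
  qed
  moreover have "span (insert (b - p) I) = span (insert q I)"
  proof (rule span_set_eqI)
   show "insert (b - p) I \<subseteq> span (insert q I)" unfolding rq by (auto intro: span_base span_scale)
   show "insert q I \<subseteq> span (insert (b - p) I)" unfolding q_def by (auto intro: span_base span_scale)
  qed
  ultimately show ?thesis using I sp qV by (intro exI[of _ "insert q I"]) auto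
 qed
qed

lemma orthonormal_basis_exists: "\<exists>I. finite I & I \<subseteq> V & orthonormal I & span I = V"
proof -
 obtain B where B: "B \<subseteq> V" "independent B" "V \<subseteq> span B" using maximal_independent_subset[of V] by blast
 obtain B' where B': "finite B'" "V \<subseteq> span B'" using V_fin by blast
 have fB: "finite B" using independent_span_bound[OF B'(1) B(2) order.trans[OF B(1) B'(2)]] by simp
 have "span B = V" using span_minimal[OF B(1) V_sub] B(3) by (rule subset_antisym)
 then show ?thesis using Gram_Schmidt[OF fB B(1)] by simp
qed

lemma expansion:
 assumes I: "finite I" "I \<subseteq> V" "orthonormal I" "span I = V" and v: "v \<in> V"
 shows "v = (\<Sum>i\<in>I. form v i *\<^sub>R i)"
proof (rule eq_if_form_eq[OF v sum_V])
 have f: "form v k = form (\<Sum>i\<in>I. form v i *\<^sub>R i) k" if k: "k \<in> I" for k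
 proof -
  have "form (\<Sum>i\<in>I. form v i *\<^sub>R i) k = (\<Sum>i\<in>I. form v i * form i k)" using I(2) k by (intro form_sum) auto
  also have "... = (\<Sum>i\<in>I. if i = k then form v i else 0)"
   using I(3) k by (intro sum.cong) (auto simp: orthonormal_def)
  also have "... = form v k" using I(1) k by simp
  finally show ?thesis by simp
 qed
 have sV: "(\<Sum>i\<in>I. form v i *\<^sub>R i) \<in> V" using I(2) by (intro sum_V) auto
 fix w assume w: "w \<in> V"
 then have "w \<in> span I" using I(4) by simp
 then have "w \<in> V & form v w = form (\<Sum>i\<in>I. form v i *\<^sub>R i) w"
 proof (induction rule: span_induct_alt)
  case base
  then show ?case using zero_V form_sym[OF v zero_V] form_sym[OF sV zero_V] form_zero[OF v] form_zero[OF sV] by simp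
 next
  case (step r x y)
  have x: "x \<in> V" "y \<in> V" using step I(2) by auto
  have sc: "r *\<^sub>R x + y \<in> V" using x V_sub by (intro subspace_add subspace_scale)
  have "form u (r *\<^sub>R x + y) = r * form u x + form u y" if "u \<in> V" for u
  proof -
   have "form u (y + r *\<^sub>R x) = form (y + r *\<^sub>R x) u"
   using that x V_sub by (intro form_sym) (auto intro: subspace_add subspace_scale)
   also have "... = form y u + r * form x u" using that x by (intro form_lin)
   also have "... = form u y + r * form u x" using that x by (simp add: form_sym)
   finally show ?thesis by (simp add: add.commute)
  qed
  then show ?case using step f[OF step(1)] sV v sc by simp
 qed
 then show "form v w = form (\<Sum>i\<in>I. form v i *\<^sub>R i) w" ..
qed (use I in auto)

lemma Riesz:
 assumes l: "!!u v r. u \<in> V ==> v \<in> V ==> l (u + r *\<^sub>R v) = l u + r * l v"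
 shows "\<exists>!w. w \<in> V & (\<forall>v\<in>V. form w v = (l v :: real))"
proof -
 obtain I where I: "finite I" "I \<subseteq> V" "orthonormal I" "span I = V" using orthonormal_basis_exists by blast
 have l0: "l 0 = 0" using l[OF zero_V zero_V, of 1] by simp
 have ls: "(!!i. i \<in> J ==> i \<in> V) ==> l (\<Sum>i\<in>J. c i *\<^sub>R i) = (\<Sum>i\<in>J. c i * l i)" for J and c :: "'v => real"
 proof (induction J rule: infinite_finite_induct)
  case (insert j J)
  have "l ((\<Sum>i\<in>J. c i *\<^sub>R i) + c j *\<^sub>R j) = l (\<Sum>i\<in>J. c i *\<^sub>R i) + c j * l j"
   using insert by (intro l sum_V) auto
  then show ?case using insert by (simp add: add.commute)
 qed (auto simp: l0)
 define w where "w = (\<Sum>i\<in>I. l i *\<^sub>R i)"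
 have wV: "w \<in> V" unfolding w_def using I by (intro sum_V) auto
 have wl: "form w v = l v" if v: "v \<in> V" for v
 proof -
  have "form w v = (\<Sum>i\<in>I. l i * form i v)" unfolding w_def using I v by (intro form_sum) auto
  also have "... = (\<Sum>i\<in>I. form v i * l i)" using I v by (intro sum.cong) (auto simp: form_sym)
  also have "... = l (\<Sum>i\<in>I. form v i *\<^sub>R i)" using I by (intro ls[symmetric]) auto
  also have "... = l v" using expansion[OF I v] by simp
  finally show ?thesis .
 qed
 show ?thesis using wV wl eq_if_form_eq by (intro ex1I[of _ w]) auto
qed

text \<open>Orthogonal projection onto the kernel of a linear map.\<close>

lemma orthogonal_complement_of_kernel:
 assumes t: "!!u v r. u \<in> V ==> v \<in> V ==> (t (u + r *\<^sub>R v) :: 'w::real_vector) = t u + r *\<^sub>R t v" and w0: "w0 \<in> V"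
 shows "\<exists>!w. w \<in> V & t w = t w0 & (\<forall>v\<in>V. t v = 0 --> form w v = 0)"
proof -
 define V0 where "V0 = {v \<in> V. t v = 0}"
 have t0: "t 0 = 0" using t[OF zero_V zero_V, of 1] by simp
 have sub0: "subspace V0"
  unfolding V0_def
 proof (rule subspaceI; clarsimp)
  show "0 \<in> V & t 0 = 0" using zero_V t0 by simp
  show "x + y \<in> V & t (x + y) = 0" if "x \<in> V" "t x = 0" "y \<in> V" "t y = 0" for x y
   using that t[of x y 1] V_sub by (simp add: subspace_add)
  show "r *\<^sub>R x \<in> V & t (r *\<^sub>R x) = 0" if "x \<in> V" "t x = 0" for x r
   using that t[OF zero_V that(1), of r] t0 V_sub by (simp add: subspace_scale)
 qed
 interpret V0: euclidean_subspace V0 form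
  by standard (use sub0 V_fin form_lin form_sym form_pos in "auto simp: V0_def")
 have "form w0 (u + r *\<^sub>R v) = form w0 u + r * form w0 v" if "u \<in> V0" "v \<in> V0" for u v r
 proof -
  have uv: "u \<in> V" "v \<in> V" using that by (auto simp: V0_def)
  then have "u + r *\<^sub>R v \<in> V" by (intro subspace_add[OF V_sub] subspace_scale[OF V_sub])
  then show ?thesis using form_lin[OF uv w0, of r] form_sym[OF w0] uv by simp
 qed
 from V0.Riesz[OF this] obtain p where p: "p \<in> V0" "!!v. v \<in> V0 ==> form p v = form w0 v"
  by (auto simp: Ex1_def)
 have pV: "p \<in> V" "t p = 0" using p(1) by (auto simp: V0_def)
 have tp: "t (w0 - p) = t w0" using t[OF w0 pV(1), of "-1"] pV(2) by simp
 show ?thesis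
 proof (rule ex1I[of _ "w0 - p"])
  show "w0 - p \<in> V & t (w0 - p) = t w0 & (\<forall>v\<in>V. t v = 0 --> form (w0 - p) v = 0)"
   using tp pV w0 p(2) V_sub by (auto simp: subspace_diff form_diff V0_def)
  fix w assume w: "w \<in> V & t w = t w0 & (\<forall>v\<in>V. t v = 0 --> form w v = 0)"
  define e where "e = w - (w0 - p)"
  have wp: "w0 - p \<in> V" using w0 pV V_sub by (simp add: subspace_diff)
  have eV: "e \<in> V" using w wp V_sub by (simp add: e_def subspace_diff)
  have "t e = t (w + (-1) *\<^sub>R (w0 - p))" unfolding e_def scaleR_minus_left scaleR_one by (simp only: add_uminus_conv_diff)
  also have "... = t w + (-1) *\<^sub>R t (w0 - p)" using w wp by (intro t) auto
  finally have te: "t e = 0" using w tp by simp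
  have "form e e = form w e - form (w0 - p) e" using form_diff[OF _ wp eV, of w] w by (simp add: e_def)
  also have "... = 0" using w eV te p(2)[of e] pV w0 by (simp add: form_diff V0_def)
  finally have "e = 0" using form_pos[OF eV] by fastforce
  then show "w = w0 - p" by (simp add: e_def)
 qed
qed

end

section \<open>The extension form\<close>

context discretization
begin

definition CH :: real where "CH = 2 / s^2 + 2 * (1 + CP)"
definition CT :: real where "CT = 8 * (2 / s^2 + 2 * CP)"

lemma CH_pos: "CH > 0" and CT_pos: "CT > 0"
 using CP s by (auto simp: CH_def CT_def intro!: add_nonneg_pos)

abbreviation "sl W t \<equiv> (%x. W (x, t))"

lemma slice_norm_bound: "W \<in> Z ==> (nrm (sl W t))^2 <= CP * (nrm (wgrad \<Omega> (sl W t)))^2"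
 by (rule Poincare_VX[OF Z_slices(2)])

lemma energy_sum:
 assumes W: "W \<in> Z" and p: "p >= 0" "q >= 0"
 shows "(\<integral>\<^sup>+ t\<in>{0<..}. ennreal (p * (t powr (- 2 * s - 1) * (nrm (%x. W (x, t) - W (x, 0)))^2)
   + q * (t powr (1 - 2 * s) * (nrm (wgrad \<Omega> (sl W t)))^2)) \<partial>lborel)
  <= ennreal ((p / s^2 + q) * (ext_norm s \<Omega> W)^2)"
proof -
 obtain Gx Gy where G: "slice_grad s \<Omega> W Gx Gy" using Z_slices(1)[OF W] by blast
 let ?a = "%t. ennreal (t powr (- 2 * s - 1)) * ennreal ((nrm (%x. W (x, t) - W (x, 0)))^2) * indicator {0<..} t"
 let ?b = "%t. ennreal (t powr (1 - 2 * s)) * ennreal ((nrm (wgrad \<Omega> (sl W t)))^2) * indicator {0<..} t"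
 note ma = trace_defect_energy[OF W] and mb = gradient_energy[OF W G]
 have "(\<integral>\<^sup>+ t\<in>{0<..}. ennreal (p * (t powr (- 2 * s - 1) * (nrm (%x. W (x, t) - W (x, 0)))^2)
   + q * (t powr (1 - 2 * s) * (nrm (wgrad \<Omega> (sl W t)))^2)) \<partial>lborel)
  = (\<integral>\<^sup>+ t. ennreal p * ?a t + ennreal q * ?b t \<partial>lborel)"
  using p by (intro nn_integral_cong) (auto simp: indicator_def ennreal_mult ennreal_plus)
 also have "... = ennreal p * (\<integral>\<^sup>+ t. ?a t \<partial>lborel) + ennreal q * (\<integral>\<^sup>+ t. ?b t \<partial>lborel)"
  using ma(2) mb(2) by (subst nn_integral_add) (auto intro!: borel_measurable_times_ennreal simp: nn_integral_cmult simp del: borel_measurable_times_ennreal)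
 also have "... <= ennreal p * ennreal (1 / s^2 * (ext_norm s \<Omega> W)^2) + ennreal q * ennreal ((ext_norm s \<Omega> W)^2)"
  by (intro add_mono mult_left_mono ma(1) mb(1)) auto
 also have "... = ennreal ((p / s^2 + q) * (ext_norm s \<Omega> W)^2)"
  using p by (simp add: ennreal_mult[symmetric] ennreal_plus[symmetric] field_simps del: ennreal_plus)
 finally show ?thesis .
qed

lemma K_functional_le:
 assumes v: "v \<in> H10 \<Omega>" and t: "t >= 0"
 shows "K_functional (nrm) (H10 \<Omega>) (H1_norm (vol \<Omega>) \<Omega>) t u
  <= nrm (u - v) + t * H1_norm (vol \<Omega>) \<Omega> v"
 unfolding K_functional_def
 by (rule cINF_lower[OF _ v]) (use t in "auto intro!: bdd_belowI[of _ 0] simp: L2_norm_nonneg H1_norm_def")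

lemma K_functional_nonneg:
 assumes t: "t >= 0" and X: "X1 ~= {}" and n: "!!v. n1 v >= 0" "!!v. n0 v >= 0"
 shows "0 <= K_functional n0 X1 n1 t (u :: 'u::ab_group_add)"
 unfolding K_functional_def using assms by (intro cINF_greatest) auto

lemma H10_nonempty: "H10 \<Omega> ~= {}"
 using VX_H10[OF subspace_0[OF VX_subspace]] by auto

text \<open>The slice of \<open>W\<close> at height \<open>t\<close> is the competitor in the K-functional at \<open>t\<close>: no integration
  over an optimal decomposition is necessary.\<close>

lemma hs_bound:
 assumes W: "W \<in> Z"
 shows "interp_sqnorm s (nrm) (H10 \<Omega>) (H1_norm (vol \<Omega>) \<Omega>) (tr W) <= ennreal (CH * (ext_norm s \<Omega> W)^2)"
proof -
 let ?K = "%t. K_functional (nrm) (H10 \<Omega>) (H1_norm (vol \<Omega>) \<Omega>) t (tr W)"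
 let ?a = "%t. (nrm (%x. W (x, t) - W (x, 0)))^2"
 let ?b = "%t. (nrm (wgrad \<Omega> (sl W t)))^2"
 have "interp_sqnorm s (nrm) (H10 \<Omega>) (H1_norm (vol \<Omega>) \<Omega>) (tr W)
  <= (\<integral>\<^sup>+ t\<in>{0<..}. ennreal (2 * (t powr (- 2 * s - 1) * ?a t) + (2 * (1 + CP)) * (t powr (1 - 2 * s) * ?b t)) \<partial>lborel)"
  unfolding interp_sqnorm_def
 proof (rule nn_integral_mono)
  fix t :: real
  show "ennreal (t powr (- 2 * s) * (?K t)^2 / t) * indicator {0<..} t
   <= ennreal (2 * (t powr (- 2 * s - 1) * ?a t) + (2 * (1 + CP)) * (t powr (1 - 2 * s) * ?b t)) * indicator {0<..} t"
  proof (cases "t > 0")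
   case True
   have "?K t <= nrm (tr W - sl W t) + t * H1_norm (vol \<Omega>) \<Omega> (sl W t)"
   using True by (intro K_functional_le VX_H10 Z_slices(2) W) auto
   moreover have "?K t >= 0"
   by (rule K_functional_nonneg) (use True H10_nonempty in "auto simp: L2_norm_nonneg H1_norm_def")
   ultimately have "(?K t)^2 <= (nrm (tr W - sl W t) + t * H1_norm (vol \<Omega>) \<Omega> (sl W t))^2"
   by (rule power_mono)
   also have "... <= 2 * (nrm (tr W - sl W t))^2 + 2 * (t * H1_norm (vol \<Omega>) \<Omega> (sl W t))^2"
   using sum_squares_bound[of "nrm (tr W - sl W t)" "t * H1_norm (vol \<Omega>) \<Omega> (sl W t)"] by (simp add: power2_sum)
   also have "(nrm (tr W - sl W t))^2 = ?a t"
   by (simp add: L2_norm_sq_real tr_def power2_commute)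
   also have "(t * H1_norm (vol \<Omega>) \<Omega> (sl W t))^2 <= t^2 * ((1 + CP) * ?b t)"
   proof -
   have "(H1_norm (vol \<Omega>) \<Omega> (sl W t))^2 = (nrm (sl W t))^2 + ?b t"
   by (simp add: H1_norm_def)
   also have "... <= (1 + CP) * ?b t" using slice_norm_bound[OF W, of t] by (simp add: algebra_simps)
   finally show ?thesis unfolding power_mult_distrib by (intro mult_left_mono) auto
   qed
   finally have K2: "(?K t)^2 <= 2 * ?a t + 2 * (t^2 * ((1 + CP) * ?b t))" by simp
   have p1: "t powr (- 2 * s) / t = t powr (- 2 * s - 1)" using True by (simp add: powr_diff)
   have p2: "t powr (- 2 * s - 1) * t^2 = t powr (1 - 2 * s)"
   proof -
   have "t powr (- 2 * s - 1) * t powr 2 = t powr (1 - 2 * s)" by (simp flip: powr_add)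
   then show ?thesis using True by (simp add: powr_numeral)
   qed
   have "t powr (- 2 * s) * (?K t)^2 / t = t powr (- 2 * s - 1) * (?K t)^2" unfolding p1[symmetric] by simp
   also have "... <= t powr (- 2 * s - 1) * (2 * ?a t + 2 * (t^2 * ((1 + CP) * ?b t)))"
   using K2 by (intro mult_left_mono) auto
   also have "... = 2 * (t powr (- 2 * s - 1) * ?a t) + (2 * (1 + CP)) * ((t powr (- 2 * s - 1) * t^2) * ?b t)"
   by (simp add: algebra_simps)
   finally show ?thesis unfolding p2 using True by (simp add: ennreal_leI)
  qed simp
 qed
 also have "... <= ennreal ((2 / s^2 + 2 * (1 + CP)) * (ext_norm s \<Omega> W)^2)"
  by (rule energy_sum[OF W]) (use CP in auto)
 finally show ?thesis by (simp add: CH_def)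
qed

text \<open>Average \<open>\<parallel>tr W\<parallel>\<^sup>2 \<le> 2 \<parallel>tr W - W (\<cdot>, t)\<parallel>\<^sup>2 + 2 \<parallel>W (\<cdot>, t)\<parallel>\<^sup>2\<close> over \<open>t \<in> [1, 2]\<close>, where all
  powers of \<open>t\<close> that occur are at least \<open>1 / 8\<close>.\<close>

lemma trace_L2_bound:
 assumes W: "W \<in> Z"
 shows "(nrm (tr W))^2 <= CT * (ext_norm s \<Omega> W)^2"
proof -
 let ?a = "%t. (nrm (%x. W (x, t) - W (x, 0)))^2"
 let ?b = "%t. (nrm (wgrad \<Omega> (sl W t)))^2"
 have "ennreal (1 / 8 * (nrm (tr W))^2) = (\<integral>\<^sup>+ t\<in>{1..2::real}. ennreal (1 / 8 * (nrm (tr W))^2) \<partial>lborel)"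
  by (subst nn_integral_cmult_indicator) auto
 also have "... <= (\<integral>\<^sup>+ t\<in>{0<..}. ennreal (2 * (t powr (- 2 * s - 1) * ?a t) + (2 * CP) * (t powr (1 - 2 * s) * ?b t)) \<partial>lborel)"
 proof (rule nn_integral_mono)
  fix t :: real
  show "ennreal (1 / 8 * (nrm (tr W))^2) * indicator {1..2} t
   <= ennreal (2 * (t powr (- 2 * s - 1) * ?a t) + (2 * CP) * (t powr (1 - 2 * s) * ?b t)) * indicator {0<..} t"
  proof (cases "t \<in> {1..2}")
   case True
   have "(nrm (tr W))^2 <= 2 * (nrm (%x. tr W x - W (x, t)))^2 + 2 * (nrm (sl W t))^2"
   by (intro L2_norm_sq_le VX_L2 tr_VX Z_slices(2) W)
   also have "(nrm (%x. tr W x - W (x, t)))^2 = ?a t"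
   by (simp add: L2_norm_sq_real tr_def power2_commute)
   finally have 1: "(nrm (tr W))^2 <= 2 * ?a t + (2 * CP) * ?b t"
   using slice_norm_bound[OF W, of t] by simp
   have p: "1 / 8 <= t powr (- 2 * s - 1)"
   proof -
   have "(1 / 8 :: real) = 2 powr (- 3)" by (simp add: powr_minus)
   also have "... <= 2 powr (- 2 * s - 1)" using s by (intro powr_mono) auto
   also have "... <= t powr (- 2 * s - 1)" using True s by (intro powr_mono2') auto
   finally show ?thesis .
   qed
   have p': "1 / 8 <= t powr (1 - 2 * s)"
   proof -
   have "t powr (- 2 * s - 1) <= t powr (1 - 2 * s)" using True by (intro powr_mono) auto
   then show ?thesis using p by linarith
   qed
   have "1 / 8 * (nrm (tr W))^2 <= 2 * (1 / 8 * ?a t) + (2 * CP) * (1 / 8 * ?b t)" using 1 by simp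
   also have "... <= 2 * (t powr (- 2 * s - 1) * ?a t) + (2 * CP) * (t powr (1 - 2 * s) * ?b t)"
   using p p' CP by (intro add_mono mult_left_mono mult_right_mono) auto
   finally show ?thesis using True by (simp add: ennreal_leI)
  qed simp
 qed
 also have "... <= ennreal ((2 / s^2 + 2 * CP) * (ext_norm s \<Omega> W)^2)"
  by (rule energy_sum[OF W]) (use CP in auto)
 finally have "1 / 8 * (nrm (tr W))^2 <= (2 / s^2 + 2 * CP) * (ext_norm s \<Omega> W)^2"
  by (subst (asm) ennreal_le_iff) (use CP in "auto intro!: mult_nonneg_nonneg add_nonneg_nonneg")
 then show ?thesis by (simp add: CT_def algebra_simps)
qed

text \<open>The Poincare inequality on every slice.\<close>

lemma Z_L2_bound:
 assumes W: "W \<in> Z"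
 shows "(L2_norm cyl W)^2 <= CP * (ext_norm s \<Omega> W)^2"
proof -
 let ?A = "%y. (\<integral>\<^sup>+ x. ennreal ((norm (W (x, y)))^2) \<partial>vol \<Omega>)"
 obtain Gx Gy where G: "slice_grad s \<Omega> W Gx Gy" using Z_slices(1)[OF W] by blast
 have Wm: "W \<in> borel_measurable (vol (cylinder \<Omega>))" using L2_meas[OF Z_L2[OF W]] by (simp add: measurable_cyl_iff)
 let ?b = "%t. (nrm (wgrad \<Omega> (sl W t)))^2"
 have "ennreal ((L2_norm cyl W)^2) = (\<integral>\<^sup>+ y\<in>{0<..}. ennreal (y powr weight s) * (?A y) \<partial>lborel)"
  unfolding L2_nn_integral[OF Z_L2[OF W], symmetric] by (rule cyl_nn_integral(1)[OF open_\<Omega> meas_sq[OF Wm]])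
 also have "... <= (\<integral>\<^sup>+ y. ennreal CP * (ennreal (y powr (1 - 2 * s)) * ennreal (?b y) * indicator {0<..} y) \<partial>lborel)"
 proof (rule nn_integral_mono)
  fix y :: real
  have "(?A y) = ennreal ((nrm (sl W y))^2)"
   by (rule L2_nn_integral[OF VX_L2[OF Z_slices(2)[OF W]]])
  also have "... <= ennreal (CP * ?b y)" by (intro ennreal_leI slice_norm_bound W)
  also have "... = ennreal CP * ennreal (?b y)" using CP by (intro ennreal_mult) auto
  finally have "ennreal (y powr weight s) * (?A y) * indicator {0<..} y
   <= ennreal (y powr weight s) * (ennreal CP * ennreal (?b y)) * indicator {0<..} y"
   by (intro mult_right_mono mult_left_mono) auto
  then show "ennreal (y powr weight s) * (?A y) * indicator {0<..} y
   <= ennreal CP * (ennreal (y powr (1 - 2 * s)) * ennreal (?b y) * indicator {0<..} y)"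
   by (simp add: weight_def mult_ac)
 qed
 also have "... = ennreal CP * (\<integral>\<^sup>+ y\<in>{0<..}. ennreal (y powr (1 - 2 * s)) * ennreal (?b y) \<partial>lborel)"
  by (rule nn_integral_cmult[OF gradient_energy(2)[OF W G]])
 also have "... <= ennreal CP * ennreal ((ext_norm s \<Omega> W)^2)"
  by (intro mult_left_mono gradient_energy(1)[OF W G]) simp
 also have "... = ennreal (CP * (ext_norm s \<Omega> W)^2)" using CP by (intro ennreal_mult[symmetric]) auto
 finally show ?thesis using CP by (subst (asm) ennreal_le_iff) auto
qed

text \<open>This makes the energy form definite on the discrete extension space: a function of zero energy vanishes on
  almost every slice by the Poincare inequality, and members of the discrete spaces that vanish almost
  everywhere are \<open>0\<close>.\<close>

lemma ext_norm_zero: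
 assumes W: "W \<in> Z" and e: "ext_norm s \<Omega> W = 0"
 shows "W = 0"
proof -
 have Wm: "W \<in> borel_measurable (vol (cylinder \<Omega>))" using L2_meas[OF Z_L2[OF W]] by (simp add: measurable_cyl_iff)
 obtain Gx Gy where G: "slice_grad s \<Omega> W Gx Gy" using Z_slices(1)[OF W] by blast
 let ?b = "%t. (nrm (wgrad \<Omega> (sl W t)))^2"
 have "(\<integral>\<^sup>+ t. ennreal (t powr (1 - 2 * s)) * ennreal (?b t) * indicator {0<..} t \<partial>lborel) = 0"
  using gradient_energy(1)[OF W G] e by simp
 then have "AE t in lborel. ennreal (t powr (1 - 2 * s)) * ennreal (?b t) * indicator {0<..} t = 0"
  using nn_integral_0_iff_AE[OF gradient_energy(2)[OF W G]] by simp
 then have ae: "AE t in lborel. t \<in> {0<..} --> sl W t = 0"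
 proof eventually_elim
  case (elim t)
  show ?case
  proof
   assume t: "t \<in> {0<..}"
   then have "?b t = 0" using elim by (auto simp: ennreal_eq_0_iff)
   then have "(nrm (sl W t))^2 <= 0" using slice_norm_bound[OF W, of t] by simp
   then have z: "(nrm (sl W t))^2 = 0" by simp
   note L = VX_L2[OF Z_slices(2)[OF W, of t]]
   have "AE x in vol \<Omega>. (norm (W (x, t)))^2 = 0"
   using z L2_int[OF L] unfolding L2_norm_sq by (subst (asm) integral_nonneg_eq_0_iff_AE) auto
   then show "sl W t = 0" using VX_zero[OF Z_slices(2)[OF W, of t]] by simp
  qed
 qed
 have "(%y. W (x, y)) = 0" for x
 proof (rule VY_zero[OF Z_slices(3)[OF W]])
  have "AE t in lborel. t \<in> {0<..} --> W (x, t) = 0"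
   using ae by eventually_elim (auto simp: fun_eq_iff)
  then show "AE t in vol {0<..}. W (x, t) = 0" by (subst AE_vol) auto
 qed
 then show ?thesis by (auto simp: fun_eq_iff)
qed

abbreviation "ext \<equiv> ext_form s \<Omega> A c"

definition ef :: "((real^'d) \<times> real => real) => ((real^'d) \<times> real => real) => (real^'d) \<times> real => real" where
 "ef U V z = (A (fst z) *v fst (wgrad (cylinder \<Omega>) U z), snd (wgrad (cylinder \<Omega>) U z)) \<bullet> wgrad (cylinder \<Omega>) V z
  + c (fst z) * U z * V z"

lemma ext_ef: "ext U V = (LINT z|cyl. ef U V z)"
 by (simp add: ext_form_def ef_def Let_def)

lemma L2_norm_fun: "u \<in> L2 M ==> (%z. norm (u z)) \<in> L2 M"
 by (rule L2I) (auto dest: L2_meas L2_int intro: measurable_compose[OF _ borel_measurable_norm])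

lemma ef_bound:
 "AE z in cyl. \<forall>U V. \<bar>ef U V z\<bar> <= (kA + 1) * (norm (wgrad (cylinder \<Omega>) U z) * norm (wgrad (cylinder \<Omega>) V z)) + kc * (\<bar>U z\<bar> * \<bar>V z\<bar>)"
 using AE_cyl_fst[OF open_\<Omega> A_bound, of s] AE_cyl_fst[OF open_\<Omega> c_bound, of s]
proof eventually_elim
 case (elim z)
 show ?case
 proof (intro allI)
  fix U V
  define p q where "p = wgrad (cylinder \<Omega>) U z" and "q = wgrad (cylinder \<Omega>) V z"
  have n: "norm (fst p) <= norm p" "norm (snd p) <= norm p"
   using norm_fst_le[of "fst p" "snd p"] norm_snd_le[of "snd p" "fst p"] by simp_all
  have "norm (A (fst z) *v fst p, snd p) <= norm (A (fst z) *v fst p) + norm (snd p)"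
   by (rule norm_Pair_le)
  also have "norm (A (fst z) *v fst p) <= kA * norm p"
   by (rule order.trans[OF norm_matrix_vector_le mult_mono[OF elim(1) n(1) kA norm_ge_zero]])
  finally have "norm (A (fst z) *v fst p, snd p) <= (kA + 1) * norm p" using n(2) by (simp add: algebra_simps)
  then have "\<bar>(A (fst z) *v fst p, snd p) \<bullet> q\<bar> <= (kA + 1) * norm p * norm q"
   by (intro order.trans[OF Cauchy_Schwarz_ineq2] mult_right_mono) auto
  moreover have "\<bar>c (fst z) * U z * V z\<bar> <= kc * (\<bar>U z\<bar> * \<bar>V z\<bar>)"
   unfolding abs_mult mult.assoc using elim(2) by (intro mult_right_mono) auto
  ultimately show "\<bar>ef U V z\<bar> <= (kA + 1) * (norm (wgrad (cylinder \<Omega>) U z) * norm (wgrad (cylinder \<Omega>) V z)) + kc * (\<bar>U z\<bar> * \<bar>V z\<bar>)"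
   unfolding ef_def p_def[symmetric] q_def[symmetric] by (simp add: mult.assoc)
 qed
qed

lemma ef_integrable:
 assumes U: "U \<in> Z" and V: "V \<in> Z"
 shows "integrable cyl (ef U V)"
proof (rule Bochner_Integration.integrable_bound)
 show "integrable cyl (%z. (kA + 1) * (norm (wgrad (cylinder \<Omega>) U z) * norm (wgrad (cylinder \<Omega>) V z)) + kc * (norm (U z) * norm (V z)))"
  by (intro Bochner_Integration.integrable_add integrable_mult_right L2_product_integrable L2_norm_fun Z_wgrad_L2 Z_L2 U V)
 show "AE z in cyl. norm (ef U V z) <= norm ((kA + 1) * (norm (wgrad (cylinder \<Omega>) U z) * norm (wgrad (cylinder \<Omega>) V z)) + kc * (norm (U z) * norm (V z)))"
  using ef_bound by eventually_elim (use kA kc in "auto intro: order.trans")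
 have mA: "(%z. A (fst z)) \<in> borel_measurable cyl" and mc: "(%z. c (fst z)) \<in> borel_measurable cyl"
  unfolding measurable_cyl_iff
  by (rule measurable_compose[OF fst_measurable_cyl[OF open_\<Omega>] A_meas], rule measurable_compose[OF fst_measurable_cyl[OF open_\<Omega>] c_meas])
 note mg = L2_meas[OF Z_wgrad_L2[OF U]] L2_meas[OF Z_wgrad_L2[OF V]] L2_meas[OF Z_L2[OF U]] L2_meas[OF Z_L2[OF V]]
 have mf: "(%z. fst (wgrad (cylinder \<Omega>) U z)) \<in> borel_measurable cyl" "(%z. snd (wgrad (cylinder \<Omega>) U z)) \<in> borel_measurable cyl"
  by (rule measurable_compose[OF mg(1)], intro borel_measurable_continuous_onI continuous_intros)+
 show "ef U V \<in> borel_measurable cyl"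
  unfolding ef_def[abs_def]
  by (intro borel_measurable_add borel_measurable_times borel_measurable_inner borel_measurable_Pair matrix_vector_measurable mA mc mf mg)
qed

lemma ext_lin:
 assumes "U \<in> Z" "V \<in> Z" "W \<in> Z"
 shows "ext (U + r *\<^sub>R V) W = ext U W + r * ext V W"
proof -
 have UV: "U + r *\<^sub>R V \<in> Z" using assms by (intro subspace_add[OF Z_subspace] subspace_scale[OF Z_subspace])
 have "AE z in cyl. ef (U + r *\<^sub>R V) W z = ef U W z + r * ef V W z"
  using Z_wgrad_add[OF assms(1,2), of r]
 proof eventually_elim
  case (elim z)
  have "(A (fst z) *v (fst a + r *\<^sub>R fst b), snd a + r *\<^sub>R snd b) = (A (fst z) *v fst a, snd a) + r *\<^sub>R (A (fst z) *v fst b, snd b)" for a b :: "(real^'d) \<times> real"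
   by (simp add: matrix_vector_right_distrib matrix_vector_mult_scaleR)
  then show ?case
   unfolding ef_def elim fst_add snd_add fst_scaleR snd_scaleR
   by (simp add: inner_prod_def inner_add_left scaleR_fun_def algebra_simps matrix_vector_right_distrib matrix_vector_mult_scaleR)
 qed
 then have "ext (U + r *\<^sub>R V) W = (LINT z|cyl. ef U W z + r * ef V W z)"
  unfolding ext_ef
  by (intro integral_cong_AE) (use ef_integrable[OF UV assms(3)] ef_integrable[OF assms(1,3)] ef_integrable[OF assms(2,3)] in "auto dest: borel_measurable_integrable")
 then show ?thesis using ef_integrable[OF assms(1,3)] ef_integrable[OF assms(2,3)] by (simp add: ext_ef)
qed

lemma ext_sym:
 assumes "U \<in> Z" "V \<in> Z"
 shows "ext U V = ext V U"
 unfolding ext_ef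
proof (rule integral_cong_AE)
 show "ef U V \<in> borel_measurable cyl" "ef V U \<in> borel_measurable cyl"
  using ef_integrable assms by (blast dest: borel_measurable_integrable)+
 show "AE z in cyl. ef U V z = ef V U z"
  using AE_cyl_fst[OF open_\<Omega> A_sym, of s]
 proof eventually_elim
  case (elim z)
  have "(A (fst z) *v a) \<bullet> b = (A (fst z) *v b) \<bullet> a" for a b
   using elim dot_lmul_matrix[of a "A (fst z)" b] by (metis inner_commute transpose_matrix_vector)
  then show ?case by (simp add: ef_def inner_prod_def mult_ac)
 qed
qed

definition a1 :: real where "a1 = min a0 1"
definition kU :: real where "kU = kA + 1 + kc * CP"

lemma a1_pos: "a1 > 0" using a0 by (simp add: a1_def)
lemma ext_coercive:
 assumes U: "U \<in> Z"
 shows "a1 * (ext_norm s \<Omega> U)^2 <= ext U U"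
proof -
 have "a1 * (ext_norm s \<Omega> U)^2 = (LINT z|cyl. a1 * (norm (wgrad (cylinder \<Omega>) U z))^2)"
  by (simp add: ext_norm_def L2_norm_sq)
 also have "... <= (LINT z|cyl. ef U U z)"
 proof (rule integral_mono_AE)
  show "integrable cyl (%z. a1 * (norm (wgrad (cylinder \<Omega>) U z))^2)"
   by (intro integrable_mult_right L2_int Z_wgrad_L2 U)
  show "integrable cyl (ef U U)" by (rule ef_integrable[OF U U])
  show "AE z in cyl. a1 * (norm (wgrad (cylinder \<Omega>) U z))^2 <= ef U U z"
   using AE_cyl_fst[OF open_\<Omega> A_ell, of s] AE_cyl_fst[OF open_\<Omega> c_nonneg, of s]
  proof eventually_elim
   case (elim z)
   define p where "p = wgrad (cylinder \<Omega>) U z"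
   have "a1 * (norm p)^2 = a1 * (norm (fst p))^2 + a1 * (norm (snd p))^2"
   by (simp add: norm_prod_def distrib_left)
   also have "... <= a0 * (norm (fst p))^2 + 1 * (norm (snd p))^2"
   by (intro add_mono mult_right_mono) (auto simp: a1_def)
   also have "... <= fst p \<bullet> (A (fst z) *v fst p) + (snd p)^2" using elim(1) by simp
   also have "... <= ef U U z"
   unfolding ef_def p_def[symmetric] using elim(2) by (simp add: inner_prod_def inner_commute power2_eq_square mult.assoc)
   finally show ?case by (simp add: p_def)
  qed
 qed
 finally show ?thesis by (simp add: ext_ef)
qed

lemma ext_upper:
 assumes U: "U \<in> Z"
 shows "ext U U <= kU * (ext_norm s \<Omega> U)^2"
proof -
 let ?A = "%z. wgrad (cylinder \<Omega>) U z"
 have i: "integrable cyl (%z. (norm (?A z))^2)" "integrable cyl (%z. (norm (U z))^2)"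
  by (intro L2_int Z_wgrad_L2 Z_L2 U)+
 have "ext U U <= (LINT z|cyl. (kA + 1) * (norm (?A z))^2 + kc * (norm (U z))^2)"
  unfolding ext_ef
 proof (rule integral_mono_AE)
  show "integrable cyl (%z. (kA + 1) * (norm (?A z))^2 + kc * (norm (U z))^2)"
   using i by auto
  show "AE z in cyl. ef U U z <= (kA + 1) * (norm (?A z))^2 + kc * (norm (U z))^2"
   using ef_bound
  proof eventually_elim
   case (elim z)
   then have "\<bar>ef U U z\<bar> <= (kA + 1) * (norm (?A z) * norm (?A z)) + kc * (\<bar>U z\<bar> * \<bar>U z\<bar>)" by blast
   then show ?case by (simp add: power2_eq_square)
  qed
 qed (rule ef_integrable[OF U U])
 also have "... = (kA + 1) * (ext_norm s \<Omega> U)^2 + kc * (L2_norm cyl U)^2"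
  using i by (simp add: ext_norm_def L2_norm_sq)
 also have "... <= (kA + 1) * (ext_norm s \<Omega> U)^2 + kc * (CP * (ext_norm s \<Omega> U)^2)"
  using Z_L2_bound[OF U] kc by (intro add_left_mono mult_left_mono) auto
 finally show ?thesis by (simp add: kU_def algebra_simps)
qed

lemma Z_finite_dim: "\<exists>B. finite B & Z \<subseteq> span B"
proof -
 obtain B1 B2 where B: "finite B1" "span B1 = VX" "finite B2" "span B2 = VY"
  using spaces by (auto simp: admissible_spaces_def discrete_space_def)
 define B where "B = (%(p, q). (%(x, y). p x * q y :: real)) ` (B1 \<times> B2)"
 have 1: "(%(x, y). p x * w y) \<in> span B" if "p \<in> B1" "w \<in> span B2" for p :: "real^'d => real" and w :: "real => real"
  using that(2)
 proof (induction rule: span_induct_alt)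
  case base
  have "(%(x, y). p x * (0 :: real => real) y) = 0" by (simp add: fun_eq_iff)
  then show ?case by (simp only: span_zero)
 next
  case (step r q w)
  have "(%(x, y). p x * (r *\<^sub>R q + w) y) = r *\<^sub>R (%(x, y). p x * q y) + (%(x, y). p x * w y)"
   by (simp add: fun_eq_iff scaleR_fun_def algebra_simps)
  moreover have "(%(x, y). p x * q y) \<in> span B" using that(1) step(1) by (intro span_base) (auto simp: B_def)
  ultimately show ?case using span_add[OF span_scale[of _ B r] step(2)] by (simp only:)
 qed
 have 2: "(%(x, y). v x * w y) \<in> span B" if "v \<in> span B1" "w \<in> span B2" for v :: "real^'d => real" and w :: "real => real"
  using that(1)
 proof (induction rule: span_induct_alt)
  case base
  have "(%(x, y). (0 :: real^'d => real) x * w y) = 0" by (simp add: fun_eq_iff)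
  then show ?case by (simp only: span_zero)
 next
  case (step r p v)
  have "(%(x, y). (r *\<^sub>R p + v) x * w y) = r *\<^sub>R (%(x, y). p x * w y) + (%(x, y). v x * w y)"
   by (simp add: fun_eq_iff scaleR_fun_def algebra_simps)
  then show ?case using span_add[OF span_scale[OF 1[OF step(1) that(2)], of r] step(2)] by (simp only:)
 qed
 have "Z \<subseteq> span B"
  unfolding tensor_def by (rule span_minimal) (use 2 B in auto)
 moreover have "finite B" using B by (simp add: B_def)
 ultimately show ?thesis by blast
qed

end

section \<open>Legendre polynomials\<close>

fun legendre :: "nat => real poly" where
 "legendre 0 = 1"
| "legendre (Suc 0) = [:0, 1:]"
| "legendre (Suc (Suc n)) = smult ((2 * real n + 3) / (real n + 2)) ([:0, 1:] * legendre (Suc n))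
  - smult ((real n + 1) / (real n + 2)) (legendre n)"

abbreviation L :: "nat => real => real" where "L n \<equiv> poly (legendre n)"
abbreviation int1 :: "(real => real) => real" where "int1 \<equiv> integral {-1..1}"
abbreviation dL :: "nat => real => real" where "dL n \<equiv> poly (pderiv (legendre n))"

lemma L_rec: "(real n + 2) * L (Suc (Suc n)) x = (2 * real n + 3) * x * L (Suc n) x - (real n + 1) * L n x"
proof -
 have "real n + 2 ~= 0" by (simp add: add_nonneg_eq_0_iff)
 then have "(real n + 2) * ((2 * real n + 3) / (real n + 2) * y - (real n + 1) / (real n + 2) * z)
  = (2 * real n + 3) * y - (real n + 1) * z" for y z :: real
  by (simp add: right_diff_distrib)
 from this[of "x * L (Suc n) x" "L n x"] show ?thesis
  by (simp only: legendre.simps poly_diff poly_smult poly_mult poly_pCons poly_0) (simp add: mult.assoc)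
qed

lemma dL_rec: "(real n + 2) * dL (Suc (Suc n)) x =
  (2 * real n + 3) * (L (Suc n) x + x * dL (Suc n) x) - (real n + 1) * dL n x"
proof -
 have "real n + 2 ~= 0" by (simp add: add_nonneg_eq_0_iff)
 then have "(real n + 2) * ((2 * real n + 3) / (real n + 2) * y - (real n + 1) / (real n + 2) * z)
  = (2 * real n + 3) * y - (real n + 1) * z" for y z :: real
  by (simp add: right_diff_distrib)
 from this[of "L (Suc n) x + x * dL (Suc n) x" "dL n x"] show ?thesis
  by (simp only: legendre.simps pderiv_diff pderiv_smult pderiv_mult pderiv_pCons
   poly_diff poly_smult poly_mult poly_pCons poly_0 poly_add)
   (simp add: algebra_simps)
qed

declare legendre.simps(3)[simp del]

lemma legendre_deriv_identities:
 "dL (Suc n) x = x * dL n x + (real n + 1) * L n x &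
 x * dL (Suc n) x - dL n x = (real n + 1) * L (Suc n) x"
proof (induction n)
 case 0
 show ?case by (simp add: pderiv_pCons)
next
 case (Suc n)
 define k where "k = real n"
 have k: "k >= 0" by (simp add: k_def)
 have 1: "(k + 2) * dL (Suc (Suc n)) x = (2 * k + 3) * (L (Suc n) x + x * dL (Suc n) x) - (k + 1) * dL n x"
  unfolding k_def by (rule dL_rec)
 have 2: "(k + 2) * L (Suc (Suc n)) x = (2 * k + 3) * x * L (Suc n) x - (k + 1) * L n x"
  unfolding k_def by (rule L_rec)
 have 3: "dL (Suc n) x = x * dL n x + (k + 1) * L n x" "dL n x = x * dL (Suc n) x - (k + 1) * L (Suc n) x"
  using Suc by (auto simp: k_def)
 have "(k + 2) * dL (Suc (Suc n)) x = (k + 2) * (x * dL (Suc n) x + (k + 2) * L (Suc n) x)"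
  unfolding 1 by (subst 3(2)) (simp add: algebra_simps)
 then have A: "dL (Suc (Suc n)) x = x * dL (Suc n) x + (k + 2) * L (Suc n) x"
  using k by simp
 have "x * dL (Suc (Suc n)) x - dL (Suc n) x = (k + 2) * x * L (Suc n) x + x * (x * dL (Suc n) x) - dL (Suc n) x"
  unfolding A by (simp add: algebra_simps)
 also have "x * (x * dL (Suc n) x) = x * (dL n x + (k + 1) * L (Suc n) x)"
  using 3(2) by (simp add: algebra_simps)
 also have "... = dL (Suc n) x - (k + 1) * L n x + (k + 1) * x * L (Suc n) x"
  using 3(1) by (simp add: algebra_simps)
 finally have "x * dL (Suc (Suc n)) x - dL (Suc n) x = (k + 2) * L (Suc (Suc n)) x"
  unfolding 2 by (simp add: algebra_simps)
 with A show ?case by (simp add: k_def algebra_simps)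
qed

lemma legendre_deriv_telescope:
 "dL (Suc (Suc n)) x - dL n x = (2 * real n + 3) * L (Suc n) x"
proof -
 have "dL (Suc (Suc n)) x = x * dL (Suc n) x + (real n + 2) * L (Suc n) x"
  "x * dL (Suc n) x - dL n x = (real n + 1) * L (Suc n) x"
  using legendre_deriv_identities[of "Suc n" x] legendre_deriv_identities[of n x] by (auto simp: algebra_simps)
 then show ?thesis by (simp add: ring_distribs)
qed

lemma legendre_first_order:
 "(1 - x^2) * dL (Suc n) x = (real n + 1) * (L n x - x * L (Suc n) x)"
proof -
 have 1: "dL (Suc n) x = x * dL n x + (real n + 1) * L n x" and
  2: "dL n x = x * dL (Suc n) x - (real n + 1) * L (Suc n) x"
  using legendre_deriv_identities[of n x] by auto
 have "dL (Suc n) x = x * (x * dL (Suc n) x - (real n + 1) * L (Suc n) x) + (real n + 1) * L n x"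
  using 1 unfolding 2[symmetric] .
 then show ?thesis by (simp add: algebra_simps power2_eq_square)
qed

lemma legendre_at_1: "L n 1 = 1"
proof (induction n rule: legendre.induct)
 case (3 n)
 have "(real n + 2) * L (Suc (Suc n)) 1 = real n + 2"
  unfolding L_rec 3 by (simp add: algebra_simps)
 then show ?case by (metis add_eq_0_iff mult_cancel_left1 mult_cancel_left2 mult_eq_0_iff nonzero_mult_div_cancel_left of_nat_0_le_iff neg_0_le_iff_le add_nonneg_eq_0_iff zero_le_numeral zero_neq_numeral)
qed auto

lemma legendre_at_minus_1: "L n (-1) = (-1) ^ n"
proof (induction n rule: legendre.induct)
 case (3 n)
 have "(real n + 2) * L (Suc (Suc n)) (-1) = (real n + 2) * (-1) ^ Suc (Suc n)"
  unfolding L_rec 3 by (simp add: algebra_simps)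
 then show ?case by (simp del: power_Suc)
qed auto

lemma legendre_ode:
 "((%x. (1 - x^2) * dL n x) has_real_derivative - (real n * (real n + 1)) * L n x) (at x within S)"
proof (cases n)
 case 0
 then show ?thesis by simp
next
 case (Suc k)
 have "((%x. (real k + 1) * (L k x - x * L (Suc k) x)) has_real_derivative
   (real k + 1) * (dL k x - (L (Suc k) x + x * dL (Suc k) x))) (at x within S)"
  by (auto intro!: derivative_eq_intros poly_DERIV[THEN DERIV_subset] simp: algebra_simps)
 moreover have "(real k + 1) * (dL k x - (L (Suc k) x + x * dL (Suc k) x))
   = - (real n * (real n + 1)) * L n x"
 proof -
  have "x * dL (Suc k) x = dL k x + (real k + 1) * L (Suc k) x"
   using legendre_deriv_identities[of k x, THEN conjunct2] by argo
  then show ?thesis by (simp only: Suc) (simp add: algebra_simps)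
 qed
 ultimately show ?thesis
  unfolding Suc legendre_first_order by simp
qed

text \<open>The function \<open>h\<close> in the proof is a Lyapunov function of the Legendre differential equation:
  \<open>h' = 2 x (L\<^sub>n')\<^sup>2 / (n (n + 1))\<close>, so that \<open>h\<close> attains its maximum over \<open>[-1, 1]\<close> at the end points,
  where it equals \<open>1\<close>.\<close>

lemma legendre_bounded:
 assumes "\<bar>x\<bar> <= 1"
 shows "\<bar>L n x\<bar> <= 1"
proof (cases "n = 0")
 case True
 then show ?thesis by simp
next
 case False
 define N where "N = real n * (real n + 1)"
 have N: "N > 0" using False by (simp add: N_def)
 define h where "h = (%x. (L n x)^2 + (1 - x^2) * dL n x * dL n x / N)"
 define ddL where "ddL = poly (pderiv (pderiv (legendre n)))"
 have e: "- (2 * x) * dL n x + (1 - x^2) * ddL x = - N * L n x" for x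
 proof -
  have "((%x. (1 - x^2) * dL n x) has_real_derivative - (2 * x) * dL n x + (1 - x^2) * ddL x) (at x)"
   unfolding ddL_def by (auto intro!: derivative_eq_intros poly_DERIV)
  from DERIV_unique[OF this legendre_ode[of n x UNIV]] show ?thesis by (simp add: N_def)
 qed
 have h': "(h has_real_derivative 2 * x * (dL n x)^2 / N) (at x)" for x
 proof -
  have "(h has_real_derivative 2 * L n x * dL n x
   + ((- N * L n x) * dL n x + (1 - x^2) * dL n x * ddL x) / N) (at x)"
   unfolding h_def power2_eq_square[of "L n _"]
   by (rule DERIV_cong,
   (rule DERIV_add DERIV_cdivide DERIV_mult[OF legendre_ode[where S = UNIV, folded N_def] poly_DERIV]
   DERIV_mult[OF poly_DERIV poly_DERIV])+) (simp add: ddL_def N_def)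
  moreover have "2 * L n x * dL n x + ((- N * L n x) * dL n x + (1 - x^2) * dL n x * ddL x) / N
   = 2 * x * (dL n x)^2 / N"
  proof -
   have "(1 - x^2) * ddL x = - N * L n x + 2 * x * dL n x" using e[of x] by simp
   then have *: "(1 - x^2) * dL n x * ddL x = (- N * L n x + 2 * x * dL n x) * dL n x"
   by (metis mult.assoc mult.commute)
   have "(- N * L n x) * dL n x + (1 - x^2) * dL n x * ddL x = - (2 * L n x * dL n x) * N + 2 * x * (dL n x)^2"
   unfolding * by (simp add: algebra_simps power2_eq_square)
   then show ?thesis using N by (simp only: add_divide_distrib) simp
  qed
  ultimately show ?thesis by simp
 qed
 have h1: "h 1 = 1" "h (-1) = 1"
  by (simp_all add: h_def legendre_at_1 legendre_at_minus_1 power_mult[symmetric])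
 have "h x <= 1"
 proof (cases "x >= 0")
  case True
  have "h x <= h 1"
  proof (rule DERIV_nonneg_imp_nondecreasing[where f = h])
   fix z assume "x <= z" "z <= 1"
   then show "\<exists>y. (h has_real_derivative y) (at z) & 0 <= y"
   using True N h'[of z] by (intro exI[of _ "2 * z * (dL n z)^2 / N"]) simp
  qed (use assms in auto)
  then show ?thesis by (simp add: h1)
 next
  case False
  have "h x <= h (-1)"
  proof (rule DERIV_nonpos_imp_nonincreasing[where f = h])
   fix z assume "-1 <= z" "z <= x"
   then show "\<exists>y. (h has_real_derivative y) (at z) & y <= 0"
   using False N h'[of z]
   by (intro exI[of _ "2 * z * (dL n z)^2 / N"]) (simp add: divide_nonpos_pos mult_nonpos_nonneg)
  qed (use assms in auto)
  then show ?thesis by (simp add: h1)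
 qed
 moreover have "(1 - x^2) * dL n x * dL n x / N >= 0"
  using assms N abs_square_le_1[of x] by (simp add: mult.assoc)
 ultimately have "(L n x)^2 <= 1" by (simp add: h_def)
 then show ?thesis by (simp add: abs_square_le_1)
qed

lemma continuous_on_poly_real [continuous_intros]: "continuous_on S (poly (p :: real poly))"
 by (intro continuous_intros continuous_on_poly)

lemma cont_int: "continuous_on {a..b} f ==> f integrable_on {a..b :: real}" for f :: "real => real"
 by (rule integrable_continuous_interval)

lemma has_vd: "(f has_real_derivative f') (at x within S) ==> (f has_vector_derivative f') (at x within S)"
 by (simp add: has_real_derivative_iff_has_vector_derivative)

lemma integral_FTC:
 assumes "a <= b" "!!x. x \<in> {a..b} ==> (f has_real_derivative f' x) (at x within {a..b})"
 shows "integral {a..b} f' = f b - f a"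
 by (rule integral_unique, rule fundamental_theorem_of_calculus) (use assms has_vd in auto)

lemma legendre_orthogonal:
 assumes "n ~= k"
 shows "int1 (%x. L n x * L k x) = 0"
proof -
 define c where "c = real n * (real n + 1) - real k * (real k + 1)"
 have "c = (real n - real k) * (real n + real k + 1)" by (simp add: c_def algebra_simps)
 then have c: "c ~= 0"
  using assms by (simp add: add_nonneg_eq_0_iff) 
 have "int1 (%x. c * (L n x * L k x)) =
   ((1 - 1^2) * dL k 1 * L n 1 - (1 - 1^2) * dL n 1 * L k 1) -
   ((1 - (-1)^2) * dL k (-1) * L n (-1) - (1 - (-1)^2) * dL n (-1) * L k (-1))"
 proof (rule integral_FTC)
  fix x :: real
  show "((%x. (1 - x^2) * dL k x * L n x - (1 - x^2) * dL n x * L k x) has_real_derivative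
   c * (L n x * L k x)) (at x within {-1..1})"
   by (rule DERIV_cong, (rule DERIV_diff DERIV_mult legendre_ode poly_DERIV[THEN DERIV_subset] subset_UNIV)+)
   (simp add: c_def algebra_simps)
 qed simp
 then show ?thesis using c by simp
qed

lemma degree_legendre: "degree (legendre n) = n"
proof (induction n rule: legendre.induct)
 case (3 n)
 have nz: "legendre (Suc n) ~= 0" using 3 by (metis degree_0 nat.simps(3))
 have "degree (smult ((2 * real n + 3) / (real n + 2)) ([:0, 1:] * legendre (Suc n))) = Suc (Suc n)"
  using nz 3 by (auto simp: degree_mult_eq add_nonneg_eq_0_iff)
 moreover have "degree (smult ((real n + 1) / (real n + 2)) (legendre n)) < Suc (Suc n)"
  using 3 by simp
 ultimately show ?case
  unfolding legendre.simps diff_conv_add_uminus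
  by (subst degree_add_eq_left) auto
qed auto

lemma poly_legendre_expansion:
 "degree p < n ==> \<exists>c. \<forall>x. poly p x = (\<Sum>i<n. c i * L i x)"
proof (induction n arbitrary: p)
 case (Suc n)
 define k where "k = coeff p n / coeff (legendre n) n"
 have nz: "coeff (legendre n) n ~= 0"
  using degree_legendre[of n] legendre_at_1[of n] leading_coeff_0_iff[of "legendre n"] by auto
 define q where "q = p - smult k (legendre n)"
 have cq: "coeff q i = 0" if "i >= n" for i
 proof (cases "i = n")
  case True
  then show ?thesis using nz by (simp add: q_def k_def)
 next
  case False
  then have "i > n" using that by simp
  then have "coeff p i = 0" "coeff (legendre n) i = 0"
   using Suc.prems by (auto intro!: coeff_eq_0 simp: degree_legendre)
  then show ?thesis by (simp add: q_def)
 qed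
 have "\<exists>c. \<forall>x. poly q x = (\<Sum>i<n. c i * L i x)"
 proof (cases "n = 0")
  case True
  then have "q = 0" using cq by (intro poly_eqI) simp
  then show ?thesis by (simp add: True)
 next
  case False
  have "degree q < n"
   using cq False by (metis leading_coeff_0_iff degree_0 not_le_imp_less neq0_conv)
  then show ?thesis by (rule Suc.IH)
 qed
 then obtain c where c: "!!x. poly q x = (\<Sum>i<n. c i * L i x)" by blast
 have "poly p x = (\<Sum>i<Suc n. (c(n := k)) i * L i x)" for x
 proof -
  have "poly p x = poly q x + k * L n x" by (simp add: q_def)
  then show ?thesis by (simp add: c)
 qed
 then show ?case by blast
qed simp

lemma integrable_legendre_mult:
 "continuous_on {-1..1} g ==> (%x. g x * poly p x) integrable_on {-1..1 :: real}"
 by (intro cont_int continuous_intros)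

lemma legendre_orthogonal_lower:
 assumes "degree p < n"
 shows "int1 (%x. poly p x * L n x) = 0"
proof -
 obtain c where c: "!!x. poly p x = (\<Sum>i<n. c i * L i x)"
  using poly_legendre_expansion[OF assms] by blast
 have "int1 (%x. poly p x * L n x) = int1 (%x. \<Sum>i<n. c i * (L i x * L n x))"
  by (simp add: c sum_distrib_right mult.assoc)
 also have "... = (\<Sum>i<n. int1 (%x. c i * (L i x * L n x)))"
  by (intro integral_sum cont_int continuous_intros) auto
 also have "... = 0"
  by (intro sum.neutral) (simp add: legendre_orthogonal)
 finally show ?thesis .
qed

lemma legendre_norm: "(2 * real n + 1) * int1 (%x. L n x * L n x) = 2"
proof (cases n)
 case 0
 then show ?thesis by simp
next
 case (Suc k)
 have int: "(%x. L n x * L n x) integrable_on {-1..1}"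
  "(%x. dL k x * L n x) integrable_on {-1..1}" "(%x. x * dL n x * L n x) integrable_on {-1..1}"
  by (intro cont_int continuous_intros)+
 have "degree (pderiv (legendre k)) < n"
  by (simp add: degree_pderiv degree_legendre Suc)
 then have 0: "int1 (%x. dL k x * L n x) = 0"
  by (rule legendre_orthogonal_lower)
 have "real n * (L n x * L n x) = x * dL n x * L n x - dL k x * L n x" for x
 proof -
  have "(real k + 1) * L (Suc k) x * L (Suc k) x = (x * dL (Suc k) x - dL k x) * L (Suc k) x"
   by (simp only: legendre_deriv_identities[of k x, THEN conjunct2])
  then show ?thesis by (simp only: Suc) (simp add: algebra_simps)
 qed
 then have "real n * int1 (%x. L n x * L n x) =
   int1 (%x. x * dL n x * L n x - dL k x * L n x)"
  by (metis (mono_tags, lifting) integral_cong integral_mult_right)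
 also have "... = int1 (%x. x * dL n x * L n x)"
  using int 0 by (simp add: integral_diff)
 finally have 1: "int1 (%x. x * dL n x * L n x) = real n * int1 (%x. L n x * L n x)" by simp
 have "int1 (%x. L n x * L n x + 2 * (x * dL n x * L n x)) = 1 * (L n 1)^2 - (-1) * (L n (-1))^2"
  by (rule integral_FTC) (auto intro!: derivative_eq_intros poly_DERIV[THEN DERIV_subset] simp: power2_eq_square algebra_simps)
 also have "... = 2" by (simp add: legendre_at_1 legendre_at_minus_1 power_mult[symmetric])
 also have "int1 (%x. L n x * L n x + 2 * (x * dL n x * L n x)) =
  int1 (%x. L n x * L n x) + 2 * int1 (%x. x * dL n x * L n x)"
  using int by (simp add: integral_add integrable_on_cmult_left)
 finally show ?thesis unfolding 1 by (simp add: algebra_simps)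
qed

section \<open>Approximation by Legendre expansions\<close>

definition smooth_seq :: "real => real => (nat => real => real) => bool" where
 "smooth_seq a b g \<longleftrightarrow>
  (\<forall>l. \<forall>x\<in>{a..b}. (g l has_real_derivative g (Suc l) x) (at x within {a..b}))"

lemma smooth_seq_cont: "smooth_seq a b g ==> continuous_on {a..b} (g l)"
 unfolding smooth_seq_def by (intro DERIV_continuous_on) blast

text \<open>The \<open>k\<close>-fold antiderivative of \<open>L\<^sub>n\<close> that vanishes at both end points.\<close>

fun legG :: "nat => nat => real poly" where
 "legG 0 n = legendre n"
| "legG (Suc k) n = smult (1 / (2 * real n + 1)) (legG k (Suc n) - legG k (n - 1))"

lemma pderiv_legG: "Suc k <= n ==> pderiv (legG (Suc k) n) = legG k n"
proof (induction k arbitrary: n)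
 case 0
 then obtain m where n: "n = Suc m" by (cases n) auto
 have "poly (pderiv (legG (Suc 0) n)) x = poly (legG 0 n) x" for x
  using legendre_deriv_telescope[of m x]
  by (simp add: n pderiv_smult pderiv_diff field_simps)
 then show ?case by (simp add: poly_eq_poly_eq_iff[symmetric] fun_eq_iff)
next
 case (Suc k)
 have "pderiv (legG (Suc k) (Suc n)) = legG k (Suc n)" "pderiv (legG (Suc k) (n - 1)) = legG k (n - 1)"
  by (rule Suc.IH, use Suc.prems in linarith)+
 then show ?case
  unfolding legG.simps(2)[of "Suc k" n] by (simp only: pderiv_smult pderiv_diff legG.simps(2)[of k n])
qed

lemma legG_boundary: "Suc k <= n ==> poly (legG (Suc k) n) 1 = 0 & poly (legG (Suc k) n) (-1) = 0"
proof (induction k arbitrary: n)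
 case 0
 then obtain m where n: "n = Suc m" by (cases n) auto
 then show ?case by (simp add: legendre_at_1 legendre_at_minus_1)
next
 case (Suc k)
 have "poly (legG (Suc k) (Suc n)) 1 = 0 & poly (legG (Suc k) (Suc n)) (-1) = 0"
  "poly (legG (Suc k) (n - 1)) 1 = 0 & poly (legG (Suc k) (n - 1)) (-1) = 0"
  by (rule Suc.IH, use Suc.prems in linarith)+
 then show ?case
  unfolding legG.simps(2)[of "Suc k" n] by simp
qed

lemma legG_bound: "k <= n ==> \<bar>x\<bar> <= 1 ==> \<bar>poly (legG k n) x\<bar> <= (1 / (real n - real k + 1)) ^ k"
proof (induction k arbitrary: n)
 case 0
 then show ?case by (simp add: legendre_bounded)
next
 case (Suc k)
 define q where "q = 1 / (real n - real (Suc k) + 1)"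
 have q: "q > 0" "n >= 1" using Suc.prems by (auto simp: q_def)
 have 1: "\<bar>poly (legG k (Suc n)) x\<bar> <= q ^ k"
 proof -
  have "\<bar>poly (legG k (Suc n)) x\<bar> <= (1 / (real (Suc n) - real k + 1)) ^ k"
   by (rule Suc.IH) (use Suc.prems in auto)
  also have "... <= q ^ k"
   unfolding q_def using Suc.prems by (intro power_mono frac_le) auto
  finally show ?thesis .
 qed
 have 2: "\<bar>poly (legG k (n - 1)) x\<bar> <= q ^ k"
  using Suc.IH[of "n - 1"] Suc.prems q by (simp add: q_def of_nat_diff)
 have "\<bar>poly (legG (Suc k) n) x\<bar> = \<bar>poly (legG k (Suc n)) x - poly (legG k (n - 1)) x\<bar> / (2 * real n + 1)"
  by (simp add: abs_mult)
 also have "... <= (2 * q ^ k) / (2 * real n + 1)"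
  using 1 2 by (intro divide_right_mono) auto
 also have "... = q ^ k * (1 / (real n + 1 / 2))"
  by (simp add: field_simps)
 also have "... <= q ^ k * q"
  using q Suc.prems unfolding q_def by (intro mult_left_mono divide_left_mono) auto
 finally show ?case by (simp add: q_def)
qed

text \<open>The antiderivatives vanish at both end points, so no boundary terms occur.\<close>

lemma integral_legendre_by_parts:
 assumes g: "smooth_seq (-1) 1 g" and "k <= n"
 shows "int1 (%x. g 0 x * L n x) = (-1) ^ k * int1 (%x. g k x * poly (legG k n) x)"
 using assms(2)
proof (induction k)
 case (Suc k)
 have cont: "continuous_on {-1..1} (g l)" for l using g by (rule smooth_seq_cont)
 have "int1 (%x. g (Suc k) x * poly (legG (Suc k) n) x + g k x * poly (legG k n) x)
   = g k 1 * poly (legG (Suc k) n) 1 - g k (-1) * poly (legG (Suc k) n) (-1)"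
 proof (rule integral_FTC)
  fix x :: real assume x: "x \<in> {-1..1}"
  have "((%x. g k x * poly (legG (Suc k) n) x) has_real_derivative
   g (Suc k) x * poly (legG (Suc k) n) x + poly (pderiv (legG (Suc k) n)) x * g k x) (at x within {-1..1})"
   using g x unfolding smooth_seq_def by (intro DERIV_mult poly_DERIV[THEN DERIV_subset]) auto
  then show "((%x. g k x * poly (legG (Suc k) n) x) has_real_derivative
   g (Suc k) x * poly (legG (Suc k) n) x + g k x * poly (legG k n) x) (at x within {-1..1})"
   unfolding pderiv_legG[OF Suc.prems] by (simp add: mult.commute)
 qed simp
 then have "int1 (%x. g (Suc k) x * poly (legG (Suc k) n) x + g k x * poly (legG k n) x) = 0"
  using legG_boundary[OF Suc.prems] by simp
 moreover have "int1 (%x. g (Suc k) x * poly (legG (Suc k) n) x + g k x * poly (legG k n) x)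
  = int1 (%x. g (Suc k) x * poly (legG (Suc k) n) x) + int1 (%x. g k x * poly (legG k n) x)"
  by (intro integral_add integrable_legendre_mult cont)
 ultimately have "int1 (%x. g k x * poly (legG k n) x) = - int1 (%x. g (Suc k) x * poly (legG (Suc k) n) x)"
  by linarith
 then show ?case using Suc by simp
qed simp

lemma integral_legendre_bound:
 assumes g: "smooth_seq (-1) 1 g" and "k <= n"
 shows "\<bar>int1 (%x. g 0 x * L n x)\<bar>
  <= (1 / (real n - real k + 1)) ^ k * int1 (%x. \<bar>g k x\<bar>)"
proof -
 have cont: "continuous_on {-1..1} (g l)" for l using g by (rule smooth_seq_cont)
 have "\<bar>int1 (%x. g 0 x * L n x)\<bar> = \<bar>int1 (%x. g k x * poly (legG k n) x)\<bar>"
  unfolding integral_legendre_by_parts[OF assms] by (simp add: abs_mult)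
 also have "... <= int1 (%x. (1 / (real n - real k + 1)) ^ k * \<bar>g k x\<bar>)"
  unfolding real_norm_def[symmetric]
  by (rule Henstock_Kurzweil_Integration.integral_norm_bound_integral)
   (use assms legG_bound[OF assms(2)] in "auto intro!: cont_int continuous_intros cont simp: abs_mult mult.commute intro: mult_mono")
 finally show ?thesis by simp
qed

definition leg_coeff :: "(real => real) => nat => real" where
 "leg_coeff g n = (2 * real n + 1) / 2 * int1 (%x. g x * L n x)"

lemma integral_eq_0_if_orthogonal_to_polynomials:
 assumes h: "continuous_on {-1..1} h" and o: "!!n. int1 (%x. h x * L n x) = 0"
  and x: "x \<in> {-1..1}"
 shows "h x = (0 :: real)"
proof -
 have op: "int1 (%x. h x * poly p x) = 0" for p
 proof -
  obtain c where c: "!!x. poly p x = (\<Sum>i<Suc (degree p). c i * L i x)"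
   using poly_legendre_expansion[of p "Suc (degree p)"] by blast
  have "int1 (%x. h x * poly p x) =
   int1 (%x. \<Sum>i<Suc (degree p). c i * (h x * L i x))"
   unfolding c sum_distrib_left by (simp only: mult.left_commute)
  also have "... = (\<Sum>i<Suc (degree p). int1 (%x. c i * (h x * L i x)))"
   by (intro integral_sum cont_int continuous_intros h) auto
  also have "... = 0" by (intro sum.neutral) (simp add: o)
  finally show ?thesis .
 qed
 define Q where "Q = int1 (%x. \<bar>h x\<bar>)"
 have Q: "Q >= 0" unfolding Q_def by (intro integral_nonneg cont_int continuous_intros h) auto
 have "int1 (%x. h x * h x) <= e * Q" if e: "e > 0" for e
 proof -
  obtain p' where p': "real_polynomial_function p'" "!!x. x \<in> {-1..1} ==> \<bar>h x - p' x\<bar> < e"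
   using Stone_Weierstrass_real_polynomial_function[OF compact_Icc h e] by blast
  obtain a n where a: "p' = (%x. \<Sum>i\<le>n. a i * x ^ i)"
   using p'(1) real_polynomial_function_iff_sum by auto
  define p where "p = (\<Sum>i\<le>n. monom (a i) i)"
  have p: "p' x = poly p x" for x by (simp add: a p_def poly_sum poly_monom)
  have "int1 (%x. h x * h x) = int1 (%x. h x * poly p x + h x * (h x - poly p x))"
   by (simp add: algebra_simps)
  also have "... = int1 (%x. h x * (h x - poly p x))"
   by (subst integral_add) (auto intro!: cont_int continuous_intros h simp: op)
  also have "... <= int1 (%x. e * \<bar>h x\<bar>)"
  proof (rule integral_le)
   fix x :: real assume x: "x \<in> {-1..1}"
   have "h x * (h x - poly p x) <= \<bar>h x\<bar> * \<bar>h x - poly p x\<bar>"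
   by (metis abs_ge_self abs_mult)
   also have "... <= \<bar>h x\<bar> * e"
   using p'(2)[OF x] p by (intro mult_left_mono) (auto simp: less_imp_le)
   finally show "h x * (h x - poly p x) <= e * \<bar>h x\<bar>" by (simp add: mult.commute)
  qed (auto intro!: cont_int continuous_intros h)
  finally show ?thesis by (simp add: Q_def)
 qed
 then have *: "int1 (%x. h x * h x) <= e" if "e > 0" for e
 proof -
  have "int1 (%x. h x * h x) <= e / (Q + 1) * Q"
   by (rule \<open>!!e. e > 0 ==> int1 (%x. h x * h x) <= e * Q\<close>) (use that Q in auto)
  also have "... <= e" using that Q by (simp add: field_simps)
  finally show ?thesis .
 qed
 have "int1 (%x. h x * h x) >= 0"
  by (intro integral_nonneg cont_int continuous_intros h) auto
 with field_le_epsilon[of "int1 (%x. h x * h x)" 0] * have "int1 (%x. h x * h x) = 0" by force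
 then have "\<forall>x\<in>{-1..1}. h x * h x = 0"
  by (subst (asm) integral_eq_0_iff) (auto intro!: continuous_intros h)
 then show ?thesis using x by simp
qed

lemma legendre_series:
 assumes g: "continuous_on {-1..1} g" and s: "summable (%n. \<bar>leg_coeff g n\<bar>)" and x: "x \<in> {-1..1}"
 shows "(%n. leg_coeff g n * L n x) sums g x"
proof -
 define S where "S = (%x. \<Sum>n. leg_coeff g n * L n x)"
 have le: "norm (leg_coeff g n * L n x) <= \<bar>leg_coeff g n\<bar>" if "x \<in> {-1..1}" for n x
 proof -
  have "\<bar>L n x\<bar> <= 1" using that by (intro legendre_bounded) auto
  then have "\<bar>leg_coeff g n\<bar> * \<bar>L n x\<bar> <= \<bar>leg_coeff g n\<bar> * 1" by (intro mult_left_mono) auto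
  then show ?thesis by (simp add: abs_mult)
 qed
 have u: "uniform_limit {-1..1} (%N x. \<Sum>n<N. leg_coeff g n * L n x) S sequentially"
  unfolding S_def by (rule Weierstrass_m_test[OF le s])
 have cS: "continuous_on {-1..1} S"
  by (rule uniform_limit_theorem[OF _ u]) (auto intro!: continuous_intros always_eventually)
 have "g y - S y = 0" if y: "y \<in> {-1..1}" for y
 proof (rule integral_eq_0_if_orthogonal_to_polynomials[where h = "%x. g x - S x"])
  fix k
  have u2: "uniform_limit {-1..1} (%N x. (\<Sum>n<N. leg_coeff g n * L n x) * L k x) (%x. S x * L k x) sequentially"
  proof (rule uniform_lim_mult)
   show "bounded (S ` {-1..1})"
   by (intro compact_imp_bounded compact_continuous_image cS compact_Icc)
   show "bounded (L k ` {-1..1})"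
   by (intro compact_imp_bounded compact_continuous_image continuous_intros compact_Icc)
  qed (auto intro: u uniform_limit_const)
  have cN: "continuous_on {-1..1} (%x. (\<Sum>n<N. leg_coeff g n * L n x) * L k x)" for N
   by (intro continuous_intros)
  obtain I J where IJ: "!!N. ((%x. (\<Sum>n<N. leg_coeff g n * L n x) * L k x) has_integral I N) {-1..1}"
   "((%x. S x * L k x) has_integral J) {-1..1}" "(I \<longlongrightarrow> J) sequentially"
   using uniform_limit_integral[OF u2 cN] by auto
  have "I N = int1 (%x. g x * L k x)" if "N > k" for N
  proof -
   have "I N = int1 (%x. \<Sum>n<N. leg_coeff g n * (L n x * L k x))"
   using integral_unique[OF IJ(1)[of N]] by (simp add: sum_distrib_right mult.assoc)
   also have "... = (\<Sum>n<N. int1 (%x. leg_coeff g n * (L n x * L k x)))"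
   by (intro integral_sum cont_int continuous_intros) auto
   also have "... = (\<Sum>n<N. if n = k then leg_coeff g k * int1 (%x. L k x * L k x) else 0)"
   by (intro sum.cong) (auto simp: legendre_orthogonal)
   also have "... = leg_coeff g k * int1 (%x. L k x * L k x)"
   using that by simp
   also have "... = int1 (%x. g x * L k x) * ((2 * real k + 1) * int1 (%x. L k x * L k x)) / 2"
   by (simp add: leg_coeff_def)
   finally show ?thesis by (simp add: legendre_norm)
  qed
  then have "(I \<longlongrightarrow> int1 (%x. g x * L k x)) sequentially"
   by (intro tendsto_eventually eventually_sequentiallyI[of "Suc k"]) auto
  then have "J = int1 (%x. g x * L k x)"
   using IJ(3) LIMSEQ_unique by blast
  then have "((%x. g x * L k x - S x * L k x) has_integral J - J) {-1..1}"
   using IJ(2) integrable_legendre_mult[OF g, of "legendre k"]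
   by (intro has_integral_diff) (auto simp: has_integral_iff)
  then show "int1 (%x. (g x - S x) * L k x) = 0"
   by (auto simp: has_integral_iff algebra_simps)
 qed (use that in "auto intro!: continuous_intros g cS")
 then have "g x = S x" using x by simp
 moreover have "summable (%n. leg_coeff g n * L n x)"
  by (rule summable_comparison_test'[OF s le[OF x]])
 ultimately show ?thesis by (simp add: S_def summable_sums)
qed


section \<open>The time projection of the discontinuous Galerkin method\<close>

lemma integral_abs_Cauchy_Schwarz:
 fixes f :: "real => real"
 assumes "continuous_on {a..b} f" "a < b"
 shows "(integral {a..b} (%x. \<bar>f x\<bar>))^2 <= (b - a) * integral {a..b} (%x. (f x)^2)"
proof -
 define Q where "Q = integral {a..b} (%x. \<bar>f x\<bar>)"
 define h where "h = b - a"
 have h: "h > 0" using assms by (simp add: h_def)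
 have "0 <= integral {a..b} (%x. (\<bar>f x\<bar> - Q / h)^2)"
  by (intro integral_nonneg cont_int continuous_intros assms) auto
 also have "(%x. (\<bar>f x\<bar> - Q / h)^2) = (%x. ((f x)^2 + (Q / h)^2) - 2 * (Q / h) * \<bar>f x\<bar>)"
  by (auto simp: fun_eq_iff power2_eq_square algebra_simps)
 also have "integral {a..b} ... = integral {a..b} (%x. (f x)^2) + h * (Q / h)^2 - 2 * (Q / h) * Q"
  using assms(2)
  by (subst integral_diff integral_add; (intro cont_int continuous_intros assms)?)+ (simp add: Q_def h_def)
 also have "... = integral {a..b} (%x. (f x)^2) - Q^2 / h"
  using h by (simp add: field_simps power2_eq_square)
 finally show ?thesis using h by (simp add: Q_def[symmetric] h_def[symmetric] field_simps)
qed

lemma summable_inverse_squares_tail: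
 "summable (%n. 1 / (real n + 1)^2)" "(\<Sum>n. 1 / (real n + 1)^2) <= 4"
proof -
 have s: "(%n. 1 / (real n + 1)^2) sums (pi^2 / 6)"
  using inverse_squares_sums by (simp add: add.commute)
 show "summable (%n. 1 / (real n + 1)^2)" using s by (rule sums_summable)
 have "pi^2 <= 4^2" using pi_less_4 by (intro power_mono) auto
 then show "(\<Sum>n. 1 / (real n + 1)^2) <= 4" using sums_unique[OF s] by simp
qed

text \<open>Integration by parts \<open>k\<close> times gains the factor \<open>R\<^sup>-\<^sup>k\<close>; three of these factors are given away to
  obtain a bound that is summable in \<open>i\<close>.\<close>

lemma leg_coeff_bound:
 assumes g: "smooth_seq (-1) 1 g" and k: "3 <= k" "2 * k <= r + 1"
 defines "R \<equiv> real r - real k + 1" and "Q \<equiv> int1 (%x. \<bar>g k x\<bar>)"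
 shows "\<bar>leg_coeff (g 0) (i + r)\<bar> <= 2 * Q * R ^ 3 / R ^ k * (1 / (real i + 1)^2)"
proof -
 have R: "R >= 1" using k by (simp add: R_def)
 define nu where "nu = R + real i"
 have nu: "nu = real (i + r) - real k + 1" "nu >= R" "nu >= real i + 1" using R by (auto simp: nu_def R_def)
 have Q: "Q >= 0"
  unfolding Q_def by (intro integral_nonneg cont_int continuous_intros smooth_seq_cont[OF g]) auto
 have "\<bar>leg_coeff (g 0) (i + r)\<bar> = (2 * real (i + r) + 1) / 2 * \<bar>int1 (%x. g 0 x * L (i + r) x)\<bar>"
  by (simp add: leg_coeff_def abs_mult)
 also have "... <= (2 * nu) * ((1 / nu) ^ k * Q)"
  unfolding nu(1) Q_def
  by (intro mult_mono integral_legendre_bound g) (use k in auto)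
 also have "... = 2 * Q * (nu / nu ^ k)" by (simp add: field_simps)
 also have "nu / nu ^ k = 1 / nu ^ 2 * (1 / nu ^ (k - 3))"
 proof -
  obtain j where "k = 3 + j" using k(1) le_Suc_ex by blast
  then have "nu ^ k = nu * (nu^2 * nu ^ (k - 3))" by (simp add: power2_eq_square power3_eq_cube power_add)
  then have e: "nu ^ k = nu * (nu^2 * nu ^ (k - 3))" .
  have "nu > 0" using R nu(2) by linarith
  then show ?thesis unfolding e by simp
 qed
 also have "2 * Q * ... <= 2 * Q * (1 / (real i + 1)^2 * (1 / R ^ (k - 3)))"
  using R nu Q by (intro mult_left_mono mult_mono divide_left_mono power_mono) auto
 also have "1 / R ^ (k - 3) = R ^ 3 / R ^ k"
 proof -
  have "R ^ k = R ^ 3 * R ^ (k - 3)" using k by (simp add: power_add[symmetric])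
  then show ?thesis using R by (simp add: field_simps)
 qed
 finally show ?thesis by (simp add: field_simps)
qed

definition dg_proj :: "nat => (real => real) => real poly" where
 "dg_proj r g = (\<Sum>n<r. smult (leg_coeff g n) (legendre n)) + smult (g 1 - (\<Sum>n<r. leg_coeff g n)) (legendre r)"

lemma poly_dg_proj:
 "poly (dg_proj r g) x = (\<Sum>n<r. leg_coeff g n * L n x) + (g 1 - (\<Sum>n<r. leg_coeff g n)) * L r x"
 by (simp add: dg_proj_def poly_sum)

lemma degree_dg_proj: "degree (dg_proj r g) <= r"
 unfolding dg_proj_def
 by (intro degree_add_le degree_sum_le order.trans[OF degree_smult_le]) (auto simp: degree_legendre)

lemma dg_proj_at_1: "poly (dg_proj r g) 1 = g 1"
 by (simp add: poly_dg_proj legendre_at_1)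

text \<open>The correction of the truncated Legendre series that enforces the value at \<open>1\<close> is a multiple of
  \<open>L\<^sub>r\<close>, hence orthogonal to lower degrees.\<close>

lemma dg_proj_orthogonal:
 assumes g: "continuous_on {-1..1} g" and q: "degree q < r"
 shows "int1 (%x. (g x - poly (dg_proj r g) x) * poly q x) = 0"
proof -
 have 1: "int1 (%x. (g x - poly (dg_proj r g) x) * L k x) = 0" if k: "k < r" for k
 proof -
  have "int1 (%x. (g x - poly (dg_proj r g) x) * L k x)
   = int1 (%x. g x * L k x - poly (dg_proj r g) x * L k x)"
   by (simp add: algebra_simps)
  also have "... = int1 (%x. g x * L k x) - int1 (%x. poly (dg_proj r g) x * L k x)"
   by (intro integral_diff cont_int continuous_intros g)
  also have "int1 (%x. poly (dg_proj r g) x * L k x)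
   = int1 (%x. (\<Sum>n<r. leg_coeff g n * (L n x * L k x)) + (g 1 - (\<Sum>n<r. leg_coeff g n)) * (L r x * L k x))"
   by (simp add: poly_dg_proj ring_distribs sum_distrib_right mult.assoc)
  also have "... = int1 (%x. (\<Sum>n<r. leg_coeff g n * (L n x * L k x))) + int1 (%x. (g 1 - (\<Sum>n<r. leg_coeff g n)) * (L r x * L k x))"
   by (intro integral_add cont_int continuous_intros)
  also have "int1 (%x. (g 1 - (\<Sum>n<r. leg_coeff g n)) * (L r x * L k x)) = 0"
   using that by (simp add: legendre_orthogonal)
  also have "int1 (%x. (\<Sum>n<r. leg_coeff g n * (L n x * L k x))) = (\<Sum>n<r. int1 (%x. leg_coeff g n * (L n x * L k x)))"
   by (intro integral_sum cont_int continuous_intros) auto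
  also have "... = (\<Sum>n<r. if n = k then leg_coeff g k * int1 (%x. L k x * L k x) else 0)"
   by (intro sum.cong) (auto simp: legendre_orthogonal)
  also have "... = int1 (%x. g x * L k x) * ((2 * real k + 1) * int1 (%x. L k x * L k x)) / 2"
   using that by (simp add: leg_coeff_def)
  finally show ?thesis by (simp add: legendre_norm)
 qed
 obtain c where c: "!!x. poly q x = (\<Sum>i<r. c i * L i x)"
  using poly_legendre_expansion[OF q] by blast
 have "int1 (%x. (g x - poly (dg_proj r g) x) * poly q x)
  = int1 (%x. \<Sum>i<r. c i * ((g x - poly (dg_proj r g) x) * L i x))"
  unfolding c sum_distrib_left by (simp only: mult.left_commute)
 also have "... = (\<Sum>i<r. int1 (%x. c i * ((g x - poly (dg_proj r g) x) * L i x)))"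
  by (intro integral_sum cont_int continuous_intros g) auto
 also have "... = 0" by (intro sum.neutral) (auto simp: 1)
 finally show ?thesis .
qed

lemma dg_proj_sup_error:
 assumes g: "smooth_seq (-1) 1 g" and k: "3 <= k" "2 * k <= r + 1" and x: "x \<in> {-1..1}"
 defines "R \<equiv> real r - real k + 1" and "Q \<equiv> int1 (%x. \<bar>g k x\<bar>)"
 shows "\<bar>g 0 x - poly (dg_proj r (g 0)) x\<bar> <= 16 * Q * R ^ 3 / R ^ k"
proof -
 define c where "c = leg_coeff (g 0)"
 define P where "P = 2 * Q * R ^ 3 / R ^ k"
 have b: "\<bar>c (i + r)\<bar> <= P * (1 / (real i + 1)^2)" for i
  unfolding c_def P_def Q_def R_def by (rule leg_coeff_bound[OF g k])
 have sP: "summable (%i. P * (1 / (real i + 1)^2))"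
  by (intro summable_mult summable_inverse_squares_tail)
 have "summable (%i. \<bar>c (i + r)\<bar>)"
  by (rule summable_comparison_test'[OF sP]) (use b in auto)
 then have s: "summable (%n. \<bar>c n\<bar>)"
  using summable_iff_shift[of "%n. \<bar>c n\<bar>" r] by simp
 have Q: "Q >= 0"
  unfolding Q_def by (intro integral_nonneg cont_int continuous_intros smooth_seq_cont[OF g]) auto
 have R: "R > 0" using k by (simp add: R_def)
 have P: "P >= 0" using Q R by (simp add: P_def)
 have tail: "\<bar>g 0 y - (\<Sum>n<r. c n * L n y)\<bar> <= 4 * P" if y: "y \<in> {-1..1}" for y
 proof -
  have S: "(%n. c n * L n y) sums g 0 y"
   unfolding c_def by (rule legendre_series) (use y s smooth_seq_cont[OF g] in "auto simp: c_def")
  from sums_split_initial_segment[OF this, of r]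
  have S': "(%i. c (i + r) * L (i + r) y) sums (g 0 y - (\<Sum>n<r. c n * L n y))" .
  have le: "norm (c (i + r) * L (i + r) y) <= P * (1 / (real i + 1)^2)" for i
  proof -
   have "\<bar>L (i + r) y\<bar> <= 1" using that by (intro legendre_bounded) auto
   then have "\<bar>c (i + r)\<bar> * \<bar>L (i + r) y\<bar> <= P * (1 / (real i + 1)^2) * 1"
   using b P by (intro mult_mono) auto
   then show ?thesis by (simp add: abs_mult)
  qed
  have "\<bar>\<Sum>i. c (i + r) * L (i + r) y\<bar> <= (\<Sum>i. P * (1 / (real i + 1)^2))"
   unfolding real_norm_def[symmetric]
   by (rule norm_suminf_le[OF le sP])
  also have "... = P * (\<Sum>i. 1 / (real i + 1)^2)"
   by (rule suminf_mult[OF summable_inverse_squares_tail(1)])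
  also have "... <= P * 4" using P summable_inverse_squares_tail(2) by (intro mult_left_mono)
  finally show ?thesis using sums_unique[OF S'] by simp
 qed
 have e: "g 0 x - poly (dg_proj r (g 0)) x =
   (g 0 x - (\<Sum>n<r. c n * L n x)) - (g 0 1 - (\<Sum>n<r. c n * L n 1)) * L r x"
  by (simp add: poly_dg_proj c_def legendre_at_1)
 have "\<bar>(g 0 1 - (\<Sum>n<r. c n * L n 1)) * L r x\<bar> <= 4 * P * 1"
  unfolding abs_mult by (intro mult_mono tail legendre_bounded) (use x P in auto)
 then have "\<bar>g 0 x - poly (dg_proj r (g 0)) x\<bar> <= 4 * P + 4 * P"
  unfolding e using tail[OF x] by linarith
 then show ?thesis by (simp add: P_def)
qed

lemma dg_proj_error_reference:
 assumes g: "smooth_seq (-1) 1 g" and k: "3 <= k" "2 * k <= r + 1"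
 defines "R \<equiv> real r - real k + 1"
 shows "int1 (%x. (g 0 x - poly (dg_proj r (g 0)) x)^2)
  <= 1024 * R ^ 6 / R ^ (2 * k) * int1 (%x. (g k x)^2)"
proof -
 have cont: "continuous_on {-1..1} (g l)" for l using g by (rule smooth_seq_cont)
 define Q where "Q = int1 (%x. \<bar>g k x\<bar>)"
 have "int1 (%x. (g 0 x - poly (dg_proj r (g 0)) x)^2) <= int1 (%x :: real. (16 * Q * R ^ 3 / R ^ k)^2)"
 proof (rule integral_le)
  fix x :: real assume x: "x \<in> {-1..1}"
  have "\<bar>g 0 x - poly (dg_proj r (g 0)) x\<bar> <= 16 * Q * R ^ 3 / R ^ k"
   unfolding Q_def R_def by (rule dg_proj_sup_error[OF g k x])
  then have "\<bar>g 0 x - poly (dg_proj r (g 0)) x\<bar>^2 <= (16 * Q * R ^ 3 / R ^ k)^2"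
   by (rule power_mono) simp
  then show "(g 0 x - poly (dg_proj r (g 0)) x)^2 <= (16 * Q * R ^ 3 / R ^ k)^2" by simp
 qed (auto intro!: cont_int continuous_intros cont)
 also have "... = 512 * R ^ 6 / R ^ (2 * k) * Q^2"
  by (simp add: power_mult_distrib power_divide flip: power_mult)
   (simp add: mult.commute)
 also have "... <= 512 * R ^ 6 / R ^ (2 * k) * (2 * int1 (%x. (g k x)^2))"
  using integral_abs_Cauchy_Schwarz[OF cont, of k] k
  by (intro mult_left_mono) (auto simp: Q_def R_def)
 finally show ?thesis by simp
qed

lemma dg_proj_stable_reference:
 assumes g: "continuous_on {-1..1} g"
 shows "int1 (%x. (g x - poly (dg_proj r g) x)^2)
  <= (16 * real r ^ 4 + 8) * (int1 (%x. (g x)^2) + (g 1)^2)"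
proof -
 define Q where "Q = int1 (%x. \<bar>g x\<bar>)"
 define G2 where "G2 = int1 (%x. (g x)^2)"
 have Q0: "Q >= 0" unfolding Q_def by (intro integral_nonneg cont_int continuous_intros g) auto
 have G0: "G2 >= 0" unfolding G2_def by (intro integral_nonneg cont_int continuous_intros g) auto
 have Q2: "Q^2 <= 2 * G2"
  using integral_abs_Cauchy_Schwarz[OF g] by (simp add: Q_def G2_def)
 have c: "\<bar>leg_coeff g n\<bar> <= (real n + 1 / 2) * Q" for n
 proof -
  have "\<bar>int1 (%x. g x * L n x)\<bar> <= Q"
   unfolding Q_def real_norm_def[symmetric]
  proof (intro Henstock_Kurzweil_Integration.integral_norm_bound_integral cont_int continuous_intros g)
   fix x :: real assume "x \<in> {-1..1}"
   then have "\<bar>L n x\<bar> <= 1" by (intro legendre_bounded) auto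
   then have "\<bar>g x\<bar> * \<bar>L n x\<bar> <= \<bar>g x\<bar> * 1" by (intro mult_left_mono) auto
   then show "norm (g x * L n x) <= norm (g x)" by (simp add: abs_mult)
  qed
  then have "(2 * real n + 1) / 2 * \<bar>int1 (%x. g x * L n x)\<bar> <= (2 * real n + 1) / 2 * Q"
   by (intro mult_left_mono) auto
  then show ?thesis by (simp add: leg_coeff_def abs_mult add_divide_distrib)
 qed
 have sum_odd: "(\<Sum>n<r. (real n + 1 / 2) * Q) = (real r)^2 / 2 * Q"
  by (induction r) (auto simp: algebra_simps power2_eq_square)
 have I: "\<bar>poly (dg_proj r g) x\<bar> <= \<bar>g 1\<bar> + (real r)^2 * Q" if x: "x \<in> {-1..1}" for x
 proof -
  have L1: "\<bar>L n x\<bar> <= 1" for n using that by (intro legendre_bounded) auto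
  have "\<bar>\<Sum>n<r. leg_coeff g n * L n x\<bar> <= (\<Sum>n<r. (real n + 1 / 2) * Q)"
  proof (rule order.trans[OF sum_abs], rule sum_mono)
   fix n
   have "\<bar>leg_coeff g n\<bar> * \<bar>L n x\<bar> <= (real n + 1 / 2) * Q * 1"
   by (intro mult_mono c L1) (use Q0 in auto)
   then show "\<bar>leg_coeff g n * L n x\<bar> <= (real n + 1 / 2) * Q" by (simp add: abs_mult)
  qed
  moreover have "\<bar>(g 1 - (\<Sum>n<r. leg_coeff g n)) * L r x\<bar> <= (\<bar>g 1\<bar> + (\<Sum>n<r. (real n + 1 / 2) * Q)) * 1"
   unfolding abs_mult
  proof (intro mult_mono L1)
   have "\<bar>\<Sum>n<r. leg_coeff g n\<bar> <= (\<Sum>n<r. (real n + 1 / 2) * Q)"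
   by (rule order.trans[OF sum_abs], rule sum_mono, rule c)
   then show "\<bar>g 1 - (\<Sum>n<r. leg_coeff g n)\<bar> <= \<bar>g 1\<bar> + (\<Sum>n<r. (real n + 1 / 2) * Q)" by linarith
  qed (use Q0 in "auto intro!: add_nonneg_nonneg sum_nonneg")
  ultimately have "\<bar>\<Sum>n<r. leg_coeff g n * L n x\<bar> + \<bar>(g 1 - (\<Sum>n<r. leg_coeff g n)) * L r x\<bar>
   <= (real r)^2 / 2 * Q + (\<bar>g 1\<bar> + (real r)^2 / 2 * Q) * 1"
   unfolding sum_odd by (rule add_mono)
  also have "... = \<bar>g 1\<bar> + (real r)^2 * Q" by (simp add: field_simps)
  finally show ?thesis unfolding poly_dg_proj by (rule order.trans[OF abs_triangle_ineq])
 qed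
 have "int1 (%x. (g x - poly (dg_proj r g) x)^2)
  <= int1 (%x. 2 * (g x)^2 + (4 * (g 1)^2 + 4 * real r ^ 4 * Q^2))"
 proof (intro integral_le cont_int continuous_intros g)
  fix x :: real assume x: "x \<in> {-1..1}"
  have "\<bar>poly (dg_proj r g) x\<bar>^2 <= (\<bar>g 1\<bar> + (real r)^2 * Q)^2"
   using I[OF x] by (rule power_mono) simp
  also have "... <= 2 * (g 1)^2 + 2 * ((real r)^2 * Q)^2"
   using sum_squares_bound[of "\<bar>g 1\<bar>" "(real r)^2 * Q"] by (simp add: power2_sum)
  also have "((real r)^2 * Q)^2 = real r ^ 4 * Q^2" by (simp add: power_mult_distrib flip: power_mult)
  finally have "(poly (dg_proj r g) x)^2 <= 2 * (g 1)^2 + 2 * (real r ^ 4 * Q^2)" by simp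
  moreover have "(g x - poly (dg_proj r g) x)^2 <= 2 * (g x)^2 + 2 * (poly (dg_proj r g) x)^2"
   using sum_squares_bound[of "g x" "- poly (dg_proj r g) x"] by (simp add: power2_diff)
  ultimately show "(g x - poly (dg_proj r g) x)^2 <= 2 * (g x)^2 + (4 * (g 1)^2 + 4 * real r ^ 4 * Q^2)" by linarith
 qed
 also have "... = 2 * G2 + 2 * (4 * (g 1)^2 + 4 * real r ^ 4 * Q^2)"
  by (subst integral_add) (auto intro!: cont_int continuous_intros g simp: G2_def)
 also have "... <= 2 * G2 + 2 * (4 * (g 1)^2 + 4 * real r ^ 4 * (2 * G2))"
  using Q2 by (intro add_left_mono mult_left_mono) auto
 also have "... = (16 * real r ^ 4 + 2) * G2 + 8 * (g 1)^2" by (simp add: algebra_simps)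
 also have "... <= (16 * real r ^ 4 + 8) * G2 + (16 * real r ^ 4 + 8) * (g 1)^2"
  using G0 by (intro add_mono mult_right_mono) auto
 finally show ?thesis unfolding G2_def by (simp add: algebra_simps)
qed

lemma integral_affine_transport:
 fixes f :: "real => real"
 assumes ab: "a < b" and f: "continuous_on {a..b} f"
 shows "integral {a..b} f = (b - a) / 2 * int1 (%x. f (a + (x + 1) * ((b - a) / 2)))"
proof -
 define \<phi> where "\<phi> x = a + (x + 1) * ((b - a) / 2)" for x :: real
 have im: "\<phi> ` {-1..1} \<subseteq> {a..b}"
 proof safe
  fix x :: real assume x: "x \<in> {-1..1}"
  have "0 <= (x + 1) * ((b - a) / 2)" using x ab by (intro mult_nonneg_nonneg) auto
  moreover have "(x + 1) * ((b - a) / 2) <= 2 * ((b - a) / 2)" using x ab by (intro mult_right_mono) auto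
  ultimately show "\<phi> x \<in> {a..b}" by (auto simp: \<phi>_def)
 qed
 have d: "(\<phi> has_real_derivative (b - a) / 2) (at x within {-1..1})" for x
  unfolding \<phi>_def by (auto intro!: derivative_eq_intros)
 have le: "(-1::real) <= 1" "\<phi> (-1) <= \<phi> 1" using ab by (auto simp: \<phi>_def)
 have "((%x. ((b - a) / 2) *\<^sub>R f (\<phi> x)) has_integral (integral {\<phi> (-1)..\<phi> 1} f)) {-1..1}"
  using has_integral_substitution[where g = \<phi> and f = f and g' = "%_. (b - a) / 2", OF le im f d] by simp
 moreover have ends: "\<phi> (-1) = a" "\<phi> 1 = b" unfolding \<phi>_def by (simp, argo)
 ultimately have "integral {a..b} f = int1 (%x. (b - a) / 2 * f (\<phi> x))"
  by (simp add: has_integral_iff ends)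
 then show ?thesis by (simp add: \<phi>_def)
qed

text \<open>The projection that reproduces the value at the right end point and is otherwise orthogonal
  to the polynomials of lower degree is the interpolation operator for which the time derivative and the
  jump terms of the discontinuous Galerkin form drop out of the error equation.\<close>

lemma dg_projection:
 fixes g :: "nat => real => real"
 assumes ab: "a < b" and g: "smooth_seq a b g"
 obtains p where "degree p <= r" "poly p b = g 0 b"
  "!!q. degree q < r ==> integral {a..b} (%x. (g 0 x - poly p x) * poly q x) = 0"
  "integral {a..b} (%x. (g 0 x - poly p x)^2)
   <= (16 * real r ^ 4 + 8) * (integral {a..b} (%x. (g 0 x)^2) + (b - a) * (g 0 b)^2)"
  "!!k. 3 <= k ==> 2 * k <= r + 1 ==> integral {a..b} (%x. (g 0 x - poly p x)^2)
   <= 1024 * (real r - real k + 1) ^ 6 * ((b - a) / (2 * (real r - real k + 1))) ^ (2 * k)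
   * integral {a..b} (%x. (g k x)^2)"
proof -
 define h where "h = (b - a) / 2"
 have h: "h > 0" using ab by (simp add: h_def)
 define \<phi> where "\<phi> x = a + (x + 1) * h" for x :: real
 define gg where "gg l x = h ^ l * g l (\<phi> x)" for l x
 have im: "\<phi> x \<in> {a..b}" if "x \<in> {-1..1}" for x
 proof -
  have "0 <= (x + 1) * h" using that h by (intro mult_nonneg_nonneg) auto
  moreover have "(x + 1) * h <= 2 * h" using that h by (intro mult_right_mono) auto
  moreover have "a + 2 * h = b" unfolding h_def by argo
  ultimately show ?thesis unfolding \<phi>_def by simp
 qed
 have gg: "smooth_seq (-1) 1 gg"
  unfolding smooth_seq_def
 proof (intro allI ballI)
  fix l and x :: real assume x: "x \<in> {-1..1}"
  have "(g l has_real_derivative g (Suc l) (\<phi> x)) (at (\<phi> x) within {a..b})"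
   using g im[OF x] unfolding smooth_seq_def by blast
  then have "(g l has_real_derivative g (Suc l) (\<phi> x)) (at (\<phi> x) within \<phi> ` {-1..1})"
   by (rule DERIV_subset) (use im in blast)
  moreover have "(\<phi> has_real_derivative h) (at x within {-1..1})"
   unfolding \<phi>_def by (auto intro!: derivative_eq_intros)
  ultimately have "((g l \<circ> \<phi>) has_real_derivative g (Suc l) (\<phi> x) * h) (at x within {-1..1})"
   by (rule DERIV_image_chain)
  then have "((%x. h ^ l * (g l \<circ> \<phi>) x) has_real_derivative h ^ l * (g (Suc l) (\<phi> x) * h)) (at x within {-1..1})"
   by (rule DERIV_cmult)
  then show "(gg l has_real_derivative gg (Suc l) x) (at x within {-1..1})"
   by (simp add: gg_def[abs_def] mult_ac)
 qed
 define P where "P = dg_proj r (gg 0)"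
 define p where "p = pcompose P [:- (a / h) - 1, 1 / h:]"
 have p: "poly p (\<phi> x) = poly P x" for x
 proof -
  have "- (a / h) - 1 + (a + (x + 1) * h) * (1 / h) = x" using h by (simp add: field_simps)
  then show ?thesis by (simp add: p_def poly_pcompose \<phi>_def)
 qed
 have cont: "continuous_on {a..b} (g l)" for l using g by (rule smooth_seq_cont)
 have ccg: "continuous_on {-1..1} (gg l)" for l using gg by (rule smooth_seq_cont)
 have tr: "integral {a..b} f = h * int1 (%x. f (\<phi> x))" if "continuous_on {a..b} f" for f :: "real => real"
  using integral_affine_transport[OF ab that] by (simp add: h_def \<phi>_def)
 have b: "\<phi> 1 = b" unfolding \<phi>_def h_def by argo
 have e: "integral {a..b} (%x. (g 0 x - poly p x)^2) = h * int1 (%x. (gg 0 x - poly P x)^2)"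
  by (subst tr) (auto intro!: continuous_intros cont simp: p gg_def)
 have n: "integral {a..b} (%x. (g l x)^2) * h ^ (2 * l) = h * int1 (%x. (gg l x)^2)" for l
  by (subst tr) (auto intro!: continuous_intros cont simp: gg_def power_mult_distrib mult_ac simp flip: power_mult)
 show thesis
 proof
  show "degree p <= r"
   using degree_pcompose_le[of P "[:- (a / h) - 1, 1 / h:]"] degree_dg_proj[of r "gg 0"] h
   by (simp add: p_def P_def)
  show "poly p b = g 0 b"
   using p[of 1] dg_proj_at_1[of r "gg 0"] by (simp add: P_def gg_def b)
  show "integral {a..b} (%x. (g 0 x - poly p x) * poly q x) = 0" if q: "degree q < r" for q
  proof -
   define q' where "q' = pcompose q [:a + h, h:]"
   have q': "poly q (\<phi> x) = poly q' x" for x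
   by (simp add: q'_def poly_pcompose \<phi>_def algebra_simps)
   have "degree q' < r"
   using degree_pcompose_le[of q "[:a + h, h:]"] q h by (simp add: q'_def)
   then have "int1 (%x. (gg 0 x - poly P x) * poly q' x) = 0"
   unfolding P_def by (rule dg_proj_orthogonal[OF ccg])
   then show ?thesis
   by (subst tr) (auto intro!: continuous_intros cont simp: p q' gg_def)
  qed
  have "integral {a..b} (%x. (g 0 x - poly p x)^2)
   <= h * ((16 * real r ^ 4 + 8) * (int1 (%x. (gg 0 x)^2) + (gg 0 1)^2))"
   unfolding e P_def using h by (intro mult_left_mono dg_proj_stable_reference ccg) auto
  also have "... = (16 * real r ^ 4 + 8) * (integral {a..b} (%x. (g 0 x)^2) + h * (g 0 b)^2)"
   using n[of 0] by (simp add: gg_def b algebra_simps)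
  also have "... <= (16 * real r ^ 4 + 8) * (integral {a..b} (%x. (g 0 x)^2) + (b - a) * (g 0 b)^2)"
   using ab by (intro mult_left_mono add_left_mono mult_right_mono) (auto simp: h_def)
  finally show "integral {a..b} (%x. (g 0 x - poly p x)^2)
   <= (16 * real r ^ 4 + 8) * (integral {a..b} (%x. (g 0 x)^2) + (b - a) * (g 0 b)^2)" .
  fix k :: nat assume k: "3 <= k" "2 * k <= r + 1"
  define R where "R = real r - real k + 1"
  have R: "R > 0" using k by (simp add: R_def)
  have "integral {a..b} (%x. (g 0 x - poly p x)^2)
   <= h * (1024 * R ^ 6 / R ^ (2 * k) * int1 (%x. (gg k x)^2))"
   unfolding e P_def R_def using h by (intro mult_left_mono dg_proj_error_reference gg k) auto
  also have "... = 1024 * R ^ 6 / R ^ (2 * k) * (integral {a..b} (%x. (g k x)^2) * h ^ (2 * k))"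
   unfolding n by simp
  also have "... = 1024 * R ^ 6 * (h / R) ^ (2 * k) * integral {a..b} (%x. (g k x)^2)"
   by (simp add: power_divide)
  finally show "integral {a..b} (%x. (g 0 x - poly p x)^2)
   <= 1024 * (real r - real k + 1) ^ 6 * ((b - a) / (2 * (real r - real k + 1))) ^ (2 * k)
   * integral {a..b} (%x. (g k x)^2)"
   by (simp add: R_def h_def)
 qed
qed

section \<open>Energy estimates for the semidiscrete problem\<close>

text \<open>The semidiscrete problem in coordinates with respect to a basis that is orthonormal for the
  energy inner product: the stiffness matrix is the identity and \<open>m\<close> is the (only
  positive semidefinite) mass matrix.\<close>

locale mass_matrix =
 fixes I :: "'i set" and m :: "'i => 'i => real" and CP :: real
 assumes fin: "finite I" and m_sym: "m i k = m k i"
  and m_psd: "0 <= (\<Sum>i\<in>I. \<Sum>k\<in>I. m i k * v i * v k)"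
  and m_bound: "(\<Sum>i\<in>I. \<Sum>k\<in>I. m i k * v i * v k) <= CP * (\<Sum>i\<in>I. (v i)^2)"
  and CP_pos: "CP > 0"
begin

definition mm :: "('i => real) => ('i => real) => real" where
 "mm v w = (\<Sum>i\<in>I. \<Sum>k\<in>I. m i k * v i * w k)"

definition sq :: "('i => real) => real" where
 "sq v = (\<Sum>i\<in>I. (v i)^2)"

lemma mm_nonneg: "0 <= mm v v"
 using m_psd by (simp add: mm_def)

lemma mm_le: "mm v v <= CP * sq v"
 using m_bound by (simp add: mm_def sq_def)

lemma mm_sym: "mm v w = mm w v"
 unfolding mm_def by (subst sum.swap) (simp add: m_sym[of _ _] mult_ac)

lemma mm_diff_left: "mm (%i. v i - v' i) w = mm v w - mm v' w"
 by (simp add: mm_def algebra_simps sum_subtractf)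

lemma mm_diff_right: "mm w (%i. v i - v' i) = mm w v - mm w v'"
 by (simp add: mm_def algebra_simps sum_subtractf)

lemma mm_two: "2 * mm v w <= mm v v + mm w w"
 using mm_nonneg[of "%i. v i - w i"] by (simp add: mm_diff_left mm_diff_right mm_sym[of w v])

lemma mm_alt: "mm v w = (\<Sum>k\<in>I. (\<Sum>i\<in>I. m i k * v i) * w k)"
 unfolding mm_def by (subst sum.swap) (simp add: sum_distrib_right)

lemma sq_nonneg: "0 <= sq v"
 by (simp add: sq_def sum_nonneg)

lemma continuous_on_mm [continuous_intros]:
 assumes "!!i. i \<in> I ==> continuous_on S (%t. v t i)" "!!i. i \<in> I ==> continuous_on S (%t. w t i)"
 shows "continuous_on S (%t. mm (v t) (w t))"
 unfolding mm_def by (intro continuous_intros assms)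

lemma continuous_on_sq [continuous_intros]:
 assumes "!!i. i \<in> I ==> continuous_on S (%t. v t i)"
 shows "continuous_on S (%t. sq (v t))"
 unfolding sq_def by (intro continuous_intros assms)

lemma DERIV_mm:
 assumes "!!i. i \<in> I ==> ((%t. v t i) has_real_derivative v' i) (at t within S)"
 shows "((%t. mm (v t) (v t)) has_real_derivative 2 * mm v' (v t)) (at t within S)"
proof -
 have "((%t. mm (v t) (v t)) has_real_derivative
   (\<Sum>i\<in>I. \<Sum>k\<in>I. m i k * v' i * v t k + m i k * v t i * v' k)) (at t within S)"
  unfolding mm_def
  by (intro DERIV_sum) (auto intro!: derivative_eq_intros assms simp: algebra_simps)
 moreover have "(\<Sum>i\<in>I. \<Sum>k\<in>I. m i k * v' i * v t k + m i k * v t i * v' k) = mm v' (v t) + mm (v t) v'"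
  by (simp add: mm_def sum.distrib)
 ultimately show ?thesis by (simp add: mm_sym[of "v t" v'])
qed

lemma DERIV_sq:
 assumes "!!i. i \<in> I ==> ((%t. v t i) has_real_derivative v' i) (at t within S)"
 shows "((%t. sq (v t)) has_real_derivative 2 * (\<Sum>i\<in>I. v' i * v t i)) (at t within S)"
 unfolding sq_def sum_distrib_left
 by (intro DERIV_sum) (auto intro!: derivative_eq_intros assms)

lemma cross_le_sq: "2 * (\<Sum>i\<in>I. v i * w i) <= e * sq v + sq w / e" if "e > 0"
proof -
 have "2 * (v i * w i) <= e * (v i)^2 + (w i)^2 / e" for i
 proof -
  have "0 <= (e * v i - w i)^2 / e" using that by simp
  also have "... = e * (v i)^2 + (w i)^2 / e - 2 * (v i * w i)"
   using that by (simp add: power2_eq_square field_simps)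
  finally show ?thesis by simp
 qed
 then have "(\<Sum>i\<in>I. 2 * (v i * w i)) <= (\<Sum>i\<in>I. e * (v i)^2 + (w i)^2 / e)" by (intro sum_mono)
 then show ?thesis by (simp add: sum_distrib_left sum.distrib sq_def sum_divide_distrib)
qed

end

locale semidiscrete_flow = mass_matrix +
 fixes u F :: "nat => real => 'a => real" and T :: real and \<Phi> :: "nat => real"
 assumes T: "T > 0"
  and u_smooth: "!!i. i \<in> I ==> smooth_seq 0 T (%l t. u l t i)"
  and flow: "!!l t k. t \<in> {0..T} ==> k \<in> I ==> (\<Sum>i\<in>I. m i k * u (Suc l) t i) + u l t k = F l t k"
  and \<Phi>: "!!l. \<Phi> l >= 0"
  and force: "!!l t v. t \<in> {0..T} ==> (\<Sum>k\<in>I. F l t k * v k) <= \<Phi> l * sqrt (mm v v)"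
begin

lemma u_cont: "i \<in> I ==> \<tau> <= T ==> continuous_on {0..\<tau>} (%t. u l t i)"
 using smooth_seq_cont[OF u_smooth] by (rule continuous_on_subset) auto

lemma u_deriv:
 "i \<in> I ==> \<tau> <= T ==> t \<in> {0..\<tau>} ==> ((%t. u l t i) has_real_derivative u (Suc l) t i) (at t within {0..\<tau>})"
 using u_smooth unfolding smooth_seq_def by (intro DERIV_subset[where t = "{0..\<tau>}" and s = "{0..T}"]) auto

lemma flow_tested:
 "t \<in> {0..T} ==> mm (u (Suc l) t) v + (\<Sum>k\<in>I. u l t k * v k) = (\<Sum>k\<in>I. F l t k * v k)"
 by (simp add: mm_alt flow[symmetric] sum.distrib[symmetric] ring_distribs)

lemma force_le: "2 * (\<Sum>k\<in>I. F l t k * v k) <= e * (\<Phi> l)^2 + mm v v / e" if "t \<in> {0..T}" "e > 0"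
proof -
 have "0 <= (e * \<Phi> l - sqrt (mm v v))^2 / e" using that by simp
 also have "... = e * (\<Phi> l)^2 + mm v v / e - 2 * (\<Phi> l * sqrt (mm v v))"
  using that mm_nonneg[of v] by (simp add: power2_diff field_simps power2_eq_square[of e])
 finally show ?thesis using force[OF that(1), of l v] by linarith
qed

definition X :: "nat => real => real" where
 "X l \<tau> = integral {0..\<tau>} (%t. t ^ (2 * l) * sq (u l t))"

definition Y :: "nat => real => real" where
 "Y l \<tau> = integral {0..\<tau>} (%t. t ^ (2 * l + 1) * mm (u (Suc l) t) (u (Suc l) t))"

lemma X_nonneg: "\<tau> <= T ==> 0 <= X l \<tau>"
 unfolding X_def by (intro integral_nonneg cont_int continuous_intros u_cont)
  (auto simp: sq_nonneg)

text \<open>Test the equation for the next derivative with \<open>t\<^sup>2\<^sup>l\<^sup>+\<^sup>2\<close> times that derivative.\<close>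

lemma X_Suc_le_Y:
 assumes "0 <= \<tau>" "\<tau> <= T"
 shows "X (Suc l) \<tau> <= (2 * real l + 2) * Y l \<tau> + CP * (\<Phi> (Suc l))^2 * \<tau> ^ (2 * l + 3)"
proof -
 let ?w = "u (Suc l)"
 have "0 <= \<tau> ^ (2 * l + 2) * mm (?w \<tau>) (?w \<tau>) - 0 ^ (2 * l + 2) * mm (?w 0) (?w 0)"
  using assms mm_nonneg by simp
 also have "... = integral {0..\<tau>} (%t. (2 * real l + 2) * (t ^ (2 * l + 1) * mm (?w t) (?w t))
   + t ^ (2 * l + 2) * (2 * mm (u (Suc (Suc l)) t) (?w t)))"
 proof (rule integral_FTC[symmetric])
  fix t assume t: "t \<in> {0..\<tau>}"
  have "((%t. t ^ (2 * l + 2) * mm (?w t) (?w t)) has_real_derivative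
   (real (2 * l + 2) * t ^ (2 * l + 2 - 1) * mm (?w t) (?w t) + 2 * mm (u (Suc (Suc l)) t) (?w t) * t ^ (2 * l + 2)))
   (at t within {0..\<tau>})"
   by (intro DERIV_mult DERIV_mm u_deriv assms t DERIV_subset[OF DERIV_pow, THEN DERIV_cong]) auto
  then show "((%t. t ^ (2 * l + 2) * mm (?w t) (?w t)) has_real_derivative
   (2 * real l + 2) * (t ^ (2 * l + 1) * mm (?w t) (?w t))
   + t ^ (2 * l + 2) * (2 * mm (u (Suc (Suc l)) t) (?w t))) (at t within {0..\<tau>})"
   by (rule DERIV_cong) (simp add: algebra_simps)
 qed (use assms in auto)
 also have "... <= integral {0..\<tau>} (%t. (2 * real l + 2) * (t ^ (2 * l + 1) * mm (?w t) (?w t))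
   + (CP * (\<Phi> (Suc l))^2 * \<tau> ^ (2 * l + 2) - t ^ (2 * l + 2) * sq (?w t)))"
 proof (rule integral_le)
  fix t assume t: "t \<in> {0..\<tau>}"
  have t': "t \<in> {0..T}" using t assms by auto
  have sqe: "(\<Sum>k\<in>I. ?w t k * ?w t k) = sq (?w t)" by (simp add: sq_def power2_eq_square)
  have "2 * mm (u (Suc (Suc l)) t) (?w t) = 2 * (\<Sum>k\<in>I. F (Suc l) t k * ?w t k) - 2 * sq (?w t)"
   using flow_tested[OF t', of "Suc l" "?w t"] sqe by linarith
  also have "... <= CP * (\<Phi> (Suc l))^2 + mm (?w t) (?w t) / CP - 2 * sq (?w t)"
   using force_le[OF t' CP_pos, of "Suc l" "?w t"] by simp
  also have "mm (?w t) (?w t) / CP <= sq (?w t)"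
   using mm_le[of "?w t"] CP_pos by (simp add: field_simps)
  finally have "t ^ (2 * l + 2) * (2 * mm (u (Suc (Suc l)) t) (?w t)) <= t ^ (2 * l + 2) * (CP * (\<Phi> (Suc l))^2 - sq (?w t))"
   using t by (intro mult_left_mono) auto
  moreover have "t ^ (2 * l + 2) * (CP * (\<Phi> (Suc l))^2) <= \<tau> ^ (2 * l + 2) * (CP * (\<Phi> (Suc l))^2)"
   using t CP_pos by (intro mult_right_mono power_mono) auto
  ultimately show "(2 * real l + 2) * (t ^ (2 * l + 1) * mm (?w t) (?w t)) + t ^ (2 * l + 2) * (2 * mm (u (Suc (Suc l)) t) (?w t))
   <= (2 * real l + 2) * (t ^ (2 * l + 1) * mm (?w t) (?w t)) + (CP * (\<Phi> (Suc l))^2 * \<tau> ^ (2 * l + 2) - t ^ (2 * l + 2) * sq (?w t))"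
   by (simp add: algebra_simps)
 qed (intro cont_int continuous_intros u_cont assms; simp)+
 also have "... = (2 * real l + 2) * Y l \<tau> + (CP * (\<Phi> (Suc l))^2 * \<tau> ^ (2 * l + 2) * \<tau> - X (Suc l) \<tau>)"
  using assms
  by (subst integral_add integral_diff; (intro cont_int continuous_intros u_cont assms; simp)?)+
   (simp add: Y_def X_def mult.commute)
 finally show ?thesis by (simp add: algebra_simps numeral_eq_Suc)
qed

text \<open>Test the equation for the \<open>l\<close>-th derivative with \<open>t\<^sup>2\<^sup>l\<^sup>+\<^sup>1 u\<^sup>(\<^sup>l\<^sup>+\<^sup>1\<^sup>)\<close>.\<close>

lemma Y_le_X:
 assumes "0 <= \<tau>" "\<tau> <= T"
 shows "Y l \<tau> <= (2 * real l + 1) * X l \<tau> + (\<Phi> l)^2 * \<tau> ^ (2 * l + 2)"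
proof -
 let ?w = "u (Suc l)"
 have "0 <= \<tau> ^ (2 * l + 1) * sq (u l \<tau>) - 0 ^ (2 * l + 1) * sq (u l 0)"
  using assms sq_nonneg by simp
 also have "... = integral {0..\<tau>} (%t. (2 * real l + 1) * (t ^ (2 * l) * sq (u l t))
   + t ^ (2 * l + 1) * (2 * (\<Sum>k\<in>I. ?w t k * u l t k)))"
 proof (rule integral_FTC[symmetric])
  fix t assume t: "t \<in> {0..\<tau>}"
  have "((%t. t ^ (2 * l + 1) * sq (u l t)) has_real_derivative
   (real (2 * l + 1) * t ^ (2 * l + 1 - 1) * sq (u l t) + 2 * (\<Sum>k\<in>I. ?w t k * u l t k) * t ^ (2 * l + 1)))
   (at t within {0..\<tau>})"
   by (intro DERIV_mult DERIV_sq u_deriv assms t DERIV_subset[OF DERIV_pow, THEN DERIV_cong]) auto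
  then show "((%t. t ^ (2 * l + 1) * sq (u l t)) has_real_derivative
   (2 * real l + 1) * (t ^ (2 * l) * sq (u l t))
   + t ^ (2 * l + 1) * (2 * (\<Sum>k\<in>I. ?w t k * u l t k))) (at t within {0..\<tau>})"
   by (rule DERIV_cong) (simp add: algebra_simps)
 qed (use assms in auto)
 also have "... <= integral {0..\<tau>} (%t. (2 * real l + 1) * (t ^ (2 * l) * sq (u l t))
   + ((\<Phi> l)^2 * \<tau> ^ (2 * l + 1) - t ^ (2 * l + 1) * mm (?w t) (?w t)))"
 proof (rule integral_le)
  fix t assume t: "t \<in> {0..\<tau>}"
  have t': "t \<in> {0..T}" using t assms by auto
  have "2 * (\<Sum>k\<in>I. ?w t k * u l t k) = 2 * (\<Sum>k\<in>I. F l t k * ?w t k) - 2 * mm (?w t) (?w t)"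
   using flow_tested[OF t', of l "?w t"] by (simp add: mult.commute)
  also have "... <= (\<Phi> l)^2 - mm (?w t) (?w t)"
   using force_le[OF t', of 1 l "?w t"] by simp
  finally have "t ^ (2 * l + 1) * (2 * (\<Sum>k\<in>I. ?w t k * u l t k)) <= t ^ (2 * l + 1) * ((\<Phi> l)^2 - mm (?w t) (?w t))"
   using t by (intro mult_left_mono) auto
  moreover have "t ^ (2 * l + 1) * (\<Phi> l)^2 <= \<tau> ^ (2 * l + 1) * (\<Phi> l)^2"
   using t by (intro mult_right_mono power_mono) auto
  ultimately show "(2 * real l + 1) * (t ^ (2 * l) * sq (u l t)) + t ^ (2 * l + 1) * (2 * (\<Sum>k\<in>I. ?w t k * u l t k))
   <= (2 * real l + 1) * (t ^ (2 * l) * sq (u l t)) + ((\<Phi> l)^2 * \<tau> ^ (2 * l + 1) - t ^ (2 * l + 1) * mm (?w t) (?w t))"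
   by (simp add: algebra_simps)
 qed (intro cont_int continuous_intros u_cont assms; simp)+
 also have "... = (2 * real l + 1) * X l \<tau> + ((\<Phi> l)^2 * \<tau> ^ (2 * l + 1) * \<tau> - Y l \<tau>)"
  using assms
  by (subst integral_add integral_diff; (intro cont_int continuous_intros u_cont assms; simp)?)+
   (simp add: Y_def X_def mult.commute)
 finally show ?thesis by (simp add: algebra_simps)
qed

text \<open>Factorial growth of the weighted energies of the time derivatives, with a constant that is
  proportional to the energy on \<open>(0, \<tau>)\<close>: this transfers the decay of the latter as \<open>\<tau> \<rightarrow> 0\<close>
  to all derivatives.\<close>

lemma X_growth:
 assumes \<Phi>_le: "!!l. \<Phi> l <= Cf * d ^ l * fact l" and "d >= 0" and \<tau>: "0 <= \<tau>" "\<tau> <= T"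
 defines "G \<equiv> Cf^2 * (4 * T + CP * (d * T)^2)"
 shows "X l \<tau> <= (5 + (d * T)^2) ^ l * (fact l)^2 * (X 0 \<tau> + G * \<tau>)"
proof (induction l)
 case 0
 have "G >= 0" using T CP_pos by (simp add: G_def)
 then show ?case using \<tau> by simp
next
 case (Suc l)
 define E where "E = 5 + (d * T)^2"
 define Z where "Z = X 0 \<tau> + G * \<tau>"
 have E: "E >= 5" "E >= (d * T)^2" by (auto simp: E_def)
 have G: "G >= 0" using T CP_pos by (simp add: G_def)
 have Z: "Z >= G * \<tau>" using X_nonneg[OF \<tau>(2), of 0] by (simp add: Z_def)
 have p1: "(\<Phi> l)^2 * \<tau> ^ (2 * l + 2) <= (fact l)^2 * Cf^2 * T * E ^ l * \<tau>"
 proof -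
  have "(\<Phi> l)^2 <= (Cf * d ^ l * fact l)^2" using \<Phi>_le \<Phi> by (intro power_mono) auto
  moreover have "\<tau> ^ (2 * l + 2) <= T ^ (2 * l + 1) * \<tau>"
  proof -
   have "\<tau> ^ (2 * l + 1) * \<tau> <= T ^ (2 * l + 1) * \<tau>" using \<tau> by (intro mult_right_mono power_mono) auto
   then show ?thesis by (simp add: mult_ac)
  qed
  ultimately have "(\<Phi> l)^2 * \<tau> ^ (2 * l + 2) <= (Cf * d ^ l * fact l)^2 * (T ^ (2 * l + 1) * \<tau>)"
   using \<tau> by (intro mult_mono) auto
  also have "... = (fact l)^2 * Cf^2 * T * ((d * T)^2) ^ l * \<tau>"
   by (simp add: power_mult_distrib power_mult[symmetric] mult_ac)
  also have "... <= (fact l)^2 * Cf^2 * T * E ^ l * \<tau>"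
   using E T \<tau> by (intro mult_right_mono mult_left_mono power_mono) auto
  finally show ?thesis .
 qed
 have p2: "CP * (\<Phi> (Suc l))^2 * \<tau> ^ (2 * l + 3) <= CP * ((fact (Suc l))^2 * Cf^2 * (d * T)^2 * E ^ l * \<tau>)"
 proof -
  have "(\<Phi> (Suc l))^2 <= (Cf * d ^ (Suc l) * fact (Suc l))^2" by (intro power_mono \<Phi>_le \<Phi>)
  moreover have "\<tau> ^ (2 * l + 3) <= T ^ (2 * l + 2) * \<tau>"
  proof -
   have "\<tau> ^ (2 * l + 2) * \<tau> <= T ^ (2 * l + 2) * \<tau>" using \<tau> by (intro mult_right_mono power_mono) auto
   then show ?thesis by (simp add: mult_ac numeral_eq_Suc)
  qed
  ultimately have "(\<Phi> (Suc l))^2 * \<tau> ^ (2 * l + 3) <= (Cf * d ^ (Suc l) * fact (Suc l))^2 * (T ^ (2 * l + 2) * \<tau>)"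
   using \<tau> by (intro mult_mono) auto
  also have "... = (fact (Suc l))^2 * Cf^2 * (d * T)^2 * ((d * T)^2) ^ l * \<tau>"
  proof -
   have "T ^ (2 * l + 2) = T^2 * (T^2) ^ l" by (simp add: power_add power_mult power2_eq_square)
   moreover have "(d ^ Suc l)^2 = d^2 * (d^2) ^ l"
   by (simp add: power_mult_distrib power_mult[symmetric] mult.commute)
   ultimately show ?thesis by (simp only: power_mult_distrib) (simp only: mult_ac)
  qed
  also have "... <= (fact (Suc l))^2 * Cf^2 * (d * T)^2 * E ^ l * \<tau>"
   using E \<tau> by (intro mult_right_mono mult_left_mono power_mono) auto
  finally show ?thesis using CP_pos by (simp add: mult.assoc)
 qed
 have "X (Suc l) \<tau> <= (2 * real l + 2) * ((2 * real l + 1) * X l \<tau> + (\<Phi> l)^2 * \<tau> ^ (2 * l + 2)) + CP * (\<Phi> (Suc l))^2 * \<tau> ^ (2 * l + 3)"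
  using X_Suc_le_Y[OF \<tau>, of l] Y_le_X[OF \<tau>, of l]
  by (meson add_right_mono mult_left_mono order_trans add_nonneg_nonneg mult_nonneg_nonneg of_nat_0_le_iff zero_le_numeral)
 also have "... <= (2 * real l + 2) * ((2 * real l + 2) * (E ^ l * (fact l)^2 * Z) + (fact l)^2 * Cf^2 * T * E ^ l * \<tau>)
   + CP * ((fact (Suc l))^2 * Cf^2 * (d * T)^2 * E ^ l * \<tau>)"
 proof (intro add_mono mult_left_mono p1 p2)
  have "(2 * real l + 1) * X l \<tau> <= (2 * real l + 2) * X l \<tau>"
   using X_nonneg[OF \<tau>(2)] by (intro mult_right_mono) auto
  also have "... <= (2 * real l + 2) * (E ^ l * (fact l)^2 * Z)"
   using Suc by (intro mult_left_mono) (auto simp: E_def Z_def)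
  finally show "(2 * real l + 1) * X l \<tau> <= (2 * real l + 2) * (E ^ l * (fact l)^2 * Z)" .
 qed auto
 also have "(2 * real l + 2) * ((2 * real l + 2) * (E ^ l * (fact l)^2 * Z) + (fact l)^2 * Cf^2 * T * E ^ l * \<tau>)
  = 4 * ((real l + 1)^2 * (fact l)^2) * E ^ l * Z + 2 * (real l + 1) * (fact l)^2 * (Cf^2 * T * E ^ l * \<tau>)"
  by (simp add: algebra_simps power2_eq_square)
 also have "2 * (real l + 1) * (fact l)^2 * (Cf^2 * T * E ^ l * \<tau>) <= 2 * (real l + 1)^2 * (fact l)^2 * (Cf^2 * T * E ^ l * \<tau>)"
 proof -
  have "(real l + 1) * 1 <= (real l + 1) * (real l + 1)" by (intro mult_left_mono) auto
  then have "real l + 1 <= (real l + 1)^2" by (simp add: power2_eq_square)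
  then show ?thesis using T E \<tau> by (intro mult_right_mono mult_left_mono) auto
 qed
 also have f: "(real l + 1)^2 * (fact l)^2 = (fact (Suc l) :: real)^2"
  by (simp add: power_mult_distrib)
 also have "2 * (real l + 1)^2 * (fact l)^2 * (Cf^2 * T * E ^ l * \<tau>) = 2 * (fact (Suc l) :: real)^2 * (Cf^2 * T * E ^ l * \<tau>)"
  unfolding f[symmetric] by (simp add: mult_ac)
 also have "4 * (fact (Suc l))^2 * E ^ l * Z + 2 * (fact (Suc l))^2 * (Cf^2 * T * E ^ l * \<tau>)
   + CP * ((fact (Suc l))^2 * Cf^2 * (d * T)^2 * E ^ l * \<tau>)
   = (fact (Suc l))^2 * E ^ l * (4 * Z + Cf^2 * (2 * T + CP * (d * T)^2) * \<tau>)"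
  by (simp add: algebra_simps)
 also have "... <= (fact (Suc l))^2 * E ^ l * (4 * Z + Z)"
 proof -
  have "Cf^2 * (2 * T + CP * (d * T)^2) * \<tau> <= G * \<tau>"
   unfolding G_def using T \<tau> by (intro mult_right_mono mult_left_mono) auto
  then show ?thesis using Z E by (intro mult_left_mono) auto
 qed
 also have "... <= (fact (Suc l))^2 * E ^ l * (E * Z)"
 proof -
  have "Z >= 0" using Z G \<tau> by (meson mult_nonneg_nonneg order_trans)
  then have "5 * Z <= E * Z" using E by (intro mult_right_mono) auto
  then show ?thesis using E by (intro mult_left_mono) auto
 qed
 finally show ?case by (simp add: E_def Z_def mult_ac)
qed

text \<open>Decay of the energy on \<open>(0, \<tau>)\<close>: the initial value is split into a part that is small in
  the weak norm and a part that is controlled in the energy norm.\<close>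

lemma X_0_bound:
 assumes \<tau>: "0 <= \<tau>" "\<tau> <= T"
  and v: "mm (%i. u 0 0 i - v i) (%i. u 0 0 i - v i) + \<tau> * sq v <= B"
 shows "X 0 \<tau> <= 6 * B + 4 * CP * (\<Phi> 0)^2 * \<tau>"
proof -
 let ?A = "2 * CP * (\<Phi> 0)^2 + 2 * sq v"
 define w where "w t i = u 0 t i - v i" for t i
 have wc: "i \<in> I ==> continuous_on {0..\<tau>} (%t. w t i)" for i
  unfolding w_def by (intro continuous_intros u_cont \<tau>)
 have "0 <= mm (w \<tau>) (w \<tau>)" by (rule mm_nonneg)
 also have "... = mm (w 0) (w 0) + integral {0..\<tau>} (%t. 2 * mm (u 1 t) (w t))"
 proof -
  have "integral {0..\<tau>} (%t. 2 * mm (u 1 t) (w t)) = mm (w \<tau>) (w \<tau>) - mm (w 0) (w 0)"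
  proof (rule integral_FTC[OF \<tau>(1)], rule DERIV_mm)
   fix t i assume "t \<in> {0..\<tau>}" "i \<in> I"
   then show "((%t. w t i) has_real_derivative u 1 t i) (at t within {0..\<tau>})"
   unfolding w_def using u_deriv[of i \<tau> t 0] \<tau> by (auto intro!: derivative_eq_intros)
  qed
  then show ?thesis by simp
 qed
 also have "integral {0..\<tau>} (%t. 2 * mm (u 1 t) (w t))
   <= integral {0..\<tau>} (%t. ?A - sq (w t))"
 proof (rule integral_le)
  fix t assume t: "t \<in> {0..\<tau>}"
  have t': "t \<in> {0..T}" using t \<tau> by auto
  have "mm (u 1 t) (w t) = (\<Sum>k\<in>I. F 0 t k * w t k) - (\<Sum>k\<in>I. u 0 t k * w t k)"
   using flow_tested[OF t', of 0 "w t"] by simp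
  also have "(\<Sum>k\<in>I. u 0 t k * w t k) = sq (w t) + (\<Sum>k\<in>I. v k * w t k)"
   by (simp add: w_def sq_def power2_eq_square sum.distrib[symmetric] ring_distribs sum_subtractf algebra_simps)
  finally have e: "2 * mm (u 1 t) (w t) = 2 * (\<Sum>k\<in>I. F 0 t k * w t k) - 2 * sq (w t) + 2 * (\<Sum>k\<in>I. - v k * w t k)"
   by (simp add: sum_negf)
  have "2 * (\<Sum>k\<in>I. F 0 t k * w t k) <= 2 * CP * (\<Phi> 0)^2 + sq (w t) / 2"
  proof -
   have "mm (w t) (w t) / (2 * CP) <= sq (w t) / 2"
   using mm_le[of "w t"] CP_pos by (simp add: field_simps)
   then show ?thesis using force_le[OF t', of "2 * CP" 0 "w t"] CP_pos by simp
  qed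
  moreover have "2 * (\<Sum>k\<in>I. - v k * w t k) <= 2 * sq v + sq (w t) / 2"
   using cross_le_sq[of 2 "%k. - v k" "w t"] by (simp add: sq_def)
  ultimately show "2 * mm (u 1 t) (w t) <= ?A - sq (w t)"
   unfolding e by simp
 qed (intro cont_int continuous_intros u_cont wc \<tau>; simp)+
 also have "... = ?A * \<tau> - integral {0..\<tau>} (%t. sq (w t))"
  using \<tau> by (subst integral_diff; (intro cont_int continuous_intros wc; simp)?) simp
 finally have 1: "integral {0..\<tau>} (%t. sq (w t)) <= mm (w 0) (w 0) + ?A * \<tau>"
  by simp
 have "X 0 \<tau> <= integral {0..\<tau>} (%t. 2 * sq (w t) + 2 * sq v)"
  unfolding X_def
 proof (rule integral_le)
  fix t
  have "(u 0 t i)^2 <= 2 * (w t i)^2 + 2 * (v i)^2" for i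
   using sum_squares_bound[of "w t i" "v i"] power2_sum[of "w t i" "v i"] by (simp add: w_def)
  then have "sq (u 0 t) <= (\<Sum>i\<in>I. 2 * (w t i)^2 + 2 * (v i)^2)"
   unfolding sq_def by (intro sum_mono)
  then show "t ^ (2 * 0) * sq (u 0 t) <= 2 * sq (w t) + 2 * sq v"
   by (simp add: sq_def sum.distrib sum_distrib_left)
 qed (intro cont_int continuous_intros u_cont wc \<tau>; simp)+
 also have "... = 2 * integral {0..\<tau>} (%t. sq (w t)) + 2 * sq v * \<tau>"
  using \<tau> by (subst integral_add; (intro cont_int continuous_intros wc; simp)?) simp
 also have "... <= 2 * (mm (w 0) (w 0) + ?A * \<tau>) + 2 * sq v * \<tau>"
  using 1 by simp
 also have "... = 2 * mm (w 0) (w 0) + 6 * (\<tau> * sq v) + 4 * CP * (\<Phi> 0)^2 * \<tau>"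
  by (simp add: algebra_simps)
 also have "... <= 6 * B + 4 * CP * (\<Phi> 0)^2 * \<tau>"
  using v mm_nonneg[of "w 0"] by (simp add: w_def[abs_def])
 finally show ?thesis .
qed

end

section \<open>One element of the discontinuous Galerkin method\<close>

lemma power_le_fact_exp: "0 <= x ==> x ^ n <= fact n * exp (x :: real)"
proof -
 assume x: "0 <= x"
 have "(%k. x ^ k /\<^sub>R fact k) sums exp x" by (rule exp_converges)
 then have "(\<Sum>k\<in>{n}. x ^ k /\<^sub>R fact k) <= exp x"
  using x by (intro sum_le_suminf[where I = "{n}", THEN order.trans])
   (auto simp: sums_iff)
 then show ?thesis by (simp add: field_simps)
qed

lemma integral_mono_subset:
 fixes f :: "real => real"
 assumes "continuous_on {0..b} f" "0 <= a" "a <= b" "!!x. x \<in> {0..b} ==> f x >= 0"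
 shows "integral {a..b} f <= integral {0..b} f"
 by (rule integral_subset_le) (use assms in "auto intro!: cont_int intro: continuous_on_subset")

text \<open>The derivative of \<open>t g(t)\<^sup>2\<close> is \<open>g\<^sup>2 + 2 t g g'\<close>. This bounds the end point values that enter
  the stability estimate of the projection on the first element.\<close>

lemma end_value_bound:
 fixes g :: "nat => real => real"
 assumes g: "smooth_seq 0 T g" and b: "0 <= b" "b <= T"
 shows "b * (g 0 b)^2 <= 2 * integral {0..b} (%t. (g 0 t)^2) + integral {0..b} (%t. t^2 * (g 1 t)^2)"
proof -
 have c: "continuous_on {0..b} (g l)" for l
  using smooth_seq_cont[OF g] by (rule continuous_on_subset) (use b in auto)
 have "b * (g 0 b)^2 = b * (g 0 b)^2 - 0 * (g 0 0)^2" by simp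
 also have "... = integral {0..b} (%t. (g 0 t)^2 + t * (2 * g 0 t * g 1 t))"
 proof (rule integral_FTC[symmetric])
  fix t assume t: "t \<in> {0..b}"
  have d: "(g 0 has_real_derivative g 1 t) (at t within {0..b})"
   using g t b unfolding smooth_seq_def
   by (intro DERIV_subset[where t = "{0..b}" and s = "{0..T}"]) auto
  show "((%t. t * (g 0 t)^2) has_real_derivative (g 0 t)^2 + t * (2 * g 0 t * g 1 t)) (at t within {0..b})"
   by (auto intro!: derivative_eq_intros d)
 qed (use b in auto)
 also have "... <= integral {0..b} (%t. 2 * (g 0 t)^2 + t^2 * (g 1 t)^2)"
 proof (rule integral_le)
  fix t assume "t \<in> {0..b}"
  have "2 * g 0 t * (t * g 1 t) <= (g 0 t)^2 + (t * g 1 t)^2" by (rule sum_squares_bound)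
  then show "(g 0 t)^2 + t * (2 * g 0 t * g 1 t) <= 2 * (g 0 t)^2 + t^2 * (g 1 t)^2"
   by (simp add: power_mult_distrib mult_ac)
 qed (auto intro!: cont_int continuous_intros c)
 also have "... = 2 * integral {0..b} (%t. (g 0 t)^2) + integral {0..b} (%t. t^2 * (g 1 t)^2)"
  by (subst integral_add) (auto intro!: cont_int continuous_intros c)
 finally show ?thesis .
qed

lemma smooth_seq_subset:
 assumes "smooth_seq a b g" "a <= a'" "b' <= b"
 shows "smooth_seq a' b' g"
 unfolding smooth_seq_def
proof (intro allI ballI)
 fix l x assume x: "x \<in> {a'..b'}"
 then have "(g l has_real_derivative g (Suc l) x) (at x within {a..b})"
  using assms unfolding smooth_seq_def by simp
 then show "(g l has_real_derivative g (Suc l) x) (at x within {a'..b'})"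
  by (rule DERIV_subset) (use assms in auto)
qed

text \<open>The projection is taken in each coordinate. The weight \<open>t\<^sup>2\<^sup>k \<ge> a\<^sup>2\<^sup>k\<close> on the element converts the
  weighted bound for the \<open>k\<close>-th derivative into an unweighted one.\<close>

lemma element_error_pointwise:
 fixes u :: "nat => real => 'i => real"
 assumes I: "finite I" and u: "!!i. i \<in> I ==> smooth_seq 0 T (%l t. u l t i)"
  and ab: "0 <= a" "a < b" "b <= T"
  and X: "!!l. integral {0..b} (%t. t ^ (2 * l) * (\<Sum>i\<in>I. (u l t i)^2)) <= D ^ l * (fact l)^2 * Z"
  and D: "D >= 1"
 shows "\<exists>p. (\<forall>i\<in>I. degree (p i) <= r & poly (p i) b = u 0 b i &
   (\<forall>q. degree q < r --> integral {a..b} (%x. (u 0 x i - poly (p i) x) * poly q x) = 0)) &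
   integral {a..b} (%x. \<Sum>i\<in>I. (u 0 x i - poly (p i) x)^2) <= (16 * real r ^ 4 + 8) * (4 * D * Z) &
   (\<forall>k \<kappa>. 3 <= k --> 2 * k <= r + 1 --> 0 < a --> b - a <= \<kappa> * a -->
   integral {a..b} (%x. \<Sum>i\<in>I. (u 0 x i - poly (p i) x)^2)
   <= 1024 * (real r - real k + 1) ^ 6 * (\<kappa> / (2 * (real r - real k + 1))) ^ (2 * k)
   * (D ^ k * (fact k)^2 * Z))"
proof -
 let ?A = "%u p. (\<Sum>i\<in>I. integral {a..b} (%x. (u 0 x i - poly (p i) x)^2))"
 have sm: "smooth_seq a b (%l t. u l t i)" if "i \<in> I" for i
  by (rule smooth_seq_subset[OF u[OF that]]) (use ab in auto)
 have c0: "continuous_on {0..b} (%t. u l t i)" if "i \<in> I" for l i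
  using smooth_seq_cont[OF u[OF that]] by (rule continuous_on_subset) (use ab in auto)
 have ca: "continuous_on {a..b} (%t. u l t i)" if "i \<in> I" for l i
  using c0[OF that] by (rule continuous_on_subset) (use ab in auto)
 let ?P = "%i p. degree p <= r & poly p b = u 0 b i &
  (\<forall>q. degree q < r --> integral {a..b} (%x. (u 0 x i - poly p x) * poly q x) = 0) &
  integral {a..b} (%x. (u 0 x i - poly p x)^2)
   <= (16 * real r ^ 4 + 8) * (integral {a..b} (%x. (u 0 x i)^2) + (b - a) * (u 0 b i)^2) &
  (\<forall>k. 3 <= k --> 2 * k <= r + 1 --> integral {a..b} (%x. (u 0 x i - poly p x)^2)
   <= 1024 * (real r - real k + 1) ^ 6 * ((b - a) / (2 * (real r - real k + 1))) ^ (2 * k)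
   * integral {a..b} (%x. (u k x i)^2))"
 have "\<forall>i\<in>I. \<exists>p. ?P i p"
 proof
  fix i assume "i \<in> I"
  from ab(2) sm[OF this] show "\<exists>p. ?P i p"
  proof (rule dg_projection[where r = r])
   fix p assume 1: "degree p <= r" and 2: "poly p b = u 0 b i"
   and 3: "!!q. degree q < r ==> integral {a..b} (%x. (u 0 x i - poly p x) * poly q x) = 0"
   and 4: "integral {a..b} (%x. (u 0 x i - poly p x)^2)
   <= (16 * real r ^ 4 + 8) * (integral {a..b} (%x. (u 0 x i)^2) + (b - a) * (u 0 b i)^2)"
   and 5: "!!k. 3 <= k ==> 2 * k <= r + 1 ==> integral {a..b} (%x. (u 0 x i - poly p x)^2)
   <= 1024 * (real r - real k + 1) ^ 6 * ((b - a) / (2 * (real r - real k + 1))) ^ (2 * k)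
   * integral {a..b} (%x. (u k x i)^2)"
   show "\<exists>p. ?P i p" by (intro exI[of _ p] conjI allI impI 1 2 3 4 5)
  qed
 qed
 then obtain p where p': "\<forall>i\<in>I. ?P i (p i)" by (rule bchoice[THEN exE])
 have p: "?P i (p i)" if "i \<in> I" for i using p' that by (rule bspec)
 have X0: "(\<Sum>i\<in>I. integral {0..b} (%t. t ^ (2 * l) * (u l t i)^2)) <= D ^ l * (fact l)^2 * Z" for l
 proof -
  have "(\<Sum>i\<in>I. integral {0..b} (%t. t ^ (2 * l) * (u l t i)^2)) = integral {0..b} (%t. \<Sum>i\<in>I. t ^ (2 * l) * (u l t i)^2)"
   by (rule integral_sum[symmetric]) (auto intro!: I cont_int continuous_intros c0)
  then show ?thesis using X[of l] by (simp add: sum_distrib_left)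
 qed
 have int_sum: "integral {a..b} (%x. \<Sum>i\<in>I. (u 0 x i - poly (p i) x)^2) = (?A u p)"
  by (rule integral_sum) (auto intro!: I cont_int continuous_intros ca)
 show ?thesis
 proof (intro exI[of _ p] conjI ballI allI impI)
  fix i assume i: "i \<in> I"
  show "degree (p i) <= r" "poly (p i) b = u 0 b i" using p[OF i] by auto
  show "integral {a..b} (%x. (u 0 x i - poly (p i) x) * poly q x) = 0" if "degree q < r" for q
   using p[OF i] that by blast
 next
  have "(?A u p)
   <= (\<Sum>i\<in>I. (16 * real r ^ 4 + 8) * (3 * integral {0..b} (%t. t ^ (2 * 0) * (u 0 t i)^2) + integral {0..b} (%t. t ^ (2 * 1) * (u 1 t i)^2)))"
  proof (rule sum_mono)
   fix i assume i: "i \<in> I"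
   have "(b - a) * (u 0 b i)^2 <= b * (u 0 b i)^2" using ab by (intro mult_right_mono) auto
   also have "... <= 2 * integral {0..b} (%t. (u 0 t i)^2) + integral {0..b} (%t. t^2 * (u 1 t i)^2)"
   using end_value_bound[OF u[OF i], of b] ab by simp
   moreover have "integral {a..b} (%x. (u 0 x i)^2) <= integral {0..b} (%x. (u 0 x i)^2)"
   using ab by (intro integral_mono_subset continuous_intros c0 i) auto
   ultimately have "integral {a..b} (%x. (u 0 x i)^2) + (b - a) * (u 0 b i)^2
   <= 3 * integral {0..b} (%t. t ^ (2 * 0) * (u 0 t i)^2) + integral {0..b} (%t. t ^ (2 * 1) * (u 1 t i)^2)"
   by simp
   then have "(16 * real r ^ 4 + 8) * (integral {a..b} (%x. (u 0 x i)^2) + (b - a) * (u 0 b i)^2)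
   <= (16 * real r ^ 4 + 8) * (3 * integral {0..b} (%t. t ^ (2 * 0) * (u 0 t i)^2) + integral {0..b} (%t. t ^ (2 * 1) * (u 1 t i)^2))"
   by (intro mult_left_mono) auto
   then show "integral {a..b} (%x. (u 0 x i - poly (p i) x)^2) <= ..."
   using p[OF i] by linarith
  qed
  also have "... = (16 * real r ^ 4 + 8) * (3 * (\<Sum>i\<in>I. integral {0..b} (%t. t ^ (2 * 0) * (u 0 t i)^2))
   + (\<Sum>i\<in>I. integral {0..b} (%t. t ^ (2 * 1) * (u 1 t i)^2)))"
   by (simp add: sum.distrib flip: sum_distrib_left)
  also have "... <= (16 * real r ^ 4 + 8) * (3 * (D ^ 0 * (fact 0)^2 * Z) + D ^ 1 * (fact 1)^2 * Z)"
   by (intro mult_left_mono add_mono X0) auto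
  also have "... <= (16 * real r ^ 4 + 8) * (4 * D * Z)"
  proof -
   have "0 <= (\<Sum>i\<in>I. integral {0..b} (%t. t ^ (2 * 0) * (u 0 t i)^2))"
   by (intro sum_nonneg integral_nonneg cont_int continuous_intros c0) auto
   then have "Z >= 0" using X0[of 0] by simp
   then have "1 * Z <= D * Z" using D by (intro mult_right_mono)
   then show ?thesis by (intro mult_left_mono) auto
  qed
  finally show "integral {a..b} (%x. \<Sum>i\<in>I. (u 0 x i - poly (p i) x)^2) <= (16 * real r ^ 4 + 8) * (4 * D * Z)"
   unfolding int_sum .
 next
  fix k :: nat and \<kappa> :: real assume k: "3 <= k" "2 * k <= r + 1" and a: "0 < a" "b - a <= \<kappa> * a"
  define R where "R = real r - real k + 1"
  have R: "R > 0" using k by (simp add: R_def)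
  have "(?A u p)
   <= (\<Sum>i\<in>I. 1024 * R ^ 6 * (\<kappa> / (2 * R)) ^ (2 * k) * integral {0..b} (%t. t ^ (2 * k) * (u k t i)^2))"
  proof (rule sum_mono)
   fix i assume i: "i \<in> I"
   have "integral {a..b} (%x. (u 0 x i - poly (p i) x)^2) <= 1024 * R ^ 6 * ((b - a) / (2 * R)) ^ (2 * k) * integral {a..b} (%x. (u k x i)^2)"
   using p[OF i] k unfolding R_def by blast
   also have "... <= 1024 * R ^ 6 * (\<kappa> * a / (2 * R)) ^ (2 * k) * integral {a..b} (%x. (u k x i)^2)"
   using ab a R
   by (intro mult_right_mono mult_left_mono power_mono divide_right_mono integral_nonneg cont_int continuous_intros ca i) auto
   also have "... = 1024 * R ^ 6 * (\<kappa> / (2 * R)) ^ (2 * k) * integral {a..b} (%x. a ^ (2 * k) * (u k x i)^2)"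
   by (simp add: power_mult_distrib power_divide)
   also have "... <= 1024 * R ^ 6 * (\<kappa> / (2 * R)) ^ (2 * k) * integral {0..b} (%t. t ^ (2 * k) * (u k t i)^2)"
   proof (intro mult_left_mono)
   have "integral {a..b} (%x. a ^ (2 * k) * (u k x i)^2) <= integral {a..b} (%t. t ^ (2 * k) * (u k t i)^2)"
   by (rule integral_le) (use a in "auto intro!: cont_int continuous_intros ca i mult_right_mono power_mono")
   also have "... <= integral {0..b} (%t. t ^ (2 * k) * (u k t i)^2)"
   using ab by (intro integral_mono_subset continuous_intros c0 i) auto
   finally show "integral {a..b} (%x. a ^ (2 * k) * (u k x i)^2) <= integral {0..b} (%t. t ^ (2 * k) * (u k t i)^2)" .
   qed (use R in auto)
   finally show "integral {a..b} (%x. (u 0 x i - poly (p i) x)^2) <= 1024 * R ^ 6 * (\<kappa> / (2 * R)) ^ (2 * k) * integral {0..b} (%t. t ^ (2 * k) * (u k t i)^2)" .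
  qed
  also have "... <= 1024 * R ^ 6 * (\<kappa> / (2 * R)) ^ (2 * k) * (D ^ k * (fact k)^2 * Z)"
   unfolding sum_distrib_left[symmetric] using R by (intro mult_left_mono X0) auto
  finally show "integral {a..b} (%x. \<Sum>i\<in>I. (u 0 x i - poly (p i) x)^2)
   <= 1024 * (real r - real k + 1) ^ 6 * (\<kappa> / (2 * (real r - real k + 1))) ^ (2 * k) * (D ^ k * (fact k)^2 * Z)"
   unfolding int_sum R_def .
 qed
qed

lemma fact_le_self_power: "(fact k :: real) <= real k ^ k"
 using fact_le_power[of k, where 'a = real] by simp

text \<open>The order \<open>k\<close> of the derivative that is used is a small fixed multiple of the degree
  \<open>r\<close>, which turns the estimate of the preceding lemma into exponential convergence in \<open>r\<close>.
  For the finitely many degrees for which \<open>k < 3\<close>, and on the first element, where no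
  derivative is controlled uniformly, the stability bound is enough.\<close>

lemma element_error:
 fixes D \<kappa> T :: real and r1 :: nat
 assumes D: "D >= 1" and \<kappa>: "\<kappa> >= 0"
 obtains C \<gamma> where "C > 0" "\<gamma> > 0"
  "!!(I :: 'i set) u a b Z r.
   finite I ==> (!!i. i \<in> I ==> smooth_seq 0 T (%l t. u l t i)) ==> 0 <= a ==> a < b ==> b <= T ==>
   (!!l. integral {0..b} (%t. t ^ (2 * l) * (\<Sum>i\<in>I. (u l t i)^2)) <= D ^ l * (fact l)^2 * Z) ==>
   a = 0 & r <= r1 \<or> a > 0 & b - a <= \<kappa> * a ==>
   \<exists>p. (\<forall>i\<in>I. degree (p i) <= r & poly (p i) b = u 0 b i &
   (\<forall>q. degree q < r --> integral {a..b} (%x. (u 0 x i - poly (p i) x) * poly q x) = 0)) &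
   integral {a..b} (%x. \<Sum>i\<in>I. (u 0 x i - poly (p i) x)^2) <= C * exp (- \<gamma> * real r) * Z"
proof -
 define \<delta> where "\<delta> = min (1 / 4) (exp (-1) / (\<kappa> * sqrt D + 1))"
 have kD: "\<kappa> * sqrt D >= 0" using D \<kappa> by simp
 have \<delta>: "\<delta> > 0" "\<delta> <= 1 / 4" using kD by (auto simp: \<delta>_def min_def intro!: divide_pos_pos)
 have \<delta>': "\<kappa> * sqrt D * \<delta> <= exp (-1)"
 proof -
  have "\<kappa> * sqrt D * \<delta> <= (\<kappa> * sqrt D + 1) * (exp (-1) / (\<kappa> * sqrt D + 1))"
   using kD \<delta> by (intro mult_mono) (auto simp: \<delta>_def)
  also have "... = exp (-1)" using kD by (simp add: add_nonneg_eq_0_iff)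
  finally show ?thesis .
 qed
 define r2 where "r2 = max (real r1) (3 / \<delta>)"
 define C1 where "C1 = (16 * r2 ^ 4 + 8) * (4 * D) * exp (\<delta> * r2)"
 define C2 where "C2 = 1024 * (720 / \<delta> ^ 6 * exp \<delta>) * exp 2"
 have r2: "r2 >= 0" using \<delta> by (simp add: r2_def)
 have C1: "C1 > 0" unfolding C1_def using D r2 by (intro mult_pos_pos add_nonneg_pos) auto
 have C2: "C2 > 0" unfolding C2_def using \<delta> by simp
 show thesis
 proof (rule that[of "C1 + C2" \<delta>])
  fix I :: "'i set" and u a b Z r
  assume I: "finite I" and u: "!!i. i \<in> I ==> smooth_seq 0 T (%l t. u l t i)" and
   ab: "0 <= a" "a < b" "b <= T" and
   X: "!!l. integral {0..b} (%t. t ^ (2 * l) * (\<Sum>i\<in>I. (u l t i)^2)) <= D ^ l * (fact l)^2 * Z" and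
   cases: "a = 0 & r <= r1 \<or> a > 0 & b - a <= \<kappa> * a"
  obtain p where
   p: "\<forall>i\<in>I. degree (p i) <= r & poly (p i) b = u 0 b i &
   (\<forall>q. degree q < r --> integral {a..b} (%x. (u 0 x i - poly (p i) x) * poly q x) = 0)"
   and stab: "integral {a..b} (%x. \<Sum>i\<in>I. (u 0 x i - poly (p i) x)^2) <= (16 * real r ^ 4 + 8) * (4 * D * Z)"
   and conv': "\<forall>k \<kappa>. 3 <= k --> 2 * k <= r + 1 --> 0 < a --> b - a <= \<kappa> * a -->
   integral {a..b} (%x. \<Sum>i\<in>I. (u 0 x i - poly (p i) x)^2)
   <= 1024 * (real r - real k + 1) ^ 6 * (\<kappa> / (2 * (real r - real k + 1))) ^ (2 * k)
   * (D ^ k * (fact k)^2 * Z)"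
   by (rule exE[OF element_error_pointwise[OF I u ab X D, of r]], assumption)
   (elim conjE, rule that; assumption)
  note conv = conv'[rule_format]
  have Z: "Z >= 0"
  proof -
   have "0 <= integral {0..b} (%t. t ^ (2 * 0) * (\<Sum>i\<in>I. (u 0 t i)^2))"
   proof (intro integral_nonneg cont_int continuous_intros)
   show "continuous_on {0..b} (%t. u 0 t i)" if "i \<in> I" for i
   by (rule continuous_on_subset[OF smooth_seq_cont[OF u[OF that]]]) (use ab in auto)
   qed (auto intro!: sum_nonneg)
   then show ?thesis using X[of 0] by simp
  qed
  have "integral {a..b} (%x. \<Sum>i\<in>I. (u 0 x i - poly (p i) x)^2) <= (C1 + C2) * exp (- \<delta> * real r) * Z"
  proof (cases "real r <= r2")
   case True
   have "(16 * real r ^ 4 + 8) * (4 * D * Z) <= (16 * r2 ^ 4 + 8) * (4 * D * Z)"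
   using True D Z by (intro mult_right_mono add_mono mult_left_mono power_mono) auto
   also have "... = C1 * exp (- \<delta> * r2) * Z"
   by (simp add: C1_def exp_minus field_simps)
   also have "... <= C1 * exp (- \<delta> * real r) * Z"
   using True \<delta> C1 Z by (intro mult_right_mono mult_left_mono) auto
   also have "... <= (C1 + C2) * exp (- \<delta> * real r) * Z"
   using C2 Z by (intro mult_right_mono) auto
   finally show ?thesis using stab by linarith
  next
   case False
   then have r: "real r > real r1" "real r > 3 / \<delta>" by (auto simp: r2_def)
   then have a: "a > 0" "b - a <= \<kappa> * a" using cases by auto
   define k where "k = nat \<lfloor>\<delta> * real r\<rfloor>"
   have dr: "\<delta> * real r > 3" using r(2) \<delta> by (simp add: field_simps)
   then have k3: "3 <= k" by (simp add: k_def le_nat_floor le_nat_iff le_floor_iff)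
   have kle: "real k <= \<delta> * real r" using dr by (simp add: k_def)
   have kge: "real k >= \<delta> * real r - 1" unfolding k_def using dr by linarith
   have "\<delta> * real r <= 1 / 4 * real r" using \<delta> by (intro mult_right_mono) auto
   then have k4: "4 * real k <= real r" using kle by linarith
   define R where "R = real r - real k + 1"
   have R: "2 * R >= real r" "R <= real r + 1" "R > 0" using k4 by (auto simp: R_def)
   have rpos: "real r > 0" using k4 k3 by linarith
   have q: "\<kappa> / (2 * R) * (sqrt D * real k) <= exp (-1)"
   proof -
   have "\<kappa> / (2 * R) * (sqrt D * real k) <= \<kappa> / real r * (sqrt D * (\<delta> * real r))"
   using R \<kappa> D rpos kle by (intro mult_mono divide_left_mono) auto
   also have "... = \<kappa> * sqrt D * \<delta>" using rpos by simp
   finally show ?thesis using \<delta>' by linarith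
   qed
   have q0: "\<kappa> / (2 * R) * (sqrt D * real k) >= 0" using R \<kappa> D by simp
   have "(\<kappa> / (2 * R)) ^ (2 * k) * (D ^ k * (fact k)^2 * Z) <= (\<kappa> / (2 * R)) ^ (2 * k) * (D ^ k * (real k ^ k)^2 * Z)"
   using Z D R \<kappa> by (intro mult_left_mono mult_right_mono power_mono fact_le_self_power) auto
   also have "... = (\<kappa> / (2 * R) * (sqrt D * real k)) ^ (2 * k) * Z"
   proof -
   have "sqrt D ^ (2 * k) = D ^ k" using D by (simp add: power_mult)
   moreover have "(real k ^ k)^2 = real k ^ (2 * k)" by (simp add: mult.commute flip: power_mult)
   ultimately show ?thesis by (simp only: power_mult_distrib)
   qed
   also have "... <= exp (-1) ^ (2 * k) * Z"
   using q q0 Z by (intro mult_right_mono power_mono)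
   also have "exp (-1 :: real) ^ (2 * k) = exp (- 2 * real k)"
   by (simp add: exp_of_nat_mult[symmetric])
   also have "exp (- 2 * real k) * Z <= exp (2 - 2 * \<delta> * real r) * Z"
   using kge Z by (intro mult_right_mono) auto
   finally have 1: "(\<kappa> / (2 * R)) ^ (2 * k) * (D ^ k * (fact k)^2 * Z) <= exp (2 - 2 * \<delta> * real r) * Z" .
   have R6: "R ^ 6 <= 720 / \<delta> ^ 6 * exp \<delta> * exp (\<delta> * real r)"
   proof -
   have "(\<delta> * R) ^ 6 <= fact 6 * exp (\<delta> * R)"
   using \<delta> R by (intro power_le_fact_exp) auto
   also have "... <= fact 6 * exp (\<delta> * (real r + 1))"
   using \<delta> R by (intro mult_left_mono) auto
   also have "... = 720 * (exp \<delta> * exp (\<delta> * real r))"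
   by (simp add: fact_numeral distrib_left exp_add mult.commute)
   finally show ?thesis using \<delta> by (simp add: field_simps power_mult_distrib)
   qed
   have "integral {a..b} (%x. \<Sum>i\<in>I. (u 0 x i - poly (p i) x)^2)
   <= 1024 * R ^ 6 * ((\<kappa> / (2 * R)) ^ (2 * k) * (D ^ k * (fact k)^2 * Z))"
   using conv[OF k3 _ a] k4 by (simp add: R_def mult.assoc)
   also have "... <= 1024 * (720 / \<delta> ^ 6 * exp \<delta> * exp (\<delta> * real r)) * (exp (2 - 2 * \<delta> * real r) * Z)"
   by (rule mult_mono[OF mult_left_mono[OF R6] 1]) (use \<delta> D Z in auto)
   also have "... = C2 * (exp (\<delta> * real r) * exp (- 2 * \<delta> * real r)) * Z"
   by (simp add: C2_def exp_diff exp_minus field_simps)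
   also have "exp (\<delta> * real r) * exp (- 2 * \<delta> * real r) = exp (- \<delta> * real r)"
   by (simp flip: exp_add)
   also have "C2 * exp (- \<delta> * real r) * Z <= (C1 + C2) * exp (- \<delta> * real r) * Z"
   using C1 Z by (intro mult_right_mono) auto
   finally show ?thesis .
  qed
  with p show "\<exists>p. (\<forall>i\<in>I. degree (p i) <= r & poly (p i) b = u 0 b i &
   (\<forall>q. degree q < r --> integral {a..b} (%x. (u 0 x i - poly (p i) x) * poly q x) = 0)) &
   integral {a..b} (%x. \<Sum>i\<in>I. (u 0 x i - poly (p i) x)^2) <= (C1 + C2) * exp (- \<delta> * real r) * Z"
   by (intro exI[of _ p] conjI)
 qed (use C1 C2 \<delta> in auto)
qed

context semidiscrete_flow
begin

text \<open>The energy identity of the method on one element. The functional \<open>\<Sum>k\<in>I. e k * v k\<close>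
  is the defect of the value that is passed on from the preceding element.\<close>

lemma dg_element:
 fixes P p :: "'a => real poly" and w :: "'a => real"
 assumes ab: "0 <= a" "a < b" "b <= T"
  and P: "!!i. i \<in> I ==> degree (P i) <= r"
  and p: "!!i. i \<in> I ==> degree (p i) <= r" "!!i. i \<in> I ==> poly (p i) b = u 0 b i"
   "!!i q. i \<in> I ==> degree q < r ==> integral {a..b} (%x. (u 0 x i - poly (p i) x) * poly q x) = 0"
  and dg: "!!k q. k \<in> I ==> degree q <= r ==>
   integral {a..b} (%t. ((\<Sum>i\<in>I. m i k * poly (pderiv (P i)) t) + poly (P k) t - F 0 t k) * poly q t)
   + ((\<Sum>i\<in>I. m i k * poly (P i) a) - w k) * poly q a = 0"
  and w: "!!v. 2 * (\<Sum>k\<in>I. (w k - (\<Sum>i\<in>I. m i k * u 0 a i)) * v k) <= E + mm v v"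
 defines "\<theta> \<equiv> %i. P i - p i"
 shows "mm (%i. poly (\<theta> i) b) (%i. poly (\<theta> i) b) + integral {a..b} (%t. sq (%i. poly (\<theta> i) t))
  <= E + integral {a..b} (%t. sq (%i. u 0 t i - poly (p i) t))"
proof -
 let ?A = "%k t \<eta>. (\<Sum>i\<in>I. m i k * poly (pderiv (\<theta> i)) t) + poly (\<theta> k) t - \<eta> k t"
 let ?B = "%t i p. u 1 t i - poly (pderiv (p i)) t"
 let ?C = "%t. %i. poly (pderiv (\<theta> i)) t"
 let ?D = "%\<eta>. %t. \<Sum>k\<in>I. \<eta> k t * poly (\<theta> k) t"
 have ca: "continuous_on {a..b} (%t. u l t i)" if "i \<in> I" for l i
  using u_cont[OF that ab(3)] by (rule continuous_on_subset) (use ab in auto)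
 define \<eta> where "\<eta> i t = u 0 t i - poly (p i) t" for i t
 have c\<eta>: "continuous_on {a..b} (\<eta> i)" if "i \<in> I" for i
  unfolding \<eta>_def by (intro continuous_intros ca that)
 have \<eta>b: "\<eta> i b = 0" if "i \<in> I" for i using p(2)[OF that] by (simp add: \<eta>_def)
 have d\<eta>: "(\<eta> i has_real_derivative u 1 t i - poly (pderiv (p i)) t) (at t within {a..b})"
  if "i \<in> I" "t \<in> {a..b}" for i t
 proof -
  have "((%t. u 0 t i) has_real_derivative u 1 t i) (at t within {a..b})"
   using u_deriv[OF that(1) ab(3), of t 0] that ab by (auto intro: DERIV_subset)
  then show ?thesis unfolding \<eta>_def by (intro DERIV_diff poly_DERIV[THEN DERIV_subset]) auto
 qed
 have parts: "integral {a..b} (%t. (?B t i p) * poly q t) = - \<eta> i a * poly q a"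
  if i: "i \<in> I" and q: "degree q <= r" for i q
 proof -
  have "integral {a..b} (%t. (?B t i p) * poly q t + poly (pderiv q) t * \<eta> i t)
   = \<eta> i b * poly q b - \<eta> i a * poly q a"
   using ab by (intro integral_FTC DERIV_mult d\<eta> i poly_DERIV[THEN DERIV_subset]) auto
  also have "integral {a..b} (%t. (?B t i p) * poly q t + poly (pderiv q) t * \<eta> i t)
   = integral {a..b} (%t. (?B t i p) * poly q t) + integral {a..b} (%t. poly (pderiv q) t * \<eta> i t)"
   by (intro integral_add cont_int continuous_intros ca c\<eta> i)
  also have "integral {a..b} (%t. poly (pderiv q) t * \<eta> i t) = 0"
  proof (cases "degree q = 0")
   case True
   then have "pderiv q = 0" by (simp add: pderiv_eq_0_iff)
   then show ?thesis by simp
  next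
   case False
   then have "degree (pderiv q) < r" using q by (simp add: degree_pderiv)
   from p(3)[OF i this] show ?thesis by (simp add: \<eta>_def mult.commute)
  qed
  finally show ?thesis using \<eta>b[OF i] by simp
 qed
 define e where "e k = w k - (\<Sum>i\<in>I. m i k * u 0 a i)" for k
 have err: "integral {a..b} (%t. (?A k t \<eta>) * poly q t)
   + ((\<Sum>i\<in>I. m i k * poly (\<theta> i) a) - e k) * poly q a = 0" if k: "k \<in> I" and q: "degree q <= r" for k q
 proof -
  have "integral {a..b} (%t. ((\<Sum>i\<in>I. m i k * poly (pderiv (P i)) t) + poly (P k) t - F 0 t k) * poly q t)
   = integral {a..b} (%t. (?A k t \<eta>) * poly q t
   - (\<Sum>i\<in>I. m i k * ((?B t i p) * poly q t)))"
  proof (rule integral_cong)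
   fix t assume t: "t \<in> {a..b}"
   have F: "F 0 t k = (\<Sum>i\<in>I. m i k * u 1 t i) + u 0 t k"
   using flow[of t k 0] t ab k by simp
   show "((\<Sum>i\<in>I. m i k * poly (pderiv (P i)) t) + poly (P k) t - F 0 t k) * poly q t
   = (?A k t \<eta>) * poly q t
   - (\<Sum>i\<in>I. m i k * ((?B t i p) * poly q t))"
   by (simp add: F \<theta>_def \<eta>_def pderiv_diff ring_distribs sum.distrib sum_subtractf sum_distrib_right
   mult.assoc right_diff_distrib left_diff_distrib)
  qed
  also have "... = integral {a..b} (%t. (?A k t \<eta>) * poly q t)
   - integral {a..b} (%t. \<Sum>i\<in>I. m i k * ((?B t i p) * poly q t))"
   by (intro integral_diff cont_int continuous_intros ca c\<eta> k)
  also have "integral {a..b} (%t. \<Sum>i\<in>I. m i k * ((?B t i p) * poly q t))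
   = (\<Sum>i\<in>I. integral {a..b} (%t. m i k * ((?B t i p) * poly q t)))"
   by (rule integral_sum) (auto intro!: fin cont_int continuous_intros ca)
  also have "... = (\<Sum>i\<in>I. m i k * (- \<eta> i a * poly q a))"
   by (intro sum.cong refl) (simp only: parts q integral_mult_right)
  finally have "integral {a..b} (%t. (?A k t \<eta>) * poly q t)
   - (\<Sum>i\<in>I. m i k * (- \<eta> i a * poly q a)) + ((\<Sum>i\<in>I. m i k * poly (P i) a) - w k) * poly q a = 0"
   using dg[OF k q] by simp
  moreover have "- (\<Sum>i\<in>I. m i k * (- \<eta> i a * poly q a)) + ((\<Sum>i\<in>I. m i k * poly (P i) a) - w k) * poly q a
   = ((\<Sum>i\<in>I. m i k * poly (\<theta> i) a) - e k) * poly q a"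
   by (simp add: \<theta>_def \<eta>_def e_def sum_negf[symmetric] sum_distrib_right sum.distrib sum_subtractf ring_distribs mult.assoc
   right_diff_distrib left_diff_distrib)
  ultimately show ?thesis by linarith
 qed
 let ?th = "%t i. poly (\<theta> i) t"
 have deg\<theta>: "degree (\<theta> k) <= r" if "k \<in> I" for k
  unfolding \<theta>_def using P[OF that] p(1)[OF that] by (rule degree_diff_le)
 have "0 = (\<Sum>k\<in>I. integral {a..b} (%t. (?A k t \<eta>) * poly (\<theta> k) t)
   + ((\<Sum>i\<in>I. m i k * poly (\<theta> i) a) - e k) * poly (\<theta> k) a)"
  by (rule sum.neutral[symmetric]) (use err deg\<theta> in blast)
 also have "... = (\<Sum>k\<in>I. integral {a..b} (%t. (?A k t \<eta>) * poly (\<theta> k) t))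
   + (mm (?th a) (?th a) - (\<Sum>k\<in>I. e k * poly (\<theta> k) a))"
  by (simp add: sum.distrib mm_alt left_diff_distrib sum_subtractf)
 also have "(\<Sum>k\<in>I. integral {a..b} (%t. (?A k t \<eta>) * poly (\<theta> k) t))
   = integral {a..b} (%t. \<Sum>k\<in>I. (?A k t \<eta>) * poly (\<theta> k) t)"
  by (rule integral_sum[symmetric]) (auto intro!: fin cont_int continuous_intros c\<eta>)
 also have "... = integral {a..b} (%t. mm (?C t) (?th t) + (sq (?th t) - (\<Sum>k\<in>I. \<eta> k t * poly (\<theta> k) t)))"
  by (simp add: mm_alt sq_def power2_eq_square ring_distribs sum.distrib sum_subtractf algebra_simps)
 also have "... = integral {a..b} (%t. mm (?C t) (?th t))
  + (integral {a..b} (%t. sq (?th t)) - integral {a..b} (?D \<eta>))"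
  by (subst integral_add integral_diff; (intro cont_int continuous_intros c\<eta>; simp)?)+ simp
 finally have id: "integral {a..b} (%t. mm (?C t) (?th t)) + integral {a..b} (%t. sq (?th t))
   + mm (?th a) (?th a) = integral {a..b} (?D \<eta>) + (\<Sum>k\<in>I. e k * poly (\<theta> k) a)"
  by linarith
 have "2 * integral {a..b} (%t. mm (?C t) (?th t))
   = integral {a..b} (%t. 2 * mm (?C t) (?th t))" by simp
 also have "... = mm (?th b) (?th b) - mm (?th a) (?th a)"
  using ab by (intro integral_FTC DERIV_mm poly_DERIV[THEN DERIV_subset]) auto
 finally have 1: "2 * integral {a..b} (%t. mm (?C t) (?th t)) = mm (?th b) (?th b) - mm (?th a) (?th a)" .
 have "2 * integral {a..b} (?D \<eta>) = integral {a..b} (%t. 2 * (\<Sum>k\<in>I. \<eta> k t * poly (\<theta> k) t))" by simp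
 also have "... <= integral {a..b} (%t. sq (%i. \<eta> i t) + sq (?th t))"
  by (rule integral_le)
   (use cross_le_sq[of 1] in "auto intro!: cont_int continuous_intros c\<eta>")
 also have "... = integral {a..b} (%t. sq (%i. \<eta> i t)) + integral {a..b} (%t. sq (?th t))"
  by (intro integral_add cont_int continuous_intros c\<eta>)
 finally have 2: "2 * integral {a..b} (?D \<eta>) <= integral {a..b} (%t. sq (%i. \<eta> i t)) + integral {a..b} (%t. sq (?th t))" .
 have 3: "2 * (\<Sum>k\<in>I. e k * poly (\<theta> k) a) <= E + mm (?th a) (?th a)"
  using w[of "?th a"] by (simp add: e_def)
 have "mm (?th b) (?th b) + integral {a..b} (%t. sq (?th t)) <= E + integral {a..b} (%t. sq (%i. \<eta> i t))"
  using id 1 2 3 by linarith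
 then show ?thesis by (simp add: \<eta>_def)
qed

end

section \<open>Exponential convergence on the geometric mesh\<close>

context semidiscrete_flow
begin

text \<open>The element estimates telescope: the defect passed on by an element is the mass norm of its
  error at the right end point.\<close>

lemma dg_total:
 fixes tn :: "nat => real" and P p :: "nat => 'a => real poly" and r :: "nat => nat" and g :: "'a => real"
 assumes tn: "tn 0 = 0" "!!j. j \<in> {1..J} ==> tn (j - 1) < tn j" "!!j. j <= J ==> 0 <= tn j & tn j <= T"
  and P: "!!j i. j \<in> {1..J} ==> i \<in> I ==> degree (P j i) <= r j"
  and p: "!!j i. j \<in> {1..J} ==> i \<in> I ==> degree (p j i) <= r j"
   "!!j i. j \<in> {1..J} ==> i \<in> I ==> poly (p j i) (tn j) = u 0 (tn j) i"
   "!!j i q. j \<in> {1..J} ==> i \<in> I ==> degree q < r j ==>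
   integral {tn (j - 1)..tn j} (%x. (u 0 x i - poly (p j i) x) * poly q x) = 0"
  and dg: "!!j k q. j \<in> {1..J} ==> k \<in> I ==> degree q <= r j ==>
   integral {tn (j - 1)..tn j} (%t. ((\<Sum>i\<in>I. m i k * poly (pderiv (P j i)) t) + poly (P j k) t - F 0 t k) * poly q t)
   + ((\<Sum>i\<in>I. m i k * poly (P j i) (tn (j - 1)))
   - (if j = 1 then g k else \<Sum>i\<in>I. m i k * poly (P (j - 1) i) (tn (j - 1)))) * poly q (tn (j - 1)) = 0"
  and g: "!!v. 2 * (\<Sum>k\<in>I. (g k - (\<Sum>i\<in>I. m i k * u 0 0 i)) * v k) <= E + mm v v"
 shows "(\<Sum>j=1..J. integral {tn (j - 1)..tn j} (%t. sq (%i. u 0 t i - poly (P j i) t)))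
  <= 2 * E + 4 * (\<Sum>j=1..J. integral {tn (j - 1)..tn j} (%t. sq (%i. u 0 t i - poly (p j i) t)))"
proof -
 define \<theta> where "\<theta> j i = P j i - p j i" for j i
 define A where "A j = integral {tn (j - 1)..tn j} (%t. sq (%i. poly (\<theta> j i) t))" for j
 define B where "B j = integral {tn (j - 1)..tn j} (%t. sq (%i. u 0 t i - poly (p j i) t))" for j
 define E' where "E' j = (if j = 0 then E else mm (%i. poly (\<theta> j i) (tn j)) (%i. poly (\<theta> j i) (tn j)))" for j
 have step: "E' j + A j <= E' (j - 1) + B j" if j: "j \<in> {1..J}" for j
 proof -
  have tnj: "0 <= tn (j - 1)" "tn j <= T" using tn(3)[of "j - 1"] tn(3)[of j] j by auto
  define w where "w k = (if j = 1 then g k else \<Sum>i\<in>I. m i k * poly (P (j - 1) i) (tn (j - 1)))" for k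
  have w: "2 * (\<Sum>k\<in>I. (w k - (\<Sum>i\<in>I. m i k * u 0 (tn (j - 1)) i)) * v k) <= E' (j - 1) + mm v v" for v
  proof (cases "j = 1")
   case True
   then show ?thesis using g[of v] by (simp add: w_def E'_def tn(1))
  next
   case False
   then have j': "j - 1 \<in> {1..J}" using j by auto
   have "(\<Sum>k\<in>I. (w k - (\<Sum>i\<in>I. m i k * u 0 (tn (j - 1)) i)) * v k) = mm (%i. poly (\<theta> (j - 1) i) (tn (j - 1))) v"
   unfolding mm_alt \<theta>_def using False p(2)[OF j']
   by (intro sum.cong refl) (simp add: w_def sum_subtractf right_diff_distrib)
   then show ?thesis using mm_two[of "%i. poly (\<theta> (j - 1) i) (tn (j - 1))" v] False j by (simp add: E'_def)
  qed
  from dg_element[OF tnj(1) tn(2)[OF j] tnj(2) P[OF j] p[OF j] dg[OF j, folded w_def] w]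
  show ?thesis using j by (simp add: E'_def A_def B_def \<theta>_def)
 qed
 have "n <= J ==> E' n + (\<Sum>j=1..n. A j) <= E + (\<Sum>j=1..n. B j)" for n
 proof (induction n)
  case 0
  then show ?case by (simp add: E'_def)
 next
  case (Suc n)
  then show ?case using step[of "Suc n"] by simp
 qed
 from this[of J] have AB: "(\<Sum>j=1..J. A j) <= E + (\<Sum>j=1..J. B j)"
 proof -
  have "E' J >= 0 \<or> J = 0" using mm_nonneg by (simp add: E'_def)
  moreover have "E >= 0" using g[of "%_. 0"] by (simp add: mm_def)
  ultimately show ?thesis using \<open>J <= J ==> E' J + (\<Sum>j=1..J. A j) <= E + (\<Sum>j=1..J. B j)\<close> by (auto simp: E'_def)
 qed
 have "(\<Sum>j=1..J. integral {tn (j - 1)..tn j} (%t. sq (%i. u 0 t i - poly (P j i) t))) <= (\<Sum>j=1..J. 2 * A j + 2 * B j)"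
 proof (rule sum_mono)
  fix j assume j: "j \<in> {1..J}"
  have c: "continuous_on {tn (j - 1)..tn j} (%t. u 0 t i)" if "i \<in> I" for i
   by (rule continuous_on_subset[OF u_cont[OF that, of T]]) (use tn(3)[of "j - 1"] tn(3)[of j] j in auto)
  have "integral {tn (j - 1)..tn j} (%t. sq (%i. u 0 t i - poly (P j i) t))
   <= integral {tn (j - 1)..tn j} (%t. 2 * sq (%i. poly (\<theta> j i) t) + 2 * sq (%i. u 0 t i - poly (p j i) t))"
  proof (rule integral_le)
   fix t
   have "(u 0 t i - poly (P j i) t)^2 <= 2 * (poly (\<theta> j i) t)^2 + 2 * (u 0 t i - poly (p j i) t)^2" for i
   proof -
   have "0 <= ((u 0 t i - poly (p j i) t) + poly (\<theta> j i) t)^2" by simp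
   then show ?thesis by (simp add: \<theta>_def power2_eq_square algebra_simps)
   qed
   then have "sq (%i. u 0 t i - poly (P j i) t) <= (\<Sum>i\<in>I. 2 * (poly (\<theta> j i) t)^2 + 2 * (u 0 t i - poly (p j i) t)^2)"
   unfolding sq_def by (intro sum_mono)
   then show "sq (%i. u 0 t i - poly (P j i) t) <= 2 * sq (%i. poly (\<theta> j i) t) + 2 * sq (%i. u 0 t i - poly (p j i) t)"
   by (simp add: sq_def sum.distrib sum_distrib_left)
  qed (intro cont_int continuous_intros c; simp)+
  also have "... = 2 * A j + 2 * B j"
   by (subst integral_add; (intro cont_int continuous_intros c; simp)?) (simp add: A_def B_def)
  finally show "integral {tn (j - 1)..tn j} (%t. sq (%i. u 0 t i - poly (P j i) t)) <= 2 * A j + 2 * B j" .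
 qed
 also have "... = 2 * (\<Sum>j=1..J. A j) + 2 * (\<Sum>j=1..J. B j)"
  by (simp add: sum.distrib sum_distrib_left)
 also have "... <= 2 * E + 4 * (\<Sum>j=1..J. B j)" using AB by linarith
 finally show ?thesis by (simp add: B_def)
qed

end

lemma time_node_facts:
 fixes M :: nat
 assumes t1: "0 < t1" "t1 < T" and \<sigma>: "0 < \<sigma>" "\<sigma> < 1" and K: "K >= 1"
 defines "tn \<equiv> time_node \<sigma> t1 T K M" and "J \<equiv> num_elements K M"
 shows "tn 0 = 0" "tn J = T"
  "!!j. j \<in> {1..J} ==> tn (j - 1) < tn j"
  "!!j. j \<in> {2..J} ==> tn (j - 1) > 0 & tn j - tn (j - 1) <= (2 / \<sigma> + T / t1) * tn (j - 1)"
proof -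
 let ?A = "2 / \<sigma> + T / t1"
 show 0: "tn 0 = 0" by (simp add: tn_def time_node_def)
 have geo: "tn j = t1 / 2 * \<sigma> ^ (M + 1 - j)" if "1 <= j" "j <= M" for j
  using that by (simp add: tn_def time_node_def)
 have uni: "tn (M + 1 + i) = t1 + (T - t1) * real i / real K" for i
  by (simp add: tn_def time_node_def)
 show "tn J = T" using uni[of K] K by (simp add: J_def num_elements_def)
 have step: "tn (j - 1) < tn j & (j >= 2 --> tn (j - 1) > 0 & tn j - tn (j - 1) <= ?A * tn (j - 1))"
  if j: "j \<in> {1..J}" for j
 proof -
  consider "j = 1" "M >= 1" | "j = 1" "M = 0" | "2 <= j" "j <= M" | "2 <= j" "j = M + 1" | "j > M + 1" using j by force
  then show ?thesis
  proof cases
   case 1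
   then have "tn 1 = t1 / 2 * \<sigma> ^ M" using geo[of 1] by simp
   moreover have "t1 / 2 * \<sigma> ^ M > 0" using t1 \<sigma> by simp
   ultimately show ?thesis using 0 1 by simp
  next
   case 2
   then show ?thesis using uni[of 0] 0 t1 by simp
  next
   case 3
   have e: "\<sigma> ^ (M + 1 - (j - 1)) = \<sigma> * \<sigma> ^ (M + 1 - j)"
   proof -
   have "M + 1 - (j - 1) = Suc (M + 1 - j)" using 3 by simp
   then show ?thesis by (simp only: power_Suc)
   qed
   define y where "y = t1 / 2 * \<sigma> ^ (M + 1 - j)"
   have y: "y > 0" using t1 \<sigma> by (simp add: y_def)
   have a: "tn (j - 1) = \<sigma> * y" "tn j = y"
   using geo[of j] geo[of "j - 1"] 3 e by (auto simp: y_def)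
   have "2 / \<sigma> * (\<sigma> * y) = 2 * y" using \<sigma> by simp
   then have "y - \<sigma> * y <= 2 / \<sigma> * (\<sigma> * y)" using y mult_pos_pos[OF \<sigma>(1) y] by linarith
   also have "... <= ?A * (\<sigma> * y)" using y \<sigma> t1 by (intro mult_right_mono) auto
   finally show ?thesis using y \<sigma> a by simp
  next
   case 4
   then have a: "tn (j - 1) = t1 / 2 * \<sigma>" "tn j = t1" using geo[of M] uni[of 0] by auto
   have "t1 - t1 / 2 * \<sigma> <= 2 / \<sigma> * (t1 / 2 * \<sigma>)" using \<sigma> t1 by simp
   also have "... <= ?A * (t1 / 2 * \<sigma>)" using \<sigma> t1 by (intro mult_right_mono) auto
   finally have le: "t1 - t1 / 2 * \<sigma> <= ?A * (t1 / 2 * \<sigma>)" .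
   have "t1 / 2 * \<sigma> < t1 * 1" using \<sigma> t1 by (intro mult_strict_mono) auto
   then have "t1 / 2 * \<sigma> < t1" by simp
   moreover have "0 < t1 / 2 * \<sigma>" using t1 \<sigma> by simp
   ultimately show ?thesis unfolding a using le by blast
  next
   case 5
   then obtain i where i: "j = M + 1 + Suc i" by (metis add_Suc_right less_imp_Suc_add)
   have a: "tn (j - 1) = t1 + (T - t1) * real i / real K" "tn j = t1 + (T - t1) * real (Suc i) / real K"
   using uni[of i] uni[of "Suc i"] i by auto
   have d: "tn j - tn (j - 1) = (T - t1) / real K" unfolding a using K by (simp add: field_simps)
   have ge: "tn (j - 1) >= t1" unfolding a using t1 by simp
   have "(T - t1) / real K <= T / 1" using t1 K by (intro frac_le) auto
   also have "... = T / t1 * t1" using t1 by simp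
   also have "... <= ?A * tn (j - 1)" using ge t1 \<sigma> by (intro mult_mono) auto
   finally have "tn j - tn (j - 1) <= ?A * tn (j - 1)" using d by simp
   moreover have "(T - t1) / real K > 0" using t1 K by simp
   ultimately show ?thesis using d ge t1 by linarith
  qed
 qed
 show "tn (j - 1) < tn j" if "j \<in> {1..J}" for j using step[OF that] by blast
 show "tn (j - 1) > 0 & tn j - tn (j - 1) <= ?A * tn (j - 1)" if "j \<in> {2..J}" for j
  using step[of j] that by auto
qed

lemma increasing_nodes:
 fixes tn :: "nat => real"
 assumes "!!j. j \<in> {1..J} ==> tn (j - 1) < tn j" "i <= k" "k <= J"
 shows "tn i <= tn k"
 using assms(2,3)
proof (induction k rule: dec_induct)
 case (step k)
 then show ?case using assms(1)[of "Suc k"] by simp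
qed simp

lemma time_degree_lower:
 assumes "m > 0" "1 <= j"
 shows "real (time_degree m M j) >= m * real (min j (M + 1)) - 1"
proof -
 have g: "real (geo_degree m i) >= m * real i - 1" for i
  unfolding geo_degree_def using assms by linarith
 show ?thesis
 proof (cases "j <= M + 1")
  case True
  then show ?thesis using g[of j] by (simp add: time_degree_def min_def)
 next
  case False
  have "geo_degree m (M + 1) <= Max (geo_degree m ` {1..M + 1})" by (intro Max_ge) auto
  then have "real (geo_degree m (M + 1)) <= real (time_degree m M j)" using False by (simp add: time_degree_def)
  then show ?thesis using g[of "M + 1"] False by (simp add: min_def)
 qed
qed

lemma time_degree_upper:
 assumes "m > 0"
 shows "real (time_degree m M j) <= m * real (M + 1)"
proof -
 have g: "real (geo_degree m i) <= m * real (M + 1)" if "i <= M + 1" for i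
 proof -
  have "real (geo_degree m i) <= m * real i" unfolding geo_degree_def using assms by simp
  also have "... <= m * real (M + 1)" using assms that by (intro mult_left_mono) auto
  finally show ?thesis .
 qed
 show ?thesis
 proof (cases "j <= M + 1")
  case True
  then show ?thesis using g[of j] by (simp add: time_degree_def)
 next
  case False
  have "Max (geo_degree m ` {1..M + 1}) \<in> geo_degree m ` {1..M + 1}" by (intro Max_in) auto
  then obtain i where "i \<in> {1..M + 1}" "Max (geo_degree m ` {1..M + 1}) = geo_degree m i" by blast
  then show ?thesis using g[of i] False by (simp add: time_degree_def)
 qed
qed

text \<open>Small elements near \<open>t = 0\<close> carry little energy, larger elements carry a high polynomial
  degree; in the product of the two bounds the worst element gives \<open>exp (- \<omega> (M + 1))\<close>.\<close>

lemma geometric_mesh_sum: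
 assumes t1: "0 < t1" "t1 < T" and \<sigma>: "0 < \<sigma>" "\<sigma> < 1" and m: "0 < m" and K: "K >= 1"
  and \<gamma>: "\<gamma> > 0" and \<beta>: "\<beta> > 0"
 obtains C \<omega> where "C > 0" "\<omega> > 0"
  "!!M. (\<Sum>j=1..num_elements K M. exp (- \<gamma> * real (time_degree m M j)) * time_node \<sigma> t1 T K M j powr \<beta>)
   <= C * exp (- \<omega> * (real M + 1))"
proof -
 let ?A = "%M j. - \<gamma> * real (time_degree m M j)"
 define w where "w = min (\<gamma> * m) (- \<beta> * ln \<sigma>)"
 have w: "w > 0" using \<gamma> m \<beta> \<sigma> by (simp add: w_def mult_pos_neg)
 define B where "B = exp \<gamma> * T powr \<beta>"
 have T: "T > 0" using t1 by simp
 have B: "B > 0" using T by (simp add: B_def)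
 have each: "exp (?A M j) * time_node \<sigma> t1 T K M j powr \<beta> <= B * exp (- w * (real M + 1))"
  if j: "j \<in> {1..num_elements K M}" for M j
 proof -
  note tnf = time_node_facts[OF t1 \<sigma> K, where M = M]
  have tnT: "time_node \<sigma> t1 T K M j <= T"
   using increasing_nodes[where tn = "time_node \<sigma> t1 T K M", OF tnf(3), of _ j "num_elements K M"] j tnf(2) by auto
  have tn0: "0 <= time_node \<sigma> t1 T K M j"
   using increasing_nodes[where tn = "time_node \<sigma> t1 T K M", OF tnf(3), of _ 0 j] j tnf(1) by auto
  have "- \<gamma> * real (time_degree m M j) <= - \<gamma> * (m * real (min j (M + 1)) - 1)"
   using time_degree_lower[OF m, of j M] \<gamma> j by (intro mult_left_mono_neg) auto
  also have "... = \<gamma> - (\<gamma> * m) * real (min j (M + 1))" by (simp add: algebra_simps)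
  also have "... <= \<gamma> - w * real (min j (M + 1))"
   by (intro diff_left_mono mult_right_mono) (auto simp: w_def)
  finally have 1: "exp (?A M j) <= exp \<gamma> * exp (- w * real (min j (M + 1)))"
   by (simp flip: exp_add)
  have 2: "time_node \<sigma> t1 T K M j powr \<beta> <= T powr \<beta> * exp (- w * real (M + 1 - min j (M + 1)))"
  proof (cases "j <= M")
   case True
   have "time_node \<sigma> t1 T K M j powr \<beta> = (t1 / 2 * \<sigma> ^ (M + 1 - j)) powr \<beta>"
   using True j by (simp add: time_node_def)
   also have "... = (t1 / 2) powr \<beta> * (\<sigma> ^ (M + 1 - j)) powr \<beta>"
   by (rule powr_mult)
   also have "... = (t1 / 2) powr \<beta> * exp (\<beta> * ln \<sigma> * real (M + 1 - j))"
   using \<sigma> by (simp add: powr_def ln_realpow mult_ac)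
   also have "... <= T powr \<beta> * exp (- w * real (M + 1 - j))"
   proof (rule mult_mono)
   have "\<beta> * ln \<sigma> <= - w" by (simp add: w_def)
   then have "\<beta> * ln \<sigma> * real (M + 1 - j) <= - w * real (M + 1 - j)" by (intro mult_right_mono) auto
   then show "exp (\<beta> * ln \<sigma> * real (M + 1 - j)) <= exp (- w * real (M + 1 - j))" by simp
   show "(t1 / 2) powr \<beta> <= T powr \<beta>" using t1 \<beta> by (intro powr_mono2) auto
   qed auto
   finally show ?thesis using True by (simp add: min_def)
  next
   case False
   then have "M + 1 - min j (M + 1) = 0" by simp
   moreover have "time_node \<sigma> t1 T K M j powr \<beta> <= T powr \<beta>" using tn0 tnT \<beta> by (intro powr_mono2) auto
   ultimately show ?thesis by simp
  qed
  have "exp (?A M j) * time_node \<sigma> t1 T K M j powr \<beta>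
   <= (exp \<gamma> * exp (- w * real (min j (M + 1)))) * (T powr \<beta> * exp (- w * real (M + 1 - min j (M + 1))))"
   by (intro mult_mono 1 2) auto
  also have "... = B * exp (- w * real (min j (M + 1)) + - w * real (M + 1 - min j (M + 1)))"
   unfolding exp_add B_def by simp
  also have "- w * real (min j (M + 1)) + - w * real (M + 1 - min j (M + 1)) = - w * (real M + 1)"
   by (simp add: of_nat_diff algebra_simps)
  finally show ?thesis .
 qed
 define C where "C = (real K + 1) * B * (2 / w)"
 show thesis
 proof (rule that[of C "w / 2"])
  show "C > 0" "w / 2 > 0" using w B by (auto simp: C_def)
  fix M
  have "(\<Sum>j=1..num_elements K M. exp (?A M j) * time_node \<sigma> t1 T K M j powr \<beta>)
   <= (\<Sum>j=1..num_elements K M. B * exp (- w * (real M + 1)))"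
   by (intro sum_mono each)
  also have "... = (real M + 1 + real K) * (B * exp (- w * (real M + 1)))"
   by (simp add: num_elements_def)
  also have "... <= ((real K + 1) * (real M + 1)) * (B * exp (- w * (real M + 1)))"
   using B by (intro mult_right_mono) (auto simp: algebra_simps)
  also have "... <= ((real K + 1) * (2 / w * exp (w / 2 * (real M + 1)))) * (B * exp (- w * (real M + 1)))"
  proof (intro mult_right_mono mult_left_mono)
   have "w / 2 * (real M + 1) <= exp (w / 2 * (real M + 1))"
   using exp_ge_add_one_self[of "w / 2 * (real M + 1)"] by linarith
   then show "real M + 1 <= 2 / w * exp (w / 2 * (real M + 1))" using w by (simp add: field_simps)
  qed (use B in auto)
  also have "... = C * exp (w / 2 * (real M + 1) + - w * (real M + 1))"
   unfolding exp_add C_def by simp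
  also have "w / 2 * (real M + 1) + - w * (real M + 1) = - (w / 2) * (real M + 1)"
   by (simp add: field_simps)
  finally show "(\<Sum>j=1..num_elements K M. exp (?A M j) * time_node \<sigma> t1 T K M j powr \<beta>)
   <= C * exp (- (w / 2) * (real M + 1))" .
 qed
qed

lemma hp_dg_convergence:
 fixes CP Cf d T \<beta> C0 \<sigma> t1 md :: real
 assumes t1: "0 < t1" "t1 < T" and \<sigma>: "0 < \<sigma>" "\<sigma> < 1" and md: "0 < md" and K: "K >= 1"
  and \<beta>: "0 < \<beta>" "\<beta> < 1" and CP: "CP > 0" and Cf: "Cf >= 0" and d: "d >= 0" and C0: "C0 >= 0"
 obtains C b where "C > 0" "b > 0"
  "!!(I :: 'i set) m u F \<Phi> M P g E.
   semidiscrete_flow I m CP u F T \<Phi> ==>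
   (!!l. \<Phi> l <= Cf * d ^ l * fact l) ==>
   (!!\<tau>. 0 < \<tau> ==> \<tau> <= T ==> \<exists>v. mass_matrix.mm I m (%i. u 0 0 i - v i) (%i. u 0 0 i - v i)
   + \<tau> * (\<Sum>i\<in>I. (v i)^2) <= C0 * \<tau> powr \<beta>) ==>
   (!!j i. j \<in> {1..num_elements K M} ==> i \<in> I ==> degree (P j i) <= time_degree md M j) ==>
   (!!j k q. j \<in> {1..num_elements K M} ==> k \<in> I ==> degree q <= time_degree md M j ==>
   integral {time_node \<sigma> t1 T K M (j - 1)..time_node \<sigma> t1 T K M j}
   (%t. ((\<Sum>i\<in>I. m i k * poly (pderiv (P j i)) t) + poly (P j k) t - F 0 t k) * poly q t)
   + ((\<Sum>i\<in>I. m i k * poly (P j i) (time_node \<sigma> t1 T K M (j - 1)))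
   - (if j = 1 then g k else \<Sum>i\<in>I. m i k * poly (P (j - 1) i) (time_node \<sigma> t1 T K M (j - 1))))
   * poly q (time_node \<sigma> t1 T K M (j - 1)) = 0) ==>
   (!!v. 2 * (\<Sum>k\<in>I. (g k - (\<Sum>i\<in>I. m i k * u 0 0 i)) * v k) <= E + mass_matrix.mm I m v v) ==>
   (\<Sum>j=1..num_elements K M. integral {time_node \<sigma> t1 T K M (j - 1)..time_node \<sigma> t1 T K M j}
   (%t. \<Sum>i\<in>I. (u 0 t i - poly (P j i) t)^2)) <= 2 * E + C * exp (- b * (real M + 1))"
proof -
 define D where "D = 5 + (d * T)^2"
 define G where "G = Cf^2 * (4 * T + CP * (d * T)^2)"
 define Cz where "Cz = 6 * C0 + (4 * CP * Cf^2 + G) * T powr (1 - \<beta>) + 1"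
 have T: "T > 0" using t1 by simp
 have G: "G >= 0" using T CP by (simp add: G_def)
 have Cz: "Cz > 0" using G C0 CP unfolding Cz_def by (intro add_nonneg_pos add_nonneg_nonneg) auto
 have D: "D >= 1" by (simp add: D_def)
 have \<kappa>: "2 / \<sigma> + T / t1 >= 0" using \<sigma> t1 by simp
 obtain Ce \<gamma> where Ce: "Ce > 0" "\<gamma> > 0" and el:
  "!!(I :: 'i set) u a b Z r.
   finite I ==> (!!i. i \<in> I ==> smooth_seq 0 T (%l t. u l t i)) ==> 0 <= a ==> a < b ==> b <= T ==>
   (!!l. integral {0..b} (%t. t ^ (2 * l) * (\<Sum>i\<in>I. (u l t i)^2)) <= D ^ l * (fact l)^2 * Z) ==>
   a = 0 & r <= geo_degree md 1 \<or> a > 0 & b - a <= (2 / \<sigma> + T / t1) * a ==>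
   \<exists>p. (\<forall>i\<in>I. degree (p i) <= r & poly (p i) b = u 0 b i &
   (\<forall>q. degree q < r --> integral {a..b} (%x. (u 0 x i - poly (p i) x) * poly q x) = 0)) &
   integral {a..b} (%x. \<Sum>i\<in>I. (u 0 x i - poly (p i) x)^2) <= Ce * exp (- \<gamma> * real r) * Z"
  using element_error[OF D \<kappa>] by blast
 obtain Cs \<omega> where Cs: "Cs > 0" "\<omega> > 0" and ms:
  "!!M. (\<Sum>j=1..num_elements K M. exp (- \<gamma> * real (time_degree md M j)) * time_node \<sigma> t1 T K M j powr \<beta>)
   <= Cs * exp (- \<omega> * (real M + 1))"
  using geometric_mesh_sum[OF t1 \<sigma> md K Ce(2) \<beta>(1)] by blast
 show thesis
 proof (rule that[of "4 * (Ce * Cz * Cs)" \<omega>])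
  show "4 * (Ce * Cz * Cs) > 0" "\<omega> > 0" using Ce Cz Cs by auto
  fix I :: "'i set" and m u F \<Phi> M P g E
  assume sfl: "semidiscrete_flow I m CP u F T \<Phi>"
   and \<Phi>_le: "!!l. \<Phi> l <= Cf * d ^ l * fact l"
   and init: "!!\<tau>. 0 < \<tau> ==> \<tau> <= T ==> \<exists>v. mass_matrix.mm I m (%i. u 0 0 i - v i) (%i. u 0 0 i - v i)
   + \<tau> * (\<Sum>i\<in>I. (v i)^2) <= C0 * \<tau> powr \<beta>"
   and P: "!!j i. j \<in> {1..num_elements K M} ==> i \<in> I ==> degree (P j i) <= time_degree md M j"
   and dg: "!!j k q. j \<in> {1..num_elements K M} ==> k \<in> I ==> degree q <= time_degree md M j ==>
   integral {time_node \<sigma> t1 T K M (j - 1)..time_node \<sigma> t1 T K M j}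
   (%t. ((\<Sum>i\<in>I. m i k * poly (pderiv (P j i)) t) + poly (P j k) t - F 0 t k) * poly q t)
   + ((\<Sum>i\<in>I. m i k * poly (P j i) (time_node \<sigma> t1 T K M (j - 1)))
   - (if j = 1 then g k else \<Sum>i\<in>I. m i k * poly (P (j - 1) i) (time_node \<sigma> t1 T K M (j - 1))))
   * poly q (time_node \<sigma> t1 T K M (j - 1)) = 0"
   and g: "!!v. 2 * (\<Sum>k\<in>I. (g k - (\<Sum>i\<in>I. m i k * u 0 0 i)) * v k) <= E + mass_matrix.mm I m v v"
  interpret semidiscrete_flow I m CP u F T \<Phi> by (rule sfl)
  define tn where "tn = time_node \<sigma> t1 T K M"
  define J where "J = num_elements K M"
  define r where "r = time_degree md M"
  note tnf = time_node_facts[OF t1 \<sigma> K, where M = M, folded tn_def J_def]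
  have tnm: "tn i <= tn k" if "i <= k" "k <= J" for i k
   using increasing_nodes[where tn = tn, OF tnf(3) that] .
  have tnb: "0 <= tn j & tn j <= T" if "j <= J" for j
   using tnm[of 0 j] tnm[of j J] that tnf(1,2) by auto
  have Xb: "integral {0..\<tau>} (%t. t ^ (2 * l) * (\<Sum>i\<in>I. (u l t i)^2)) <= D ^ l * (fact l)^2 * (Cz * \<tau> powr \<beta>)"
   if \<tau>: "0 < \<tau>" "\<tau> <= T" for l \<tau>
  proof -
   have \<tau>\<beta>: "\<tau> <= T powr (1 - \<beta>) * \<tau> powr \<beta>"
   proof -
   have "\<tau> = \<tau> powr (1 - \<beta>) * \<tau> powr \<beta>" using \<tau> by (simp flip: powr_add)
   also have "... <= T powr (1 - \<beta>) * \<tau> powr \<beta>" using \<tau> \<beta> by (intro mult_right_mono powr_mono2) auto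
   finally show ?thesis .
   qed
   obtain v where v: "mm (%i. u 0 0 i - v i) (%i. u 0 0 i - v i) + \<tau> * sq v <= C0 * \<tau> powr \<beta>"
   using init[OF \<tau>] by (auto simp: sq_def)
   have "X 0 \<tau> <= 6 * (C0 * \<tau> powr \<beta>) + 4 * CP * (\<Phi> 0)^2 * \<tau>"
   using \<tau> by (intro X_0_bound[OF _ _ v]) auto
   also have "... <= 6 * (C0 * \<tau> powr \<beta>) + 4 * CP * Cf^2 * \<tau>"
   proof -
   have "(\<Phi> 0)^2 <= Cf^2" using \<Phi>_le[of 0] \<Phi>[of 0] by (intro power_mono) auto
   then show ?thesis using \<tau> CP by (intro add_left_mono mult_right_mono mult_left_mono) auto
   qed
   finally have "X 0 \<tau> + G * \<tau> <= 6 * (C0 * \<tau> powr \<beta>) + (4 * CP * Cf^2 + G) * \<tau>" by (simp add: algebra_simps)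
   also have "... <= 6 * (C0 * \<tau> powr \<beta>) + (4 * CP * Cf^2 + G) * (T powr (1 - \<beta>) * \<tau> powr \<beta>) + \<tau> powr \<beta>"
   proof -
   have "(4 * CP * Cf^2 + G) * \<tau> <= (4 * CP * Cf^2 + G) * (T powr (1 - \<beta>) * \<tau> powr \<beta>)"
   using \<tau>\<beta> CP G by (intro mult_left_mono) auto
   then show ?thesis using powr_ge_zero[of \<tau> \<beta>] by linarith
   qed
   also have "... = Cz * \<tau> powr \<beta>" by (simp add: Cz_def algebra_simps)
   finally have Z: "X 0 \<tau> + G * \<tau> <= Cz * \<tau> powr \<beta>" .
   have "X l \<tau> <= D ^ l * (fact l)^2 * (X 0 \<tau> + G * \<tau>)"
   unfolding D_def G_def using \<tau> by (intro X_growth \<Phi>_le d) auto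
   also have "... <= D ^ l * (fact l)^2 * (Cz * \<tau> powr \<beta>)"
   using Z D by (intro mult_left_mono) auto
   finally show ?thesis by (simp add: X_def sq_def)
  qed
  have "\<forall>j\<in>{1..J}. \<exists>p. (\<forall>i\<in>I. degree (p i) <= r j & poly (p i) (tn j) = u 0 (tn j) i &
   (\<forall>q. degree q < r j --> integral {tn (j - 1)..tn j} (%x. (u 0 x i - poly (p i) x) * poly q x) = 0)) &
   integral {tn (j - 1)..tn j} (%x. \<Sum>i\<in>I. (u 0 x i - poly (p i) x)^2)
   <= Ce * exp (- \<gamma> * real (r j)) * (Cz * tn j powr \<beta>)"
  proof
   fix j assume j: "j \<in> {1..J}"
   have nonneg: "0 <= tn (j - 1)" "tn j <= T" using tnb[of "j - 1"] tnb[of j] j by auto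
   have pos: "0 < tn j" using nonneg tnf(3)[OF j] by linarith
   have "tn (j - 1) = 0 & r j <= geo_degree md 1 \<or> tn (j - 1) > 0 & tn j - tn (j - 1) <= (2 / \<sigma> + T / t1) * tn (j - 1)"
   proof (cases "j = 1")
   case True
   then show ?thesis using tnf(1) by (simp add: r_def time_degree_def)
   next
   case False
   then have "j \<in> {2..J}" using j by auto
   from tnf(4)[OF this] show ?thesis by blast
   qed
   then show "\<exists>p. (\<forall>i\<in>I. degree (p i) <= r j & poly (p i) (tn j) = u 0 (tn j) i &
   (\<forall>q. degree q < r j --> integral {tn (j - 1)..tn j} (%x. (u 0 x i - poly (p i) x) * poly q x) = 0)) &
   integral {tn (j - 1)..tn j} (%x. \<Sum>i\<in>I. (u 0 x i - poly (p i) x)^2)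
   <= Ce * exp (- \<gamma> * real (r j)) * (Cz * tn j powr \<beta>)"
   by (intro el fin u_smooth nonneg tnf(3)[OF j] Xb pos)
  qed
  then obtain p where p': "\<forall>j\<in>{1..J}. (\<forall>i\<in>I. degree (p j i) <= r j & poly (p j i) (tn j) = u 0 (tn j) i &
   (\<forall>q. degree q < r j --> integral {tn (j - 1)..tn j} (%x. (u 0 x i - poly (p j i) x) * poly q x) = 0)) &
   integral {tn (j - 1)..tn j} (%x. \<Sum>i\<in>I. (u 0 x i - poly (p j i) x)^2)
   <= Ce * exp (- \<gamma> * real (r j)) * (Cz * tn j powr \<beta>)"
   by (rule bchoice[THEN exE])
  note p = bspec[OF p']
  have "(\<Sum>j=1..J. integral {tn (j - 1)..tn j} (%t. sq (%i. u 0 t i - poly (P j i) t)))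
   <= 2 * E + 4 * (\<Sum>j=1..J. integral {tn (j - 1)..tn j} (%t. sq (%i. u 0 t i - poly (p j i) t)))"
  proof (rule dg_total[where r = r and g = g])
   show "degree (p j i) <= r j" "poly (p j i) (tn j) = u 0 (tn j) i" if "j \<in> {1..J}" "i \<in> I" for j i
   using p[OF that(1)] that(2) by auto
   show "integral {tn (j - 1)..tn j} (%x. (u 0 x i - poly (p j i) x) * poly q x) = 0"
   if "j \<in> {1..J}" "i \<in> I" "degree q < r j" for j i q
   using p[OF that(1)] that(2,3) by blast
   show "degree (P j i) <= r j" if "j \<in> {1..J}" "i \<in> I" for j i
   using P that by (simp add: J_def r_def)
   show "integral {tn (j - 1)..tn j} (%t. ((\<Sum>i\<in>I. m i k * poly (pderiv (P j i)) t) + poly (P j k) t - F 0 t k) * poly q t)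
   + ((\<Sum>i\<in>I. m i k * poly (P j i) (tn (j - 1)))
   - (if j = 1 then g k else \<Sum>i\<in>I. m i k * poly (P (j - 1) i) (tn (j - 1)))) * poly q (tn (j - 1)) = 0"
   if "j \<in> {1..J}" "k \<in> I" "degree q <= r j" for j k q
   using dg[of j k q] that unfolding J_def r_def tn_def by blast
  qed (use tnf tnb g in auto)
  also have "(\<Sum>j=1..J. integral {tn (j - 1)..tn j} (%t. sq (%i. u 0 t i - poly (p j i) t)))
   <= (\<Sum>j=1..J. Ce * exp (- \<gamma> * real (r j)) * (Cz * tn j powr \<beta>))"
   using p by (intro sum_mono) (auto simp: sq_def)
  also have "... = Ce * Cz * (\<Sum>j=1..J. exp (- \<gamma> * real (r j)) * tn j powr \<beta>)"
   by (simp add: sum_distrib_left mult_ac)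
  also have "... <= Ce * Cz * (Cs * exp (- \<omega> * (real M + 1)))"
   using ms[of M] Ce Cz unfolding J_def tn_def r_def by (intro mult_left_mono) auto
  finally show "(\<Sum>j=1..num_elements K M. integral {time_node \<sigma> t1 T K M (j - 1)..time_node \<sigma> t1 T K M j}
   (%t. \<Sum>i\<in>I. (u 0 t i - poly (P j i) t)^2)) <= 2 * E + 4 * (Ce * Cz * Cs) * exp (- \<omega> * (real M + 1))"
   by (simp add: J_def tn_def sq_def mult_ac)
 qed
qed

section \<open>The semidiscrete problem in an energy orthonormal basis\<close>

lemma L2_add_fun: "u \<in> L2 M ==> v \<in> L2 M ==> u + v \<in> L2 M" for u v :: "'a => real"
 using L2_add[of u M v] by (simp add: plus_fun_def)

lemma L2_scale_fun: "u \<in> L2 M ==> r *\<^sub>R u \<in> L2 M" for u :: "'a => real"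
 using L2_scaleR[of u M r] by (simp add: scaleR_fun_def)

lemma L2_diff_fun: "u \<in> L2 M ==> v \<in> L2 M ==> u - v \<in> L2 M" for u v :: "'a => real"
 using L2_diff[of u M v] by (simp add: fun_diff_def)

lemma L2_zero_fun: "(0 :: 'a => real) \<in> L2 M"
 by (rule L2I) (simp_all add: zero_fun_def)

lemma L2_inner_zero: "L2_inner M 0 v = 0"
 by (simp add: L2_inner_def)

lemma L2_sum_fun: "(!!i. i \<in> I ==> f i \<in> L2 M) ==> (\<Sum>i\<in>I. w i *\<^sub>R f i) \<in> L2 M" for f :: "'i => 'a => real"
 by (induction I rule: infinite_finite_induct) (auto simp: L2_zero_fun intro!: L2_add_fun L2_scale_fun)

lemma L2_inner_sum:
 "(!!i. i \<in> I ==> f i \<in> L2 M) ==> v \<in> L2 M ==> L2_inner M (\<Sum>i\<in>I. w i *\<^sub>R f i) v = (\<Sum>i\<in>I. w i * L2_inner M (f i) v)"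
proof (induction I rule: infinite_finite_induct)
 case (insert i I)
 have "L2_inner M (w i *\<^sub>R f i + (\<Sum>i\<in>I. w i *\<^sub>R f i)) v = L2_inner M (w i *\<^sub>R f i) v + L2_inner M (\<Sum>i\<in>I. w i *\<^sub>R f i) v"
  using insert by (intro L2_inner_add L2_scale_fun L2_sum_fun) auto
 also have "... = w i * L2_inner M (f i) v + (\<Sum>i\<in>I. w i * L2_inner M (f i) v)"
  using insert by (simp only: L2_inner_scale) simp
 finally show ?case unfolding sum.insert[OF insert(1,2)] .
qed (auto simp: L2_inner_zero)

text \<open>Passes from a derivative in \<open>L\<^sup>2\<close> to scalar functions, by the Cauchy-Schwarz inequality.\<close>

lemma L2_deriv_inner:
 assumes u: "has_L2_deriv M u d t S" and uL: "!!\<tau>. \<tau> \<in> S ==> u \<tau> \<in> L2 M" and t: "t \<in> S" and d: "d \<in> L2 M" and e: "e \<in> L2 M"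
 shows "((%\<tau>. L2_inner M (u \<tau>) e) has_real_derivative L2_inner M d e) (at t within S)"
 unfolding has_field_derivative_iff
proof (rule Lim_null[THEN iffD2])
 show "((%\<tau>. (L2_inner M (u \<tau>) e - L2_inner M (u t) e) / (\<tau> - t) - L2_inner M d e) \<longlongrightarrow> 0) (at t within S)"
 proof (rule Lim_null_comparison)
  let ?q = "%\<tau>. (%x. (u \<tau> x - u t x) / (\<tau> - t) - d x)"
  have "((%\<tau>. L2_norm M (?q \<tau>) * L2_norm M e) \<longlongrightarrow> 0 * L2_norm M e) (at t within S)"
   using u unfolding has_L2_deriv_def by (intro tendsto_mult tendsto_const)
  then show "((%\<tau>. L2_norm M (?q \<tau>) * L2_norm M e) \<longlongrightarrow> 0) (at t within S)" by simp
  have "norm ((L2_inner M (u \<tau>) e - L2_inner M (u t) e) / (\<tau> - t) - L2_inner M d e) <= L2_norm M (?q \<tau>) * L2_norm M e"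
   if \<tau>: "\<tau> \<in> S" "\<tau> ~= t" for \<tau>
  proof -
   have q: "?q \<tau> = (1 / (\<tau> - t)) *\<^sub>R (u \<tau> - u t) - d"
   by (simp add: fun_eq_iff scaleR_fun_def)
   have qL: "?q \<tau> \<in> L2 M"
   unfolding q by (intro L2_diff_fun L2_scale_fun uL \<tau> t d)
   have "L2_inner M (?q \<tau>) e = L2_inner M ((1 / (\<tau> - t)) *\<^sub>R (u \<tau> - u t)) e - L2_inner M d e"
   unfolding q by (intro L2_inner_diff L2_diff_fun L2_scale_fun uL \<tau> t d e)
   also have "L2_inner M ((1 / (\<tau> - t)) *\<^sub>R (u \<tau> - u t)) e = (L2_inner M (u \<tau>) e - L2_inner M (u t) e) / (\<tau> - t)"
   unfolding L2_inner_scale by (subst L2_inner_diff) (use uL \<tau> t e in auto)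
   finally show ?thesis using L2_Cauchy_Schwarz[OF qL e] by simp
  qed
  then show "\<forall>\<^sub>F \<tau> in at t within S. norm ((L2_inner M (u \<tau>) e - L2_inner M (u t) e) / (\<tau> - t) - L2_inner M d e) <= L2_norm M (?q \<tau>) * L2_norm M e"
   by (auto simp: eventually_at_filter)
 qed
qed

lemma tr_add: "tr (U + V) = tr U + tr V" and tr_diff: "tr (U - V) = tr U - tr V" and tr_scale: "tr (r *\<^sub>R U) = r *\<^sub>R tr U"
 and tr_zero: "tr 0 = 0"
 by (simp_all add: tr_def fun_eq_iff scaleR_fun_def)

lemma tr_sum: "tr (\<Sum>i\<in>I. w i *\<^sub>R f i) = (\<Sum>i\<in>I. w i *\<^sub>R tr (f i))"
 by (induction I rule: infinite_finite_induct)
  (simp_all add: tr_zero tr_add tr_scale del: plus_fun_apply zero_fun_apply)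

lemma L2_norm_zero_AE:
 assumes u: "u \<in> L2 M" and n: "L2_norm M u = 0"
 shows "AE x in M. (u x :: real) = 0"
proof -
 have "(LINT x|M. (norm (u x))^2) = 0" using n L2_norm_sq[of M u] by simp
 then have "AE x in M. (norm (u x))^2 = 0"
  using L2_int[OF u] by (subst (asm) integral_nonneg_eq_0_iff_AE) auto
 then show ?thesis by eventually_elim simp
qed

context discretization
begin

abbreviation "ip \<equiv> L2_inner (vol \<Omega>)"

lemma d_const_pos: "d_const s > 0"
 using s by (simp add: d_const_def Gamma_real_pos)

definition af :: "((real^'d) \<times> real => real) => ((real^'d) \<times> real => real) => real" where
 "af U V = inverse (d_const s) * ext U V"

lemma af_coercive: "U \<in> Z ==> (ext_norm s \<Omega> U)^2 <= d_const s / a1 * af U U"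
 using ext_coercive[of U] d_const_pos a1_pos by (simp add: af_def field_simps)

definition CM :: real where "CM = CT * (d_const s / a1)"

lemma CM_pos: "CM > 0" using CT_pos d_const_pos a1_pos by (simp add: CM_def)

definition CE :: real where "CE = CH * (d_const s / a1)"

lemma CE_pos: "CE > 0" using CH_pos d_const_pos a1_pos by (simp add: CE_def)

sublocale ZE: euclidean_subspace Z af
proof
 show "subspace Z" by (rule Z_subspace)
 show "\<exists>B. finite B & Z \<subseteq> span B" by (rule Z_finite_dim)
 show "af (u + r *\<^sub>R v) w = af u w + r * af v w" if "u \<in> Z" "v \<in> Z" "w \<in> Z" for u v w r
  using ext_lin[OF that] by (simp add: af_def algebra_simps)
 show "af u v = af v u" if "u \<in> Z" "v \<in> Z" for u v using ext_sym[OF that] by (simp add: af_def)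
 show "af u u > 0" if u: "u \<in> Z" "u ~= 0" for u
 proof -
  have "ext_norm s \<Omega> u ~= 0" using ext_norm_zero[OF u(1)] u(2) by blast
  then have "0 < (ext_norm s \<Omega> u)^2" by simp
  then have "0 < d_const s / a1 * af u u" using af_coercive[OF u(1)] by linarith
  then show ?thesis using d_const_pos a1_pos by (simp add: zero_less_mult_iff zero_less_divide_iff)
 qed
qed

sublocale XE: euclidean_subspace VX ip
proof
 show "subspace VX" by (rule VX_subspace)
 show "\<exists>B. finite B & VX \<subseteq> span B"
  using spaces by (auto simp: admissible_spaces_def discrete_space_def)
 show "ip (u + r *\<^sub>R v) w = ip u w + r * ip v w" if "u \<in> VX" "v \<in> VX" "w \<in> VX" for u v w r
  using L2_inner_add[OF VX_L2[OF that(1)] L2_scale_fun[OF VX_L2[OF that(2)]] VX_L2[OF that(3)], of r]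
  by (simp add: L2_inner_scale)
 show "ip u v = ip v u" for u v by (rule L2_inner_sym)
 show "ip u u > 0" if u: "u \<in> VX" "u ~= 0" for u
 proof -
  have "nrm u ~= 0" using L2_norm_zero_AE[OF VX_L2[OF u(1)]] VX_zero[OF u(1)] u(2) by blast
  then show ?thesis by (simp add: L2_inner_self)
 qed
qed

abbreviation "D \<equiv> lifting s \<Omega> A c VX VY"

lemma lifting_ex1:
 assumes u: "u \<in> VX"
 shows "\<exists>!W. W \<in> Z & tr W = u & (\<forall>V\<in>Z. tr V = 0 --> ext W V = 0)"
proof -
 obtain v1 where v1: "v1 \<in> VY" "v1 0 = 1" using spaces by (auto simp: admissible_spaces_def)
 define W0 :: "(real^'d) \<times> real => real" where "W0 = (%(x, y). u x * v1 y)"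
 have W0: "W0 \<in> Z" "tr W0 = u" unfolding W0_def using product_in_Z[OF u v1(1)] v1(2) by (auto simp: tr_def)
 have "\<exists>!W. W \<in> Z & tr W = tr W0 & (\<forall>V\<in>Z. tr V = 0 --> af W V = 0)"
  by (rule ZE.orthogonal_complement_of_kernel[OF _ W0(1)]) (simp add: tr_add tr_scale)
 moreover have "af W V = 0 \<longleftrightarrow> ext W V = 0" for W V using d_const_pos by (simp add: af_def)
 ultimately show ?thesis by (simp add: W0(2))
qed

lemma lifting:
 assumes u: "u \<in> VX"
 shows "D u \<in> Z" "tr (D u) = u" "!!V. V \<in> Z ==> tr V = 0 ==> af (D u) V = 0"
 using theI'[OF lifting_ex1[OF u], folded lifting_def] by (auto simp: af_def)

lemma lifting_eqI:
 assumes u: "u \<in> VX" and W: "W \<in> Z" "tr W = u" "!!V. V \<in> Z ==> tr V = 0 ==> af W V = 0"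
 shows "D u = W"
 unfolding lifting_def
proof (rule the1_equality[OF lifting_ex1[OF u]])
 show "W \<in> Z & tr W = u & (\<forall>V\<in>Z. tr V = 0 --> ext W V = 0)"
  using W d_const_pos by (auto simp: af_def)
qed

lemma lifting_lin:
 assumes "u \<in> VX" "v \<in> VX"
 shows "D (u + r *\<^sub>R v) = D u + r *\<^sub>R D v"
proof (rule lifting_eqI)
 show "u + r *\<^sub>R v \<in> VX" using assms by (intro subspace_add[OF VX_subspace] subspace_scale[OF VX_subspace])
 show "D u + r *\<^sub>R D v \<in> Z" using assms by (intro subspace_add[OF Z_subspace] subspace_scale[OF Z_subspace] lifting)
 show "tr (D u + r *\<^sub>R D v) = u + r *\<^sub>R v" using assms by (simp add: tr_add tr_scale lifting)
 show "af (D u + r *\<^sub>R D v) V = 0" if "V \<in> Z" "tr V = 0" for V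
  using ZE.form_lin[OF lifting(1)[OF assms(1)] lifting(1)[OF assms(2)] that(1), of r] lifting(3) assms that by simp
qed

text \<open>\<open>W\<close> and the lifting of its trace differ by a function with trace \<open>0\<close>.\<close>

lemma af_lifting_trace:
 assumes u: "u \<in> VX" and W: "W \<in> Z"
 shows "af (D u) W = af (D u) (D (tr W))"
proof -
 have t: "tr W \<in> VX" by (rule tr_VX[OF W])
 have d: "W - D (tr W) \<in> Z" using W lifting(1)[OF t] Z_subspace by (simp add: subspace_diff)
 have "af (W - D (tr W)) (D u) = 0"
  using lifting(3)[OF u d] ZE.form_sym[OF d lifting(1)[OF u]] lifting(2)[OF t] by (simp add: tr_diff)
 then have "af W (D u) = af (D (tr W)) (D u)"
  using ZE.form_diff[OF W lifting(1)[OF t] lifting(1)[OF u]] by simp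
 then show ?thesis using ZE.form_sym W lifting(1) u t by simp
qed

abbreviation "Lh \<equiv> discrete_op s \<Omega> A c VX VY"
abbreviation "Pi2 \<equiv> L2_proj (vol \<Omega>) VX"

lemma Lh:
 assumes u: "u \<in> VX"
 shows "Lh u \<in> VX" "!!v. v \<in> VX ==> ip (Lh u) v = af (D u) (D v)"
proof -
 have "\<exists>!w. w \<in> VX & (\<forall>v\<in>VX. ip w v = af (D u) (D v))"
 proof (rule XE.Riesz)
  fix v w r assume vw: "v \<in> VX" "w \<in> VX"
  have vw': "D v + r *\<^sub>R D w \<in> Z" using vw by (intro subspace_add[OF Z_subspace] subspace_scale[OF Z_subspace] lifting)
  show "af (D u) (D (v + r *\<^sub>R w)) = af (D u) (D v) + r * af (D u) (D w)"
   unfolding lifting_lin[OF vw] ZE.form_sym[OF lifting(1)[OF u] vw']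
   using ZE.form_lin[OF lifting(1)[OF vw(1)] lifting(1)[OF vw(2)] lifting(1)[OF u], of r]
   ZE.form_sym[OF lifting(1)[OF u] lifting(1)[OF vw(1)]] ZE.form_sym[OF lifting(1)[OF u] lifting(1)[OF vw(2)]] by simp
 qed
 from theI'[OF this] show "Lh u \<in> VX" "!!v. v \<in> VX ==> ip (Lh u) v = af (D u) (D v)"
  by (auto simp: discrete_op_def af_def)
qed

lemma Pi2:
 assumes g: "g \<in> L2\<Omega>"
 shows "Pi2 g \<in> VX" "!!v. v \<in> VX ==> ip (Pi2 g) v = ip g v"
proof -
 have "\<exists>!w. w \<in> VX & (\<forall>v\<in>VX. ip w v = ip g v)"
 proof (rule XE.Riesz)
  fix v w r assume vw: "v \<in> VX" "w \<in> VX"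
  show "ip g (v + r *\<^sub>R w) = ip g v + r * ip g w"
   unfolding L2_inner_sym[of _ g]
   using L2_inner_add[OF VX_L2[OF vw(1)] L2_scale_fun[OF VX_L2[OF vw(2)]] g, of r] by (simp add: L2_inner_scale)
 qed
 from theI'[OF this] show "Pi2 g \<in> VX" "!!v. v \<in> VX ==> ip (Pi2 g) v = ip g v"
  by (auto simp: L2_proj_def)
qed

lemma energy_basis_exists: "\<exists>I. finite I & I \<subseteq> Z & ZE.orthonormal I & span I = Z"
 by (rule ZE.orthonormal_basis_exists)

end

locale semidiscrete = discretization \<Omega> s A c VX VY R a0 kA kc
 for \<Omega> :: "(real^'d) set" and s :: real and A :: "real^'d => real^'d^'d" and c :: "real^'d => real"
  and VX :: "(real^'d => real) set" and VY :: "(real => real) set" and R a0 kA kc :: real +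
 fixes I :: "((real^'d) \<times> real => real) set"
  and T :: real and f :: "real => real^'d => real" and fd :: "nat => real => real^'d => real"
  and uh0 :: "real^'d => real" and uh :: "real => real^'d => real"
 assumes I: "finite I" "I \<subseteq> Z" "ZE.orthonormal I" "span I = Z"
  and T_pos: "T > 0"
  and fd: "L2_time_derivs (vol \<Omega>) {0..T} f fd"
  and sol: "semidiscrete_solution s \<Omega> A c VX VY T f uh0 uh"
begin

primrec ud :: "nat => real => real^'d => real" where
 "ud 0 = uh"
| "ud (Suc l) = (%t. Pi2 (fd l t) - Lh (ud l t))"

definition coord :: "((real^'d) \<times> real => real) => ((real^'d) \<times> real => real) => real" where
 "coord W i = af W i"

definition comb :: "(((real^'d) \<times> real => real) => real) => (real^'d) \<times> real => real" where
 "comb v = (\<Sum>i\<in>I. v i *\<^sub>R i)"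

definition mass :: "((real^'d) \<times> real => real) => ((real^'d) \<times> real => real) => real" where
 "mass i k = ip (tr i) (tr k)"

lemma IZ: "i \<in> I ==> i \<in> Z" using I(2) by auto
lemma tr_I: "i \<in> I ==> tr i \<in> VX" by (rule tr_VX[OF IZ])
lemma tr_I_L2: "i \<in> I ==> tr i \<in> L2\<Omega>" by (rule VX_L2[OF tr_I])

lemma comb_Z: "comb v \<in> Z"
 unfolding comb_def by (rule ZE.sum_V[OF IZ])

lemma comb_coord: "W \<in> Z ==> comb (coord W) = W"
 unfolding comb_def coord_def using ZE.expansion[OF I] by simp

lemma tr_comb: "tr (comb v) = (\<Sum>i\<in>I. v i *\<^sub>R tr i)"
 unfolding comb_def by (rule tr_sum)

lemma tr_comb_L2: "tr (comb v) \<in> L2\<Omega>" by (rule VX_L2[OF tr_VX[OF comb_Z]])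

lemma comb_diff: "comb (%i. v i - w i) = comb v - comb w"
 by (simp add: comb_def scaleR_diff_left sum_subtractf)

lemma af_comb: "k \<in> I ==> af (comb v) k = v k"
proof -
 assume k: "k \<in> I"
 have "af (comb v) k = (\<Sum>i\<in>I. v i * af i k)" unfolding comb_def using I(2) k by (intro ZE.form_sum) auto
 also have "... = (\<Sum>i\<in>I. if i = k then v i else 0)"
  using I(3) k by (intro sum.cong) (auto simp: ZE.orthonormal_def)
 finally show ?thesis using I(1) k by simp
qed

lemma af_comb_self: "af (comb v) (comb v) = (\<Sum>i\<in>I. (v i)^2)"
proof -
 have "af (comb v) (comb v) = (\<Sum>i\<in>I. v i * af i (comb v))"
  unfolding comb_def[of v] by (rule ZE.form_sum) (use IZ comb_Z[of v] in "auto simp: comb_def")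
 also have "... = (\<Sum>i\<in>I. v i * v i)"
  using af_comb ZE.form_sym[OF comb_Z IZ] by (intro sum.cong) auto
 finally show ?thesis by (simp add: power2_eq_square)
qed

lemma ip_tr_comb: "g \<in> L2\<Omega> ==> ip (tr (comb v)) g = (\<Sum>i\<in>I. v i * ip (tr i) g)"
 unfolding tr_comb by (rule L2_inner_sum[OF tr_I_L2])

lemma mass_form: "(\<Sum>i\<in>I. \<Sum>k\<in>I. mass i k * v i * w k) = ip (tr (comb v)) (tr (comb w))"
proof -
 have "ip (tr (comb v)) (tr (comb w)) = (\<Sum>i\<in>I. v i * ip (tr (comb w)) (tr i))"
  by (simp add: ip_tr_comb[OF tr_comb_L2] L2_inner_sym)
 also have "... = (\<Sum>i\<in>I. \<Sum>k\<in>I. mass i k * v i * w k)"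
 proof (intro sum.cong refl)
  fix i assume i: "i \<in> I"
  have "v i * ip (tr (comb w)) (tr i) = (\<Sum>k\<in>I. v i * (w k * ip (tr k) (tr i)))"
   unfolding ip_tr_comb[OF tr_I_L2[OF i]] sum_distrib_left ..
  also have "... = (\<Sum>k\<in>I. mass i k * v i * w k)"
   unfolding mass_def by (intro sum.cong refl) (simp add: L2_inner_sym[of _ "tr i"] mult_ac)
  finally show "v i * ip (tr (comb w)) (tr i) = (\<Sum>k\<in>I. mass i k * v i * w k)" .
 qed
 finally show ?thesis by simp
qed

sublocale M: mass_matrix I mass CM
proof
 show "finite I" by (rule I)
 show "mass i k = mass k i" for i k by (simp add: mass_def L2_inner_sym)
 show "0 <= (\<Sum>i\<in>I. \<Sum>k\<in>I. mass i k * v i * v k)" for v by (simp add: mass_form L2_inner_self)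
 show "(\<Sum>i\<in>I. \<Sum>k\<in>I. mass i k * v i * v k) <= CM * (\<Sum>i\<in>I. (v i)^2)" for v
 proof -
  have "ip (tr (comb v)) (tr (comb v)) <= CT * (ext_norm s \<Omega> (comb v))^2"
   unfolding L2_inner_self by (rule trace_L2_bound[OF comb_Z])
  also have "... <= CT * (d_const s / a1 * af (comb v) (comb v))"
   using CT_pos by (intro mult_left_mono af_coercive comb_Z) auto
  finally show ?thesis by (simp add: mass_form af_comb_self CM_def)
 qed
 show "CM > 0" by (rule CM_pos)
qed

lemma mm_tr: "M.mm v w = ip (tr (comb v)) (tr (comb w))"
 unfolding M.mm_def by (rule mass_form)

lemma fd_L2: "t \<in> {0..T} ==> fd l t \<in> L2\<Omega>"
 using fd by (auto simp: L2_time_derivs_def)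

lemma fd_0: "fd 0 = f" using fd by (auto simp: L2_time_derivs_def)

lemma ud_VX: "t \<in> {0..T} ==> ud l t \<in> VX"
proof (induction l)
 case 0
 then show ?case using sol by (auto simp: semidiscrete_solution_def)
next
 case (Suc l)
 then show ?case unfolding ud.simps by (intro subspace_diff[OF VX_subspace] Pi2(1) fd_L2 Lh(1))
qed

lemma ip_ud_Suc:
 assumes t: "t \<in> {0..T}" and e: "e \<in> VX"
 shows "ip (ud (Suc l) t) e = ip (fd l t) e - ip (ud l t) (Lh e)"
proof -
 have "ip (ud (Suc l) t) e = ip (Pi2 (fd l t)) e - ip (Lh (ud l t)) e"
  unfolding ud.simps by (intro L2_inner_diff VX_L2 Pi2(1) Lh(1) fd_L2 ud_VX t e)
 also have "ip (Lh (ud l t)) e = af (D e) (D (ud l t))"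
  using Lh(2)[OF ud_VX[OF t] e] ZE.form_sym[OF lifting(1)[OF ud_VX[OF t]] lifting(1)[OF e]] by simp
 also have "... = ip (ud l t) (Lh e)"
  using Lh(2)[OF e ud_VX[OF t]] by (simp add: L2_inner_sym)
 finally show ?thesis unfolding Pi2(2)[OF fd_L2[OF t] e] .
qed

text \<open>Since the discrete operator is symmetric, it can be moved to the fixed test function; so the equation itself
  yields the next derivative, and the semidiscrete solution is as smooth in time as the data.\<close>

lemma ud_deriv:
 assumes t: "t \<in> {0..T}" and e: "e \<in> VX"
 shows "((%\<tau>. ip (ud l \<tau>) e) has_real_derivative ip (ud (Suc l) t) e) (at t within {0..T})"
 using e
proof (induction l arbitrary: e)
 case 0
 obtain d where d: "d \<in> VX" "has_L2_deriv (vol \<Omega>) uh d t {0..T}" "d + Lh (uh t) = Pi2 (f t)"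
  using sol t unfolding semidiscrete_solution_def by blast
 have "d = ud (Suc 0) t" unfolding ud.simps fd_0 d(3)[symmetric] by (rule add_diff_cancel_right'[symmetric])
 have "uh \<tau> \<in> L2\<Omega>" if "\<tau> \<in> {0..T}" for \<tau> using VX_L2[OF ud_VX[OF that, of 0]] by simp
 then show ?case
  unfolding \<open>d = ud (Suc 0) t\<close>[symmetric] ud.simps(1) by (intro L2_deriv_inner[OF d(2) _ t VX_L2[OF d(1)] VX_L2[OF 0]])
next
 case (Suc l)
 have f: "((%\<tau>. ip (fd l \<tau>) e) has_real_derivative ip (fd (Suc l) t) e) (at t within {0..T})"
  using fd t by (intro L2_deriv_inner fd_L2 VX_L2 Suc) (auto simp: L2_time_derivs_def)
 have "((%\<tau>. ip (fd l \<tau>) e - ip (ud l \<tau>) (Lh e)) has_real_derivative ip (fd (Suc l) t) e - ip (ud (Suc l) t) (Lh e)) (at t within {0..T})"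
  by (intro DERIV_diff f Suc.IH Lh Suc.prems)
 then show ?case
  unfolding ip_ud_Suc[OF t Suc.prems, of "Suc l"] has_field_derivative_def
  by (rule has_derivative_transform[OF t, rotated]) (simp only: ip_ud_Suc[OF _ Suc.prems])
qed

definition cu :: "nat => real => ((real^'d) \<times> real => real) => real" where
 "cu l t = coord (D (ud l t))"

lemma comb_cu: "t \<in> {0..T} ==> comb (cu l t) = D (ud l t)"
 unfolding cu_def by (intro comb_coord lifting ud_VX)

lemma tr_comb_cu: "t \<in> {0..T} ==> tr (comb (cu l t)) = ud l t"
 by (simp add: comb_cu lifting ud_VX)

lemma cu_ip: "t \<in> {0..T} ==> i \<in> I ==> cu l t i = ip (ud l t) (Lh (tr i))"
proof -
 assume t: "t \<in> {0..T}" and i: "i \<in> I"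
 note u = ud_VX[OF t, of l] and ti = tr_I[OF i]
 have "cu l t i = af (D (ud l t)) (D (tr i))"
  unfolding cu_def coord_def by (rule af_lifting_trace[OF u IZ[OF i]])
 also have "... = af (D (tr i)) (D (ud l t))" by (rule ZE.form_sym[OF lifting(1)[OF u] lifting(1)[OF ti]])
 finally show ?thesis using Lh(2)[OF ti u] by (simp add: L2_inner_sym)
qed

definition load :: "nat => real => ((real^'d) \<times> real => real) => real" where
 "load l t k = ip (fd l t) (tr k)"

lemma load_deriv:
 assumes "t \<in> {0..T}" "k \<in> I"
 shows "((%\<tau>. load l \<tau> k) has_real_derivative load (Suc l) t k) (at t within {0..T})"
 unfolding load_def using fd assms by (intro L2_deriv_inner fd_L2 tr_I_L2) (auto simp: L2_time_derivs_def)

text \<open>The \<open>i\<close>-th coordinate of the lifting of \<open>u\<close> is at the same time the value of the discrete operator tested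
  with the trace of the \<open>i\<close>-th basis function. Therefore the lifted solution satisfies the system although the
  basis functions need not be liftings.\<close>

lemma flow_in_coordinates:
 assumes \<Phi>: "!!l t. t \<in> {0..T} ==> nrm (fd l t) <= \<Phi> l"
 shows "semidiscrete_flow I mass CM cu load T \<Phi>"
proof
 show "T > 0" by (rule T_pos)
 show "smooth_seq 0 T (%l t. cu l t i)" if i: "i \<in> I" for i
  unfolding smooth_seq_def
 proof (intro allI ballI)
  fix l t assume t: "t \<in> {0..T}"
  have "((%\<tau>. ip (ud l \<tau>) (Lh (tr i))) has_real_derivative cu (Suc l) t i) (at t within {0..T})"
   unfolding cu_ip[OF t i] by (intro ud_deriv t Lh tr_I i)
  then show "((%t. cu l t i) has_real_derivative cu (Suc l) t i) (at t within {0..T})"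
   unfolding has_field_derivative_def
   by (rule has_derivative_transform[OF t, rotated]) (simp only: cu_ip[OF _ i])
 qed
 show "(\<Sum>i\<in>I. mass i k * cu (Suc l) t i) + cu l t k = load l t k" if t: "t \<in> {0..T}" and k: "k \<in> I" for l t k
 proof -
  have "(\<Sum>i\<in>I. mass i k * cu (Suc l) t i) = ip (tr (comb (cu (Suc l) t))) (tr k)"
   by (simp add: ip_tr_comb[OF tr_I_L2[OF k]] mass_def mult.commute)
  also have "... = load l t k - cu l t k"
   unfolding tr_comb_cu[OF t] ip_ud_Suc[OF t tr_I[OF k]] cu_ip[OF t k] load_def by simp
  finally show ?thesis by simp
 qed
 have "0 \<in> {0..T}" using T_pos by simp
 then show "\<Phi> l >= 0" for l using \<Phi>[of 0 l] L2_norm_nonneg[of "vol \<Omega>" "fd l 0"] by linarith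
 show "(\<Sum>k\<in>I. load l t k * v k) <= \<Phi> l * sqrt (M.mm v v)" if t: "t \<in> {0..T}" for l t v
 proof -
  have "(\<Sum>k\<in>I. load l t k * v k) = ip (fd l t) (tr (comb v))"
   unfolding L2_inner_sym[of _ "fd l t" "tr (comb v)"] ip_tr_comb[OF fd_L2[OF t]] load_def
   by (intro sum.cong refl) (simp add: L2_inner_sym[of _ "fd l t"])
  also have "... <= nrm (fd l t) * nrm (tr (comb v))"
   using L2_Cauchy_Schwarz[OF fd_L2[OF t] tr_comb_L2, of l v] by linarith
  also have "... <= \<Phi> l * nrm (tr (comb v))"
   by (intro mult_right_mono \<Phi> t L2_norm_nonneg)
  also have "nrm (tr (comb v)) = sqrt (M.mm v v)"
   by (simp add: mm_tr L2_inner_self L2_norm_nonneg)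
  finally show ?thesis .
 qed
qed

end

section \<open>The initial value in the interpolation space\<close>

text \<open>The K-functional is monotone in its parameter, so its value at \<open>t\<close> bounds it on \<open>[t, 2 t]\<close>.\<close>

lemma interp_sqnorm_lower:
 fixes u :: "'u::ab_group_add"
 assumes \<beta>: "0 < \<beta>" "\<beta> < 1" and X: "X1 ~= {}" and n: "!!v. 0 <= n0 v" "!!v. 0 <= n1 v" and t: "t > 0"
 shows "ennreal (t powr (- 2 * \<beta>) * (K_functional n0 X1 n1 t u)^2 / 8) <= interp_sqnorm \<beta> n0 X1 n1 u"
proof -
 let ?K = "%t. K_functional n0 X1 n1 t u"
 have K0: "0 <= ?K r" if "r > 0" for r unfolding K_functional_def using that n X by (intro cINF_greatest) auto
 have Km: "?K t <= ?K r" if r: "t <= r" for r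
  unfolding K_functional_def
 proof (rule cINF_mono[OF X])
  show "bdd_below ((%v. n0 (u - v) + t * n1 v) ` X1)" using n t by (intro bdd_belowI[of _ 0]) auto
  show "\<exists>v\<in>X1. n0 (u - v) + t * n1 v <= n0 (u - w) + r * n1 w" if "w \<in> X1" for w
   using that n r t by (intro bexI[of _ w]) (auto intro: mult_right_mono)
 qed
 define q where "q = (2 * t) powr (- 2 * \<beta> - 1) * (?K t)^2"
 have q: "q >= 0" by (simp add: q_def)
 have "t powr (- 2 * \<beta>) * (?K t)^2 / 8 <= q * t"
 proof -
  have e: "(2 * t) powr (- 2 * \<beta> - 1) * t = 2 powr (- 2 * \<beta> - 1) * t powr (- 2 * \<beta>)"
  proof -
   have "t powr (- 2 * \<beta> - 1) * t = t powr (- 2 * \<beta> - 1) * t powr 1" using t by (simp only: powr_one)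
   also have "... = t powr (- 2 * \<beta>)" unfolding powr_add[symmetric] by simp
   finally show ?thesis using t by (simp add: powr_mult mult.assoc)
  qed
  have "(1 / 8 :: real) = 2 powr (- 3)" by (simp add: powr_minus)
  also have "... <= 2 powr (- 2 * \<beta> - 1)" using \<beta> by (intro powr_mono) auto
  finally have "1 / 8 * (t powr (- 2 * \<beta>) * (?K t)^2) <= 2 powr (- 2 * \<beta> - 1) * (t powr (- 2 * \<beta>) * (?K t)^2)"
   by (intro mult_right_mono) auto
  also have "... = q * t" unfolding q_def using e by (simp add: mult_ac)
  finally show ?thesis by simp
 qed
 then have "ennreal (t powr (- 2 * \<beta>) * (?K t)^2 / 8) <= ennreal (q * t)" by (rule ennreal_leI)
 also have "... = (\<integral>\<^sup>+ r\<in>{t..2 * t}. ennreal q \<partial>lborel)"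
  using t q by (subst nn_integral_cmult_indicator) (auto simp: ennreal_mult)
 also have "... <= interp_sqnorm \<beta> n0 X1 n1 u"
  unfolding interp_sqnorm_def
 proof (rule nn_integral_mono)
  fix r :: real
  show "ennreal q * indicator {t..2 * t} r <= ennreal (r powr (- 2 * \<beta>) * (?K r)^2 / r) * indicator {0<..} r"
  proof (cases "r \<in> {t..2 * t}")
   case True
   have "(2 * t) powr (- 2 * \<beta> - 1) <= r powr (- 2 * \<beta> - 1)" using True t \<beta> by (intro powr_mono2') auto
   also have "... = r powr (- 2 * \<beta>) / r" using True t by (simp add: powr_diff)
   finally have "q <= r powr (- 2 * \<beta>) / r * (?K r)^2"
   unfolding q_def using True t Km[of r] K0[OF t] by (intro mult_mono power_mono) auto
   then show ?thesis using True t by (simp add: ennreal_leI)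
  qed simp
 qed
 finally show ?thesis .
qed

text \<open>The norm is the real value of an extended integral, with value \<open>0\<close> for an infinite one; a bound for the
  norm has a meaning only because of this finiteness. The competitors \<open>u\<close> and \<open>0\<close> are used for small and for
  large parameters.\<close>

lemma interp_sqnorm_finite:
 fixes u :: "'u::ab_group_add"
 assumes \<beta>: "0 < \<beta>" "\<beta> < 1" and u: "u \<in> X1" and z: "0 \<in> X1" and n: "!!v. 0 <= n0 v" "!!v. 0 <= n1 v"
  and n00: "n0 0 = 0" "n1 0 = 0"
 shows "interp_sqnorm \<beta> n0 X1 n1 u < \<infinity>"
proof -
 let ?A = "%r. indicator {1..} r * r powr (- 2 * \<beta> - 1)"
 let ?K = "%t. K_functional n0 X1 n1 t u"
 have K0: "0 <= ?K r" if "r > 0" for r unfolding K_functional_def using that n z by (intro cINF_greatest) auto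
 have Kle: "?K r <= n0 (u - v) + r * n1 v" if "r > 0" "v \<in> X1" for r v
  unfolding K_functional_def by (rule cINF_lower[OF _ that(2)]) (use that n in "auto intro!: bdd_belowI[of _ 0]")
 have K1: "?K r <= r * n1 u" and K2: "?K r <= n0 u" if "r > 0" for r
  using Kle[OF that u] Kle[OF that z] n00 by auto
 have i1: "(\<integral>\<^sup>+ r. ennreal (indicator {0..1} r * r powr (1 - 2 * \<beta>)) \<partial>lborel) = ennreal (1 powr (1 - 2 * \<beta> + 1) / (1 - 2 * \<beta> + 1))"
  by (rule nn_integral_has_integral_lebesgue[OF _ has_integral_powr_from_0]) (use \<beta> in auto)
 have i2: "(\<integral>\<^sup>+ r. ennreal (?A r) \<partial>lborel) = ennreal (- (1 powr (- 2 * \<beta> - 1 + 1)) / (- 2 * \<beta> - 1 + 1))"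
  by (rule nn_integral_has_integral_lebesgue[OF _ has_integral_powr_to_inf]) (use \<beta> in auto)
 have "interp_sqnorm \<beta> n0 X1 n1 u <= (\<integral>\<^sup>+ r. ennreal ((n1 u)^2) * ennreal (indicator {0..1} r * r powr (1 - 2 * \<beta>))
   + ennreal ((n0 u)^2) * ennreal (?A r) \<partial>lborel)"
  unfolding interp_sqnorm_def
 proof (rule nn_integral_mono)
  fix r :: real
  show "ennreal (r powr (- 2 * \<beta>) * (?K r)^2 / r) * indicator {0<..} r
   <= ennreal ((n1 u)^2) * ennreal (indicator {0..1} r * r powr (1 - 2 * \<beta>)) + ennreal ((n0 u)^2) * ennreal (?A r)"
  proof (cases "r > 0")
   case True
   have p1: "r powr (- 2 * \<beta>) / r = r powr (- 2 * \<beta> - 1)" using True by (simp add: powr_diff)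
   have p2: "r powr (- 2 * \<beta> - 1) * r^2 = r powr (1 - 2 * \<beta>)"
   proof -
   have "r powr (- 2 * \<beta> - 1) * r powr 2 = r powr (1 - 2 * \<beta>)" by (simp flip: powr_add)
   then show ?thesis using True by (simp add: powr_numeral)
   qed
   have e: "r powr (- 2 * \<beta>) * (?K r)^2 / r = r powr (- 2 * \<beta> - 1) * (?K r)^2" unfolding p1[symmetric] by simp
   show ?thesis
   proof (cases "r <= 1")
   case r: True
   have "r powr (- 2 * \<beta> - 1) * (?K r)^2 <= r powr (- 2 * \<beta> - 1) * (r * n1 u)^2"
   using True K0 K1 by (intro mult_left_mono power_mono) auto
   also have "... = (n1 u)^2 * r powr (1 - 2 * \<beta>)" unfolding p2[symmetric] by (simp add: power_mult_distrib mult_ac)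
   finally have "ennreal (r powr (- 2 * \<beta>) * (?K r)^2 / r) <= ennreal ((n1 u)^2) * ennreal (r powr (1 - 2 * \<beta>))"
   unfolding e by (subst ennreal_mult[symmetric]) (auto intro: ennreal_leI)
   from add_mono[OF this zero_le[of "ennreal ((n0 u)^2) * ennreal (?A r)"]]
   show ?thesis using True r by simp
   next
   case r: False
   have "r powr (- 2 * \<beta> - 1) * (?K r)^2 <= r powr (- 2 * \<beta> - 1) * (n0 u)^2"
   using True K0 K2 by (intro mult_left_mono power_mono) auto
   then have "ennreal (r powr (- 2 * \<beta>) * (?K r)^2 / r) <= ennreal ((n0 u)^2) * ennreal (r powr (- 2 * \<beta> - 1))"
   unfolding e by (subst ennreal_mult[symmetric]) (auto intro: ennreal_leI simp: mult.commute)
   then show ?thesis using True r by simp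
   qed
  qed simp
 qed
 also have "... = ennreal ((n1 u)^2) * ennreal (1 powr (1 - 2 * \<beta> + 1) / (1 - 2 * \<beta> + 1))
   + ennreal ((n0 u)^2) * ennreal (- (1 powr (- 2 * \<beta> - 1 + 1)) / (- 2 * \<beta> - 1 + 1))"
  unfolding i1[symmetric] i2[symmetric] by (subst nn_integral_add) (auto simp: nn_integral_cmult)
 also have "... < \<infinity>" by (simp add: ennreal_mult_less_top)
 finally show ?thesis .
qed

text \<open>A nearly optimal splitting at the parameter \<open>sqrt \<tau>\<close> of the K-functional.\<close>

lemma interpolation_splitting:
 fixes u :: "'u::ab_group_add"
 assumes \<beta>: "0 < \<beta>" "\<beta> < 1" and u: "u \<in> X1" and z: "0 \<in> X1" and n: "!!v. 0 <= n0 v" "!!v. 0 <= n1 v"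
  and n00: "n0 0 = 0" "n1 0 = 0" and B: "interp_norm \<beta> n0 X1 n1 u <= B" and \<tau>: "\<tau> > 0"
 shows "\<exists>v\<in>X1. (n0 (u - v))^2 + \<tau> * (n1 v)^2 <= (3 * B + 1)^2 * \<tau> powr \<beta>"
proof -
 define t where "t = sqrt \<tau>"
 have t: "t > 0" "t^2 = \<tau>" using \<tau> by (auto simp: t_def)
 let ?K = "%t. K_functional n0 X1 n1 t u"
 define Q where "Q = enn2real (interp_sqnorm \<beta> n0 X1 n1 u)"
 have Q: "ennreal Q = interp_sqnorm \<beta> n0 X1 n1 u"
  using interp_sqnorm_finite[of \<beta> u X1 n0 n1] \<beta> u z n n00 by (simp add: Q_def ennreal_enn2real)
 have Q0: "Q >= 0" by (simp add: Q_def)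
 have BQ: "sqrt Q <= B" using B by (simp add: interp_norm_def Q_def)
 have B0: "B >= 0" using BQ Q0 real_sqrt_ge_zero by (meson order.trans)
 have QB: "Q <= B^2" using power_mono[OF BQ, of 2] Q0 by simp
 have K0: "0 <= ?K t" unfolding K_functional_def using t n z by (intro cINF_greatest) auto
 have tp: "0 < t powr (- 2 * \<beta>)" using t(1) powr_gt_zero[of t "- 2 * \<beta>"] by linarith
 have pt: "t powr (- 2 * \<beta>) * (t powr \<beta>)^2 = 1"
 proof -
  have "(t powr \<beta>)^2 = t powr (2 * \<beta>)" by (simp add: power2_eq_square flip: powr_add)
  then have "t powr (- 2 * \<beta>) * (t powr \<beta>)^2 = t powr 0" by (simp flip: powr_add)
  then show ?thesis using t by simp
 qed
 have "ennreal (t powr (- 2 * \<beta>) * (?K t)^2 / 8) <= ennreal Q"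
  unfolding Q by (rule interp_sqnorm_lower) (use \<beta> n t z in auto)
 then have "t powr (- 2 * \<beta>) * (?K t)^2 <= 9 * Q" using Q0 by (subst (asm) ennreal_le_iff) auto
 also have "... <= 9 * B^2" using QB by simp
 also have "... = t powr (- 2 * \<beta>) * (3 * B * t powr \<beta>)^2" using pt by (simp add: power_mult_distrib)
 finally have "t powr (- 2 * \<beta>) * (?K t)^2 <= t powr (- 2 * \<beta>) * (3 * B * t powr \<beta>)^2" .
 then have "(?K t)^2 <= (3 * B * t powr \<beta>)^2" using mult_le_cancel_left_pos[OF tp] by blast
 then have Kt: "?K t <= 3 * B * t powr \<beta>" by (rule power2_le_imp_le) (use B0 in auto)
 have "?K t < (3 * B + 1) * t powr \<beta>" using Kt t(1) powr_gt_zero[of t \<beta>] unfolding distrib_right by linarith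
 then obtain v where v: "v \<in> X1" "n0 (u - v) + t * n1 v < (3 * B + 1) * t powr \<beta>"
  unfolding K_functional_def
  by (subst (asm) cINF_less_iff) (use n t z in "auto intro!: bdd_belowI[of _ 0]")
 have "(n0 (u - v))^2 + \<tau> * (n1 v)^2 <= (n0 (u - v) + t * n1 v)^2"
  using n t by (simp add: power2_sum power_mult_distrib)
 also have "... <= ((3 * B + 1) * t powr \<beta>)^2" using v n t by (intro power_mono) auto
 also have "... = (3 * B + 1)^2 * \<tau> powr \<beta>"
 proof -
  have tt: "t * t = \<tau>" using t(2) by (simp only: power2_eq_square)
  have "t powr \<beta> * t powr \<beta> = (t * t) powr \<beta>" by (rule powr_mult[symmetric])
  then show ?thesis unfolding tt power_mult_distrib power2_eq_square by simp
 qed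
 finally show ?thesis using v(1) by blast
qed

context semidiscrete
begin

text \<open>The hypothesis of the energy decay \<open>X_0_bound\<close>, with \<open>B\<close> proportional to \<open>\<tau>\<^sup>\<beta>\<close>.\<close>

lemma initial_splitting:
 assumes \<beta>: "0 < \<beta>" "\<beta> < 1" and B: "discrete_interp_norm s \<Omega> A c VX VY \<beta> uh0 <= B" and \<tau>: "\<tau> > 0"
 shows "\<exists>v. M.mm (%i. cu 0 0 i - v i) (%i. cu 0 0 i - v i) + \<tau> * (\<Sum>i\<in>I. (v i)^2)
  <= max 1 (kU / d_const s) * (3 * B + 1)^2 * \<tau> powr \<beta>"
proof -
 let ?A = "%v. ext_norm s \<Omega> (D v)"
 have T0: "0 \<in> {0..T}" using T_pos by simp
 have u0: "uh0 = ud 0 0" using sol by (simp add: semidiscrete_solution_def)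
 have uX: "uh0 \<in> VX" unfolding u0 by (rule ud_VX[OF T0])
 have D0: "D 0 = 0"
  using lifting_lin[OF XE.zero_V XE.zero_V, of "-1"] by simp
 have "ext 0 0 = 0" using ZE.form_zero[OF ZE.zero_V] d_const_pos by (simp add: af_def)
 then have "a1 * (ext_norm s \<Omega> 0)^2 <= 0" using ext_coercive[OF ZE.zero_V] by simp
 then have e0: "ext_norm s \<Omega> 0 = 0" using a1_pos by (simp add: mult_le_0_iff)
 have "\<exists>v\<in>VX. (nrm (uh0 - v))^2 + \<tau> * (discrete_norm s \<Omega> A c VX VY v)^2 <= (3 * B + 1)^2 * \<tau> powr \<beta>"
 proof (rule interpolation_splitting[OF \<beta> uX XE.zero_V])
  show "0 <= nrm v" for v :: "real^'d => real" by (rule L2_norm_nonneg)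
  show "0 <= discrete_norm s \<Omega> A c VX VY v" for v unfolding discrete_norm_def ext_norm_def by (rule L2_norm_nonneg)
  show "nrm (0 :: real^'d => real) = 0" by (simp add: L2_norm_def)
  show "discrete_norm s \<Omega> A c VX VY 0 = 0" by (simp add: discrete_norm_def D0 e0)
  show "interp_norm \<beta> (nrm) VX (discrete_norm s \<Omega> A c VX VY) uh0 <= B"
   using B by (simp add: discrete_interp_norm_def)
 qed (rule \<tau>)
 then obtain v where v: "v \<in> VX" "(nrm (uh0 - v))^2 + \<tau> * (?A v)^2 <= (3 * B + 1)^2 * \<tau> powr \<beta>"
  by (auto simp: discrete_norm_def)
 note Dv = lifting(1)[OF v(1)]
 let ?v = "coord (D v)" and ?k = "max 1 (kU / d_const s)"
 have "M.mm (%i. cu 0 0 i - ?v i) (%i. cu 0 0 i - ?v i) = (nrm (uh0 - v))^2"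
  unfolding mm_tr comb_diff tr_diff tr_comb_cu[OF T0] comb_coord[OF Dv] lifting(2)[OF v(1)] u0 by (rule L2_inner_self)
 moreover have "(\<Sum>i\<in>I. (?v i)^2) <= ?k * (?A v)^2"
 proof -
  have "(\<Sum>i\<in>I. (?v i)^2) = af (D v) (D v)" unfolding af_comb_self[symmetric] comb_coord[OF Dv] ..
  also have "... <= kU / d_const s * (?A v)^2"
   using ext_upper[OF Dv] d_const_pos by (simp add: af_def field_simps)
  also have "... <= ?k * (?A v)^2" by (intro mult_right_mono) auto
  finally show ?thesis .
 qed
 moreover have "(nrm (uh0 - v))^2 <= ?k * (nrm (uh0 - v))^2"
  using mult_right_mono[of 1 ?k "(nrm (uh0 - v))^2"] by simp
 ultimately have "M.mm (%i. cu 0 0 i - ?v i) (%i. cu 0 0 i - ?v i) + \<tau> * (\<Sum>i\<in>I. (?v i)^2)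
  <= ?k * (nrm (uh0 - v))^2 + \<tau> * (?k * (?A v)^2)"
  using \<tau> by (intro add_mono) auto
 also have "... = ?k * ((nrm (uh0 - v))^2 + \<tau> * (?A v)^2)" by (simp add: algebra_simps)
 also have "... <= ?k * ((3 * B + 1)^2 * \<tau> powr \<beta>)" using v(2) by (intro mult_left_mono) auto
 finally show ?thesis by (intro exI[of _ ?v]) (simp add: mult.assoc)
qed

end

section \<open>The discontinuous Galerkin solution in coordinates\<close>

lemma dg_space_piece:
 "v \<in> dg_space tn J r ==> j \<in> {1..J} ==> \<exists>p. degree p <= r j & (\<forall>t\<in>{tn (j - 1)<..tn j}. v t = poly p t)"
 unfolding dg_space_def by blast

lemma dg_space_subspace: "subspace (dg_space tn J r)"
proof (rule subspaceI)
 show "0 \<in> dg_space tn J r" unfolding dg_space_def by (auto intro: exI[of _ 0])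
next
 fix v w assume vw: "v \<in> dg_space tn J r" "w \<in> dg_space tn J r"
 show "v + w \<in> dg_space tn J r"
  unfolding dg_space_def
 proof (intro CollectI conjI ballI allI impI)
  fix j assume j: "j \<in> {1..J}"
  obtain p where p: "degree p <= r j" "\<forall>t\<in>{tn (j - 1)<..tn j}. v t = poly p t" using dg_space_piece[OF vw(1) j] by blast
  obtain q where q: "degree q <= r j" "\<forall>t\<in>{tn (j - 1)<..tn j}. w t = poly q t" using dg_space_piece[OF vw(2) j] by blast
  show "\<exists>p. degree p <= r j & (\<forall>t\<in>{tn (j - 1)<..tn j}. (v + w) t = poly p t)"
   using p q by (intro exI[of _ "p + q"]) (auto intro: degree_add_le)
 qed (use vw in "auto simp: dg_space_def")
next
 fix c v assume v: "v \<in> dg_space tn J r"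
 show "c *\<^sub>R v \<in> dg_space tn J r"
  unfolding dg_space_def
 proof (intro CollectI conjI ballI allI impI)
  fix j assume j: "j \<in> {1..J}"
  obtain p where p: "degree p <= r j" "\<forall>t\<in>{tn (j - 1)<..tn j}. v t = poly p t" using dg_space_piece[OF v j] by blast
  show "\<exists>p. degree p <= r j & (\<forall>t\<in>{tn (j - 1)<..tn j}. (c *\<^sub>R v) t = poly p t)"
   using p by (intro exI[of _ "smult c p"]) (auto simp: scaleR_fun_def intro: order.trans[OF degree_smult_le])
 qed (use v in "auto simp: dg_space_def scaleR_fun_def")
qed

lemma mesh_cover:
 fixes tn :: "nat => real"
 assumes t: "t \<in> {tn 0<..tn J}"
 shows "\<exists>k\<in>{1..J}. t \<in> {tn (k - 1)<..tn k}"
proof -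
 define k where "k = (LEAST k. t <= tn k)"
 have 1: "t <= tn k" unfolding k_def by (rule LeastI[of _ J]) (use t in simp)
 have 2: "k <= J" unfolding k_def by (rule Least_le) (use t in simp)
 have 3: "k ~= 0" using 1 t by (intro notI) simp
 have "\<not> t <= tn (k - 1)" using not_less_Least[of "k - 1" "%k. t <= tn k"] 3 unfolding k_def by simp
 then show ?thesis using 1 2 3 by (intro bexI[of _ k]) auto
qed

text \<open>The number of monomials times indicator functions bounds the dimension.\<close>

lemma dim_dg_space:
 assumes tn: "!!j. j \<in> {1..J} ==> tn (j - 1) < tn j"
 shows "dim (dg_space tn J r) <= (\<Sum>j=1..J. r j + 1)"
proof -
 define e where "e = (%(j, i) t. indicator {tn (j - 1)<..tn j} t * t ^ i :: real)"
 define W where "W = e ` (SIGMA j:{1..J}. {..r j})"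
 have W: "finite W" "card W <= (\<Sum>j=1..J. r j + 1)"
 proof -
  have "card W <= card (SIGMA j:{1..J}. {..r j})" unfolding W_def by (rule card_image_le) auto
  also have "... = (\<Sum>j=1..J. r j + 1)" by (subst card_SigmaI) auto
  finally show "card W <= (\<Sum>j=1..J. r j + 1)" .
  show "finite W" by (auto simp: W_def)
 qed
 have "dg_space tn J r \<subseteq> span W"
 proof
  fix v assume v: "v \<in> dg_space tn J r"
  then have "\<forall>j\<in>{1..J}. \<exists>p. degree p <= r j & (\<forall>t\<in>{tn (j - 1)<..tn j}. v t = poly p t)"
   by (simp add: dg_space_def)
  from bchoice[OF this] obtain p where p: "!!j. j \<in> {1..J} ==> degree (p j) <= r j"
   "!!j t. j \<in> {1..J} ==> t \<in> {tn (j - 1)<..tn j} ==> v t = poly (p j) t" by blast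
  have inc: "tn i <= tn k" if "i <= k" "k <= J" for i k
   by (rule increasing_nodes[where tn = tn and J = J]) (use tn that in auto)
  have "v = (\<Sum>j=1..J. \<Sum>i\<le>r j. coeff (p j) i *\<^sub>R e (j, i))"
  proof
   fix t
   have s: "(\<Sum>j=1..J. \<Sum>i\<le>r j. coeff (p j) i *\<^sub>R e (j, i)) t = (\<Sum>j=1..J. indicator {tn (j - 1)<..tn j} t * poly (p j) t)"
   unfolding sum_fun_apply
   proof (intro sum.cong refl)
   fix j assume j: "j \<in> {1..J}"
   have "poly (p j) t = (\<Sum>i\<le>r j. coeff (p j) i * t ^ i)"
   unfolding poly_altdef
   by (rule sum.mono_neutral_left) (use p(1)[OF j] in "auto simp: coeff_eq_0")
   then show "(\<Sum>i\<le>r j. (coeff (p j) i *\<^sub>R e (j, i)) t) = indicator {tn (j - 1)<..tn j} t * poly (p j) t"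
   by (simp add: e_def scaleR_fun_def sum_distrib_left mult_ac)
   qed
   show "v t = (\<Sum>j=1..J. \<Sum>i\<le>r j. coeff (p j) i *\<^sub>R e (j, i)) t"
   unfolding s
   proof (cases "t \<in> {tn 0<..tn J}")
   case False
   have "t \<notin> {tn (j - 1)<..tn j}" if "j \<in> {1..J}" for j
   using False inc[of 0 "j - 1"] inc[of j J] that by force
   then show "v t = (\<Sum>j=1..J. indicator {tn (j - 1)<..tn j} t * poly (p j) t)"
   using False v by (simp add: dg_space_def)
   next
   case True
   obtain k where k: "k \<in> {1..J}" "t \<in> {tn (k - 1)<..tn k}"
   using mesh_cover[where tn = tn, OF True] by blast
   have "t \<notin> {tn (j - 1)<..tn j}" if "j \<in> {1..J}" "j ~= k" for j
   using k that inc[of j "k - 1"] inc[of k "j - 1"] by (cases "j < k") force+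
   then have "(\<Sum>j=1..J. indicator {tn (j - 1)<..tn j} t * poly (p j) t) = (\<Sum>j=1..J. if j = k then poly (p k) t else 0)"
   using k(2) by (intro sum.cong) auto
   then show "v t = (\<Sum>j=1..J. indicator {tn (j - 1)<..tn j} t * poly (p j) t)"
   using k p(2)[OF k] by simp
   qed
  qed
  also have "... \<in> span W"
   unfolding W_def by (intro span_sum span_scale span_base) auto
  finally show "v \<in> span W" .
 qed
 then have "dim (dg_space tn J r) <= card W" by (rule dim_le_card[OF _ W(1)])
 then show ?thesis using W(2) by simp
qed

lemma integral_open_closed:
 fixes h :: "real => real"
 assumes "continuous_on {a..b} h"
 shows "set_integrable lborel {a<..<b} h" "(LINT t:{a<..<b}|lborel. h t) = integral {a..b} h"
proof -
 show i: "set_integrable lborel {a<..<b} h"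
  by (rule set_integrable_subset[OF borel_integrable_atLeastAtMost']) (use assms in auto)
 show "(LINT t:{a<..<b}|lborel. h t) = integral {a..b} h"
  using set_borel_integral_eq_integral(2)[OF i] by (simp add: integral_open_interval_real)
qed

lemma Lim_at_right_cong:
 fixes g h :: "real => real"
 assumes "a < b" "!!t. t \<in> {a<..<b} ==> g t = h t" "isCont h a"
 shows "Lim (at_right a) g = h a"
proof (rule tendsto_Lim)
 have "(h \<longlongrightarrow> h a) (at_right a)" using assms(3) by (simp add: isCont_def filterlim_at_split)
 moreover have "\<forall>\<^sub>F t in at_right a. h t = g t"
  using assms(1,2) by (auto simp: eventually_at_right intro!: exI[of _ b])
 ultimately show "(g \<longlongrightarrow> h a) (at_right a)" by (rule Lim_transform_eventually)
qed simp

lemma Lim_at_left_cong: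
 fixes g h :: "real => real"
 assumes "b < a" "!!t. t \<in> {b<..<a} ==> g t = h t" "isCont h a"
 shows "Lim (at_left a) g = h a"
proof (rule tendsto_Lim)
 have "(h \<longlongrightarrow> h a) (at_left a)" using assms(3) by (simp add: isCont_def filterlim_at_split)
 moreover have "\<forall>\<^sub>F t in at_left a. h t = g t"
  using assms(1,2) by (auto simp: eventually_at_left intro!: exI[of _ b])
 ultimately show "(g \<longlongrightarrow> h a) (at_left a)" by (rule Lim_transform_eventually)
qed simp

context semidiscrete
begin

lemma tensor_coordinates:
 assumes S: "subspace S" and U: "U \<in> tensor S Z"
 shows "at_time U t \<in> Z" "i \<in> I ==> (%t. coord (at_time U t) i) \<in> S"
proof -
 have "(\<forall>t. at_time U t \<in> Z) & (\<forall>i\<in>I. (%t. coord (at_time U t) i) \<in> S)"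
  using U unfolding tensor_def[of S]
 proof (induction rule: span_induct_alt)
  case base
  have "(%t. coord (at_time 0 t) i) = 0" if "i \<in> I" for i
   using ZE.form_zero[OF IZ[OF that]] by (simp add: fun_eq_iff coord_def at_time_def zero_fun_def)
  moreover have "at_time 0 t = (0 :: (real^'d) \<times> real => real)" for t by (simp add: at_time_def fun_eq_iff)
  ultimately show ?case using subspace_0[OF S] ZE.zero_V by (simp del: zero_fun_apply)
 next
  case (step r p U)
  then obtain v w where vw: "v \<in> S" "w \<in> Z" and p: "p = (%(x, y). v x * w y)" by auto
  have e: "at_time (r *\<^sub>R p + U) t = at_time U t + (r * v t) *\<^sub>R w" for t
   by (simp add: p scaleR_fun_def fun_eq_iff at_time_def)
  have UZ: "at_time U t \<in> Z" for t using step by blast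
  have "at_time (r *\<^sub>R p + U) t \<in> Z" for t
   unfolding e by (intro subspace_add[OF Z_subspace] subspace_scale[OF Z_subspace] UZ vw)
  moreover have "(%t. coord (at_time (r *\<^sub>R p + U) t) i) \<in> S" if i: "i \<in> I" for i
  proof -
   have "(%t. coord (at_time (r *\<^sub>R p + U) t) i) = (%t. coord (at_time U t) i) + (r * coord w i) *\<^sub>R v"
   unfolding e coord_def ZE.form_lin[OF UZ vw(2) IZ[OF i]] by (simp add: fun_eq_iff scaleR_fun_def)
   also have "... \<in> S" using step i vw by (intro subspace_add[OF S] subspace_scale[OF S]) auto
   finally show ?thesis .
  qed
  ultimately show ?case by blast
 qed
 then show "at_time U t \<in> Z" "i \<in> I ==> (%t. coord (at_time U t) i) \<in> S" by auto
qed

end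

locale dg = semidiscrete \<Omega> s A c VX VY R a0 kA kc I T f fd uh0 uh
 for \<Omega> :: "(real^'d) set" and s :: real and A :: "real^'d => real^'d^'d" and c :: "real^'d => real"
  and VX :: "(real^'d => real) set" and VY :: "(real => real) set" and R a0 kA kc :: real
  and I T f fd uh0 uh +
 fixes tn :: "nat => real" and J :: nat and r :: "nat => nat" and u0 :: "real^'d => real"
  and U :: "real \<times> ((real^'d) \<times> real) => real"
 assumes tn: "tn 0 = 0" "tn J = T" "!!j. j \<in> {1..J} ==> tn (j - 1) < tn j"
  and u0: "u0 \<in> L2 (vol \<Omega>)"
  and U: "dg_solution s \<Omega> A c VX VY tn J r f u0 U"
begin

lemma tn_mono: "i <= k ==> k <= J ==> tn i <= tn k"
 by (rule increasing_nodes[where tn = tn and J = J]) (use tn(3) in auto)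

lemma tn_range: "j \<in> {1..J} ==> {tn (j - 1)..tn j} \<subseteq> {0..T}"
 using tn_mono[of 0 "j - 1"] tn_mono[of j J] tn by auto

abbreviation "el j \<equiv> {tn (j - 1)<..<tn j}"

lemma U_tensor: "U \<in> tensor (dg_space tn J r) Z" using U by (simp add: dg_solution_def)

lemma U_Z: "at_time U t \<in> Z" by (rule tensor_coordinates(1)[OF dg_space_subspace U_tensor])

lemma U_comb: "at_time U t = comb (coord (at_time U t))" by (simp add: comb_coord U_Z)

definition P :: "nat => ((real^'d) \<times> real => real) => real poly" where
 "P j i = (SOME p. degree p <= r j & (\<forall>t\<in>{tn (j - 1)<..tn j}. coord (at_time U t) i = poly p t))"

lemma P:
 assumes "j \<in> {1..J}" "i \<in> I"
 shows "degree (P j i) <= r j" "!!t. t \<in> {tn (j - 1)<..tn j} ==> coord (at_time U t) i = poly (P j i) t"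
proof -
 have "\<exists>p. degree p <= r j & (\<forall>t\<in>{tn (j - 1)<..tn j}. coord (at_time U t) i = poly p t)"
  using tensor_coordinates(2)[OF dg_space_subspace U_tensor assms(2)] assms(1) by (simp add: dg_space_def)
 from someI_ex[OF this] show "degree (P j i) <= r j" "!!t. t \<in> {tn (j - 1)<..tn j} ==> coord (at_time U t) i = poly (P j i) t"
  by (auto simp: P_def)
qed

lemma U_eq: "j \<in> {1..J} ==> t \<in> {tn (j - 1)<..tn j} ==> at_time U t = comb (%i. poly (P j i) t)"
 by (subst U_comb) (simp add: comb_def P(2))

lemma tr_comb_apply: "tr (comb v) x = (\<Sum>i\<in>I. v i * tr i x)"
 by (simp add: tr_comb sum_fun_apply scaleR_fun_def)

lemma tr_right_U: "j \<in> {1..J} ==> tr_right U (tn (j - 1)) = tr (comb (%i. poly (P j i) (tn (j - 1))))"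
 unfolding tr_right_def tr_comb_apply
 by (rule ext, rule Lim_at_right_cong[OF tn(3)]) (auto simp: U_eq tr_comb_apply intro!: continuous_intros)

lemma tr_left_U: "j \<in> {1..J} ==> tr_left U (tn j) = tr (comb (%i. poly (P j i) (tn j)))"
 unfolding tr_left_def tr_comb_apply
 by (rule ext, rule Lim_at_left_cong[OF tn(3)]) (auto simp: U_eq tr_comb_apply intro!: continuous_intros)

lemma tr_dot_U:
 assumes j: "j \<in> {1..J}" and t: "t \<in> el j"
 shows "tr_dot U t = tr (comb (%i. poly (pderiv (P j i)) t))"
proof
 fix x
 have "((%\<tau>. \<Sum>i\<in>I. poly (P j i) \<tau> * tr i x) has_real_derivative (\<Sum>i\<in>I. poly (pderiv (P j i)) t * tr i x)) (at t)"
  by (intro DERIV_sum DERIV_cmult_right poly_DERIV)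
 then have "((%\<tau>. tr (at_time U \<tau>) x) has_real_derivative (\<Sum>i\<in>I. poly (pderiv (P j i)) t * tr i x)) (at t)"
  by (rule has_field_derivative_transform_within_open[where S = "el j"]) (use t j in "auto simp: U_eq tr_comb_apply")
 then show "tr_dot U t x = tr (comb (%i. poly (pderiv (P j i)) t)) x"
  unfolding tr_dot_def tr_comb_apply by (rule DERIV_imp_deriv)
qed

text \<open>The test function is a polynomial \<open>q\<close> on the \<open>j\<close>-th element, extended by \<open>0\<close>, times a basis function. It
  is left continuous, so that only its right limit at the left end point of the element is seen by the jump terms.\<close>

lemma element_equation:
 assumes j: "j \<in> {1..J}" and k: "k \<in> I" and q: "degree q <= r j"
 shows "integral {tn (j - 1)..tn j} (%t. ((\<Sum>i\<in>I. mass i k * poly (pderiv (P j i)) t) + poly (P j k) t - load 0 t k) * poly q t)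
  + ((\<Sum>i\<in>I. mass i k * poly (P j i) (tn (j - 1)))
   - (if j = 1 then ip u0 (tr k) else \<Sum>i\<in>I. mass i k * poly (P (j - 1) i) (tn (j - 1)))) * poly q (tn (j - 1)) = 0"
proof -
 let ?A = "%j tn. (\<Sum>i\<in>I. mass i k * poly (P j i) (tn (j - 1))) - (\<Sum>i\<in>I. mass i k * poly (P (j - 1) i) (tn (j - 1)))"
 let ?B = "%t. load 0 t k * poly q t"
 define \<psi> where "\<psi> t = (if t \<in> {tn (j - 1)<..tn j} then poly q t else 0)" for t
 define V where "V = (%(t, z). \<psi> t * k z)"
 have disj: "t \<notin> {tn (j - 1)<..tn j}" if "l \<in> {1..J}" "l ~= j" "t \<in> {tn (l - 1)<..tn l}" for l t
  using that j tn_mono[of l "j - 1"] tn_mono[of j "l - 1"] by (cases "l < j") force+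
 have \<psi>: "\<psi> \<in> dg_space tn J r"
  unfolding dg_space_def
 proof (intro CollectI conjI ballI allI impI)
  fix l assume l: "l \<in> {1..J}"
  show "\<exists>p. degree p <= r l & (\<forall>t\<in>{tn (l - 1)<..tn l}. \<psi> t = poly p t)"
  proof (cases "l = j")
   case True
   then show ?thesis using q by (intro exI[of _ q]) (simp add: \<psi>_def)
  next
   case False
   then show ?thesis using disj[OF l False] by (intro exI[of _ 0]) (auto simp: \<psi>_def)
  qed
 next
  fix t assume "t \<notin> {tn 0<..tn J}"
  then show "\<psi> t = 0" using tn_range[OF j] tn by (force simp: \<psi>_def)
 qed
 have V: "V \<in> tensor (dg_space tn J r) Z"
  unfolding tensor_def[of "dg_space tn J r"] V_def by (rule span_base) (use \<psi> IZ[OF k] in blast)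
 have atV: "at_time V t = \<psi> t *\<^sub>R k" for t by (simp add: V_def at_time_def scaleR_fun_def)
 have trV: "tr (at_time V t) = \<psi> t *\<^sub>R tr k" for t by (simp add: atV tr_scale)
 have trV0: "tr_right V (tn (l - 1)) = (if l = j then poly q (tn (j - 1)) *\<^sub>R tr k else 0)" if l: "l \<in> {1..J}" for l
 proof
  fix x
  have "Lim (at_right (tn (l - 1))) (%\<tau>. tr (at_time V \<tau>) x) = (%\<tau>. if l = j then poly q \<tau> * tr k x else 0) (tn (l - 1))"
  proof (rule Lim_at_right_cong[OF tn(3)[OF l]])
   fix t assume t: "t \<in> el l"
   show "tr (at_time V t) x = (if l = j then poly q t * tr k x else 0)"
   using t disj[OF l, of t] by (auto simp: trV \<psi>_def scaleR_fun_def)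
  next
   show "isCont (%\<tau>. if l = j then poly q \<tau> * tr k x else 0) (tn (l - 1))"
   by (cases "l = j") (auto intro!: continuous_intros)
  qed
  then show "tr_right V (tn (l - 1)) x = (if l = j then poly q (tn (j - 1)) *\<^sub>R tr k else 0) x"
   by (simp add: tr_right_def scaleR_fun_def)
 qed
 have kL: "tr k \<in> L2\<Omega>" by (rule tr_I_L2[OF k])
 have mk: "ip (tr (comb v)) (tr k) = (\<Sum>i\<in>I. mass i k * v i)" for v
  by (simp add: ip_tr_comb[OF kL] mass_def mult.commute)
 have scr: "ip g (a *\<^sub>R tr k) = a * ip g (tr k)" for g a
  unfolding L2_inner_sym[of _ g] by (rule L2_inner_scale)
 have zr: "ip g 0 = 0" for g unfolding L2_inner_sym[of _ g] by (rule L2_inner_zero)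
 let ?a = "%t. ((\<Sum>i\<in>I. mass i k * poly (pderiv (P j i)) t) + poly (P j k) t) * poly q t"
 have ca: "continuous_on {tn (j - 1)..tn j} ?a" by (intro continuous_intros)
 have cb: "continuous_on {tn (j - 1)..tn j} ?B"
 proof (intro continuous_intros continuous_on_subset[OF _ tn_range[OF j]])
  show "continuous_on {0..T} (%t. load 0 t k)" by (rule DERIV_continuous_on[OF load_deriv[OF _ k]])
 qed
 have L: "(LINT t:el l|lborel. ip (tr_dot U t) (tr (at_time V t)) + inverse (d_const s) * ext (at_time U t) (at_time V t))
   = (if l = j then integral {tn (j - 1)..tn j} ?a else 0)" if l: "l \<in> {1..J}" for l
 proof (cases "l = j")
  case True
  have "(LINT t:el j|lborel. ip (tr_dot U t) (tr (at_time V t)) + inverse (d_const s) * ext (at_time U t) (at_time V t))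
   = (LINT t:el j|lborel. ?a t)"
  proof (rule set_lebesgue_integral_cong; (intro allI impI)?)
   fix t assume t: "t \<in> el j"
   then have \<psi>t: "\<psi> t = poly q t" by (simp add: \<psi>_def)
   have Ut: "at_time U t = comb (%i. poly (P j i) t)" using t j by (intro U_eq) auto
   have "inverse (d_const s) * ext (at_time U t) (at_time V t) = af (comb (%i. poly (P j i) t)) (poly q t *\<^sub>R k)"
   by (simp add: af_def atV \<psi>t Ut)
   also have "... = poly q t * af k (comb (%i. poly (P j i) t))"
   using ZE.form_sym[OF comb_Z subspace_scale[OF Z_subspace IZ[OF k]]] ZE.form_scale[OF IZ[OF k] comb_Z] by simp
   also have "af k (comb (%i. poly (P j i) t)) = poly (P j k) t"
   using ZE.form_sym[OF IZ[OF k] comb_Z] af_comb[OF k] by simp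
   finally show "ip (tr_dot U t) (tr (at_time V t)) + inverse (d_const s) * ext (at_time U t) (at_time V t) = ?a t"
   by (simp add: trV scr \<psi>t tr_dot_U[OF j t] mk algebra_simps)
  qed simp
  then show ?thesis using True unfolding integral_open_closed(2)[OF ca] by simp
 next
  case False
  have "(LINT t:el l|lborel. ip (tr_dot U t) (tr (at_time V t)) + inverse (d_const s) * ext (at_time U t) (at_time V t))
   = (LINT t:el l|lborel. 0)"
  proof (rule set_lebesgue_integral_cong; (intro allI impI)?)
   fix t assume t: "t \<in> el l"
   then have "\<psi> t = 0" using disj[OF l False, of t] by (auto simp: \<psi>_def)
   then have z: "at_time V t = 0" by (simp add: atV)
   have "af 0 (at_time U t) = 0" by (rule ZE.form_zero[OF U_Z])
   then have "ext (at_time U t) 0 = 0"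
   using ZE.form_sym[OF U_Z ZE.zero_V, of t] d_const_pos by (simp add: af_def)
   then show "ip (tr_dot U t) (tr (at_time V t)) + inverse (d_const s) * ext (at_time U t) (at_time V t) = 0"
   unfolding z tr_zero zr by simp
  qed simp
  then show ?thesis using False by simp
 qed
 have Rt: "(LINT t:el l|lborel. ip (f t) (tr (at_time V t)))
   = (if l = j then integral {tn (j - 1)..tn j} ?B else 0)" if l: "l \<in> {1..J}" for l
 proof (cases "l = j")
  case True
  have "(LINT t:el j|lborel. ip (f t) (tr (at_time V t))) = (LINT t:el j|lborel. load 0 t k * poly q t)"
   by (rule set_lebesgue_integral_cong) (auto simp: trV scr \<psi>_def load_def fd_0)
  then show ?thesis using True unfolding integral_open_closed(2)[OF cb] by simp
 next
  case False
  have "(LINT t:el l|lborel. ip (f t) (tr (at_time V t))) = (LINT t:el l|lborel. 0)"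
  proof (rule set_lebesgue_integral_cong; (intro allI impI)?)
   fix t assume t: "t \<in> el l"
   then have "\<psi> t = 0" using disj[OF l False, of t] by (auto simp: \<psi>_def)
   then show "ip (f t) (tr (at_time V t)) = 0" by (simp add: trV zr)
  qed simp
  then show ?thesis using False by simp
 qed
 define q0 where "q0 = poly q (tn (j - 1))"
 have 1: "1 \<in> {1..J}" using j by auto
 have Jmp: "ip (tr_jump U (tn (l - 1))) (tr_right V (tn (l - 1))) = (if l = j then
   (?A j tn) * q0 else 0)"
  if l: "l \<in> {2..J}" for l
 proof (cases "l = j")
  case True
  have j1: "j - 1 \<in> {1..J}" using l True by auto
  have "ip (tr_jump U (tn (j - 1))) (tr k) = ip (tr (comb (%i. poly (P j i) (tn (j - 1))))) (tr k)
   - ip (tr (comb (%i. poly (P (j - 1) i) (tn (j - 1))))) (tr k)"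
   unfolding tr_jump_def tr_right_U[OF j] tr_left_U[OF j1] by (rule L2_inner_diff[OF tr_comb_L2 tr_comb_L2 kL])
  have v: "tr_right V (tn (j - 1)) = q0 *\<^sub>R tr k" using trV0[OF j] by (simp add: q0_def)
  show ?thesis unfolding True v scr \<open>ip (tr_jump U (tn (j - 1))) (tr k) = _\<close> mk by simp
 next
  case False
  have "tr_right V (tn (l - 1)) = 0" using trV0[of l] False l by simp
  then show ?thesis unfolding zr using False by (simp only: zr if_False)
 qed
 have eq: "dg_form s \<Omega> A c tn J U V = dg_rhs \<Omega> f u0 tn J V" using U V by (simp add: dg_solution_def)
 have l0: "dg_form s \<Omega> A c tn J U V = integral {tn (j - 1)..tn j} ?a
   + (if j ~= 1 then (?A j tn) * q0 else 0)
   + (if j = 1 then (\<Sum>i\<in>I. mass i k * poly (P j i) (tn (j - 1))) * q0 else 0)"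
 proof -
  have a: "(\<Sum>l=1..J. LINT t:el l|lborel. ip (tr_dot U t) (tr (at_time V t)) + inverse (d_const s) * ext (at_time U t) (at_time V t))
   = integral {tn (j - 1)..tn j} ?a"
   by (rule trans[OF sum.cong[OF refl L]]) (use j in simp_all)
  have b: "(\<Sum>l=2..J. ip (tr_jump U (tn (l - 1))) (tr_right V (tn (l - 1)))) = (if j ~= 1 then
   (?A j tn) * q0 else 0)"
  proof -
   have "j \<in> {2..J} \<longleftrightarrow> j ~= 1" using j by auto
   then show ?thesis by (intro trans[OF sum.cong[OF refl Jmp]]) simp_all
  qed
  have c: "ip (tr_right U (tn 0)) (tr_right V (tn 0)) = (if j = 1 then (\<Sum>i\<in>I. mass i k * poly (P j i) (tn (j - 1))) * q0 else 0)"
   using tr_right_U[OF 1] trV0[OF 1] by (cases "j = 1") (simp_all add: scr mk zr q0_def)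
  show ?thesis unfolding dg_form_def a b c ..
 qed
 have r0: "dg_rhs \<Omega> f u0 tn J V = integral {tn (j - 1)..tn j} ?B + (if j = 1 then ip u0 (tr k) * q0 else 0)"
 proof -
  have a: "(\<Sum>l=1..J. LINT t:el l|lborel. ip (f t) (tr (at_time V t))) = integral {tn (j - 1)..tn j} ?B"
   by (rule trans[OF sum.cong[OF refl Rt]]) (use j in simp_all)
  have b: "ip u0 (tr_right V (tn 0)) = (if j = 1 then ip u0 (tr k) * q0 else 0)"
   using trV0[OF 1] by (cases "j = 1") (simp_all add: scr zr q0_def)
  show ?thesis unfolding dg_rhs_def a b ..
 qed
 have "integral {tn (j - 1)..tn j} (%t. ((\<Sum>i\<in>I. mass i k * poly (pderiv (P j i)) t) + poly (P j k) t - load 0 t k) * poly q t)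
   = integral {tn (j - 1)..tn j} ?a - integral {tn (j - 1)..tn j} ?B"
  unfolding left_diff_distrib by (rule integral_diff[OF cont_int[OF ca] cont_int[OF cb]])
 then show ?thesis
  using eq[unfolded l0 r0] unfolding q0_def[symmetric] by (cases "j = 1") (auto simp: algebra_simps)
qed

text \<open>The defect passed on to the first element is the \<open>L\<^sup>2\<close> functional of \<open>u0 - uh0\<close> on traces.\<close>

lemma initial_defect:
 "2 * (\<Sum>k\<in>I. (ip u0 (tr k) - (\<Sum>i\<in>I. mass i k * cu 0 0 i)) * v k) <= (nrm (u0 - uh0))^2 + M.mm v v"
proof -
 have T0: "0 \<in> {0..T}" using T_pos by simp
 have uL: "uh0 \<in> L2\<Omega>" using VX_L2[OF ud_VX[OF T0, of 0]] sol by (simp add: semidiscrete_solution_def)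
 have u: "tr (comb (cu 0 0)) = uh0" using tr_comb_cu[OF T0, of 0] sol by (simp add: semidiscrete_solution_def)
 note eL = L2_diff_fun[OF u0 uL]
 have "ip u0 (tr k) - (\<Sum>i\<in>I. mass i k * cu 0 0 i) = ip (u0 - uh0) (tr k)" if k: "k \<in> I" for k
  using ip_tr_comb[OF tr_I_L2[OF k], of "cu 0 0"] L2_inner_diff[OF u0 uL tr_I_L2[OF k]] unfolding u
  by (simp add: mass_def mult.commute)
 then have "(\<Sum>k\<in>I. (ip u0 (tr k) - (\<Sum>i\<in>I. mass i k * cu 0 0 i)) * v k) = (\<Sum>k\<in>I. v k * ip (tr k) (u0 - uh0))"
  by (intro sum.cong) (auto simp: L2_inner_sym[of _ _ "u0 - uh0"] mult.commute)
 also have "... = ip (tr (comb v)) (u0 - uh0)" by (rule ip_tr_comb[OF eL, symmetric])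
 also have "... <= nrm (tr (comb v)) * nrm (u0 - uh0)"
  using L2_Cauchy_Schwarz[OF tr_comb_L2 eL, of v] by linarith
 finally show ?thesis
  using sum_squares_bound[of "nrm (tr (comb v))" "nrm (u0 - uh0)"]
  by (simp add: mm_tr L2_inner_self)
qed

end

section \<open>Measurability of interpolation norms along a path\<close>

text \<open>The K-functional is an infimum of jointly continuous functions of the parameter and of time,
  hence upper semicontinuous.\<close>

lemma interp_sqnorm_path_measurable:
 fixes e :: "real => 'a => real"
 assumes Q: "open Q" and X1: "X1 ~= {}" and n1: "!!v. 0 <= n1 v"
  and c: "!!v. v \<in> X1 ==> continuous_on Q (%t. L2_norm M (e t - v))"
 shows "(%t. interp_sqnorm s (L2_norm M) X1 n1 (e t) * indicator Q t) \<in> borel_measurable lborel"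
proof -
 define O2 where "O2 = {0::real<..} \<times> Q"
 have O2: "open O2" unfolding O2_def by (intro open_Times Q) simp
 let ?G = "%v z. L2_norm M (e (snd z) - v) + fst z * n1 v"
 let ?K = "%z. K_functional (L2_norm M) X1 n1 (fst z) (e (snd z))"
 define k where "k z = (if z \<in> O2 then ?K z else 0)" for z
 have cG: "continuous_on O2 (?G v)" if "v \<in> X1" for v
  unfolding O2_def
  by (intro continuous_intros continuous_on_compose2[OF c[OF that]]) auto
 have km: "k \<in> borel_measurable borel"
 proof (rule borel_measurableI_less)
  fix y :: real
  have "{x \<in> space borel. k x < y} = (\<Union>v\<in>X1. {z \<in> O2. ?G v z < y}) \<union> (if 0 < y then - O2 else {})"
  proof -
   have "?K z < y \<longleftrightarrow> (\<exists>v\<in>X1. ?G v z < y)" if z: "z \<in> O2" for z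
   unfolding K_functional_def
   by (rule cINF_less_iff[OF X1]) (use z n1 in "auto intro!: bdd_belowI[of _ 0] simp: O2_def L2_norm_nonneg")
   then show ?thesis by (auto simp: k_def split: if_splits)
  qed
  moreover have "open {z \<in> O2. ?G v z < y}" if v: "v \<in> X1" for v
  proof -
   have "open (O2 \<inter> ?G v -` {..<y})" by (rule continuous_open_preimage[OF cG[OF v] O2]) simp
   also have "O2 \<inter> ?G v -` {..<y} = {z \<in> O2. ?G v z < y}" by auto
   finally show ?thesis .
  qed
  then have "open (\<Union>v\<in>X1. {z \<in> O2. ?G v z < y})" by blast
  ultimately show "{x \<in> space borel. k x < y} \<in> sets borel" using O2 by auto
 qed
 define h where "h z = ennreal (fst z powr (- 2 * s) * (k z)^2 / fst z) * indicator {0<..} (fst z)" for z :: "real \<times> real"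
 have hm: "h \<in> borel_measurable (lborel \<Otimes>\<^sub>M lborel)"
 proof -
  have [measurable]: "k \<in> borel_measurable borel" by (rule km)
  have [measurable]: "(fst :: real \<times> real => real) \<in> borel_measurable borel"
   by (intro borel_measurable_continuous_onI continuous_intros)
  have "h \<in> borel_measurable borel" unfolding h_def[abs_def] by measurable
  then show ?thesis by (simp add: lborel_prod)
 qed
 have "(%t. (\<integral>\<^sup>+ r. h (r, t) \<partial>lborel) * indicator Q t) \<in> borel_measurable lborel"
 proof -
  have [measurable]: "Q \<in> sets lborel" using Q by simp
  have [measurable]: "(%z. h (snd z, fst z)) \<in> borel_measurable (lborel \<Otimes>\<^sub>M lborel)"
   by (rule measurable_compose[OF measurable_pair_swap' hm, simplified case_prod_beta' fst_conv snd_conv]) 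
  show ?thesis by measurable
 qed
 also have "(%t. (\<integral>\<^sup>+ r. h (r, t) \<partial>lborel) * indicator Q t) = (%t. interp_sqnorm s (L2_norm M) X1 n1 (e t) * indicator Q t)"
 proof
  fix t
  show "(\<integral>\<^sup>+ r. h (r, t) \<partial>lborel) * indicator Q t = interp_sqnorm s (L2_norm M) X1 n1 (e t) * indicator Q t"
  proof (cases "t \<in> Q")
   case True
   have "h (r, t) = ennreal (r powr (- 2 * s) * (K_functional (L2_norm M) X1 n1 r (e t))^2 / r) * indicator {0<..} r" for r
   using True by (cases "r > 0") (auto simp: h_def k_def O2_def)
   then show ?thesis by (simp add: interp_sqnorm_def)
  qed simp
 qed
 finally show ?thesis .
qed

lemma L2_norm_expand:
 assumes "p \<in> L2 M" "v \<in> L2 M"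
 shows "L2_norm M (p - v) = sqrt (L2_inner M p p - 2 * L2_inner M p v + L2_inner M v v)"
proof -
 have "(L2_norm M (p - v))^2 = L2_inner M p (p - v) - L2_inner M v (p - v)"
  unfolding L2_inner_self[symmetric] by (rule L2_inner_diff[OF assms L2_diff_fun[OF assms]])
 also have "L2_inner M p (p - v) = L2_inner M p p - L2_inner M v p"
  unfolding L2_inner_sym[of M p "p - v"] by (rule L2_inner_diff[OF assms assms(1)])
 also have "L2_inner M v (p - v) = L2_inner M p v - L2_inner M v v"
  unfolding L2_inner_sym[of M v "p - v"] by (rule L2_inner_diff[OF assms assms(2)])
 finally have "(L2_norm M (p - v))^2 = L2_inner M p p - 2 * L2_inner M p v + L2_inner M v v"
  unfolding L2_inner_sym[of M v p] by linarith
 from real_sqrt_unique[OF this L2_norm_nonneg] show ?thesis ..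
qed

lemma L2_norm_path_continuous:
 fixes \<phi> :: "'i => 'a => real"
 assumes \<phi>: "!!i. i \<in> I ==> \<phi> i \<in> L2 M" and w: "!!i. i \<in> I ==> continuous_on Q (w i)" and v: "v \<in> L2 M"
 shows "continuous_on Q (%t. L2_norm M ((\<Sum>i\<in>I. w i t *\<^sub>R \<phi> i) - v))"
proof -
 let ?A = "%w t \<phi>. (\<Sum>i\<in>I. w i t *\<^sub>R \<phi> i)"
 have pL: "(?A w t \<phi>) \<in> L2 M" for t by (rule L2_sum_fun[OF \<phi>])
 have e: "L2_inner M (?A w t \<phi>) g = (\<Sum>i\<in>I. w i t * L2_inner M (\<phi> i) g)" if "g \<in> L2 M" for g t
  by (rule L2_inner_sum[OF \<phi> that])
 have c: "continuous_on Q (%t. L2_inner M (?A w t \<phi>) g)" if "g \<in> L2 M" for g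
  unfolding e[OF that] by (intro continuous_intros w)
 have "continuous_on Q (%t. L2_inner M (?A w t \<phi>) (?A w t \<phi>))"
 proof -
  have "continuous_on Q (%t. \<Sum>i\<in>I. w i t * L2_inner M (?A w t \<phi>) (\<phi> i))"
   by (intro continuous_intros w c \<phi>)
  also have "(%t. \<Sum>i\<in>I. w i t * L2_inner M (?A w t \<phi>) (\<phi> i))
   = (%t. L2_inner M (?A w t \<phi>) (?A w t \<phi>))"
   by (rule ext, subst e[OF pL]) (simp only: L2_inner_sym[of M "\<phi> _"])
  finally show ?thesis .
 qed
 then show ?thesis unfolding L2_norm_expand[OF pL v] by (intro continuous_intros c v)
qed

section \<open>Real analytic functions on compact sets\<close>

text \<open>The power series at \<open>x\<close> converges absolutely at a point \<open>p\<close> with equal coordinate increments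
  \<open>\<rho>\<close>, which dominates it uniformly on the ball of radius \<open>\<rho>\<close>.\<close>

lemma real_analytic_continuous:
 assumes "real_analytic_on u S"
 shows "continuous_on S (u :: real^'d => real)"
proof (intro continuous_at_imp_continuous_on ballI)
 fix x assume "x \<in> S"
 then obtain r a where r: "r > 0" and a: "!!z. z \<in> ball x r ==>
   ((%k. a k * (\<Prod>i\<in>UNIV. (z $ i - x $ i) ^ k i)) has_sum u z) (UNIV :: ('d => nat) set)"
  using assms unfolding real_analytic_on_def by blast
 define \<rho> where "\<rho> = r / (2 * real CARD('d))"
 have \<rho>: "\<rho> > 0" using r by (simp add: \<rho>_def)
 define p where "p = (\<chi> i. x $ i + \<rho>)"
 have "dist x p <= (\<Sum>i\<in>UNIV. \<bar>(x - p) $ i\<bar>)" unfolding dist_norm by (rule norm_le_l1_cart)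
 also have "... = real CARD('d) * \<rho>" using \<rho> by (simp add: p_def)
 also have "... < r" using r by (simp add: \<rho>_def)
 finally have p: "p \<in> ball x r" by simp
 have "(%k. a k * (\<Prod>i\<in>UNIV. (p $ i - x $ i) ^ k i)) summable_on UNIV"
  using a[OF p] by (rule has_sum_imp_summable)
 then have M: "(%k. norm (a k * (\<Prod>i\<in>UNIV. \<rho> ^ k i))) summable_on UNIV"
  by (subst (asm) summable_on_iff_abs_summable_on_real) (simp add: p_def)
 have \<rho>r: "\<rho> <= r"
 proof -
  have c: "1 <= 2 * real CARD('d)" using zero_less_card_finite[where 'a = 'd] by linarith
  have "r / (2 * real CARD('d)) <= r / 1" by (rule divide_left_mono[OF c]) (use r in auto)
  then show ?thesis by (simp add: \<rho>_def)
 qed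
 have "uniform_limit (ball x \<rho>) (%F z. \<Sum>k\<in>F. a k * (\<Prod>i\<in>UNIV. (z $ i - x $ i) ^ k i)) u (finite_subsets_at_top UNIV)"
 proof (rule Weierstrass_m_test_general'[OF _ _ M])
  fix k :: "'d => nat" and z assume z: "z \<in> ball x \<rho>"
  have "\<bar>z $ i - x $ i\<bar> <= \<rho>" for i
   using component_le_norm_cart[of "z - x" i] z by (simp add: dist_norm norm_minus_commute)
  then have "(\<Prod>i\<in>UNIV. \<bar>z $ i - x $ i\<bar> ^ k i) <= (\<Prod>i\<in>UNIV. \<rho> ^ k i)"
   by (intro prod_mono conjI power_mono) auto
  then show "norm (a k * (\<Prod>i\<in>UNIV. (z $ i - x $ i) ^ k i)) <= norm (a k * (\<Prod>i\<in>UNIV. \<rho> ^ k i))"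
   using \<rho> by (auto simp: abs_mult abs_prod power_abs intro!: mult_left_mono)
 next
  fix z assume "z \<in> ball x \<rho>"
  then show "((%k. a k * (\<Prod>i\<in>UNIV. (z $ i - x $ i) ^ k i)) has_sum u z) UNIV"
   using \<rho>r by (intro a) auto
 qed
 then have "continuous_on (ball x \<rho>) u"
  by (rule uniform_limit_theorem[rotated]) (auto intro!: always_eventually continuous_intros)
 then show "isCont u x" using \<rho> by (simp add: continuous_on_eq_continuous_at)
qed

lemma continuous_closure_L2:
 fixes u :: "'a::euclidean_space => real"
 assumes S: "open S" "bounded S" and u: "continuous_on (closure S) u"
 shows "u \<in> L2 (vol S)"
proof -
 have "compact (u ` closure S)" using S(2) u by (intro compact_continuous_image) (auto simp: compact_closure)
 then have "bounded (u ` closure S)" by (rule compact_imp_bounded)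
 then obtain B where "\<forall>y\<in>u ` closure S. norm y <= B" unfolding bounded_iff by blast
 then have B: "\<bar>u x\<bar> <= B" if "x \<in> S" for x using closure_subset[of S] that by auto
 have m: "u \<in> borel_measurable (vol S)"
  unfolding vol_def using borel_measurable_continuous_on_restrict[OF continuous_on_subset[OF u closure_subset]]
  by (simp add: measurable_def space_restrict_space sets_restrict_space)
 have fin: "emeasure (vol S) (space (vol S)) < \<infinity>"
  using emeasure_bounded_finite[OF S(2)] S(1) by (simp add: vol_def emeasure_restrict_space space_restrict_space)
 show ?thesis
 proof (rule L2I[OF m])
  show "integrable (vol S) (%x. (norm (u x))^2)"
  proof (rule integrableI_bounded_set[where A = "space (vol S)" and B = "B^2"])
   show "AE x in vol S. x \<in> space (vol S) --> norm ((norm (u x))^2) <= B^2"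
   proof (intro AE_I2 impI)
   fix x assume "x \<in> space (vol S)"
   then have "\<bar>u x\<bar> <= B" using B by (simp add: vol_def space_restrict_space)
   then have "\<bar>u x\<bar>^2 <= B^2" by (intro power_mono) auto
   then show "norm ((norm (u x))^2) <= B^2" by simp
   qed
  qed (use m fin in auto)
 qed
qed

section \<open>The error in the fractional Sobolev norm\<close>

context dg
begin

abbreviation "err t \<equiv> uh t - tr (at_time U t)"
abbreviation "Hs_sq \<equiv> interp_sqnorm s (nrm) (H10 \<Omega>) (H1_norm (vol \<Omega>) \<Omega>)"

definition w :: "((real^'d) \<times> real => real) => real => real" where
 "w i t = cu 0 t i - coord (at_time U t) i"

lemma err_comb: "t \<in> {0..T} ==> err t = tr (comb (%i. w i t))"
 unfolding w_def comb_diff tr_diff U_comb[symmetric] by (simp add: tr_comb_cu)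

lemma err_bound:
 assumes t: "t \<in> {0..T}"
 shows "Hs_sq (err t) <= ennreal (CE * (\<Sum>i\<in>I. (w i t)^2))"
proof -
 have "Hs_sq (err t) <= ennreal (CH * (ext_norm s \<Omega> (comb (%i. w i t)))^2)"
  unfolding err_comb[OF t] by (rule hs_bound[OF comb_Z])
 also have "... <= ennreal (CH * (d_const s / a1 * af (comb (%i. w i t)) (comb (%i. w i t))))"
  using CH_pos by (intro ennreal_leI mult_left_mono af_coercive comb_Z) auto
 finally show ?thesis by (simp add: af_comb_self CE_def mult_ac)
qed

lemma err_Hs: "t \<in> {0..T} ==> err t \<in> Hs_tilde \<Omega> s"
 unfolding Hs_tilde_def interp_space_def
 using err_bound[of t] tr_comb_L2 err_comb[of t] by (auto intro: le_less_trans)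

lemma Hs_norm_sq: "(Hs_tilde_norm \<Omega> s u)^2 = enn2real (Hs_sq u)"
 by (simp add: Hs_tilde_norm_def interp_norm_def)

lemma err_norm_bound: "t \<in> {0..T} ==> (Hs_tilde_norm \<Omega> s (err t))^2 <= CE * (\<Sum>i\<in>I. (w i t)^2)"
 unfolding Hs_norm_sq using err_bound CE_pos
 by (intro enn2real_leI) (auto intro!: mult_nonneg_nonneg sum_nonneg)

definition interiors :: "real set" where "interiors = (\<Union>j\<in>{1..J}. el j)"

lemma cu_continuous: "i \<in> I ==> continuous_on {0..T} (%t. cu l t i)"
proof -
 assume i: "i \<in> I"
 have "continuous_on {0..T} (%t. ip (ud l t) (Lh (tr i)))"
  by (rule DERIV_continuous_on[OF ud_deriv[OF _ Lh(1)[OF tr_I[OF i]]]])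
 then show ?thesis by (rule continuous_on_eq) (simp add: cu_ip i)
qed

lemma w_element: "j \<in> {1..J} ==> i \<in> I ==> t \<in> el j ==> w i t = cu 0 t i - poly (P j i) t"
 by (simp add: w_def P(2))

lemma w_continuous:
 assumes i: "i \<in> I"
 shows "continuous_on interiors (w i)"
 unfolding interiors_def
proof (rule continuous_on_open_Union)
 fix S assume "S \<in> el ` {1..J}"
 then obtain j where j: "j \<in> {1..J}" and S: "S = el j" by auto
 show "open S" unfolding S by simp
 have "continuous_on (el j) (%t. cu 0 t i - poly (P j i) t)"
  using tn_range[OF j] by (intro continuous_intros continuous_on_subset[OF cu_continuous[OF i]]) auto
 then show "continuous_on S (w i)" unfolding S by (rule continuous_on_eq) (simp add: w_element[OF j i])
qed

lemma interiors: "interiors \<subseteq> {0..T}" "t \<in> {0..T} ==> t \<notin> tn ` {0..J} ==> t \<in> interiors"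
proof -
 show "interiors \<subseteq> {0..T}" using tn_range by (force simp: interiors_def)
 assume t: "t \<in> {0..T}" "t \<notin> tn ` {0..J}"
 have "tn 0 \<in> tn ` {0..J}" by simp
 then have "t ~= tn 0" using t(2) by metis
 then have "t \<in> {tn 0<..tn J}" using t(1) tn by auto
 from mesh_cover[where tn = tn, OF this] obtain k where k: "k \<in> {1..J}" "t \<in> {tn (k - 1)<..tn k}" by blast
 have "tn k \<in> tn ` {0..J}" using k by simp
 then have "t ~= tn k" using t(2) by metis
 then show "t \<in> interiors" using k by (force simp: interiors_def)
qed

text \<open>The error is continuous in time away from the nodes.\<close>

lemma err_norm_measurable: "(%t. indicator {0..T} t *\<^sub>R (Hs_tilde_norm \<Omega> s (err t))^2) \<in> borel_measurable lborel"
proof (rule measurable_discrete_difference)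
 have o: "open interiors" by (auto simp: interiors_def)
 have "(%t. Hs_sq (tr (comb (%i. w i t))) * indicator interiors t) \<in> borel_measurable lborel"
 proof (rule interp_sqnorm_path_measurable[OF o H10_nonempty])
  show "0 <= H1_norm (vol \<Omega>) \<Omega> v" for v by (simp add: H1_norm_def)
  show "continuous_on interiors (%t. nrm (tr (comb (%i. w i t)) - v))" if "v \<in> H10 \<Omega>" for v
   unfolding tr_comb using that
   by (intro L2_norm_path_continuous tr_I_L2 w_continuous) (auto simp: H10_def H1_def)
 qed
 then show "(%t. enn2real (Hs_sq (tr (comb (%i. w i t))) * indicator interiors t)) \<in> borel_measurable lborel"
  by measurable
 show "enn2real (Hs_sq (tr (comb (%i. w i t))) * indicator interiors t) = indicator {0..T} t *\<^sub>R (Hs_tilde_norm \<Omega> s (err t))^2"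
  if "t \<notin> tn ` {0..J}" for t
 proof (cases "t \<in> interiors")
  case True
  then have "t \<in> {0..T}" using interiors(1) by blast
  then show ?thesis using True by (simp add: Hs_norm_sq err_comb)
 next
  case False
  then have "t \<notin> {0..T}" using interiors(2) that by blast
  then show ?thesis using False by simp
 qed
qed auto

lemma err_integral:
 shows "set_integrable lborel {0..T} (%t. (Hs_tilde_norm \<Omega> s (err t))^2)"
  and "(LINT t:{0..T}|lborel. (Hs_tilde_norm \<Omega> s (err t))^2)
   <= CE * (\<Sum>j=1..J. integral {tn (j - 1)..tn j} (%t. \<Sum>i\<in>I. (cu 0 t i - poly (P j i) t)^2))"
proof -
 define h where "h j t = (\<Sum>i\<in>I. (cu 0 t i - poly (P j i) t)^2)" for j t
 have h0: "h j t >= 0" for j t by (simp add: h_def sum_nonneg)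
 have hc: "continuous_on {tn (j - 1)..tn j} (h j)" if j: "j \<in> {1..J}" for j
  unfolding h_def by (intro continuous_intros continuous_on_subset[OF cu_continuous tn_range[OF j]])
 define G where "G t = CE * (\<Sum>j=1..J. indicator (el j) t *\<^sub>R h j t)" for t
 have gi: "integrable lborel (%t. indicator (el j) t *\<^sub>R h j t)" if "j \<in> {1..J}" for j
  using integral_open_closed(1)[OF hc[OF that]] by (simp only: set_integrable_def)
 have G: "integrable lborel G"
  unfolding G_def by (intro integrable_mult_right Bochner_Integration.integrable_sum gi)
 have GI: "(LINT t|lborel. G t) = CE * (\<Sum>j=1..J. integral {tn (j - 1)..tn j} (h j))"
 proof -
  have "(LINT t|lborel. G t) = CE * (\<Sum>j=1..J. LINT t|lborel. indicator (el j) t *\<^sub>R h j t)"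
   unfolding G_def by (subst integral_mult_right_zero, subst Bochner_Integration.integral_sum) (use gi in auto)
  also have "(\<Sum>j=1..J. LINT t|lborel. indicator (el j) t *\<^sub>R h j t) = (\<Sum>j=1..J. integral {tn (j - 1)..tn j} (h j))"
   using integral_open_closed(2)[OF hc] by (intro sum.cong) (auto simp: set_lebesgue_integral_def)
  finally show ?thesis .
 qed
 let ?H = "%t. indicator {0..T} t *\<^sub>R (Hs_tilde_norm \<Omega> s (err t))^2"
 have G0: "G t >= 0" for t
  unfolding G_def using CE_pos h0 by (intro mult_nonneg_nonneg sum_nonneg) auto
 have HG: "?H t <= G t" if t: "t \<notin> tn ` {0..J}" for t
 proof (cases "t \<in> {0..T}")
  case True
  then obtain j where j: "j \<in> {1..J}" "t \<in> el j" using interiors(2)[OF _ t] by (auto simp: interiors_def)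
  have "?H t <= CE * (\<Sum>i\<in>I. (w i t)^2)" using err_norm_bound[OF True] True by simp
  also have "(\<Sum>i\<in>I. (w i t)^2) = indicator (el j) t *\<^sub>R h j t"
   using j(2) w_element[OF j(1) _ j(2)] by (simp add: h_def)
  also have "CE * ... <= G t"
   unfolding G_def using CE_pos h0 j(1) by (intro mult_left_mono member_le_sum) auto
  finally show ?thesis .
 next
  case False
  then show ?thesis using G0[of t] by simp
 qed
 have fin: "AE t in lborel. t \<notin> tn ` {0..J}"
  by (intro AE_not_in countable_imp_null_set_lborel countable_finite) auto
 then have ae: "AE t in lborel. ?H t <= G t" by eventually_elim (rule HG)
 have HI: "integrable lborel ?H"
 proof (rule Bochner_Integration.integrable_bound[OF G err_norm_measurable])
  show "AE t in lborel. norm (?H t) <= norm (G t)" using ae by eventually_elim (use G0 in simp)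
 qed
 then show "set_integrable lborel {0..T} (%t. (Hs_tilde_norm \<Omega> s (err t))^2)" by (simp add: set_integrable_def)
 have "(LINT t|lborel. ?H t) <= (LINT t|lborel. G t)" by (rule integral_mono_AE[OF HI G ae])
 then show "(LINT t:{0..T}|lborel. (Hs_tilde_norm \<Omega> s (err t))^2)
   <= CE * (\<Sum>j=1..J. integral {tn (j - 1)..tn j} (%t. \<Sum>i\<in>I. (cu 0 t i - poly (P j i) t)^2))"
  unfolding GI h_def by (simp add: set_lebesgue_integral_def)
qed

end

lemma dim_hp_time_space:
 fixes M :: nat
 assumes t1: "0 < t1" "t1 < T" and \<sigma>: "0 < \<sigma>" "\<sigma> < 1" and K: "K >= 1" and m: "0 < m"
 shows "real (dim (dg_space (time_node \<sigma> t1 T K M) (num_elements K M) (time_degree m M))) <= (real K + 1) * (m + 1) * (real M + 1)^2"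
proof -
 have "real (dim (dg_space (time_node \<sigma> t1 T K M) (num_elements K M) (time_degree m M)))
   <= real (\<Sum>j=1..num_elements K M. time_degree m M j + 1)"
  using dim_dg_space[of "num_elements K M" "time_node \<sigma> t1 T K M" "time_degree m M"]
   time_node_facts(3)[OF t1 \<sigma> K] by (intro of_nat_mono) auto
 also have "... = (\<Sum>j=1..num_elements K M. real (time_degree m M j) + 1)" by (simp add: add.commute)
 also have "... <= (\<Sum>j=1..num_elements K M. (m + 1) * (real M + 1))"
 proof (rule sum_mono)
  fix j
  show "real (time_degree m M j) + 1 <= (m + 1) * (real M + 1)"
   using time_degree_upper[OF m, of M j] by (simp add: algebra_simps)
 qed
 also have "... = (real M + 1 + real K) * ((m + 1) * (real M + 1))" by (simp add: num_elements_def)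
 also have "... <= ((real K + 1) * (real M + 1)) * ((m + 1) * (real M + 1))"
  using m by (intro mult_right_mono) (auto simp: algebra_simps)
 finally show ?thesis by (simp add: power2_eq_square mult_ac)
qed

text \<open>Here \<open>n = M + 1\<close>, \<open>Y = N\<close> is the dimension of the time space, \<open>X = (dim VX) powr \<mu>\<close> and
  \<open>e\<close> is the error of the initial value.\<close>

lemma combine_exponential_bounds:
 fixes X Y n E v \<kappa> C1 b0 b1 c2 Ca e :: real
 assumes v: "v <= \<kappa> * (2 * e^2 + C1 * exp (- b1 * n))" and e: "0 <= e" "e <= Ca * exp (- b0 * X)"
  and pos: "\<kappa> > 0" "C1 > 0" "b0 > 0" "b1 > 0" "c2 > 0" and X: "X >= 0" and Y: "0 <= Y" "Y <= c2 * n^2" and n: "n >= 0"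
 defines "b \<equiv> min b0 (b1 / (2 * sqrt c2))"
 shows "sqrt v <= sqrt (\<kappa> * (2 * Ca^2 + C1)) * (exp (- b * sqrt Y) + exp (- b * X))"
proof -
 let ?S = "exp (- b * sqrt Y) + exp (- b * X)"
 have b: "b > 0" "b <= b0" "b <= b1 / (2 * sqrt c2)" using pos by (auto simp: b_def)
 have "e^2 <= (Ca * exp (- b0 * X))^2" using e by (intro power_mono) auto
 also have "... = Ca^2 * (exp (- b0 * X))^2" by (simp add: power_mult_distrib)
 also have "... <= Ca^2 * ?S^2"
 proof (intro mult_left_mono power_mono)
  have "exp (- b0 * X) <= exp (- b * X)" using mult_right_mono[OF b(2) X] by simp
  then show "exp (- b0 * X) <= ?S" using exp_ge_zero[of "- b * sqrt Y"] by linarith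
 qed auto
 finally have 1: "e^2 <= Ca^2 * ?S^2" .
 have 2: "exp (- b1 * n) <= ?S^2"
 proof -
  have "sqrt Y <= sqrt (c2 * n^2)" using Y(2) by simp
  also have "... = sqrt c2 * n" using n by (simp add: real_sqrt_mult)
  finally have "b * sqrt Y <= b1 / (2 * sqrt c2) * (sqrt c2 * n)" using b Y pos by (intro mult_mono) auto
  also have "... = b1 * n / 2" using pos by (simp add: field_simps)
  finally have "exp (- b1 * n) <= exp (2 * (- b * sqrt Y))" by simp
  also have "... = (exp (- b * sqrt Y))^2" by (rule exp_double)
  also have "... <= ?S^2" by (intro power_mono) auto
  finally show ?thesis .
 qed
 have "v <= \<kappa> * (2 * (Ca^2 * ?S^2) + C1 * ?S^2)"
  using 1 2 pos by (intro order.trans[OF v] mult_left_mono add_mono) auto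
 also have "... = \<kappa> * (2 * Ca^2 + C1) * ?S^2" by (simp add: algebra_simps)
 finally have "sqrt v <= sqrt (\<kappa> * (2 * Ca^2 + C1) * ?S^2)" by simp
 also have "... = sqrt (\<kappa> * (2 * Ca^2 + C1)) * ?S" by (simp add: real_sqrt_mult add_nonneg_nonneg)
 finally show ?thesis .
qed

theorem theorem4p6:
  fixes \<Omega> :: "(real^'d) set"
    and A :: "real^'d \<Rightarrow> real^'d^'d" and c :: "real^'d \<Rightarrow> real"
    and u0 :: "real^'d \<Rightarrow> real"
    and f :: "real \<Rightarrow> real^'d \<Rightarrow> real" and fd :: "nat \<Rightarrow> real \<Rightarrow> real^'d \<Rightarrow> real"
    and s t1 T \<sigma> m C_f d_f \<beta> b\<^sub>0 \<mu> C_stab C_approx :: real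
    and K :: nat
  assumes "bounded \<Omega>" and "lipschitz_domain \<Omega>"
    and "0 < s" and "s < 1"
    and "admissible_coeffs \<Omega> A c"
    and "0 < t1" and "t1 < T"
    and "0 < \<sigma>" and "\<sigma> < 1" and "0 < m" and "K \<ge> 1"
    and "real_analytic_on u0 (closure \<Omega>)"
    and "L2_time_derivs (vol \<Omega>) {0..T} f fd"
    and "\<And>l t. t \<in> {0..T} \<Longrightarrow>
      L2_norm (vol \<Omega>) (fd l t) \<le> C_f * d_f ^ l * Gamma (real l + 1)"
    and "0 < \<beta>" and "\<beta> < 1" and "0 < b\<^sub>0" and "0 < \<mu>"
  shows "\<exists>C b. C > 0 \<and> b > 0 \<and>
    (\<forall>(M::nat) VX VY uh0 uh U.
      (let tn = time_node \<sigma> t1 T K M; J = num_elements K M; r = time_degree m M;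
           N = dim (dg_space tn J r); uhk = (\<lambda>t. tr (at_time U t))
       in
        admissible_spaces s \<Omega> VX VY \<and>
        uh0 \<in> VX \<and>
        discrete_interp_norm s \<Omega> A c VX VY \<beta> uh0 \<le> C_stab \<and>
        L2_norm (vol \<Omega>) (u0 - uh0) \<le> C_approx * exp (- b\<^sub>0 * real (dim VX) powr \<mu>) \<and>
        semidiscrete_solution s \<Omega> A c VX VY T f uh0 uh \<and>
        dg_solution s \<Omega> A c VX VY tn J r f u0 U \<longrightarrow>
        (\<forall>t\<in>{0..T}. uh t - uhk t \<in> Hs_tilde \<Omega> s) \<and>
        set_integrable lborel {0..T} (\<lambda>t. (Hs_tilde_norm \<Omega> s (uh t - uhk t))\<^sup>2) \<and>
        sqrt (LINT t:{0..T}|lborel. (Hs_tilde_norm \<Omega> s (uh t - uhk t))\<^sup>2)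
          \<le> C * (exp (- b * sqrt (real N)) + exp (- b * real (dim VX) powr \<mu>))))"
proof -
 note bounded = \<open>bounded \<Omega>\<close> and coeffs = \<open>admissible_coeffs \<Omega> A c\<close> and s = \<open>0 < s\<close> \<open>s < 1\<close>
 note t1 = \<open>0 < t1\<close> \<open>t1 < T\<close> and \<sigma> = \<open>0 < \<sigma>\<close> \<open>\<sigma> < 1\<close> and \<beta> = \<open>0 < \<beta>\<close> \<open>\<beta> < 1\<close>
 have open_\<Omega>: "open \<Omega>" using \<open>lipschitz_domain \<Omega>\<close> by (simp add: lipschitz_domain_def)
 obtain R where R: "R > 0" "!!x. x \<in> \<Omega> ==> norm x <= R" using bounded by (auto simp: bounded_pos)
 obtain kA' where kA': "AE x in vol \<Omega>. norm (A x) <= kA'" using coeffs by (auto simp: admissible_coeffs_def)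
 obtain kc' where kc': "AE x in vol \<Omega>. \<bar>c x\<bar> <= kc'" using coeffs by (auto simp: admissible_coeffs_def)
 obtain a0 where a0: "a0 > 0" "AE x in vol \<Omega>. \<forall>\<xi>. \<xi> \<bullet> (A x *v \<xi>) >= a0 * (norm \<xi>)^2" using coeffs by (auto simp: admissible_coeffs_def)
 define kA where "kA = max 0 kA'"
 define kc where "kc = max 0 kc'"
 have kA: "AE x in vol \<Omega>. norm (A x) <= kA" using kA' by eventually_elim (simp add: kA_def)
 have kc: "AE x in vol \<Omega>. \<bar>c x\<bar> <= kc" using kc' by eventually_elim (simp add: kc_def)
 have disc: "discretization \<Omega> s A c VX VY R a0 kA kc" if "admissible_spaces s \<Omega> VX VY" for VX VY
  by standard (use open_\<Omega> R s coeffs kA kc a0 that in "auto simp: admissible_coeffs_def kA_def kc_def")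
 have u0: "u0 \<in> L2 (vol \<Omega>)"
  by (rule continuous_closure_L2[OF open_\<Omega> bounded real_analytic_continuous]) (rule \<open>real_analytic_on u0 (closure \<Omega>)\<close>)
 show ?thesis
 proof (cases "\<exists>VX VY. admissible_spaces s \<Omega> VX VY")
  case False
  then show ?thesis by (intro exI[of _ 1]) (simp add: Let_def)
 next
  case True
  then obtain VX1 VY1 where "admissible_spaces s \<Omega> VX1 VY1" by blast
  then interpret D1: discretization \<Omega> s A c VX1 VY1 R a0 kA kc by (rule disc)
  define C0 where "C0 = max 1 (D1.kU / d_const s) * (3 * C_stab + 1)^2"
  have C0: "C0 >= 0" by (simp add: C0_def)
  show ?thesis
  proof (rule hp_dg_convergence[OF t1 \<sigma> \<open>0 < m\<close> \<open>K >= 1\<close> \<beta> D1.CM_pos abs_ge_zero[of C_f] abs_ge_zero[of d_f] C0, where 'i = "(real^'d) \<times> real => real"], goal_cases)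
   case (1 C1 b1)
   note conv = 1(3)
   define c2 where "c2 = (real K + 1) * (m + 1)"
   define C where "C = sqrt (D1.CE * (2 * C_approx^2 + C1))"
   define b where "b = min b\<^sub>0 (b1 / (2 * sqrt c2))"
   have c2: "c2 > 0" using \<open>0 < m\<close> by (simp add: c2_def add_pos_pos)
   have C: "C > 0" using D1.CE_pos 1(1) by (simp add: C_def add_nonneg_pos)
   have b: "b > 0" using c2 1(2) \<open>0 < b\<^sub>0\<close> by (simp add: b_def)
   show ?case
   proof (rule exI[of _ C], rule exI[of _ b], intro conjI C b allI, unfold Let_def, intro impI, elim conjE)
   fix M :: nat and VX :: "(real^'d => real) set" and VY :: "(real => real) set" and uh0 :: "real^'d => real"
   and uh :: "real => real^'d => real" and U :: "real \<times> ((real^'d) \<times> real) => real"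
   let ?tn = "time_node \<sigma> t1 T K M" and ?J = "num_elements K M" and ?r = "time_degree m M"
   assume sp: "admissible_spaces s \<Omega> VX VY"
   and init: "discrete_interp_norm s \<Omega> A c VX VY \<beta> uh0 <= C_stab"
   "L2_norm (vol \<Omega>) (u0 - uh0) <= C_approx * exp (- b\<^sub>0 * real (dim VX) powr \<mu>)"
   and sol: "semidiscrete_solution s \<Omega> A c VX VY T f uh0 uh"
   and dgs: "dg_solution s \<Omega> A c VX VY ?tn ?J ?r f u0 U"
   interpret discretization \<Omega> s A c VX VY R a0 kA kc by (rule disc[OF sp])
   obtain I where I: "finite I" "I \<subseteq> Z" "ZE.orthonormal I" "span I = Z" using energy_basis_exists by blast
   note nodes = time_node_facts(1-3)[OF t1 \<sigma> \<open>K >= 1\<close>, where M = M]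
   interpret dg \<Omega> s A c VX VY R a0 kA kc I T f fd uh0 uh ?tn ?J ?r u0 U
   by standard (use I t1 \<open>L2_time_derivs (vol \<Omega>) {0..T} f fd\<close> sol nodes u0 dgs in auto)
   define \<Phi> where "\<Phi> l = \<bar>C_f\<bar> * \<bar>d_f\<bar> ^ l * fact l" for l
   have \<Phi>: "L2_norm (vol \<Omega>) (fd l t) <= \<Phi> l" if "t \<in> {0..T}" for l t
   proof -
   have "L2_norm (vol \<Omega>) (fd l t) <= C_f * d_f ^ l * Gamma (real l + 1)" using assms(14) that .
   also have "Gamma (real l + 1) = fact l" using Gamma_fact[of l, where 'a = real] by (simp add: add.commute)
   also have "C_f * d_f ^ l * fact l <= \<bar>C_f * d_f ^ l\<bar> * fact l" by (intro mult_right_mono) auto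
   finally show ?thesis by (simp add: \<Phi>_def abs_mult power_abs)
   qed
   define E where "E = (L2_norm (vol \<Omega>) (u0 - uh0))^2"
   have "(\<Sum>j=1..?J. integral {?tn (j - 1)..?tn j} (%t. \<Sum>i\<in>I. (cu 0 t i - poly (P j i) t)^2))
   <= 2 * E + C1 * exp (- b1 * (real M + 1))"
   proof (rule conv[of I mass cu load \<Phi> M P "%k. ip u0 (tr k)" E])
   show "semidiscrete_flow I mass CM cu load T \<Phi>" by (rule flow_in_coordinates[OF \<Phi>])
   show "\<Phi> l <= \<bar>C_f\<bar> * \<bar>d_f\<bar> ^ l * fact l" for l by (simp add: \<Phi>_def)
   show "\<exists>v. M.mm (%i. cu 0 0 i - v i) (%i. cu 0 0 i - v i) + \<tau> * (\<Sum>i\<in>I. (v i)^2) <= C0 * \<tau> powr \<beta>" if "0 < \<tau>" for \<tau>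
   unfolding C0_def by (rule initial_splitting[OF \<beta> init(1) that])
   show "degree (P j i) <= ?r j" if "j \<in> {1..?J}" "i \<in> I" for j i by (rule P(1)[OF that])
   show "2 * (\<Sum>k\<in>I. (ip u0 (tr k) - (\<Sum>i\<in>I. mass i k * cu 0 0 i)) * v k) <= E + M.mm v v" for v
   unfolding E_def by (rule initial_defect)
   qed (rule element_equation)
   then have "CE * (\<Sum>j=1..?J. integral {?tn (j - 1)..?tn j} (%t. \<Sum>i\<in>I. (cu 0 t i - poly (P j i) t)^2))
   <= CE * (2 * E + C1 * exp (- b1 * (real M + 1)))"
   using CE_pos by (intro mult_left_mono) auto
   with err_integral(2) have int: "(LINT t:{0..T}|lborel. (Hs_tilde_norm \<Omega> s (err t))^2)
   <= CE * (2 * (L2_norm (vol \<Omega>) (u0 - uh0))^2 + C1 * exp (- b1 * (real M + 1)))"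
   unfolding E_def by linarith
   have "sqrt (LINT t:{0..T}|lborel. (Hs_tilde_norm \<Omega> s (err t))^2)
   <= C * (exp (- b * sqrt (real (dim (dg_space ?tn ?J ?r)))) + exp (- b * real (dim VX) powr \<mu>))"
   unfolding C_def b_def
   by (rule combine_exponential_bounds[OF int L2_norm_nonneg init(2)])
   (use CE_pos 1(1,2) \<open>0 < b\<^sub>0\<close> c2 dim_hp_time_space[OF t1 \<sigma> \<open>K >= 1\<close> \<open>0 < m\<close>, of M] in "auto simp: c2_def")
   then show "(\<forall>t\<in>{0..T}. err t \<in> Hs_tilde \<Omega> s) &
   set_integrable lborel {0..T} (%t. (Hs_tilde_norm \<Omega> s (err t))^2) &
   sqrt (LINT t:{0..T}|lborel. (Hs_tilde_norm \<Omega> s (err t))^2)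
   <= C * (exp (- b * sqrt (real (dim (dg_space ?tn ?J ?r)))) + exp (- b * real (dim VX) powr \<mu>))"
   using err_Hs err_integral(1) by blast
   qed
  qed
 qed
qed

end
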